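(* Fix integers $m,n\ge1$ and $a\in\mathbb{C}$. That $z=a$ is a zero of the generalised Hermite polynomial $H_{m,n}(z)$ is equivalent to any of the following three statements. (H.1) There exists $b\in\mathbb{C}$ (a fortiori unique) such that the anharmonic oscillator $\psi''(\lambda)=V(\lambda;a,b,\theta)\psi(\lambda)$ with $\theta_0=\frac12 n$ and $\theta_\infty=m+1+\frac12n$ has an apparent singularity at $\lambda=0$, and the subdominant solution at $\lambda=\infty$ in $\Omega_0$ is also subdominant at $\lambda=0$, i.e. $\psi_0\equiv\psi_+$. Furthermore, in such case, $\psi_0\equiv\psi_2$ and $$\psi_0(\lambda)=\lambda^{\frac12(n+1)}e^{-g(\lambda,a)}p(\lambda),$$ where $p$ is a polynomial of degree $m-1$ with no repeated roots and $p(0)\ne0$; in particular $\psi_0$ has exactly $m-1$ nonzero simple roots in the complex plane. (H.2) There exists $b\in\mathbb{C}$ (a fortiori unique) such that the anharmonic oscillator $\psi''(\lambda)=V(\lambda;a,b,\theta)\psi(\lambda)$ with $\theta_0=\frac12m$ and $\theta_\infty=1-\frac12m-n$ has an apparent singularity at $\lambda=0$, and the subdominant solution at $\lambda=\infty$ in $\Omega_1$ is also subdominant at $\lambda=0$, i.e. $\psi_1\equiv\psi_+$. Furthermore, in such case, $\psi_1\equiv\psi_3$ and $$\psi_1(\lambda)=\lambda^{\frac12(m+1)}e^{g(\lambda,a)}p(\lambda),$$ where $p$ is a polynomial of degree $n-1$ with no repeated roots and $p(0)\neq0$; in particular $\psi_1$ has exactly $n-1$ nonzero simple roots in the complex plane.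 (H.3) There exists $b\in\mathbb{C}$ (a fortiori unique) such that, for the anharmonic oscillator $\psi''(\lambda)=V(\lambda;a,b,\theta)\psi(\lambda)$ with $\theta_0=\frac12(m+n)$ and $\theta_\infty=\frac12(n-m+2)$, subdominant solutions near $\lambda=\infty$ in opposite Stokes sectors are linearly dependent, i.e. $\psi_0\equiv\psi_2$ and $\psi_1\equiv\psi_3$. Furthermore, in such case, $\lambda=0$ is an apparent singularity and $$\psi_0(\lambda)=\lambda^{-\frac{m+n-1}{2}}e^{-g(\lambda,a)}p(\lambda),\qquad \psi_1(\lambda)=\lambda^{-\frac{m+n-1}{2}}e^{g(\lambda,a)}q(\lambda),$$ where $p$ and $q$ are polynomials of degree $n-1$ and $m-1$ respectively, without repeated roots and with $p(0),q(0)\ne0$; in particular $\psi_0$ and $\psi_1$ have exactly $n-1$ and $m-1$ nonzero simple roots in the complex plane, respectively.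
   Context: Generalised Hermite polynomials $H_{m,n}(z)$, $m,n\in\mathbb{N}=\{0,1,2,\dots\}$, are defined recursively by $2mH_{m+1,n}H_{m-1,n}=H_{m,n}H_{m,n}''-(H_{m,n}')^2+2mH_{m,n}^2$ and $2nH_{m,n+1}H_{m,n-1}=-H_{m,n}H_{m,n}''+(H_{m,n}')^2+2nH_{m,n}^2$, with $H_{0,0}=H_{1,0}=H_{0,1}=1$, $H_{1,1}=2z$. For $a,b\in\mathbb{C}$ and $\theta=(\theta_0,\theta_\infty)\in\mathbb{C}^*\times\mathbb{C}$ the anharmonic oscillator is $\psi''(\lambda)=V(\lambda;a,b,\theta)\psi(\lambda)$ with $$V(\lambda;a,b,\theta)=\lambda^2+2a\lambda+a^2+2(1-\theta_\infty)-\left[b+\left(2\theta_\infty-\tfrac12\right)a\right]\lambda^{-1}+\left(\theta_0^2-\tfrac14\right)\lambda^{-2}.$$ Put $g(\lambda,z)=\frac12\lambda^2+z\lambda$. Behaviour at $\infty$: Stokes sectors are $\Omega_k=e^{\frac{k\pi i}{2}}\Omega_0$, $\Omega_0=\{-\frac\pi4<\arg\lambda<\frac\pi4\}$, $k\in\{0,1,2,3\}$. Powers of $\lambda$ are taken with branch cut $\arg\lambda=-\frac\pi4$, i.e. $-\frac\pi4<\arg\lambda<\frac{7\pi}4$, and solutions are considered on this cut plane. $\psi_k$ is the unique solution, subdominant (exponentially decaying) in $\Omega_k$, normalised by $$\psi_k(\lambda)=\left(1+\mathcal{O}(\lambda^{-1})\right)e^{g(\lambda,a)}\lambda^{\frac12-\theta_\infty}\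 (k\text{ odd}),\qquad \psi_k(\lambda)=\left(-\tfrac12+\mathcal{O}(\lambda^{-1})\right)e^{-g(\lambda,a)}\lambda^{\theta_\infty-\frac32}\ (k\text{ even}),$$ as $\lambda\to\infty$ in $\Omega_k$. Behaviour at $0$: $\lambda=0$ is a regular singular point with indices $\frac12\pm\theta_0$. $\psi_+$ is the subdominant solution at $0$: $\psi_+(\lambda)=\lambda^{\frac12+\theta_0}(1+\mathcal{O}(\lambda))$. When $\theta_0\in\frac12\{1,2,3,\dots\}$ (resonant case) a dominant solution has the form $\psi_-(\lambda)=c\log(\lambda)\psi_+(\lambda)+\lambda^{\frac12-\theta_0}(1+\sum_{k\ge1}c_k\lambda^k)$, and the singularity $\lambda=0$ is called apparent if there is no logarithmic term, i.e. $c=0$. $\psi\equiv\phi$ means that the solutions $\psi$ and $\phi$ are linearly dependent. *)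

theory Defs
  imports "HOL-Complex_Analysis.Complex_Analysis" "HOL-Library.Landau_Symbols"
begin

section \<open>Generalised Hermite polynomials\<close>

text \<open>
  The recurrences and initial values determine \<open>H\<close>: the second recurrence fixes \<open>H 0 n\<close> and
  \<open>H 1 n\<close>, and the first one then fixes \<open>H m n\<close> (all members are nonzero, as \<open>H m n\<close> has
  degree \<open>m * n\<close>). Each recurrence is required only where its left-hand side has no negative index.
\<close>

definition generalised_hermite :: "(nat \<Rightarrow> nat \<Rightarrow> complex poly) \<Rightarrow> bool" where
  "generalised_hermite H \<longleftrightarrow>
     H 0 0 = 1 \<and> H 1 0 = 1 \<and> H 0 1 = 1 \<and> H 1 1 = [:0, 2:] \<and>
     (\<forall>m n. m \<ge> 1 \<longrightarrow>
        smult (2 * of_nat m) (H (m + 1) n * H (m - 1) n) =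
          H m n * pderiv (pderiv (H m n)) - (pderiv (H m n))\<^sup>2
            + smult (2 * of_nat m) ((H m n)\<^sup>2)) \<and>
     (\<forall>m n. n \<ge> 1 \<longrightarrow>
        smult (2 * of_nat n) (H m (n + 1) * H m (n - 1)) =
          - (H m n * pderiv (pderiv (H m n))) + (pderiv (H m n))\<^sup>2
            + smult (2 * of_nat n) ((H m n)\<^sup>2))"

section \<open>The cut plane and its branch of the powers\<close>

definition cut_plane :: "complex set" where
  "cut_plane = {x. \<forall>r::real. r \<ge> 0 \<longrightarrow> x \<noteq> of_real r * cis (- (pi / 4))}"

text \<open>
  The library's \<open>Ln\<close> has imaginary part in \<open>(-pi, pi]\<close>; turning by \<open>3 * pi / 4\<close> gives the branch
  whose imaginary part lies in \<open>(-pi/4, 7*pi/4)\<close> on the cut plane.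
\<close>

definition cut_ln :: "complex \<Rightarrow> complex" where
  "cut_ln x = Ln (cis (- (3 * pi / 4)) * x) + \<i> * of_real (3 * pi / 4)"

definition cut_powr :: "complex \<Rightarrow> complex \<Rightarrow> complex" where
  "cut_powr x s = exp (s * cut_ln x)"

definition stokes_sector :: "nat \<Rightarrow> complex set" where
  "stokes_sector k =
     (\<lambda>x. cis (of_nat k * pi / 2) * x) ` {x. x \<noteq> 0 \<and> - (pi / 4) < Arg x \<and> Arg x < pi / 4}"

section \<open>The anharmonic oscillator\<close>

definition potential :: "complex \<Rightarrow> complex \<Rightarrow> complex \<Rightarrow> complex \<Rightarrow> complex \<Rightarrow> complex" where
  "potential a b \<theta>\<^sub>0 \<theta>\<^sub>i x =
     x\<^sup>2 + 2 * a * x + a\<^sup>2 + 2 * (1 - \<theta>\<^sub>i)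
       - (b + (2 * \<theta>\<^sub>i - 1 / 2) * a) / x + (\<theta>\<^sub>0\<^sup>2 - 1 / 4) / x\<^sup>2"

definition g :: "complex \<Rightarrow> complex \<Rightarrow> complex" where
  "g x z = x\<^sup>2 / 2 + z * x"

definition oscillator_solution ::
  "complex \<Rightarrow> complex \<Rightarrow> complex \<Rightarrow> complex \<Rightarrow> (complex \<Rightarrow> complex) \<Rightarrow> bool" where
  "oscillator_solution a b \<theta>\<^sub>0 \<theta>\<^sub>i \<psi> \<longleftrightarrow>
     \<psi> holomorphic_on cut_plane \<and>
     (\<forall>x\<in>cut_plane. deriv (deriv \<psi>) x = potential a b \<theta>\<^sub>0 \<theta>\<^sub>i x * \<psi> x)"

text \<open>
  \<open>is_psi_infty a b \<theta>\<^sub>0 \<theta>\<^sub>i k \<psi>\<close> says that \<open>\<psi>\<close> is the normalised solution \<open>\<psi>\<^sub>k\<close> that is subdominant in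
  the Stokes sector \<open>k\<close>, and \<open>is_psi_plus\<close> that it is the normalised solution \<open>\<psi>\<^sub>+\<close> subdominant
  at the origin (for \<open>Re \<theta>\<^sub>0 > 0\<close>). These solutions exist and are unique as functions on the cut
  plane. Values outside the cut plane are irrelevant, which is why predicates are used.
\<close>

definition is_psi_infty ::
  "complex \<Rightarrow> complex \<Rightarrow> complex \<Rightarrow> complex \<Rightarrow> nat \<Rightarrow> (complex \<Rightarrow> complex) \<Rightarrow> bool" where
  "is_psi_infty a b \<theta>\<^sub>0 \<theta>\<^sub>i k \<psi> \<longleftrightarrow>
     oscillator_solution a b \<theta>\<^sub>0 \<theta>\<^sub>i \<psi> \<and>
     (\<exists>r. r \<in> O[inf at_infinity (principal (stokes_sector k))](\<lambda>x. inverse x) \<and>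
        (\<forall>x\<in>stokes_sector k. \<psi> x =
           (if odd k
            then (1 + r x) * exp (g x a) * cut_powr x (1 / 2 - \<theta>\<^sub>i)
            else (- 1 / 2 + r x) * exp (- g x a) * cut_powr x (\<theta>\<^sub>i - 3 / 2))))"

definition is_psi_plus ::
  "complex \<Rightarrow> complex \<Rightarrow> complex \<Rightarrow> complex \<Rightarrow> (complex \<Rightarrow> complex) \<Rightarrow> bool" where
  "is_psi_plus a b \<theta>\<^sub>0 \<theta>\<^sub>i \<psi> \<longleftrightarrow>
     oscillator_solution a b \<theta>\<^sub>0 \<theta>\<^sub>i \<psi> \<and>
     (\<exists>r. r \<in> O[at 0 within cut_plane](\<lambda>x. x) \<and>
        (\<forall>x\<in>cut_plane. \<psi> x = cut_powr x (1 / 2 + \<theta>\<^sub>0) * (1 + r x)))"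

text \<open>
  \<open>c\<close> is the coefficient of the logarithm in the dominant Frobenius solution \<open>\<psi>\<close> of the resonant
  case. The only finite singularity of the equation is the origin, so the power series
  converges in the whole plane.
\<close>

definition is_psi_minus ::
  "complex \<Rightarrow> complex \<Rightarrow> complex \<Rightarrow> complex \<Rightarrow> complex \<Rightarrow> (complex \<Rightarrow> complex) \<Rightarrow> bool" where
  "is_psi_minus a b \<theta>\<^sub>0 \<theta>\<^sub>i c \<psi> \<longleftrightarrow>
     oscillator_solution a b \<theta>\<^sub>0 \<theta>\<^sub>i \<psi> \<and>
     (\<exists>\<phi>. is_psi_plus a b \<theta>\<^sub>0 \<theta>\<^sub>i \<phi> \<and>
       (\<exists>u :: nat \<Rightarrow> complex. u 0 = 1 \<and>
         (\<forall>x\<in>cut_plane. summable (\<lambda>k. u k * x ^ k) \<and>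
            \<psi> x = c * cut_ln x * \<phi> x + cut_powr x (1 / 2 - \<theta>\<^sub>0) * (\<Sum>k. u k * x ^ k))))"

definition apparent_singularity :: "complex \<Rightarrow> complex \<Rightarrow> complex \<Rightarrow> complex \<Rightarrow> bool" where
  "apparent_singularity a b \<theta>\<^sub>0 \<theta>\<^sub>i \<longleftrightarrow>
     (\<exists>N::nat. N \<ge> 1 \<and> \<theta>\<^sub>0 = of_nat N / 2) \<and> (\<exists>\<psi>. is_psi_minus a b \<theta>\<^sub>0 \<theta>\<^sub>i 0 \<psi>)"

definition linearly_dependent :: "(complex \<Rightarrow> complex) \<Rightarrow> (complex \<Rightarrow> complex) \<Rightarrow> bool" where
  "linearly_dependent \<psi> \<phi> \<longleftrightarrow>
     (\<exists>c d. (c, d) \<noteq> (0, 0) \<and> (\<forall>x\<in>cut_plane. c * \<psi> x + d * \<phi> x = 0))"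

text \<open>Linear dependence of two solutions, each given by the predicate that characterises it.\<close>

definition dependent_solutions ::
  "((complex \<Rightarrow> complex) \<Rightarrow> bool) \<Rightarrow> ((complex \<Rightarrow> complex) \<Rightarrow> bool) \<Rightarrow> bool"  (infix "\<sim>\<^sub>s" 50) where
  "P \<sim>\<^sub>s Q \<longleftrightarrow> (\<exists>\<psi> \<phi>. P \<psi> \<and> Q \<phi> \<and> linearly_dependent \<psi> \<phi>)"

section \<open>Roots\<close>

text \<open>
  A root may lie on the branch cut, where \<open>\<psi>\<close> itself is not considered but is continued
  analytically from either side. Roots and their simplicity are therefore expressed by the
  behaviour of \<open>\<psi> y\<close> as \<open>y\<close> tends to \<open>x\<close> in the cut plane; at points of the (open) cut plane this
  says that \<open>\<psi> x = 0\<close>, respectively that the zero is of order one.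
\<close>

definition nonzero_roots :: "(complex \<Rightarrow> complex) \<Rightarrow> complex set" where
  "nonzero_roots \<psi> = {x. x \<noteq> 0 \<and> (\<psi> \<longlongrightarrow> 0) (at x within cut_plane)}"

definition simple_root :: "(complex \<Rightarrow> complex) \<Rightarrow> complex \<Rightarrow> bool" where
  "simple_root \<psi> x \<longleftrightarrow>
     (\<psi> \<longlongrightarrow> 0) (at x within cut_plane) \<and> \<psi> \<in> \<Theta>[at x within cut_plane](\<lambda>y. y - x)"

definition exactly_nonzero_simple_roots :: "(complex \<Rightarrow> complex) \<Rightarrow> nat \<Rightarrow> bool" where
  "exactly_nonzero_simple_roots \<psi> N \<longleftrightarrow>
     finite (nonzero_roots \<psi>) \<and> card (nonzero_roots \<psi>) = N \<and>
     (\<forall>x\<in>nonzero_roots \<psi>. simple_root \<psi> x)"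

end

theory Submission
  imports Defs "Jordan_Normal_Form.Determinant" "HOL-Real_Asymp.Real_Asymp"
    "HOL-Computational_Algebra.Fundamental_Theorem_Algebra"
begin

text \<open>
  Write \<open>\<psi> = x^((1 - K) / 2) exp (- s g) f\<close> with \<open>K = 2 \<theta>\<^sub>0\<close> and \<open>s = 1\<close> or \<open>s = - 1\<close>. The oscillator becomes
  the confluent equation
  \<open>x f'' + (1 - K) f' - 2 s x (x + a) f' + (2 s d x + \<kappa>) f = 0\<close>, where \<open>d\<close> depends on \<open>K\<close>, \<open>\<theta>\<^sub>i\<close>, \<open>s\<close> only and
  \<open>\<kappa>\<close> is a translate of \<open>b\<close>. For the three choices of parameters \<open>d\<close> is a natural number, and the
  normalised subdominant solution at infinity for the matching sign is the one with \<open>f = (c + O(1/x)) x^d\<close>.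

  Algebra. Put \<open>N = m + n\<close>. Both \<open>H m n a = 0\<close> and each of the three statements are equivalent to the existence of a
  \<open>\<kappa>\<close> for which the equation with \<open>K = N\<close> has two polynomial solutions: \<open>P\<close> of degree \<open>n - 1\<close> for \<open>s = 1\<close>
  with parameter \<open>\<kappa>\<close>, and \<open>Q\<close> of degree \<open>m - 1\<close> for \<open>s = - 1\<close> with parameter \<open>\<kappa> - 2 a (N - 1)\<close>.

  For \<open>H m n a = 0\<close>: by the Toda equation \<open>H m n\<close> is a multiple of a Hankel determinant of Hermite polynomials.
  Its vanishing at \<open>a\<close> says that \<open>E(t) = exp (- t^2 - 2 a t)\<close> has a degenerate Pade approximant,
  \<open>P E = Q + O(t^N)\<close> with \<open>deg P < n\<close> and \<open>deg Q < m\<close>. Then \<open>P Q' - P' Q + 2 (t + a) P Q\<close> has order at least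
  \<open>N - 1\<close> and degree at most \<open>N - 1\<close>, so it is a monomial; differentiating it once gives the two equations, and
  the argument can be reversed (\<open>pade_imp_poly_solutions\<close>, \<open>poly_solutions_imp_pade\<close>). The Pade
  approximant is unique up to a factor, and it determines \<open>\<kappa>\<close>.

  For the first statement, where \<open>K = n\<close> and \<open>d = N - 1\<close>: multiplying the coefficients of a power series by
  a quotient of binomial coefficients exchanges the equations \<open>(K, d) = (n, N - 1)\<close> and \<open>(N, n - 1)\<close> up to the
  resonance, so that the singularity is apparent iff \<open>P\<close> exists. An expansion in Hermite polynomials
  shows that then some solution \<open>F\<close> is a polynomial of degree \<open>N - 1\<close>; it is \<open>\<psi>\<^sub>0\<close> by uniqueness. That
  \<open>\<psi>\<^sub>0\<close> is also subdominant at the origin means that \<open>x^n\<close> divides \<open>F\<close>, and reading the coefficients of \<open>F\<close>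
  backwards turns such an \<open>F\<close> into \<open>Q\<close> (\<open>one_sided\<close>). The second statement is the first one with
  \<open>m\<close> and \<open>n\<close> exchanged and the opposite sign.

  Analysis. For the third statement, \<open>K = N\<close>, one has to show that polynomiality follows from
  \<open>\<psi>\<^sub>0 \<equiv> \<psi>\<^sub>2\<close> and \<open>\<psi>\<^sub>1 \<equiv> \<psi>\<^sub>3\<close> (\<open>opposite_sectors_imp_polynomial\<close>). Let \<open>f\<close>, \<open>G\<close> be the two solutions in their
  own gauges. They satisfy \<open>f G' - f' G + 2 (x + a) f G = w x^(N - 1)\<close> on the cut plane. Across each ray between
  adjacent Stokes sectors this relation bounds both functions by powers of \<open>x\<close> and computes \<open>w\<close> from
  their leading coefficients (\<open>crossing\<close>). Going once around the origin, \<open>w\<close> comes back to its value, while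
  the logarithm of the Frobenius basis would change it. So the logarithm is absent, or one of the two
  solutions is a multiple of the subdominant one at the origin. In every case an
  entire function of polynomial growth appears; Liouville's theorem makes it a polynomial, and its
  degree is too small for the subdominant solution. Hence there is no logarithm and both solutions are polynomials.

  The remaining claims are properties of polynomial solutions: a nonzero double root contradicts the
  second-order equation, and the degrees and \<open>p(0) \<noteq> 0\<close> are read off the recursion of the coefficients.
\<close>

hide_const (open) Determinants.det Finite_Cartesian_Product.vec Finite_Cartesian_Product.mat
hide_const (open) module.smult
no_notation Matrix.vec_index (infixl \<open>$\<close> 100)

section \<open>Hermite polynomials and determinants\<close>

text \<open>
  For \<open>s = 1\<close> these are the physicists' Hermite polynomials \<open>H\<^sub>k\<close>, for \<open>s = - 1\<close> the polynomials \<open>(- i)^k H\<^sub>k(i x)\<close>.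
  The sign is the one of the exponential in the gauge transformation of the oscillator.
\<close>

fun hermite :: "complex \<Rightarrow> nat \<Rightarrow> complex poly" where
  "hermite s 0 = 1"
| "hermite s (Suc 0) = [:0, 2:]"
| "hermite s (Suc (Suc k)) =
     [:0, 2:] * hermite s (Suc k) - smult (2 * s * of_nat (Suc k)) (hermite s k)"

lemma pderiv_hermite_Suc:
  "pderiv (hermite s (Suc k)) = smult (2 * of_nat (Suc k)) (hermite s k)"
proof (induction k rule: less_induct)
  case (less k)
  show ?case
  proof (cases k)
    case 0 then show ?thesis by (simp add: pderiv_pCons)
  next
    case (Suc j)
    have IH1: "pderiv (hermite s (Suc j)) = smult (2 * of_nat (Suc j)) (hermite s j)"
      using less Suc by simp
    have IH0: "pderiv (hermite s j) = smult (2 * of_nat j) (hermite s (j - 1))"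
      using less[of "j - 1"] Suc by (cases j) auto
    have rec: "smult (2 * s * of_nat j) (hermite s (j - 1)) = [:0, 2:] * hermite s j - hermite s (Suc j)"
      by (cases j) auto
    have d2: "pderiv [:0, 2:] = [:2::complex:]" by (simp add: pderiv_pCons)
    have "pderiv (hermite s (Suc (Suc j))) =
        [:0, 2:] * smult (2 * of_nat (Suc j)) (hermite s j) + hermite s (Suc j) * [:2:]
        - smult (2 * s * of_nat (Suc j)) (smult (2 * of_nat j) (hermite s (j - 1)))"
      by (simp only: hermite.simps pderiv_diff pderiv_mult pderiv_smult IH1 IH0 d2)
    also have "smult (2 * s * of_nat (Suc j)) (smult (2 * of_nat j) (hermite s (j - 1)))
      = smult (2 * of_nat (Suc j)) (smult (2 * s * of_nat j) (hermite s (j - 1)))"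
      by (simp add: algebra_simps)
    also have "\<dots> = smult (2 * of_nat (Suc j)) ([:0, 2:] * hermite s j - hermite s (Suc j))"
      by (simp only: rec)
    also have "[:0, 2:] * smult (2 * of_nat (Suc j)) (hermite s j) + hermite s (Suc j) * [:2:]
        - smult (2 * of_nat (Suc j)) ([:0, 2:] * hermite s j - hermite s (Suc j))
       = smult (2 * of_nat (Suc (Suc j))) (hermite s (Suc j))"
      by (simp add: smult_diff_right algebra_simps flip: smult_add_left)
    finally show ?thesis using Suc by simp
  qed
qed

lemma pderiv_hermite: "pderiv (hermite s k) = smult (2 * of_nat k) (hermite s (k - 1))"
  by (cases k) (simp_all add: pderiv_hermite_Suc del: hermite.simps(3))

lemma hermite_Suc: "hermite s (Suc k) = [:0, 2:] * hermite s k - smult s (pderiv (hermite s k))"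
  by (cases k) (simp_all add: pderiv_hermite_Suc mult_ac)

lemma degree_hermite: "degree (hermite s k) = k \<and> coeff (hermite s k) k = 2 ^ k"
proof (induction k)
  case (Suc k)
  have 1: "hermite s (Suc k) = smult 2 (pCons 0 (hermite s k)) - smult s (pderiv (hermite s k))"
    by (simp add: hermite_Suc)
  have d: "degree (pderiv (hermite s k)) \<le> k" using Suc by (simp add: degree_pderiv)
  have c: "coeff (hermite s (Suc k)) (Suc k) = 2 ^ Suc k"
    using Suc d by (simp add: 1 coeff_eq_0)
  moreover have "degree (hermite s (Suc k)) \<le> Suc k"
    unfolding 1 using Suc d
    by (intro degree_diff_le order.trans[OF degree_smult_le] degree_pCons_le[THEN order.trans]) auto
  ultimately show ?case
    by (metis le_antisym le_degree power_not_zero zero_neq_numeral)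
qed simp

lemma hermite_nonzero: "hermite s k \<noteq> 0"
  using degree_hermite[of s k] by (metis coeff_0 power_not_zero zero_neq_numeral)

text \<open>
  The determinant of the Schur complement, with the inverse of \<open>A\<close> cleared so that it makes sense over an
  integral domain such as the polynomials.
\<close>

lemma det_schur_complement:
  fixes A :: "'a::idom mat"
  assumes A: "A \<in> carrier_mat k k" and B: "B \<in> carrier_mat k l"
    and C: "C \<in> carrier_mat l k" and D: "D \<in> carrier_mat l l" and nz: "Determinant.det A \<noteq> 0"
  shows "Determinant.det (four_block_mat A B C D) * Determinant.det A ^ l
       = Determinant.det A * Determinant.det (Determinant.det A \<cdot>\<^sub>m D - C * (adj_mat A * B))"
proof -
  let ?d = "Determinant.det A"
  let ?J = "adj_mat A"
  let ?N = "four_block_mat ?J (0\<^sub>m k l) (- (C * ?J)) (?d \<cdot>\<^sub>m 1\<^sub>m l)"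
  let ?M = "four_block_mat A B C D"
  let ?S = "?d \<cdot>\<^sub>m D - C * (?J * B)"
  note J = adj_mat[OF A]
  have N: "?N \<in> carrier_mat (k + l) (k + l)" using J C by auto
  have M: "?M \<in> carrier_mat (k + l) (k + l)" using A D by auto
  have e1: "- (C * ?J) * A + ?d \<cdot>\<^sub>m 1\<^sub>m l * C = 0\<^sub>m l k"
  proof -
    have "- (C * ?J) * A = - (C * (?J * A))"
      using A C J by (simp add: assoc_mult_mat[of C l k ?J k A k])
    also have "C * (?J * A) = ?d \<cdot>\<^sub>m C" using J C by (simp add: mult_smult_distrib[of C l k _ k])
    moreover have "?d \<cdot>\<^sub>m 1\<^sub>m l * C = ?d \<cdot>\<^sub>m C"
      using C mult_smult_assoc_mat[of "1\<^sub>m l" l l C k] by simp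
    ultimately show ?thesis using C by (intro eq_matI) auto
  qed
  have e2: "- (C * ?J) * B + ?d \<cdot>\<^sub>m 1\<^sub>m l * D = ?S"
  proof -
    have "- (C * ?J) * B = - (C * (?J * B))"
      using B C J by (simp add: assoc_mult_mat[of C l k ?J k B l])
    moreover have "?d \<cdot>\<^sub>m 1\<^sub>m l * D = ?d \<cdot>\<^sub>m D"
      using D mult_smult_assoc_mat[of "1\<^sub>m l" l l D l] by simp
    ultimately show ?thesis using B C D J by (intro eq_matI) auto
  qed
  have NM: "?N * ?M = four_block_mat (?d \<cdot>\<^sub>m 1\<^sub>m k) (?J * B) (0\<^sub>m l k) ?S"
    using mult_four_block_mat[of ?J k k "0\<^sub>m k l" l "- (C * ?J)" l "?d \<cdot>\<^sub>m 1\<^sub>m l" A k B l C D]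
      A B C D J e1 e2 by (simp add: left_add_zero_mat)
  have Sc: "?S \<in> carrier_mat l l"
    by (intro minus_carrier_mat mult_carrier_mat[of _ l k] mult_carrier_mat[of _ k k] C J B)
  have a: "Determinant.det (?N * ?M) = ?d ^ k * Determinant.det ?S"
    unfolding NM
    using det_four_block_mat_lower_left_zero[of "?d \<cdot>\<^sub>m 1\<^sub>m k" k "?J * B" l "0\<^sub>m l k" ?S] A B C D J Sc by simp
  have b: "Determinant.det (?N * ?M) = Determinant.det ?N * Determinant.det ?M"
    by (rule det_mult[OF N M])
  have c: "Determinant.det ?N = Determinant.det ?J * ?d ^ l"
    using det_four_block_mat_upper_right_zero[of ?J k "0\<^sub>m k l" l "- (C * ?J)" "?d \<cdot>\<^sub>m 1\<^sub>m l"] C J by simp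
  have d: "Determinant.det ?J * ?d = ?d ^ k"
    using det_mult[OF J(1) A] J(3) by simp
  have "?d ^ k * (Determinant.det ?M * ?d ^ l) = Determinant.det (?N * ?M) * ?d"
    unfolding b c d[symmetric] by (simp only: mult_ac)
  also have "\<dots> = ?d ^ k * (?d * Determinant.det ?S)"
    unfolding a by (simp only: mult_ac)
  finally have "?d ^ k * (Determinant.det ?M * ?d ^ l) = ?d ^ k * (?d * Determinant.det ?S)" .
  then show ?thesis using nz by simp
qed

lemma det_two:
  fixes A :: "'a::idom mat" assumes A: "A \<in> carrier_mat 2 2"
  shows "Determinant.det A = A $$ (0,0) * A $$ (1,1) - A $$ (0,1) * A $$ (1,0)"
proof -
  have "Determinant.det A = (\<Sum>i<2. A $$ (i,0) * cofactor A i 0)"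
    by (rule laplace_expansion_column[OF A]) simp
  also have "\<dots> = A $$ (0,0) * A $$ (1,1) - A $$ (0,1) * A $$ (1,0)"
    using A by (simp add: numeral_2_eq_2 cofactor_def det_single mat_delete_def)
  finally show ?thesis .
qed

abbreviation det_fn :: "nat \<Rightarrow> (nat \<Rightarrow> nat \<Rightarrow> 'a::comm_ring_1) \<Rightarrow> 'a" where
  "det_fn n e \<equiv> Determinant.det (Matrix.mat n n (\<lambda>(i, j). e i j))"

lemma det_bordered:
  fixes e :: "nat \<Rightarrow> nat \<Rightarrow> 'a::idom"
  assumes nz: "det_fn k e \<noteq> 0"
  shows "det_fn (Suc k) (\<lambda>i j. e (if i < k then i else r) (if j < k then j else c))
    = det_fn k e * e r c - (\<Sum>i<k. e r i * (\<Sum>j<k. adj_mat (Matrix.mat k k (\<lambda>(i, j). e i j)) $$ (i, j) * e j c))"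
proof -
  let ?A = "Matrix.mat k k (\<lambda>(i, j). e i j)"
  let ?B = "Matrix.mat k 1 (\<lambda>(i, j). e i c)"
  let ?C = "Matrix.mat 1 k (\<lambda>(i, j). e r j)"
  let ?D = "Matrix.mat 1 1 (\<lambda>(i, j). e r c)"
  have J: "adj_mat ?A \<in> carrier_mat k k" by (rule adj_mat(1)) simp
  have "Matrix.mat (Suc k) (Suc k) (\<lambda>(i, j). e (if i < k then i else r) (if j < k then j else c))
      = four_block_mat ?A ?B ?C ?D"
    by (rule eq_matI) auto
  then have "det_fn (Suc k) (\<lambda>i j. e (if i < k then i else r) (if j < k then j else c)) * Determinant.det ?A ^ 1
     = Determinant.det ?A * Determinant.det (Determinant.det ?A \<cdot>\<^sub>m ?D - ?C * (adj_mat ?A * ?B))"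
    using det_schur_complement[of ?A k ?B 1 ?C ?D] nz by simp
  then have "det_fn (Suc k) (\<lambda>i j. e (if i < k then i else r) (if j < k then j else c))
     = Determinant.det (Determinant.det ?A \<cdot>\<^sub>m ?D - ?C * (adj_mat ?A * ?B))"
    using nz by simp
  also have "\<dots> = (Determinant.det ?A \<cdot>\<^sub>m ?D - ?C * (adj_mat ?A * ?B)) $$ (0, 0)"
    using J by (subst det_single) auto
  also have "\<dots> = det_fn k e * e r c - (\<Sum>i<k. e r i * (\<Sum>j<k. adj_mat ?A $$ (i, j) * e j c))"
    using J by (simp add: scalar_prod_def atLeast0LessThan row_def col_def)
  finally show ?thesis .
qed

text \<open>
  Jacobi's identity for the last two rows and columns: the case of a two by two Schur complement, whose entries are
  the bordered minors up to the determinant of the block. The minors are written as determinants of the leading block bordered by one row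
  and one column, which is the form in which differentiation produces them.
\<close>

lemma det_jacobi:
  fixes e :: "nat \<Rightarrow> nat \<Rightarrow> 'a::idom"
  assumes nz: "det_fn k e \<noteq> 0"
  defines "bd \<equiv> \<lambda>r c. det_fn (Suc k) (\<lambda>i j. e (if i < k then i else r) (if j < k then j else c))"
  shows "det_fn (Suc (Suc k)) e * det_fn k e = bd k k * bd (Suc k) (Suc k) - bd k (Suc k) * bd (Suc k) k"
proof -
  let ?A = "Matrix.mat k k (\<lambda>(i, j). e i j)"
  let ?B = "Matrix.mat k 2 (\<lambda>(i, j). e i (k + j))"
  let ?C = "Matrix.mat 2 k (\<lambda>(i, j). e (k + i) j)"
  let ?D = "Matrix.mat 2 2 (\<lambda>(i, j). e (k + i) (k + j))"
  let ?S = "Determinant.det ?A \<cdot>\<^sub>m ?D - ?C * (adj_mat ?A * ?B)"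
  have J: "adj_mat ?A \<in> carrier_mat k k" by (rule adj_mat(1)) simp
  have "Matrix.mat (Suc (Suc k)) (Suc (Suc k)) (\<lambda>(i, j). e i j) = four_block_mat ?A ?B ?C ?D"
    by (rule eq_matI) auto
  then have "det_fn (Suc (Suc k)) e * Determinant.det ?A ^ 2 = Determinant.det ?A * Determinant.det ?S"
    using det_schur_complement[of ?A k ?B 2 ?C ?D] nz by simp
  then have 1: "det_fn (Suc (Suc k)) e * Determinant.det ?A = Determinant.det ?S"
    using nz by (simp add: power2_eq_square)
  have S: "?S $$ (i, j) = bd (k + i) (k + j)" if "i < 2" "j < 2" for i j
  proof -
    have "bd (k + i) (k + j) = det_fn k e * e (k + i) (k + j)
      - (\<Sum>i'<k. e (k + i) i' * (\<Sum>j'<k. adj_mat ?A $$ (i', j') * e j' (k + j)))"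
      unfolding bd_def by (rule det_bordered[OF nz])
    then show ?thesis using that J
      by (simp add: scalar_prod_def atLeast0LessThan row_def col_def)
  qed
  have "Determinant.det ?S = ?S $$ (0,0) * ?S $$ (1,1) - ?S $$ (0,1) * ?S $$ (1,0)"
    using J by (intro det_two) auto
  also have "\<dots> = bd (k+0) (k+0) * bd (k+1) (k+1) - bd (k+0) (k+1) * bd (k+1) (k+0)"
    using S by (simp only: less_numeral_extra one_less_numeral_iff zero_less_numeral semiring_norm)
  finally show ?thesis using 1 by simp
qed

lemma smult_cancel: "smult c p = smult c q \<Longrightarrow> c \<noteq> 0 \<Longrightarrow> p = q" for c :: "'a::field"
  by (metis smult_smult left_inverse smult_1_left)

section \<open>The Toda equation of Hankel determinants\<close>

lemma pderiv_prod_perm: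
  fixes F F' :: "nat \<Rightarrow> complex poly"
  assumes "finite A" "\<And>i. i \<in> A \<Longrightarrow> pderiv (F i) = [:0, 2:] * F i - F' i"
  shows "pderiv (\<Prod>i\<in>A. F i) =
    [:0, 2 * of_nat (card A):] * (\<Prod>i\<in>A. F i) - (\<Sum>k\<in>A. \<Prod>i\<in>A. if i = k then F' i else F i)"
proof -
  have "pderiv (\<Prod>i\<in>A. F i) = (\<Sum>k\<in>A. prod F (A - {k}) * ([:0, 2:] * F k - F' k))"
    using assms by (simp add: pderiv_prod)
  also have "\<dots> = (\<Sum>k\<in>A. [:0, 2:] * prod F A - (\<Prod>i\<in>A. if i = k then F' i else F i))"
  proof (rule sum.cong[OF refl])
    fix k assume k: "k \<in> A"
    have "prod F A = F k * prod F (A - {k})" using assms(1) k by (rule prod.remove)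
    moreover have "(\<Prod>i\<in>A. if i = k then F' i else F i) = F' k * prod F (A - {k})"
      by (subst prod.remove[OF assms(1) k]) (auto intro!: prod.cong)
    ultimately show "prod F (A - {k}) * ([:0, 2:] * F k - F' k)
       = [:0, 2:] * prod F A - (\<Prod>i\<in>A. if i = k then F' i else F i)"
      by (simp only: right_diff_distrib mult_ac)
  qed
  also have "\<dots> = of_nat (card A) * ([:0, 2:] * prod F A) - (\<Sum>k\<in>A. \<Prod>i\<in>A. if i = k then F' i else F i)"
    by (simp add: sum_subtractf)
  also have "of_nat (card A) * ([:0, 2:] * prod F A) = [:0, 2 * of_nat (card A):] * prod F A"
    by (simp add: of_nat_poly mult_ac)
  finally show ?thesis .
qed

lemma pderiv_sum': "pderiv (\<Sum>i\<in>A. F i) = (\<Sum>i\<in>A. pderiv (F i))"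
  by (induction A rule: infinite_finite_induct) (simp_all add: pderiv_add)

text \<open>
  The functions \<open>f k * exp (- x^2)\<close> are the iterated derivatives of the first one up to sign, so differentiating a determinant
  in them raises the index of one row at a time; the first summand comes from the exponential.
\<close>

lemma pderiv_det_rows:
  fixes f :: "nat \<Rightarrow> complex poly"
  assumes "\<And>k. pderiv (f k) = [:0, 2:] * f k - f (Suc k)"
  shows "pderiv (det_fn n (\<lambda>i j. f (\<rho> i + \<gamma> j))) =
    [:0, 2 * of_nat n:] * det_fn n (\<lambda>i j. f (\<rho> i + \<gamma> j))
      - (\<Sum>k<n. det_fn n (\<lambda>i j. f ((\<rho>(k := Suc (\<rho> k))) i + \<gamma> j)))"
proof -
  let ?P = "{p. p permutes {0..<n}}"
  have fin: "finite ?P" by (simp add: finite_permutations)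
  have D: "det_fn n (\<lambda>i j. f (r i + \<gamma> j)) = (\<Sum>p\<in>?P. signof p * (\<Prod>i=0..<n. f (r i + \<gamma> (p i))))" for r
    by (subst det_def'[of _ n]) (auto intro!: sum.cong prod.cong arg_cong2[of _ _ _ _ "(*)"] simp: permutes_in_image)
  have sg: "pderiv (signof p * q) = signof p * pderiv q" for p :: "nat \<Rightarrow> nat" and q :: "complex poly"
    by (simp add: sign_def pderiv_minus)
  have "pderiv (det_fn n (\<lambda>i j. f (\<rho> i + \<gamma> j)))
     = (\<Sum>p\<in>?P. signof p * pderiv (\<Prod>i=0..<n. f (\<rho> i + \<gamma> (p i))))"
    by (simp add: D pderiv_sum' sg)
  also have "\<dots> = (\<Sum>p\<in>?P. signof p * ([:0, 2 * of_nat n:] * (\<Prod>i=0..<n. f (\<rho> i + \<gamma> (p i)))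
        - (\<Sum>k=0..<n. \<Prod>i=0..<n. f ((\<rho>(k := Suc (\<rho> k))) i + \<gamma> (p i)))))"
  proof (rule sum.cong[OF refl])
    fix p
    have "pderiv (\<Prod>i=0..<n. f (\<rho> i + \<gamma> (p i))) =
      [:0, 2 * of_nat (card {0..<n}):] * (\<Prod>i=0..<n. f (\<rho> i + \<gamma> (p i)))
        - (\<Sum>k=0..<n. \<Prod>i=0..<n. if i = k then f (Suc (\<rho> i + \<gamma> (p i))) else f (\<rho> i + \<gamma> (p i)))"
      by (rule pderiv_prod_perm) (auto simp: assms)
    also have "(\<Sum>k=0..<n. \<Prod>i=0..<n. if i = k then f (Suc (\<rho> i + \<gamma> (p i))) else f (\<rho> i + \<gamma> (p i)))
       = (\<Sum>k=0..<n. \<Prod>i=0..<n. f ((\<rho>(k := Suc (\<rho> k))) i + \<gamma> (p i)))"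
      by (intro sum.cong prod.cong) auto
    finally show "signof p * pderiv (\<Prod>i=0..<n. f (\<rho> i + \<gamma> (p i)))
      = signof p * ([:0, 2 * of_nat n:] * (\<Prod>i=0..<n. f (\<rho> i + \<gamma> (p i)))
        - (\<Sum>k=0..<n. \<Prod>i=0..<n. f ((\<rho>(k := Suc (\<rho> k))) i + \<gamma> (p i))))"
      by simp
  qed
  also have "\<dots> = [:0, 2 * of_nat n:] * (\<Sum>p\<in>?P. signof p * (\<Prod>i=0..<n. f (\<rho> i + \<gamma> (p i))))
     - (\<Sum>k=0..<n. \<Sum>p\<in>?P. signof p * (\<Prod>i=0..<n. f ((\<rho>(k := Suc (\<rho> k))) i + \<gamma> (p i))))"
    by (subst sum.swap[of _ ?P "{0..<n}"]) (simp only: right_diff_distrib sum_subtractf sum_distrib_left mult_ac)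
  finally show ?thesis by (simp only: D atLeast0LessThan)
qed

text \<open>
  Raising any row but the last produces two equal rows, so one term of the sum survives.
\<close>

lemma pderiv_det_last_row:
  fixes f :: "nat \<Rightarrow> complex poly"
  assumes f: "\<And>k. pderiv (f k) = [:0, 2:] * f k - f (Suc k)"
  shows "pderiv (det_fn (Suc k) (\<lambda>i j. f (m + i + \<gamma> j))) =
    [:0, 2 * of_nat (Suc k):] * det_fn (Suc k) (\<lambda>i j. f (m + i + \<gamma> j))
      - det_fn (Suc k) (\<lambda>i j. f (m + (if i < k then i else Suc k) + \<gamma> j))"
proof -
  let ?\<rho> = "\<lambda>i. m + i"
  have "(\<Sum>l<Suc k. det_fn (Suc k) (\<lambda>i j. f ((?\<rho>(l := Suc (?\<rho> l))) i + \<gamma> j)))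
     = (\<Sum>l\<in>{k}. det_fn (Suc k) (\<lambda>i j. f ((?\<rho>(l := Suc (?\<rho> l))) i + \<gamma> j)))"
  proof (rule sum.mono_neutral_right)
    show "\<forall>l\<in>{..<Suc k} - {k}. det_fn (Suc k) (\<lambda>i j. f ((?\<rho>(l := Suc (?\<rho> l))) i + \<gamma> j)) = 0"
    proof
      fix l assume l: "l \<in> {..<Suc k} - {k}"
      show "det_fn (Suc k) (\<lambda>i j. f ((?\<rho>(l := Suc (?\<rho> l))) i + \<gamma> j)) = 0"
        by (rule det_identical_rows[of _ "Suc k" l "Suc l"]) (use l in \<open>auto intro!: eq_vecI\<close>)
    qed
  qed auto
  also have "\<dots> = det_fn (Suc k) (\<lambda>i j. f (m + (if i < k then i else Suc k) + \<gamma> j))"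
    by (auto intro!: arg_cong[of _ _ Determinant.det] eq_matI)
  finally show ?thesis
    using pderiv_det_rows[where f = f, OF f, of "Suc k" ?\<rho> \<gamma>] by simp
qed

lemma det_fn_transpose: "det_fn n (\<lambda>i j. e j i) = det_fn n e"
proof -
  have "(Matrix.mat n n (\<lambda>(i, j). e i j))\<^sup>T = Matrix.mat n n (\<lambda>(i, j). e j i)"
    by (rule eq_matI) auto
  then show ?thesis by (metis det_transpose mat_carrier)
qed

definition hankel :: "nat \<Rightarrow> nat \<Rightarrow> complex poly" where
  "hankel m n = det_fn n (\<lambda>i j. hermite 1 (m + i + j))"

text \<open>
  One differentiation borders the last row and a second one the last column, so the derivatives of
  \<open>\<tau>\<close> are exactly the minors in Jacobi's identity.
\<close>

lemma hankel_toda: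
  assumes nz: "hankel m k \<noteq> 0"
  defines "\<tau> \<equiv> hankel m (Suc k)"
  shows "hankel m (Suc (Suc k)) * hankel m k =
    - (- (\<tau> * pderiv (pderiv \<tau>)) + (pderiv \<tau>)\<^sup>2 + smult (2 * of_nat (Suc k)) (\<tau>\<^sup>2))"
proof -
  let ?h = "hermite 1"
  have h: "pderiv (?h k) = [:0, 2:] * ?h k - ?h (Suc k)" for k by (simp add: hermite_Suc)
  let ?e = "\<lambda>i j. ?h (m + i + j)"
  define bd where "bd \<equiv> \<lambda>r c. det_fn (Suc k) (\<lambda>i j. ?e (if i < k then i else r) (if j < k then j else c))"
  define A where "A = bd (Suc k) k"
  have \<tau>: "\<tau> = bd k k"
    unfolding \<tau>_def hankel_def bd_def by (auto intro!: arg_cong[of _ _ Determinant.det] eq_matI simp: less_Suc_eq)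
  have sym: "bd r c = bd c r" for r c
    unfolding bd_def by (subst det_fn_transpose[symmetric]) (simp add: ac_simps)
  have D: "pderiv (bd k c) = [:0, 2 * of_nat (Suc k):] * bd k c - bd (Suc k) c" for c
  proof -
    have "bd k c = det_fn (Suc k) (\<lambda>i j. ?h (m + i + (if j < k then j else c)))"
      unfolding bd_def by (auto intro!: arg_cong[of _ _ Determinant.det] eq_matI simp: less_Suc_eq)
    then show ?thesis
      using pderiv_det_last_row[where f = ?h, OF h, of k m "\<lambda>j. if j < k then j else c"] unfolding bd_def by simp
  qed
  have 1: "pderiv \<tau> = [:0, 2 * of_nat (Suc k):] * \<tau> - A"
    using D[of k] by (simp add: \<tau> A_def)
  have 2: "pderiv A = [:0, 2 * of_nat (Suc k):] * A - bd (Suc k) (Suc k)"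
    using D[of "Suc k"] by (simp add: A_def sym[of "Suc k" k])
  have toda_algebra: "t * (X * A - A') - A * A = - (- (t * t2) + t1\<^sup>2 + C * t\<^sup>2)"
    if "A = X * t - t1" "A' = C * t + X * t1 - t2" for t t1 t2 A A' X C :: "complex poly"
    unfolding that by (simp add: algebra_simps power2_eq_square)
  have "hankel m (Suc (Suc k)) * hankel m k = bd k k * bd (Suc k) (Suc k) - bd k (Suc k) * bd (Suc k) k"
    unfolding hankel_def bd_def by (rule det_jacobi[of k ?e]) (use nz in \<open>simp add: hankel_def\<close>)
  then have "hankel m (Suc (Suc k)) * hankel m k = \<tau> * bd (Suc k) (Suc k) - A * A"
    by (simp add: \<tau> A_def sym[of k "Suc k"])
  moreover have A: "A = [:0, 2 * of_nat (Suc k):] * \<tau> - pderiv \<tau>"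
    by (simp only: 1 diff_diff_eq2 add_diff_cancel_left')
  moreover have "bd (Suc k) (Suc k) = [:0, 2 * of_nat (Suc k):] * A - pderiv A"
    by (simp only: 2 diff_diff_eq2 add_diff_cancel_left')
  moreover have "pderiv A = [:2 * of_nat (Suc k):] * \<tau> + [:0, 2 * of_nat (Suc k):] * pderiv \<tau> - pderiv (pderiv \<tau>)"
    unfolding A pderiv_diff pderiv_mult by (simp add: pderiv_pCons)
  ultimately have "hankel m (Suc (Suc k)) * hankel m k =
      - (- (\<tau> * pderiv (pderiv \<tau>)) + (pderiv \<tau>)\<^sup>2 + [:2 * of_nat (Suc k):] * \<tau>\<^sup>2)"
    using toda_algebra by metis
  then show ?thesis by simp
qed

text \<open>
  The term \<open>c p^2\<close> has the highest degree. This makes all Hankel determinants nonzero, by induction along \<open>hankel_toda\<close>.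
\<close>

lemma toda_rhs_nonzero:
  fixes p :: "complex poly"
  assumes "p \<noteq> 0" "c \<noteq> 0"
  shows "- (p * pderiv (pderiv p)) + (pderiv p)\<^sup>2 + smult c (p\<^sup>2) \<noteq> 0"
proof
  assume eq: "- (p * pderiv (pderiv p)) + (pderiv p)\<^sup>2 + smult c (p\<^sup>2) = 0"
  show False
  proof (cases "degree p = 0")
    case True
    then have "pderiv p = 0" by (simp add: pderiv_eq_0_iff)
    then show False using eq assms by simp
  next
    case False
    let ?d = "degree p + degree p"
    have "degree (p * pderiv (pderiv p)) < ?d" "degree ((pderiv p)\<^sup>2) < ?d"
      using False by (auto simp: power2_eq_square degree_pderiv intro!: le_less_trans[OF degree_mult_le])
    then have "coeff (- (p * pderiv (pderiv p)) + (pderiv p)\<^sup>2 + smult c (p\<^sup>2)) ?d = c * (lead_coeff p * lead_coeff p)"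
      by (simp add: coeff_eq_0 power2_eq_square coeff_mult_degree_sum)
    then show False unfolding eq using assms by simp
  qed
qed

text \<open>
  For \<open>n = 0, 1\<close> the first recurrence is the one of \<open>1\<close> and of the Hermite polynomials. The second recurrence then agrees
  with the Toda equation up to a sign, which only changes the constant.
\<close>

lemma generalised_hermite_hankel:
  assumes "generalised_hermite H"
  shows "\<exists>c. c \<noteq> 0 \<and> H m n = smult c (hankel m n)"
proof -
  have i: "H 0 0 = 1" "H 1 0 = 1" "H 0 1 = 1" "H 1 1 = [:0, 2:]"
    and r1: "\<And>m n. m \<ge> 1 \<Longrightarrow> smult (2 * of_nat m) (H (m + 1) n * H (m - 1) n) =
          H m n * pderiv (pderiv (H m n)) - (pderiv (H m n))\<^sup>2 + smult (2 * of_nat m) ((H m n)\<^sup>2)"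
    and r2: "\<And>m n. n \<ge> 1 \<Longrightarrow> smult (2 * of_nat n) (H m (n + 1) * H m (n - 1)) =
          - (H m n * pderiv (pderiv (H m n))) + (pderiv (H m n))\<^sup>2 + smult (2 * of_nat n) ((H m n)\<^sup>2)"
    using assms unfolding generalised_hermite_def by auto
  have H0: "H m 0 = 1" for m
  proof (induction m rule: less_induct)
    case (less m)
    consider "m = 0" | "m = 1" | k where "m = Suc (Suc k)" by (metis One_nat_def not0_implies_Suc)
    then show ?case
    proof cases
      case 3
      then have "smult (2 * of_nat (Suc k)) (H m 0) = smult (2 * of_nat (Suc k)) 1"
        using r1[of "Suc k" 0] less[of "Suc k"] less[of k] by (simp del: of_nat_Suc)
      then show ?thesis using smult_cancel by (metis mult_eq_0_iff of_nat_eq_0_iff nat.distinct(2) zero_neq_numeral)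
    qed (use i in auto)
  qed
  have H1: "H m 1 = hermite 1 m" for m
  proof (induction m rule: less_induct)
    case (less m)
    consider "m = 0" | "m = 1" | k where "m = Suc (Suc k)" by (metis One_nat_def not0_implies_Suc)
    then show ?case
    proof cases
      case 3
      let ?h = "hermite 1"
      have d1: "pderiv (?h (Suc k)) = [:2 * of_nat (Suc k):] * ?h k" using pderiv_hermite_Suc by simp
      have d2: "pderiv (?h k) = [:0, 2:] * ?h k - ?h (Suc k)" by (simp add: hermite_Suc)
      have r: "?h (Suc (Suc k)) = [:0, 2:] * ?h (Suc k) - [:2 * of_nat (Suc k):] * ?h k" by simp
      have "smult (2 * of_nat (Suc k)) (H m 1 * ?h k) = ?h (Suc k) * pderiv (pderiv (?h (Suc k)))
          - (pderiv (?h (Suc k)))\<^sup>2 + smult (2 * of_nat (Suc k)) ((?h (Suc k))\<^sup>2)"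
        using r1[of "Suc k" 1] less[of "Suc k"] less[of k] 3 by (simp del: of_nat_Suc hermite.simps(3))
      moreover have "smult (2 * of_nat (Suc k)) q = [:2 * of_nat (Suc k):] * q" for q :: "complex poly" by simp
      moreover have "pderiv (pderiv (?h (Suc k))) = [:2 * of_nat (Suc k):] * pderiv (?h k)"
        by (subst d1) (simp add: pderiv_smult)
      ultimately have "[:2 * of_nat (Suc k):] * (H m 1 * ?h k) =
          ?h (Suc k) * ([:2 * of_nat (Suc k):] * pderiv (?h k)) - ([:2 * of_nat (Suc k):] * ?h k)\<^sup>2
           + [:2 * of_nat (Suc k):] * (?h (Suc k))\<^sup>2"
        unfolding d1 by metis
      moreover have "h1 * (C * d) - (C * h0)\<^sup>2 + C * h1\<^sup>2 = C * (h2 * h0)"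
        if "d = X * h0 - h1" "h2 = X * h1 - C * h0" for d h0 h1 h2 C X :: "complex poly"
        unfolding that by (simp add: algebra_simps power2_eq_square)
      ultimately have "[:2 * of_nat (Suc k):] * (H m 1 * ?h k) = [:2 * of_nat (Suc k):] * (?h (Suc (Suc k)) * ?h k)"
        using d2 r by metis
      moreover have "[:2 * of_nat (Suc k):] \<noteq> (0 :: complex poly)" by (simp del: of_nat_Suc)
      ultimately show ?thesis using 3 hermite_nonzero[of 1 k] by (metis mult_cancel_left mult_cancel_right)
    qed (use i in auto)
  qed
  have nz: "H m n \<noteq> 0 \<and> H m (Suc n) \<noteq> 0" for n
  proof (induction n)
    case 0 then show ?case using H0 H1 hermite_nonzero by simp
  next
    case (Suc n)
    have "smult (2 * of_nat (Suc n)) (H m (Suc (Suc n)) * H m n) \<noteq> 0"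
      using r2[of "Suc n" m] toda_rhs_nonzero[of "H m (Suc n)" "2 * of_nat (Suc n)"] Suc
      by (simp del: of_nat_Suc)
    then show ?case using Suc by auto
  qed
  have "(\<exists>c. c \<noteq> 0 \<and> H m n = smult c (hankel m n)) \<and> (\<exists>c. c \<noteq> 0 \<and> H m (Suc n) = smult c (hankel m (Suc n)))"
  proof (induction n)
    case 0
    have "hankel m 0 = 1" "hankel m 1 = hermite 1 m"
      by (simp_all add: hankel_def det_single)
    then show ?case using H0 H1 by (auto intro!: exI[of _ 1])
  next
    case (Suc n)
    then obtain c c' where c: "c \<noteq> 0" "H m n = smult c (hankel m n)" "c' \<noteq> 0" "H m (Suc n) = smult c' (hankel m (Suc n))"
      by auto
    have t0: "hankel m n \<noteq> 0" using nz[of n] c by auto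
    define \<tau> where "\<tau> = hankel m (Suc n)"
    have "smult (2 * of_nat (Suc n)) (H m (Suc (Suc n)) * H m n) =
       smult (c' * c') (- (\<tau> * pderiv (pderiv \<tau>)) + (pderiv \<tau>)\<^sup>2 + smult (2 * of_nat (Suc n)) (\<tau>\<^sup>2))"
      using r2[of "Suc n" m] c(4)
      by (simp add: \<tau>_def pderiv_smult power2_eq_square smult_add_right smult_diff_right mult_ac del: of_nat_Suc)
    also have "- (\<tau> * pderiv (pderiv \<tau>)) + (pderiv \<tau>)\<^sup>2 + smult (2 * of_nat (Suc n)) (\<tau>\<^sup>2)
       = - (hankel m (Suc (Suc n)) * hankel m n)"
      using hankel_toda[OF t0] by (simp add: \<tau>_def del: of_nat_Suc)
    finally have "hankel m n * smult (2 * of_nat (Suc n) * c) (H m (Suc (Suc n)))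
      = hankel m n * smult (- (c' * c')) (hankel m (Suc (Suc n)))"
      using c(2) by (simp add: mult_ac del: of_nat_Suc)
    then have *: "smult (2 * of_nat (Suc n) * c) (H m (Suc (Suc n))) = smult (- (c' * c')) (hankel m (Suc (Suc n)))"
      using t0 by (metis mult_cancel_left)
    have "H m (Suc (Suc n)) = smult (inverse (2 * of_nat (Suc n) * c)) (smult (2 * of_nat (Suc n) * c) (H m (Suc (Suc n))))"
      unfolding smult_smult using c by (subst left_inverse) (simp_all del: of_nat_Suc)
    also have "\<dots> = smult (inverse (2 * of_nat (Suc n) * c) * - (c' * c')) (hankel m (Suc (Suc n)))"
      unfolding * by simp
    finally have "\<exists>d. d \<noteq> 0 \<and> H m (Suc (Suc n)) = smult d (hankel m (Suc (Suc n)))"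
      using c by (intro exI[of _ "inverse (2 * of_nat (Suc n) * c) * - (c' * c')"]) (simp del: of_nat_Suc)
    then show ?case using Suc by auto
  qed
  then show ?thesis by blast
qed

section \<open>Zeros of Hankel determinants and Pade approximants\<close>

text \<open>
  The Taylor series of \<open>exp (- t^2 - 2 a t)\<close> in \<open>t\<close>, by the generating function of the Hermite polynomials.
\<close>

definition gauss_fps :: "complex \<Rightarrow> complex fps" where
  "gauss_fps a = Abs_fps (\<lambda>k. (-1) ^ k * poly (hermite 1 k) a / fact k)"

lemma gauss_fps_rec:
  "of_nat (Suc k) * fps_nth (gauss_fps a) (Suc k) =
     - 2 * a * fps_nth (gauss_fps a) k - 2 * (if k = 0 then 0 else fps_nth (gauss_fps a) (k - 1))"
proof (cases k)
  case (Suc j)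
  then show ?thesis
    by (simp add: gauss_fps_def field_simps del: of_nat_Suc)
qed (simp add: gauss_fps_def)

lemma fps_deriv_gauss_fps:
  "fps_deriv (gauss_fps a) = - 2 * (fps_X + fps_const a) * gauss_fps a"
proof (rule fps_ext)
  fix k
  show "fps_nth (fps_deriv (gauss_fps a)) k = fps_nth (- 2 * (fps_X + fps_const a) * gauss_fps a) k"
    using gauss_fps_rec[of k a] by (simp add: distrib_right mult.assoc fps_numeral_fps_const del: of_nat_Suc)
qed

lemma gauss_fps_0: "fps_nth (gauss_fps a) 0 = 1"
  by (simp add: gauss_fps_def)

text \<open>
  The coefficients of \<open>(2 x - D)^j\<close>, where \<open>D\<close> is differentiation, when the powers of \<open>D\<close> are collected on the right;
  \<open>(2 x - D)^j\<close> maps \<open>H\<^sub>k\<close> to \<open>H\<^sub>k\<^sub>+\<^sub>j\<close>.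
\<close>

fun rodrigues :: "nat \<Rightarrow> nat \<Rightarrow> complex poly" where
  "rodrigues l 0 = (if l = 0 then 1 else 0)"
| "rodrigues l (Suc j) = [:0, 2:] * rodrigues l j - pderiv (rodrigues l j)
     - (if l = 0 then 0 else rodrigues (l - 1) j)"

lemma rodrigues_eq_0: "j < l \<Longrightarrow> rodrigues l j = 0"
  by (induction j arbitrary: l) auto

lemma rodrigues_diag: "rodrigues j j = (-1) ^ j"
  by (induction j) (auto simp: rodrigues_eq_0)

lemma hermite_add_rodrigues:
  "hermite 1 (k + j) = (\<Sum>l\<le>j. rodrigues l j * (pderiv ^^ l) (hermite 1 k))"
proof (induction j)
  case (Suc j)
  let ?d = "\<lambda>l. (pderiv ^^ l) (hermite 1 k)"
  have "hermite 1 (k + Suc j) = [:0, 2:] * hermite 1 (k + j) - pderiv (hermite 1 (k + j))"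
    using hermite_Suc[of 1 "k + j"] by simp
  also have "\<dots> = (\<Sum>l\<le>j. [:0, 2:] * rodrigues l j * ?d l)
      - ((\<Sum>l\<le>j. pderiv (rodrigues l j) * ?d l) + (\<Sum>l\<le>j. rodrigues l j * ?d (Suc l)))"
    by (simp add: Suc pderiv_sum' pderiv_mult sum_distrib_left sum.distrib mult_ac)
  also have "(\<Sum>l\<le>j. rodrigues l j * ?d (Suc l)) = (\<Sum>l\<le>Suc j. (if l = 0 then 0 else rodrigues (l - 1) j) * ?d l)"
    by (subst sum.atMost_Suc_shift) simp
  also have "(\<Sum>l\<le>j. pderiv (rodrigues l j) * ?d l) = (\<Sum>l\<le>Suc j. pderiv (rodrigues l j) * ?d l)"
    by (simp add: rodrigues_eq_0)
  also have "(\<Sum>l\<le>j. [:0, 2:] * rodrigues l j * ?d l) = (\<Sum>l\<le>Suc j. [:0, 2:] * rodrigues l j * ?d l)"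
    by (simp add: rodrigues_eq_0)
  finally show ?case
    by (simp only: sum_subtractf[symmetric] sum.distrib[symmetric] left_diff_distrib rodrigues.simps
        diff_diff_eq distrib_right)
qed simp

lemma iterated_pderiv_hermite:
  "(pderiv ^^ l) (hermite 1 k) = (if l \<le> k then smult (2 ^ l * fact k / fact (k - l)) (hermite 1 (k - l)) else 0)"
proof (induction l)
  case (Suc l)
  show ?case
  proof (cases "Suc l \<le> k")
    case True
    then have "fact (k - l) = (of_nat (k - l) * fact (k - Suc l) :: complex)"
      by (metis Suc_diff_Suc Suc_le_lessD fact_Suc of_nat_fact of_nat_mult)
    moreover have "of_nat (k - l) \<noteq> (0::complex)" using True by simp
    moreover have "A / (M * F) * (2 * M) = 2 * A / F" if "M \<noteq> 0" for A M F :: complex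
      using that by (cases "F = 0") (simp_all add: field_simps)
    ultimately have "2 ^ l * fact k / fact (k - l) * (2 * of_nat (k - l)) = (2 * (2 ^ l * fact k) / fact (k - Suc l) :: complex)"
      by (simp only:) blast
    then show ?thesis using True Suc
      by (simp add: pderiv_smult pderiv_hermite mult.assoc del: hermite.simps)
  next
    case False
    then show ?thesis using Suc by (cases "l = k") auto
  qed
qed simp

text \<open>
  The denominators \<open>p\<close> of approximants \<open>p E = q + O(t^(m + n))\<close> with \<open>deg q < m\<close>. There are \<open>n\<close> conditions on \<open>n\<close>
  coefficients, hence a nonzero \<open>p\<close> exists only if a determinant vanishes.
\<close>

definition pade_kernel :: "complex \<Rightarrow> nat \<Rightarrow> nat \<Rightarrow> complex poly \<Rightarrow> bool" where
  "pade_kernel a m n p \<longleftrightarrow> degree p < n \<and>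
     (\<forall>i<n. fps_nth (fps_of_poly p * gauss_fps a) (m + i) = 0)"

text \<open>
  Column operations with the triangular matrix \<open>rodrigues\<close> replace \<open>H\<^sub>m\<^sub>+\<^sub>i\<^sub>+\<^sub>j\<close> by the \<open>j\<close>-th derivative of \<open>H\<^sub>m\<^sub>+\<^sub>i\<close>, a
  multiple of \<open>H\<^sub>m\<^sub>+\<^sub>i\<^sub>-\<^sub>j\<close>. After rescaling, the Hankel matrix becomes the Toeplitz matrix of the linear
  conditions in \<open>pade_kernel\<close>.
\<close>

lemma hankel_zero_iff_pade:
  assumes n: "n \<ge> 1"
  shows "poly (hankel m n) a = 0 \<longleftrightarrow> (\<exists>p. p \<noteq> 0 \<and> pade_kernel a m n p)"
proof -
  let ?h = "hermite 1"
  let ?E = "fps_nth (gauss_fps a)"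
  interpret ev: comm_ring_hom "\<lambda>p. poly p a" by unfold_locales auto
  define W where "W = Matrix.mat n n (\<lambda>(i, l). poly ((pderiv ^^ l) (?h (m + i))) a)"
  define U where "U = Matrix.mat n n (\<lambda>(l, j). poly (rodrigues l j) a)"
  have Wc: "W \<in> carrier_mat n n" and Uc: "U \<in> carrier_mat n n" by (simp_all add: W_def U_def)
  have "map_mat (\<lambda>p. poly p a) (Matrix.mat n n (\<lambda>(i, j). ?h (m + i + j))) = W * U"
  proof (rule eq_matI)
    fix i j assume ij: "i < dim_row (W * U)" "j < dim_col (W * U)"
    then have i: "i < n" and j: "j < n" by (auto simp: W_def U_def)
    have "poly (?h (m + i + j)) a = (\<Sum>l\<le>j. poly (rodrigues l j) a * poly ((pderiv ^^ l) (?h (m + i))) a)"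
      by (simp add: hermite_add_rodrigues poly_sum)
    also have "\<dots> = (\<Sum>l<n. poly (rodrigues l j) a * poly ((pderiv ^^ l) (?h (m + i))) a)"
      using j by (intro sum.mono_neutral_left) (auto simp: rodrigues_eq_0)
    finally show "map_mat (\<lambda>p. poly p a) (Matrix.mat n n (\<lambda>(i, j). ?h (m + i + j))) $$ (i, j) = (W * U) $$ (i, j)"
      using i j by (simp add: W_def U_def scalar_prod_def atLeast0LessThan mult.commute)
  qed (auto simp: W_def U_def)
  then have "poly (hankel m n) a = Determinant.det (W * U)"
    unfolding hankel_def ev.hom_det[symmetric] by simp
  also have "\<dots> = Determinant.det W * Determinant.det U" by (rule det_mult[OF Wc Uc])
  finally have "poly (hankel m n) a = Determinant.det W * Determinant.det U" .
  moreover have "Determinant.det U \<noteq> 0"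
  proof -
    have "upper_triangular U" by (auto simp: U_def rodrigues_eq_0)
    then have "Determinant.det U = prod_list (diag_mat U)" by (rule det_upper_triangular[OF _ Uc])
    moreover have "0 \<notin> set (diag_mat U)" by (auto simp: diag_mat_def U_def rodrigues_diag)
    ultimately show ?thesis by (simp add: prod_list_zero_iff)
  qed
  ultimately have "poly (hankel m n) a = 0 \<longleftrightarrow> (\<exists>v. v \<in> carrier_vec n \<and> v \<noteq> 0\<^sub>v n \<and> W *\<^sub>v v = 0\<^sub>v n)"
    using det_0_iff_vec_prod_zero[OF Wc] by simp
  also have "\<dots> \<longleftrightarrow> (\<exists>p. p \<noteq> 0 \<and> pade_kernel a m n p)"
  proof -
    have key: "(\<Sum>l<n. W $$ (i, l) * c l) = fact (m + i) * (-1) ^ (m + i) * fps_nth (fps_of_poly p * gauss_fps a) (m + i)"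
      if i: "i < n" and p: "\<And>l. coeff p l = (if l < n then (-2) ^ l * c l else 0)" for i p c
    proof -
      have W: "W $$ (i, l) * c l = fact (m + i) * (-1) ^ (m + i) * (if l \<le> m + i then coeff p l * ?E (m + i - l) else 0)"
        if l: "l < n" for l
      proof (cases "l \<le> m + i")
        case True
        have "(-1) ^ (m + i) = ((-1) ^ l * (-1) ^ (m + i - l) :: complex)"
          using True by (simp flip: power_add)
        moreover have "(-2) ^ l = ((-1) ^ l * 2 ^ l :: complex)" by (simp flip: power_mult_distrib)
        moreover have "(-1) ^ j * (-1) ^ j = (1 :: complex)" for j by (simp flip: power_mult_distrib)
        then have "(-1) ^ j * ((-1) ^ j * x) = (x :: complex)" for j x by (simp flip: mult.assoc)
        ultimately show ?thesis using True i l
          by (simp add: W_def iterated_pderiv_hermite gauss_fps_def p mult_ac del: hermite.simps)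
      qed (use i l in \<open>simp add: W_def iterated_pderiv_hermite\<close>)
      have "(\<Sum>l<n. W $$ (i, l) * c l) = (\<Sum>l<n. fact (m + i) * (-1) ^ (m + i) * (if l \<le> m + i then coeff p l * ?E (m + i - l) else 0))"
        using W by (intro sum.cong) auto
      also have "\<dots> = fact (m + i) * (-1) ^ (m + i) * (\<Sum>l<n. if l \<le> m + i then coeff p l * ?E (m + i - l) else 0)"
        by (simp add: sum_distrib_left)
      also have "(\<Sum>l<n. if l \<le> m + i then coeff p l * ?E (m + i - l) else 0) = (\<Sum>l\<in>{..<n} \<inter> {..m + i}. coeff p l * ?E (m + i - l))"
        by (simp add: sum.inter_restrict)
      also have "\<dots> = (\<Sum>l=0..m + i. coeff p l * ?E (m + i - l))"
        by (intro sum.mono_neutral_left) (auto simp: p)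
      finally show ?thesis by (simp add: fps_mult_nth)
    qed
    show ?thesis
    proof
      assume "\<exists>v. v \<in> carrier_vec n \<and> v \<noteq> 0\<^sub>v n \<and> W *\<^sub>v v = 0\<^sub>v n"
      then obtain v where v: "v \<in> carrier_vec n" "v \<noteq> 0\<^sub>v n" "W *\<^sub>v v = 0\<^sub>v n" by blast
      define p where "p = (\<Sum>l<n. monom ((-2) ^ l * vec_index v l) l)"
      have p: "coeff p l = (if l < n then (-2) ^ l * vec_index v l else 0)" for l
        by (auto simp: p_def coeff_sum)
      have "(\<Sum>l<n. W $$ (i, l) * vec_index v l) = 0" if "i < n" for i
        using arg_cong[OF v(3), of "\<lambda>w. vec_index w i"] that v(1) Wc
        by (simp add: scalar_prod_def atLeast0LessThan)
      then have "pade_kernel a m n p" unfolding pade_kernel_def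
        using key[OF _ p] n by (auto intro!: le_less_trans[OF degree_le[of "n - 1"]] simp: p)
      moreover have "p \<noteq> 0"
      proof
        assume "p = 0"
        then have "vec_index v l = 0" if "l < n" for l using p[of l] that by simp
        then show False using v by (auto intro!: eq_vecI)
      qed
      ultimately show "\<exists>p. p \<noteq> 0 \<and> pade_kernel a m n p" by blast
    next
      assume "\<exists>p. p \<noteq> 0 \<and> pade_kernel a m n p"
      then obtain p where p: "p \<noteq> 0" "pade_kernel a m n p" by blast
      define v where "v = Matrix.vec n (\<lambda>l. coeff p l / (-2) ^ l)"
      have c: "coeff p l = (if l < n then (-2) ^ l * (coeff p l / (-2) ^ l) else 0)" for l
        using p(2) by (auto simp: pade_kernel_def coeff_eq_0)
      have "(\<Sum>l<n. W $$ (i, l) * (coeff p l / (-2) ^ l)) = 0" if "i < n" for i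
        using key[OF that c] p(2) that by (simp add: pade_kernel_def)
      then have "W *\<^sub>v v = 0\<^sub>v n"
        using Wc by (intro eq_vecI) (auto simp: v_def scalar_prod_def atLeast0LessThan)
      moreover have "v \<noteq> 0\<^sub>v n"
      proof
        assume "v = 0\<^sub>v n"
        then have "vec_index v (degree p) = 0" using p(2) by (simp add: pade_kernel_def)
        then show False using p by (simp add: v_def pade_kernel_def)
      qed
      moreover have "v \<in> carrier_vec n" by (simp add: v_def)
      ultimately show "\<exists>v. v \<in> carrier_vec n \<and> v \<noteq> 0\<^sub>v n \<and> W *\<^sub>v v = 0\<^sub>v n" by blast
    qed
  qed
  finally show ?thesis .
qed

theorem generalised_hermite_zero_iff_pade:
  assumes "generalised_hermite H" "n \<ge> 1"
  shows "poly (H m n) a = 0 \<longleftrightarrow> (\<exists>p. p \<noteq> 0 \<and> pade_kernel a m n p)"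
  using generalised_hermite_hankel[OF assms(1), of m n] hankel_zero_iff_pade[OF assms(2), of m a] by auto

section \<open>From Pade approximants to polynomial solutions\<close>

text \<open>
  The equation satisfied by \<open>f\<close> when \<open>\<psi> = x^((1 - K) / 2) exp (- s g) f\<close> solves the oscillator with \<open>\<theta>\<^sub>0 = K / 2\<close>,
  for power series. Polynomial solutions of degree \<open>d\<close> are the ones to be expected, as \<open>d\<close> annihilates the leading term.
\<close>

definition fps_ode :: "complex \<Rightarrow> complex \<Rightarrow> complex \<Rightarrow> complex \<Rightarrow> complex \<Rightarrow> complex fps \<Rightarrow> complex fps" where
  "fps_ode K s a d \<kappa> F =
     fps_X * fps_deriv (fps_deriv F) + fps_const (1 - K) * fps_deriv F
      - fps_const (2 * s) * fps_X * (fps_X + fps_const a) * fps_deriv F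
      + (fps_const (2 * s * d) * fps_X + fps_const \<kappa>) * F"

lemma fps_nth_fps_ode:
  "fps_nth (fps_ode K s a d \<kappa> F) k =
     of_nat (Suc k) * (of_nat (Suc k) - K) * fps_nth F (Suc k) + (\<kappa> - 2 * s * a * of_nat k) * fps_nth F k
      + (if k = 0 then 0 else 2 * s * (d + 1 - of_nat k) * fps_nth F (k - 1))"
proof -
  have x2: "fps_const c * fps_X * (fps_X + fps_const b) * G = fps_const c * (fps_X * (fps_X * G)) + fps_const (c * b) * (fps_X * G)"
    for c b and G :: "complex fps" by (simp add: algebra_simps flip: fps_const_mult)
  have x1: "(fps_const c * fps_X + fps_const b) * G = fps_const c * (fps_X * G) + fps_const b * G" for c b and G :: "complex fps"
    by (simp add: algebra_simps)
  have X: "fps_nth (fps_X * G) k = (if k = 0 then 0 else fps_nth G (k - 1))" for k and G :: "complex fps" by simp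
  show ?thesis
    unfolding fps_ode_def x1 x2 fps_add_nth fps_sub_nth fps_mult_left_const_nth X fps_deriv_nth
    by (cases k; cases "k - 1") (simp_all add: algebra_simps)
qed

lemma fps_ode_diff_kappa:
  "fps_ode K s a d \<kappa> F - fps_ode K s a d \<kappa>' F = fps_const (\<kappa> - \<kappa>') * F"
  by (simp add: fps_ode_def algebra_simps flip: fps_const_sub)

lemma fps_ode_const_mult: "fps_ode K s a d \<kappa> (fps_const c * F) = fps_const c * fps_ode K s a d \<kappa> F"
  by (simp add: fps_ode_def algebra_simps)

lemma fps_ode_low_zero:
  assumes "fps_ode (of_nat K) s a d \<kappa> F = 0" "fps_nth F 0 = 0" "k < K"
  shows "fps_nth F k = 0"
  using assms(3)
proof (induction k rule: less_induct)
  case (less k)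
  show ?case
  proof (cases k)
    case (Suc j)
    have "fps_nth F j = 0" "j \<noteq> 0 \<Longrightarrow> fps_nth F (j - 1) = 0" using less Suc by auto
    moreover have "fps_nth (fps_ode (of_nat K) s a d \<kappa> F) j = 0" using assms by simp
    ultimately have "of_nat (Suc j) * (of_nat (Suc j) - of_nat K) * fps_nth F (Suc j) = 0"
      unfolding fps_nth_fps_ode by (auto split: if_splits)
    moreover have "of_nat (Suc j) \<noteq> (of_nat K :: complex)" using less.prems Suc by (metis less_irrefl of_nat_eq_iff)
    ultimately show ?thesis using Suc by (simp del: of_nat_Suc)
  qed (use assms in simp)
qed

text \<open>
  The parameter \<open>d = r - 1\<close> is the only degree that a nonzero polynomial solution can have.
\<close>

definition poly_solution :: "nat \<Rightarrow> complex \<Rightarrow> complex \<Rightarrow> nat \<Rightarrow> complex \<Rightarrow> complex poly \<Rightarrow> bool" where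
  "poly_solution K s a r \<kappa> P \<longleftrightarrow> P \<noteq> 0 \<and> degree P < r \<and>
     fps_ode (of_nat K) s a (of_nat r - 1) \<kappa> (fps_of_poly P) = 0"

text \<open>
  The exponents at the origin are \<open>0\<close> and \<open>K\<close>, and a polynomial of degree below \<open>K\<close> cannot begin with \<open>x^K\<close>.
\<close>

lemma poly_solution_0:
  assumes "poly_solution K s a r \<kappa> P" "r \<le> K"
  shows "coeff P 0 \<noteq> 0"
proof
  assume 0: "coeff P 0 = 0"
  have "coeff P (degree P) = 0"
    using fps_ode_low_zero[of K s a _ \<kappa> "fps_of_poly P" "degree P"] assms 0
    by (auto simp: poly_solution_def)
  then show False using assms by (simp add: poly_solution_def)
qed

text \<open>
  With \<open>E = exp (- t^2 - 2 a t)\<close> this is \<open>P^2 E\<close> times the derivative of \<open>Q / (P E)\<close>.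
\<close>

definition wronskian_poly :: "complex \<Rightarrow> complex poly \<Rightarrow> complex poly \<Rightarrow> complex poly" where
  "wronskian_poly a P Q = P * pderiv Q - pderiv P * Q + [:2 * a, 2:] * P * Q"

lemma fps_of_poly_lin: "fps_of_poly [:b, c :: complex:] = fps_const b + fps_const c * fps_X"
  by (rule fps_ext) (auto simp: coeff_pCons split: nat.splits)

lemma fps_of_poly_wronskian:
  "fps_of_poly (wronskian_poly a P Q) = fps_of_poly P * fps_deriv (fps_of_poly Q)
    - fps_deriv (fps_of_poly P) * fps_of_poly Q + 2 * (fps_X + fps_const a) * fps_of_poly P * fps_of_poly Q"
proof -
  have "fps_of_poly [:2 * a, 2:] = 2 * (fps_X + fps_const a)"
    by (simp add: fps_of_poly_lin algebra_simps fps_numeral_fps_const)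
  then show ?thesis
    by (simp add: wronskian_poly_def fps_of_poly_mult fps_of_poly_diff fps_of_poly_add fps_of_poly_pderiv
        del: mult_pCons_left)
qed

lemma degree_wronskian_poly:
  assumes "P \<noteq> 0" "Q \<noteq> 0"
  shows "degree (wronskian_poly a P Q) = degree P + degree Q + 1"
    and "lead_coeff (wronskian_poly a P Q) = 2 * lead_coeff P * lead_coeff Q"
proof -
  let ?d = "degree P + degree Q + 1"
  have 1: "degree (P * pderiv Q) < ?d" "degree (pderiv P * Q) < ?d"
    by (auto simp: degree_pderiv intro!: le_less_trans[OF degree_mult_le])
  have 2: "degree ([:2 * a, 2:] * P * Q) = ?d" using assms by (simp add: degree_mult_eq del: mult_pCons_left)
  have 3: "lead_coeff ([:2 * a, 2:] * P * Q) = 2 * lead_coeff P * lead_coeff Q" by (simp add: lead_coeff_mult del: mult_pCons_left)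
  have c: "coeff (wronskian_poly a P Q) ?d = 2 * lead_coeff P * lead_coeff Q"
    using 1 3 unfolding 2 by (simp add: wronskian_poly_def coeff_eq_0 del: mult_pCons_left)
  have "degree (wronskian_poly a P Q) \<le> ?d"
    unfolding wronskian_poly_def using 1 2 by (intro degree_add_le degree_diff_le) auto
  moreover have "coeff (wronskian_poly a P Q) ?d \<noteq> 0" using c assms by simp
  ultimately show *: "degree (wronskian_poly a P Q) = ?d" using le_degree by (metis le_antisym)
  show "lead_coeff (wronskian_poly a P Q) = 2 * lead_coeff P * lead_coeff Q" using c by (simp add: *)
qed

text \<open>
  If \<open>Q = P E\<close> up to order \<open>K\<close>, then \<open>Q / (P E)\<close> is constant up to order \<open>K\<close>, which costs one order in the derivative.
\<close>

lemma pade_wronskian_order: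
  assumes PE: "fps_of_poly P * gauss_fps a = fps_of_poly Q + fps_X ^ K * r" and k: "k + 1 < K"
  shows "coeff (wronskian_poly a P Q) k = 0"
proof -
  obtain j where j: "K = Suc j" using k by (cases K) auto
  let ?P = "fps_of_poly P" and ?E = "gauss_fps a" and ?W = "fps_X + fps_const a"
  have Q: "fps_of_poly Q = ?P * ?E - fps_X ^ K * r" using PE by simp
  have dX: "fps_deriv (fps_X ^ K * r) = fps_X ^ j * (of_nat K * r + fps_X * fps_deriv r)"
    unfolding j fps_deriv_mult fps_deriv_power by (simp add: algebra_simps fps_of_nat del: of_nat_Suc)
  have XK: "fps_X ^ K * r = fps_X ^ j * (fps_X * r)" by (simp add: j mult_ac)
  have "fps_of_poly (wronskian_poly a P Q) =
     - (fps_X ^ j * (?P * (of_nat K * r + fps_X * fps_deriv r) - fps_deriv ?P * (fps_X * r) + 2 * ?W * ?P * (fps_X * r)))"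
    unfolding fps_of_poly_wronskian Q fps_deriv_sub dX
    unfolding fps_deriv_mult fps_deriv_gauss_fps XK by (simp add: algebra_simps)
  then have "fps_nth (fps_of_poly (wronskian_poly a P Q)) k = 0"
    using k j by (simp add: fps_X_power_mult_nth)
  then show ?thesis by simp
qed

lemma pade_degree_bound:
  assumes PE: "fps_of_poly P * gauss_fps a = fps_of_poly Q + fps_X ^ K * r" and "P \<noteq> 0" "Q \<noteq> 0"
  shows "K \<le> degree P + degree Q + 2"
proof (rule ccontr)
  assume "\<not> ?thesis"
  then have "lead_coeff (wronskian_poly a P Q) = 0"
    using pade_wronskian_order[OF PE, of "degree P + degree Q + 1"] degree_wronskian_poly(1)[of P Q a] assms by simp
  then show False using degree_wronskian_poly(2)[of P Q a] assms by simp
qed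

text \<open>
  The Wronskian has order at least \<open>m + n - 1\<close> and degree \<open>deg p + deg q + 1\<close>, so all degrees are the largest possible.
\<close>

lemma pade_kernel_obtain:
  assumes "p \<noteq> 0" "pade_kernel a m n p"
  obtains q r where "fps_of_poly p * gauss_fps a = fps_of_poly q + fps_X ^ (m + n) * r"
    "q \<noteq> 0" "degree q < m" "degree q = m - 1" "degree p = n - 1" "coeff p 0 \<noteq> 0"
proof -
  let ?F = "fps_of_poly p * gauss_fps a"
  define q where "q = (\<Sum>k<m. monom (fps_nth ?F k) k)"
  define r where "r = fps_shift (m + n) (?F - fps_of_poly q)"
  have q: "coeff q k = (if k < m then fps_nth ?F k else 0)" for k by (auto simp: q_def coeff_sum)
  have z: "fps_nth (?F - fps_of_poly q) k = 0" if "k < m + n" for k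
    using that assms(2) q[of k] unfolding pade_kernel_def
    by (cases "k < m") (auto dest: spec[of _ "k - m"])
  have F: "?F = fps_of_poly q + fps_X ^ (m + n) * r"
  proof (rule fps_ext)
    fix k show "fps_nth ?F k = fps_nth (fps_of_poly q + fps_X ^ (m + n) * r) k"
      using z[of k] by (cases "k < m + n") (auto simp: fps_X_power_mult_nth r_def)
  qed
  have dp: "degree p < n" using assms(2) by (simp add: pade_kernel_def)
  have q0: "q \<noteq> 0"
  proof
    assume "q = 0"
    then have z': "fps_nth ?F k = 0" if "k < m + n" for k using z[OF that] by simp
    have "subdegree (fps_of_poly p) \<le> degree p" using assms(1) by (intro subdegree_leI) simp
    moreover have "gauss_fps a \<noteq> 0" using gauss_fps_0[of a] by auto
    moreover have "subdegree (gauss_fps a) = 0" using gauss_fps_0[of a] by (simp add: subdegree_eq_0_iff)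
    ultimately have "subdegree ?F \<le> degree p" "?F \<noteq> 0" using assms(1) by auto
    then show False using z'[of "subdegree ?F"] dp by (metis nth_subdegree_nonzero le_less_trans trans_less_add2)
  qed
  have dq: "degree q < m"
  proof (rule ccontr)
    assume "\<not> degree q < m" then have "lead_coeff q = 0" by (simp add: q)
    then show False using q0 by simp
  qed
  have *: "m + n \<le> degree p + degree q + 2" by (rule pade_degree_bound[OF F assms(1) q0])
  have "coeff p 0 \<noteq> 0"
  proof
    assume p0: "coeff p 0 = 0"
    then obtain p1 where p1: "p = pCons 0 p1" by (cases p) auto
    have "coeff q 0 = 0" using p0 q[of 0] by (simp add: fps_mult_nth)
    then obtain q1 where q1: "q = pCons 0 q1" by (cases q) auto
    have nz: "p1 \<noteq> 0" "q1 \<noteq> 0" using assms(1) q0 p1 q1 by auto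
    have "fps_X * (fps_of_poly p1 * gauss_fps a) = fps_X * (fps_of_poly q1 + fps_X ^ (m + n - 1) * r)"
      using F dp by (cases "m + n") (auto simp: p1 q1 fps_of_poly_pCons algebra_simps)
    then have "fps_of_poly p1 * gauss_fps a = fps_of_poly q1 + fps_X ^ (m + n - 1) * r"
      by (metis fps_X_neq_zero mult_cancel_left)
    from pade_degree_bound[OF this nz] show False using dp dq nz by (simp add: p1 q1)
  qed
  then show ?thesis using that[OF F q0 dq] * dp dq by simp
qed

text \<open>
  Two denominators have the same degree, so a combination of smaller degree vanishes.
\<close>

lemma pade_kernel_unique:
  assumes "p \<noteq> 0" "pade_kernel a m n p" "q \<noteq> 0" "pade_kernel a m n q"
  shows "\<exists>c. q = smult c p"
proof -
  define r where "r = smult (lead_coeff q) p - smult (lead_coeff p) q"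
  have d: "degree p = n - 1" "degree q = n - 1" "n \<ge> 1"
    using pade_kernel_obtain[OF assms(1,2)] pade_kernel_obtain[OF assms(3,4)] assms(2) by (auto simp: pade_kernel_def)
  have c0: "coeff r (n - 1) = 0" using d by (simp add: r_def)
  have dr: "degree r \<le> n - 1" unfolding r_def using d by (intro degree_diff_le) (auto intro: order.trans[OF degree_smult_le])
  have "pade_kernel a m n r"
    using assms(2,4) dr d(3)
    by (auto simp: pade_kernel_def r_def fps_of_poly_diff fps_of_poly_smult left_diff_distrib mult.assoc)
  then have "r = 0"
    using pade_kernel_obtain[of r a m n] c0 by (metis leading_coeff_0_iff)
  then have "smult (inverse (lead_coeff p)) (smult (lead_coeff q) p) = smult (inverse (lead_coeff p)) (smult (lead_coeff p) q)"
    by (simp add: r_def)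
  then show ?thesis using assms(1) by (intro exI[of _ "inverse (lead_coeff p) * lead_coeff q"]) simp
qed

lemma dvd_mult_no_common_root:
  fixes P Q C :: "complex poly"
  assumes "P \<noteq> 0" "P dvd Q * C" "\<And>z. poly P z = 0 \<Longrightarrow> poly Q z \<noteq> 0"
  shows "P dvd C"
  using assms
proof (induction "degree P" arbitrary: P C)
  case 0
  then show ?case by (metis is_unit_iff_degree unit_imp_dvd)
next
  case (Suc k)
  then obtain z where z: "poly P z = 0"
    using alg_closed_imp_poly_has_root[of P] by (metis zero_less_Suc)
  then obtain P' where P': "P = [:-z, 1:] * P'" by (auto simp: poly_eq_0_iff_dvd)
  have "P' \<noteq> 0" using Suc.prems P' by auto
  obtain W where "Q * C = P * W" using Suc.prems(2) by (auto elim: dvdE)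
  then have "poly Q z * poly C z = 0" using z by (metis poly_mult mult_zero_left)
  then have "poly C z = 0" using Suc.prems(3)[OF z] by simp
  then obtain C' where C': "C = [:-z, 1:] * C'" by (auto simp: poly_eq_0_iff_dvd)
  have "[:-z, 1:] * P' dvd [:-z, 1:] * (Q * C')" using Suc.prems(2) unfolding P' C' by (metis mult.left_commute)
  then have "P' dvd Q * C'" by (subst (asm) dvd_mult_cancel_left) auto
  moreover have "k = degree P'" using Suc.hyps(2) \<open>P' \<noteq> 0\<close> unfolding P' by (subst (asm) degree_mult_eq) auto
  moreover have "poly Q y \<noteq> 0" if "poly P' y = 0" for y using Suc.prems(3)[of y] that by (simp add: P')
  ultimately have "P' dvd C'" using Suc.hyps(1) \<open>P' \<noteq> 0\<close> by blast
  then show ?case unfolding P' C' by (rule mult_dvd_mono[OF dvd_refl])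
qed

lemma monom_eqI: "(\<And>k. k \<noteq> N \<Longrightarrow> coeff p k = 0) \<Longrightarrow> p = monom (coeff p N) N"
  by (rule poly_eqI) auto

text \<open>
  The Wronskian \<open>R\<close> is a monomial of degree \<open>N - 1\<close>, so \<open>t R' = (N - 1) R\<close>. Written out, this reads \<open>P D = Q C\<close>, where \<open>C\<close> and \<open>D\<close>
  collect the derivatives of \<open>P\<close> and \<open>Q\<close> respectively. A common root of \<open>P\<close> and \<open>Q\<close> would be a root of \<open>R\<close>, hence
  zero, where \<open>P\<close> does not vanish. So \<open>P\<close> divides \<open>C\<close>; the quotient \<open>T\<close> has degree one by counting, and its constant
  term is \<open>- \<kappa>\<close>. Then \<open>C = P T\<close> and \<open>D = Q T\<close> are the two equations.
\<close>

theorem pade_imp_poly_solutions: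
  assumes m: "m \<ge> 1" and n: "n \<ge> 1" and P0: "P \<noteq> 0" and ker: "pade_kernel a m n P"
  shows "\<exists>\<kappa> Q. poly_solution (m + n) 1 a n \<kappa> P \<and>
    poly_solution (m + n) (-1) a m (\<kappa> - 2 * a * (of_nat (m + n) - 1)) Q"
proof -
  let ?N = "m + n"
  obtain Q r where Q: "fps_of_poly P * gauss_fps a = fps_of_poly Q + fps_X ^ (m + n) * r"
    "Q \<noteq> 0" "degree Q = m - 1" "degree P = n - 1" "coeff P 0 \<noteq> 0"
    using pade_kernel_obtain[OF P0 ker] by metis
  define R where "R = wronskian_poly a P Q"
  have dR: "degree R = ?N - 1" unfolding R_def using degree_wronskian_poly(1)[OF P0 Q(2)] Q m n by simp
  define c where "c = coeff R (?N - 1)"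
  have R: "R = monom c (?N - 1)" unfolding c_def
  proof (rule monom_eqI)
    fix k assume "k \<noteq> ?N - 1"
    then consider "k + 1 < ?N" | "k > ?N - 1" by linarith
    then show "coeff R k = 0"
    proof cases
      case 1 then show ?thesis unfolding R_def by (rule pade_wronskian_order[OF Q(1)])
    qed (simp add: dR coeff_eq_0)
  qed
  have "c \<noteq> 0" unfolding c_def using degree_wronskian_poly(2)[OF P0 Q(2), of a] P0 Q(2) dR by (simp add: R_def)
  define M where "M = [:of_nat (?N - 1) :: complex:]"
  let ?X = "[:0, 1::complex:]" and ?A = "[:a:]"
  define C where "C = ?X * pderiv (pderiv P) - M * pderiv P - 2 * ?X * (?X + ?A) * pderiv P"
  define D where "D = ?X * pderiv (pderiv Q) - M * pderiv Q + 2 * ?X * (?X + ?A) * pderiv Q + 2 * ?X * Q - 2 * M * (?X + ?A) * Q"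
  have XR: "?X * pderiv R = M * R"
  proof (cases "?N - 1")
    case (Suc j)
    have "pderiv R = monom (of_nat (Suc j) * c) j" unfolding R Suc pderiv_monom by simp
    then show ?thesis unfolding M_def R Suc by (simp add: monom_Suc smult_monom del: of_nat_Suc)
  qed (simp add: R M_def pderiv_monom)
  have lin: "[:2 * a, 2:] = 2 * (?X + ?A)" by (simp add: numeral_poly)
  have "P * D = Q * C"
  proof -
    have "pderiv R = P * pderiv (pderiv Q) - pderiv (pderiv P) * Q + 2 * P * Q + 2 * (?X + ?A) * (pderiv P * Q + P * pderiv Q)"
    proof -
      define L where "L = 2 * (?X + ?A)"
      have "pderiv L = 2" by (simp add: L_def numeral_poly pderiv_pCons)
      then show ?thesis unfolding R_def wronskian_poly_def lin L_def[symmetric]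
        by (simp add: pderiv_mult pderiv_add pderiv_diff algebra_simps)
    qed
    then have "?X * (P * pderiv (pderiv Q) - pderiv (pderiv P) * Q + 2 * P * Q + 2 * (?X + ?A) * (pderiv P * Q + P * pderiv Q))
      = M * (P * pderiv Q - pderiv P * Q + 2 * (?X + ?A) * P * Q)"
      using XR unfolding R_def wronskian_poly_def lin by simp
    moreover have "p * (X * q2 - M * q1 + 2 * X * W * q1 + 2 * X * q - 2 * M * W * q) = q * (X * p2 - M * p1 - 2 * X * W * p1)"
      if "X * (p * q2 - p2 * q + 2 * p * q + 2 * W * (p1 * q + p * q1)) = M * (p * q1 - p1 * q + 2 * W * p * q)"
      for p p1 p2 q q1 q2 X W M :: "complex poly"
    proof -
      have "p * (X * q2 - M * q1 + 2 * X * W * q1 + 2 * X * q - 2 * M * W * q) - q * (X * p2 - M * p1 - 2 * X * W * p1)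
        = X * (p * q2 - p2 * q + 2 * p * q + 2 * W * (p1 * q + p * q1)) - M * (p * q1 - p1 * q + 2 * W * p * q)"
        by (simp add: algebra_simps)
      then show ?thesis using that by simp
    qed
    ultimately show ?thesis unfolding C_def D_def by blast
  qed
  have nr: "poly Q z \<noteq> 0" if "poly P z = 0" for z
  proof
    assume "poly Q z = 0"
    then have "poly R z = 0" using that by (simp add: R_def wronskian_poly_def)
    then have "z = 0" using \<open>c \<noteq> 0\<close> by (simp add: R poly_monom)
    then show False using that Q(5) by (simp add: poly_0_coeff_0)
  qed
  have "P dvd C"
    by (rule dvd_mult_no_common_root[OF P0 _ nr]) (metis \<open>P * D = Q * C\<close> dvd_triv_left)
  then obtain T where T: "C = P * T" by (auto elim: dvdE)
  have DT: "D = Q * T" using \<open>P * D = Q * C\<close> P0 unfolding T by (metis mult.left_commute mult_cancel_left)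
  have dC: "degree C \<le> n"
  proof -
    have "degree (pderiv P) \<le> n - 1 - 1" "degree (pderiv (pderiv P)) \<le> n - 1 - 1"
      using Q by (auto simp: degree_pderiv)
    moreover have "2 * ?X * (?X + ?A) = [:0, 2 * a, 2:]" by (simp add: numeral_poly)
    ultimately show ?thesis
    proof (cases "n = 1")
      case True
      then have "pderiv P = 0" using Q by (simp add: pderiv_eq_0_iff)
      then show ?thesis by (simp add: C_def)
    next
      case False
      assume *: "degree (pderiv P) \<le> n - 1 - 1" "degree (pderiv (pderiv P)) \<le> n - 1 - 1" "2 * ?X * (?X + ?A) = [:0, 2 * a, 2:]"
      show ?thesis unfolding C_def M_def *(3) using * False n
        by (intro degree_diff_le order.trans[OF degree_mult_le]) auto
    qed
  qed
  have "degree T \<le> 1"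
  proof (cases "T = 0")
    case False
    then have "degree C = degree P + degree T" unfolding T using P0 by (simp add: degree_mult_eq)
    then show ?thesis using dC Q n by simp
  qed simp
  then obtain t0 t1 where t: "T = [:t0, t1:]" 
    by (metis One_nat_def degree_0_id degree_pCons_eq_if le_SucE le_zero_eq pCons_0_0 pCons_cases nat.inject)
  have t1: "t1 = - 2 * (of_nat n - 1)"
  proof -
    have "coeff C n = - 2 * (of_nat n - 1) * lead_coeff P"
    proof (cases "n = 1")
      case True
      then have "pderiv P = 0" using Q by (simp add: pderiv_eq_0_iff)
      then show ?thesis using True by (simp add: C_def)
    next
      case False
      then obtain j where j: "n = Suc (Suc j)" using n by (metis One_nat_def not0_implies_Suc not_one_le_zero)
      have X2: "2 * ?X * (?X + ?A) = [:0, 2 * a, 2:]" by (simp add: numeral_poly)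
      show ?thesis unfolding C_def M_def X2 using Q(4) j
        by (simp add: coeff_pderiv coeff_eq_0 algebra_simps)
    qed
    moreover have "coeff C n = lead_coeff P * t1"
      using Q(4) n unfolding T t by (cases n) (auto simp: coeff_eq_0 mult.commute)
    ultimately show ?thesis using P0 by auto
  qed
  have fX: "fps_of_poly ?X = fps_X" by (simp add: fps_of_poly_lin)
  have two: "fps_of_poly (2 :: complex poly) = 2" by simp
  have M: "fps_of_poly M = - fps_const (1 - of_nat ?N)" using n m by (simp add: M_def fps_of_poly_const of_nat_diff)
  have Tf: "fps_of_poly T = - (fps_const (2 * 1 * (of_nat n - 1)) * fps_X + fps_const (- t0))"
    unfolding t by (simp add: fps_of_poly_lin t1 algebra_simps)
  have 2: "fps_const (2 * 1) = (2 :: complex fps)" "fps_const (2 * -1) = (-2 :: complex fps)" by (simp_all add: fps_numeral_fps_const)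
  have "fps_of_poly C = fps_of_poly P * fps_of_poly T" by (simp add: T fps_of_poly_mult)
  then have eC: "fps_X * fps_deriv (fps_deriv (fps_of_poly P)) - - fps_const (1 - of_nat ?N) * fps_deriv (fps_of_poly P)
      - 2 * fps_X * (fps_X + fps_const a) * fps_deriv (fps_of_poly P)
      = fps_of_poly P * - (fps_const (2 * 1 * (of_nat n - 1)) * fps_X + fps_const (- t0))"
    unfolding C_def fps_of_poly_diff fps_of_poly_mult fps_of_poly_add fps_of_poly_pderiv fX M two Tf fps_of_poly_const .
  have "fps_of_poly D = fps_of_poly Q * fps_of_poly T" by (simp add: DT fps_of_poly_mult)
  then have eD: "fps_X * fps_deriv (fps_deriv (fps_of_poly Q)) - - fps_const (1 - of_nat ?N) * fps_deriv (fps_of_poly Q)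
      + 2 * fps_X * (fps_X + fps_const a) * fps_deriv (fps_of_poly Q) + 2 * fps_X * fps_of_poly Q
      - 2 * - fps_const (1 - of_nat ?N) * (fps_X + fps_const a) * fps_of_poly Q
      = fps_of_poly Q * - (fps_const (2 * 1 * (of_nat n - 1)) * fps_X + fps_const (- t0))"
    unfolding D_def fps_of_poly_diff fps_of_poly_mult fps_of_poly_add fps_of_poly_pderiv fX M two Tf fps_of_poly_const .
  have c2: "fps_const (2 * -1 * (of_nat m - 1)) = fps_const (2 * 1 * (of_nat n - 1)) + 2 + 2 * fps_const (1 - of_nat ?N :: complex)"
    "fps_const (- t0 - 2 * a * (of_nat (m + n) - 1)) = fps_const (- t0) + 2 * fps_const (1 - of_nat ?N) * fps_const a"
    unfolding fps_numeral_fps_const by (simp_all add: algebra_simps)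
  have g1: "X * p2 + K * p1 - s * X * (X + A) * p1 + (c * X + k) * p = 0"
    if "X * p2 - - K * p1 - 2 * X * (X + A) * p1 = p * - (c * X + k)" "s = 2" for X p p1 p2 K A c k s :: "complex fps"
    using that(1) unfolding that(2) by (simp add: algebra_simps)
  have g2: "X * q2 + K * q1 - s * X * (X + A) * q1 + (c' * X + k') * q = 0"
    if "X * q2 - - K * q1 + 2 * X * (X + A) * q1 + 2 * X * q - 2 * - K * (X + A) * q = q * - (c * X + k)"
      "s = - 2" "c' = c + 2 + 2 * K" "k' = k + 2 * K * A" for X q q1 q2 K A c k c' k' s :: "complex fps"
  proof -
    have "X * q2 + K * q1 - s * X * (X + A) * q1 + (c' * X + k') * q
      = (X * q2 - - K * q1 + 2 * X * (X + A) * q1 + 2 * X * q - 2 * - K * (X + A) * q) - q * - (c * X + k)"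
      unfolding that(2-) by (simp add: algebra_simps)
    then show ?thesis unfolding that(1) by simp
  qed
  have o1: "fps_ode (of_nat ?N) 1 a (of_nat n - 1) (- t0) (fps_of_poly P) = 0"
    unfolding fps_ode_def by (rule g1[OF eC 2(1)])
  have o2: "fps_ode (of_nat ?N) (-1) a (of_nat m - 1) (- t0 - 2 * a * (of_nat (m + n) - 1)) (fps_of_poly Q) = 0"
    unfolding fps_ode_def by (rule g2[OF eD 2(2) c2])
  show ?thesis
    using o1 o2 P0 Q m n by (intro exI[of _ "- t0"] exI[of _ Q]) (auto simp: poly_solution_def)
qed

text \<open>
  The two equations give \<open>t R' = (N - 1) R\<close> for the Wronskian \<open>R\<close>, so \<open>R\<close> is a monomial of degree \<open>N - 1\<close> and the derivative \<open>R / (P^2 E)\<close> of \<open>Q / (P E)\<close>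
  has order \<open>N - 1\<close>. Thus \<open>P E\<close> is a multiple of \<open>Q\<close> up to order \<open>N\<close>.
\<close>

theorem poly_solutions_imp_pade:
  assumes P: "poly_solution (m + n) 1 a n \<kappa> P"
    and Q: "poly_solution (m + n) (-1) a m (\<kappa> - 2 * a * (of_nat (m + n) - 1)) Q"
  shows "pade_kernel a m n P"
proof -
  let ?N = "m + n"
  let ?P = "fps_of_poly P" and ?Q = "fps_of_poly Q" and ?E = "gauss_fps a" and ?W = "fps_X + fps_const a"
  have mn: "m \<ge> 1" "n \<ge> 1" using P Q by (auto simp: poly_solution_def)
  have dP: "degree P < n" and dQ: "degree Q < m" using P Q by (auto simp: poly_solution_def)
  define R where "R = fps_of_poly (wronskian_poly a P Q)"
  have R: "R = ?P * fps_deriv ?Q - fps_deriv ?P * ?Q + 2 * ?W * ?P * ?Q"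
    by (simp add: R_def fps_of_poly_wronskian)
  have XR: "fps_X * fps_deriv R = of_nat (?N - 1) * R"
  proof -
    note o1 = poly_solution_def[of "m + n" 1 a n \<kappa> P, THEN iffD1, OF P, THEN conjunct2, THEN conjunct2,
        unfolded fps_ode_def]
    note o2 = poly_solution_def[THEN iffD1, OF Q, THEN conjunct2, THEN conjunct2, unfolded fps_ode_def]
    have dR: "fps_deriv R = ?P * fps_deriv (fps_deriv ?Q) - fps_deriv (fps_deriv ?P) * ?Q + 2 * ?P * ?Q
       + 2 * ?W * (fps_deriv ?P * ?Q + ?P * fps_deriv ?Q)"
      unfolding R by (simp add: algebra_simps)
    have cc: "fps_const (1 - of_nat ?N) = - (of_nat (?N - 1) :: complex fps)"
      "fps_const (2 * 1) = (2 :: complex fps)" "fps_const (2 * (- 1)) = (- 2 :: complex fps)"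
      "fps_const (2 * (- 1) * (of_nat m - 1)) = (fps_const (2 * 1 * (of_nat n - 1)) + 2 - 2 * of_nat (?N - 1) :: complex fps)"
      "fps_const (\<kappa> - 2 * a * (of_nat (m + n) - 1)) = fps_const \<kappa> - 2 * of_nat (?N - 1) * fps_const a"
      using mn unfolding fps_numeral_fps_const fps_of_nat[symmetric] by (simp_all add: of_nat_diff algebra_simps)
    have alg: "X * (p * q2 - p2 * q + 2 * p * q + 2 * (X + A) * (p1 * q + p * q1)) = M * (p * q1 - p1 * q + 2 * (X + A) * p * q)"
      if "X * p2 + K * p1 - s * X * (X + A) * p1 + (c * X + k) * p = 0"
         "X * q2 + K * q1 - s' * X * (X + A) * q1 + (c' * X + k') * q = 0"
         "K = - M" "s = 2" "s' = - 2" "c' = c + 2 - 2 * M" "k' = k - 2 * M * A"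
      for p p1 p2 q q1 q2 X A M c k c' k' s s' K :: "complex fps"
    proof -
      have "X * (p * q2 - p2 * q + 2 * p * q + 2 * (X + A) * (p1 * q + p * q1)) - M * (p * q1 - p1 * q + 2 * (X + A) * p * q)
        = p * (X * q2 + K * q1 - s' * X * (X + A) * q1 + (c' * X + k') * q)
          - q * (X * p2 + K * p1 - s * X * (X + A) * p1 + (c * X + k) * p)"
        unfolding that(3-) by (simp add: algebra_simps)
      then show ?thesis using that(1,2) by simp
    qed
    show ?thesis unfolding dR unfolding R by (rule alg[OF o1 o2 cc])
  qed
  have Rk: "fps_nth R k = 0" if "k \<noteq> ?N - 1" for k
  proof -
    have "fps_nth (fps_X * fps_deriv R) k = of_nat k * fps_nth R k" by (cases k) auto
    moreover have "fps_nth (of_nat (?N - 1) * R) k = of_nat (?N - 1) * fps_nth R k" by (simp flip: fps_of_nat)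
    ultimately have "(of_nat k - of_nat (?N - 1)) * fps_nth R k = 0"
      unfolding left_diff_distrib using XR by (metis diff_self)
    moreover have "of_nat k - of_nat (?N - 1) \<noteq> (0 :: complex)"
      using that by (metis of_nat_eq_iff right_minus_eq)
    ultimately show ?thesis by (metis mult_eq_0_iff)
  qed
  have P0: "coeff P 0 \<noteq> 0" by (rule poly_solution_0[OF P]) simp
  define F where "F = ?Q * inverse (?P * ?E)"
  have u: "fps_nth (?P * ?E) 0 \<noteq> 0" "fps_nth (?P * ?P * ?E) 0 \<noteq> 0" using P0 by (simp_all add: gauss_fps_0)
  have Fq: "?P * ?E * F = ?Q" using inverse_mult_eq_1'[OF u(1)] by (metis F_def mult.left_commute mult_1_right)
  have dF: "?P * ?P * ?E * fps_deriv F = R"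
  proof -
    have "fps_deriv (?P * ?E * F) = fps_deriv ?Q" by (simp add: Fq)
    moreover have "fps_deriv (?P * ?E * F) = (fps_deriv ?P * ?E + ?P * (- 2 * ?W * ?E)) * F + ?P * ?E * fps_deriv F"
      by (simp add: fps_deriv_gauss_fps algebra_simps)
    moreover have "p * p * e * f1 = p * q1 - p1 * q + 2 * w * p * q"
      if "(p1 * e + p * (- 2 * w * e)) * f + p * e * f1 = q1" "p * e * f = q" for p p1 e f f1 q q1 w :: "complex fps"
      unfolding that[symmetric] by (simp add: algebra_simps)
    ultimately show ?thesis unfolding R using Fq by metis
  qed
  have "fps_deriv F = R * inverse (?P * ?P * ?E)"
  proof -
    define U where "U = ?P * ?P * ?E"
    have "U * inverse U = 1" using u(2) by (simp add: U_def inverse_mult_eq_1')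
    moreover have "R * inverse U = (U * inverse U) * fps_deriv F"
      unfolding dF[symmetric] U_def by (simp only: mult_ac)
    ultimately show ?thesis by (simp add: U_def)
  qed
  then have "fps_nth (fps_deriv F) k = 0" if "k < ?N - 1" for k
    using that Rk by (simp add: fps_mult_nth)
  then have Fk: "fps_nth F (Suc k) = 0" if "Suc k < ?N" for k using that by (force simp del: of_nat_Suc)
  have conv: "fps_nth ?Q k = fps_nth (?P * ?E) k * fps_nth F 0" if "k < ?N" for k
  proof -
    have "fps_nth ?Q k = (\<Sum>i=0..k. fps_nth (?P * ?E) i * fps_nth F (k - i))" by (simp only: Fq[symmetric] fps_mult_nth)
    also have "\<dots> = (\<Sum>i\<in>{k}. fps_nth (?P * ?E) i * fps_nth F (k - i))"
      using that Fk by (intro sum.mono_neutral_right) (auto, metis Suc_diff_Suc le_neq_implies_less less_imp_diff_less)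
    finally show ?thesis by simp
  qed
  have F0: "fps_nth F 0 \<noteq> 0"
  proof
    assume "fps_nth F 0 = 0"
    then have "coeff Q (degree Q) = 0" using conv[of "degree Q"] dQ by simp
    then show False using Q by (simp add: poly_solution_def)
  qed
  have "fps_nth (?P * ?E) (m + i) = 0" if "i < n" for i
    using conv[of "m + i"] that F0 dQ by (simp add: coeff_eq_0)
  then show ?thesis using dP by (simp add: pade_kernel_def)
qed

text \<open>
  \<open>P\<close> is determined up to a factor as the denominator of the Pade approximant, and it satisfies the equation for one \<open>\<kappa>\<close> only.
\<close>

theorem poly_solutions_kappa_unique:
  assumes P: "poly_solution (m + n) 1 a n \<kappa> P"
    and Q: "poly_solution (m + n) (-1) a m (\<kappa> - 2 * a * (of_nat (m + n) - 1)) Q"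
    and P': "poly_solution (m + n) 1 a n \<kappa>' P'"
    and Q': "poly_solution (m + n) (-1) a m (\<kappa>' - 2 * a * (of_nat (m + n) - 1)) Q'"
  shows "\<kappa> = \<kappa>'"
proof -
  have nz: "P \<noteq> 0" "P' \<noteq> 0" using P P' by (auto simp: poly_solution_def)
  obtain c where c: "P' = smult c P"
    using pade_kernel_unique[OF nz(1) poly_solutions_imp_pade[OF P Q] nz(2) poly_solutions_imp_pade[OF P' Q']] by blast
  then have "c \<noteq> 0" using nz by auto
  have "fps_const c * fps_ode (of_nat (m + n)) 1 a (of_nat n - 1) \<kappa>' (fps_of_poly P) = 0"
    using P' unfolding poly_solution_def c fps_of_poly_smult fps_ode_const_mult by blast
  then have "fps_ode (of_nat (m + n)) 1 a (of_nat n - 1) \<kappa>' (fps_of_poly P) = 0"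
    using \<open>c \<noteq> 0\<close> by (simp del: of_nat_add)
  then have "fps_const (\<kappa> - \<kappa>') * fps_of_poly P = 0"
    using P fps_ode_diff_kappa[of "of_nat (m + n)" 1 a "of_nat n - 1" \<kappa> "fps_of_poly P" \<kappa>'] by (simp add: poly_solution_def)
  then show ?thesis using nz by simp
qed

section \<open>Apparent singularities and polynomial solutions\<close>

lemma poly_solution_degree:
  assumes "poly_solution K s a r \<kappa> P" "s \<noteq> 0"
  shows "degree P = r - 1"
proof (rule ccontr)
  assume *: "degree P \<noteq> r - 1"
  let ?k = "Suc (degree P)"
  have "fps_nth (fps_ode (of_nat K) s a (of_nat r - 1) \<kappa> (fps_of_poly P)) ?k = 0"
    using assms by (simp add: poly_solution_def)
  then have "2 * s * (of_nat r - 1 + 1 - of_nat ?k) * lead_coeff P = 0"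
    unfolding fps_nth_fps_ode by (simp add: coeff_eq_0 del: of_nat_Suc)
  moreover have "of_nat r \<noteq> (of_nat ?k :: complex)"
    using * assms by (metis diff_Suc_1 of_nat_eq_iff)
  ultimately show False using assms by (auto simp: poly_solution_def simp del: of_nat_Suc)
qed

text \<open>
  The series with constant term \<open>1\<close> that solves the equation with right-hand side \<open>S\<close> as far as possible: at a
  resonance \<open>k + 1 = K\<close> the denominator is \<open>0\<close>, so that the coefficient is \<open>0\<close> and the row \<open>k\<close> of the equation may fail. The
  singularity is apparent iff it does not fail for \<open>S = 0\<close>.
\<close>

fun frobenius_coeff :: "complex \<Rightarrow> complex \<Rightarrow> complex \<Rightarrow> complex \<Rightarrow> complex \<Rightarrow> (nat \<Rightarrow> complex) \<Rightarrow> nat \<Rightarrow> complex" where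
  "frobenius_coeff K s a d \<kappa> S 0 = 1"
| "frobenius_coeff K s a d \<kappa> S (Suc 0) = (S 0 - \<kappa>) / (1 - K)"
| "frobenius_coeff K s a d \<kappa> S (Suc (Suc k)) =
     (S (Suc k) - (\<kappa> - 2 * s * a * of_nat (Suc k)) * frobenius_coeff K s a d \<kappa> S (Suc k)
        - 2 * s * (d - of_nat k) * frobenius_coeff K s a d \<kappa> S k)
       / (of_nat (Suc (Suc k)) * (of_nat (Suc (Suc k)) - K))"

definition frobenius :: "complex \<Rightarrow> complex \<Rightarrow> complex \<Rightarrow> complex \<Rightarrow> complex \<Rightarrow> (nat \<Rightarrow> complex) \<Rightarrow> complex fps" where
  "frobenius K s a d \<kappa> S = Abs_fps (frobenius_coeff K s a d \<kappa> S)"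

lemma frobenius_0 [simp]: "fps_nth (frobenius K s a d \<kappa> S) 0 = 1"
  by (simp add: frobenius_def)

lemma fps_ode_frobenius:
  assumes "of_nat (Suc k) \<noteq> K"
  shows "fps_nth (fps_ode K s a d \<kappa> (frobenius K s a d \<kappa> S)) k = S k"
proof -
  have *: "of_nat (Suc k) * (of_nat (Suc k) - K) \<noteq> 0" using assms by (simp del: of_nat_Suc)
  show ?thesis
  proof (cases k)
    case 0
    then show ?thesis using assms unfolding fps_nth_fps_ode by (simp add: frobenius_def)
  next
    case (Suc j)
    have "of_nat (Suc k) * (of_nat (Suc k) - K) * fps_nth (frobenius K s a d \<kappa> S) (Suc k) =
       S k - (\<kappa> - 2 * s * a * of_nat k) * fps_nth (frobenius K s a d \<kappa> S) k
        - 2 * s * (d - of_nat j) * fps_nth (frobenius K s a d \<kappa> S) j"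
      using * unfolding Suc by (simp add: frobenius_def del: of_nat_Suc)
    then show ?thesis unfolding fps_nth_fps_ode using Suc by (simp add: algebra_simps)
  qed
qed

definition binom_ratio :: "nat \<Rightarrow> nat \<Rightarrow> nat \<Rightarrow> complex" where
  "binom_ratio n N k = of_nat ((n - 1) choose k) / of_nat ((N - 1) choose k)"

lemma binom_ratio_rec:
  assumes "n \<ge> 1" "n \<le> N" "k + 1 < N"
  shows "(of_nat (k + 1) - of_nat N) * binom_ratio n N (k + 1) = (of_nat (k + 1) - of_nat n) * binom_ratio n N k"
proof -
  have b: "of_nat (Suc k) * of_nat (j choose Suc k) = (of_nat j - of_nat k) * (of_nat (j choose k) :: complex)" for j
  proof (cases "k \<le> j")
    case True
    have "(j choose Suc k) * Suc k = (j choose k) * (j - k)"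
      using binomial_absorb_comp[of j k] binomial_absorption[of k j] True
      by (metis mult.commute binomial_absorb_comp Suc_times_binomial_eq choose_mult_lemma binomial_eq_0_iff)
    then have "of_nat (j choose Suc k) * of_nat (Suc k) = (of_nat (j choose k) * of_nat (j - k) :: complex)"
      by (metis of_nat_mult)
    then show ?thesis using True by (simp add: of_nat_diff mult.commute del: of_nat_Suc)
  qed (simp add: binomial_eq_0)
  have nz: "of_nat ((N - 1) choose k) \<noteq> (0::complex)" "of_nat ((N - 1) choose Suc k) \<noteq> (0::complex)" "of_nat (Suc k) \<noteq> (0::complex)"
    using assms by (auto simp: binomial_eq_0_iff simp del: of_nat_Suc)
  have sN: "of_nat (Suc k) - of_nat N = (- (of_nat (N - 1) - of_nat k) :: complex)"
    and sn: "of_nat (Suc k) - of_nat n = (- (of_nat (n - 1) - of_nat k) :: complex)" using assms by (auto simp: of_nat_diff)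
  moreover have "M * (B' / C') = L * (B / C)"
    if *: "K * C' = M * C" "K * B' = L * B" "C \<noteq> 0" "C' \<noteq> 0" "K \<noteq> 0"
    for B B' C C' K M L :: complex
  proof -
    have "M * B' * C = (M * C) * B'" by simp
    also have "\<dots> = K * B' * C'" by (simp flip: *(1))
    also have "\<dots> = L * B * C'" by (simp add: *(2))
    finally have "M * B' * C / (C' * C) = L * B * C' / (C' * C)" by simp
    then show ?thesis using *(3,4) by simp
  qed
  ultimately have "(of_nat (N - 1) - of_nat k) * (of_nat ((n - 1) choose Suc k) / of_nat ((N - 1) choose Suc k))
    = (of_nat (n - 1) - of_nat k) * (of_nat ((n - 1) choose k) / of_nat ((N - 1) choose k) :: complex)"
    using b[of "N - 1"] b[of "n - 1"] nz by blast
  then show ?thesis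
    unfolding binom_ratio_def Suc_eq_plus1[symmetric] sN sn by (simp only: mult_minus_left)
qed

lemma binom_ratio_nonzero: "k < n \<Longrightarrow> n \<le> N \<Longrightarrow> binom_ratio n N k \<noteq> 0"
  by (auto simp: binom_ratio_def binomial_eq_0_iff)

lemma binom_ratio_zero: "n \<ge> 1 \<Longrightarrow> binom_ratio n N n = 0"
  by (simp add: binom_ratio_def binomial_eq_0)

text \<open>
  The coefficient recursion for \<open>(K, d) = (n, N - 1)\<close> is that for \<open>(N, n - 1)\<close> after multiplication of the coefficients by
  \<open>binom_ratio\<close>, for all rows below the resonance at \<open>n\<close>. As \<open>binom_ratio n N n = 0\<close>, the last of these rows is the
  resonance condition on one side and the termination of the polynomial on the other.
\<close>

lemma row_scaling:
  assumes n: "n \<ge> 1" "n < N" and k: "k < n"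
    and P: "\<And>k. k \<le> n \<Longrightarrow> fps_nth P k = binom_ratio n N k * fps_nth U k"
  shows "fps_nth (fps_ode (of_nat N) s a (of_nat n - 1) \<kappa> P) k =
    binom_ratio n N k * fps_nth (fps_ode (of_nat n) s a (of_nat N - 1) \<kappa> U) k"
proof -
  have 1: "(of_nat (Suc k) - of_nat N) * binom_ratio n N (Suc k) = (of_nat (Suc k) - of_nat n) * binom_ratio n N k"
    using binom_ratio_rec[of n N k] n k by simp
  have 2: "(of_nat n - of_nat k) * binom_ratio n N (k - 1) = (of_nat N - of_nat k) * binom_ratio n N k" if "k \<noteq> 0"
    using binom_ratio_rec[of n N "k - 1"] that n k by (simp add: algebra_simps)
  have sc: "c * u * (b' * x) = b * (c * v * x)" if "u * b' = v * b" for u b b' v c x :: complex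
  proof -
    have "c * u * (b' * x) = c * x * (u * b')" by (simp only: mult_ac)
    also have "\<dots> = b * (c * v * x)" unfolding that by (simp only: mult_ac)
    finally show ?thesis .
  qed
  have e: "of_nat (Suc k) * (of_nat (Suc k) - of_nat N) * (binom_ratio n N (Suc k) * x)
      = binom_ratio n N k * (of_nat (Suc k) * (of_nat (Suc k) - of_nat n) * x)" for x
    by (rule sc[OF 1])
  have f: "2 * s * (of_nat n - 1 + 1 - of_nat k) * (binom_ratio n N (k - 1) * x)
      = binom_ratio n N k * (2 * s * (of_nat N - 1 + 1 - of_nat k) * x)" if "k \<noteq> 0" for x
    using sc[OF 2[OF that], of "2 * s" x] by simp
  have p: "fps_nth P (Suc k) = binom_ratio n N (Suc k) * fps_nth U (Suc k)"
    "fps_nth P k = binom_ratio n N k * fps_nth U k" "fps_nth P (k - 1) = binom_ratio n N (k - 1) * fps_nth U (k - 1)"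
    using k by (auto intro!: P)
  have i: "(if k = 0 then 0 else 2 * s * (of_nat n - 1 + 1 - of_nat k) * (binom_ratio n N (k - 1) * fps_nth U (k - 1)))
    = binom_ratio n N k * (if k = 0 then 0 else 2 * s * (of_nat N - 1 + 1 - of_nat k) * fps_nth U (k - 1))"
    using f by simp
  show ?thesis unfolding fps_nth_fps_ode p e i by (simp only: distrib_left mult_ac)
qed

lemma apparent_imp_poly_solution:
  assumes n: "n \<ge> 1" "n < N" and U: "fps_nth U 0 \<noteq> 0" "fps_ode (of_nat n) s a (of_nat N - 1) \<kappa> U = 0"
  shows "\<exists>P. poly_solution N s a n \<kappa> P"
proof -
  define P where "P = (\<Sum>k<n. monom (binom_ratio n N k * fps_nth U k) k)"
  have P: "coeff P k = (if k < n then binom_ratio n N k * fps_nth U k else 0)" for k by (auto simp: P_def coeff_sum)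
  have P': "fps_nth (fps_of_poly P) k = binom_ratio n N k * fps_nth U k" if "k \<le> n" for k
    using that binom_ratio_zero[OF n(1)] by (cases "k = n") (auto simp: P)
  have "fps_nth (fps_ode (of_nat N) s a (of_nat n - 1) \<kappa> (fps_of_poly P)) k = 0" for k
  proof (cases "k < n")
    case True
    then show ?thesis using row_scaling[OF n True P'] U by simp
  next
    case False
    then show ?thesis unfolding fps_nth_fps_ode by (cases "k = n") (auto simp: P)
  qed
  moreover have "coeff P 0 \<noteq> 0" using U n by (simp add: P binom_ratio_def)
  moreover have "degree P < n" using n by (auto intro!: le_less_trans[OF degree_le[of "n - 1"]] simp: P)
  ultimately show ?thesis unfolding poly_solution_def by (intro exI[of _ P]) (auto intro: fps_ext)
qed

lemma poly_solution_imp_apparent: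
  assumes n: "n \<ge> 1" "n < N" and P: "poly_solution N s a n \<kappa> P"
  shows "fps_ode (of_nat n) s a (of_nat N - 1) \<kappa> (frobenius (of_nat n) s a (of_nat N - 1) \<kappa> (\<lambda>_. 0)) = 0"
proof (rule fps_ext)
  fix k
  let ?U = "frobenius (of_nat n) s a (of_nat N - 1) \<kappa> (\<lambda>_. 0)"
  let ?P = "fps_of_poly P"
  have P0: "coeff P 0 \<noteq> 0" using poly_solution_0[OF P] n by simp
  have dP: "degree P < n" using P by (simp add: poly_solution_def)
  define V where "V = Abs_fps (\<lambda>k. fps_nth ?P k / binom_ratio n N k)"
  have PV: "fps_nth ?P k = binom_ratio n N k * fps_nth V k" if "k \<le> n" for k
    using that binom_ratio_nonzero[of k n N] n binom_ratio_zero[of n N] dP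
    by (cases "k = n") (auto simp: V_def coeff_eq_0)
  have V: "fps_nth (fps_ode (of_nat n) s a (of_nat N - 1) \<kappa> V) k = 0" if "k < n" for k
    using row_scaling[OF n that PV, of s a \<kappa>] P binom_ratio_nonzero[OF that, of N] n that
    by (simp add: poly_solution_def)
  have rows_diff: "fps_nth (fps_ode (of_nat n) s a (of_nat N - 1) \<kappa> V) j
      - coeff P 0 * fps_nth (fps_ode (of_nat n) s a (of_nat N - 1) \<kappa> ?U) j
      = of_nat (Suc j) * (of_nat (Suc j) - of_nat n) * (fps_nth V (Suc j) - coeff P 0 * fps_nth ?U (Suc j))"
    if "fps_nth V j = coeff P 0 * fps_nth ?U j" "fps_nth V (j - 1) = coeff P 0 * fps_nth ?U (j - 1)" for j
    unfolding fps_nth_fps_ode that by (cases "j = 0") (simp_all add: algebra_simps del: of_nat_Suc)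
  have UV: "fps_nth V k = coeff P 0 * fps_nth ?U k" if "k < n" for k
    using that
  proof (induction k rule: less_induct)
    case (less k)
    show ?case
    proof (cases k)
      case 0 then show ?thesis using n by (simp add: V_def binom_ratio_def)
    next
      case (Suc j)
      have e: "of_nat (Suc j) \<noteq> (of_nat n :: complex)" using less.prems Suc by (metis less_irrefl of_nat_eq_iff)
      have v: "fps_nth V j = coeff P 0 * fps_nth ?U j" "fps_nth V (j - 1) = coeff P 0 * fps_nth ?U (j - 1)"
        using less Suc by auto
      have "of_nat (Suc j) * (of_nat (Suc j) - of_nat n) * (fps_nth V (Suc j) - coeff P 0 * fps_nth ?U (Suc j))
        = fps_nth (fps_ode (of_nat n) s a (of_nat N - 1) \<kappa> V) j
          - coeff P 0 * fps_nth (fps_ode (of_nat n) s a (of_nat N - 1) \<kappa> ?U) j"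
        unfolding rows_diff[OF v] ..
      also have "\<dots> = 0" using fps_ode_frobenius[OF e] V less.prems Suc by simp
      finally have "of_nat (Suc j) * (of_nat (Suc j) - of_nat n) * (fps_nth V (Suc j) - coeff P 0 * fps_nth ?U (Suc j)) = 0" .
      then show ?thesis using e Suc by (simp del: of_nat_Suc)
    qed
  qed
  show "fps_nth (fps_ode (of_nat n) s a (of_nat N - 1) \<kappa> ?U) k = fps_nth 0 k"
  proof (cases "Suc k = n")
    case False
    then show ?thesis using fps_ode_frobenius[of k "of_nat n"] by (metis fps_zero_nth of_nat_eq_iff)
  next
    case True
    have v: "fps_nth V k = coeff P 0 * fps_nth ?U k" "fps_nth V (k - 1) = coeff P 0 * fps_nth ?U (k - 1)"
      using UV True by auto
    have "fps_nth (fps_ode (of_nat n) s a (of_nat N - 1) \<kappa> V) k = 0" using V True by simp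
    moreover have "of_nat (Suc k) - of_nat n = (0 :: complex)" using True by simp
    ultimately have "coeff P 0 * fps_nth (fps_ode (of_nat n) s a (of_nat N - 1) \<kappa> ?U) k = 0"
      using rows_diff[OF v] by (simp only: mult_zero_right mult_zero_left) simp
    then show ?thesis using P0 by simp
  qed
qed

text \<open>
  The operator of \<open>fps_ode\<close> in the variable \<open>y = x + a\<close>, in which the drift term is that of Hermite's equation.
\<close>

definition shifted_ode :: "complex \<Rightarrow> complex \<Rightarrow> complex \<Rightarrow> complex \<Rightarrow> complex \<Rightarrow> complex poly \<Rightarrow> complex poly" where
  "shifted_ode K s a d \<kappa> G = [:-a, 1:] * pderiv (pderiv G) + smult (1 - K) (pderiv G)
     - [:-a, 1:] * [:0, 2 * s:] * pderiv G + [:\<kappa> - 2 * s * d * a, 2 * s * d:] * G"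

text \<open>
  In the Hermite basis the operator is tridiagonal, with the same structure as in the basis of monomials.
\<close>

lemma shifted_ode_hermite:
  assumes s: "s * s = 1"
  shows "shifted_ode K s a d \<kappa> (hermite s j) = smult (s * (d - of_nat j)) (hermite s (Suc j))
     + smult (\<kappa> - 2 * s * a * (d - of_nat j)) (hermite s j)
     + smult (2 * of_nat j * (d + 1 - of_nat j - K)) (hermite s (j - 1))"
proof -
  let ?h = "hermite s"
  let ?X = "[:0, 1:] :: complex poly"
  have p1: "pderiv (?h j) = [:2 * of_nat j:] * ?h (j - 1)" by (simp add: pderiv_hermite)
  have r: "?h (Suc j) = 2 * ?X * ?h j - [:s:] * pderiv (?h j)" by (simp add: hermite_Suc numeral_poly)
  have a1: "pderiv (?h (Suc j)) = [:2 * (of_nat j + 1):] * ?h j" by (simp add: pderiv_hermite_Suc algebra_simps)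
  have a2: "pderiv (?h (Suc j)) = 2 * ?h j + 2 * ?X * pderiv (?h j) - [:s:] * pderiv (pderiv (?h j))"
  proof -
    define L where "L = 2 * ?X"
    have "pderiv L = 2" by (simp add: L_def numeral_poly pderiv_pCons)
    then show ?thesis unfolding r L_def[symmetric] by (simp add: pderiv_mult pderiv_diff pderiv_smult algebra_simps)
  qed
  have a3: "[:2 * (of_nat j + 1):] = 2 * [:of_nat j:] + (2 :: complex poly)" by (simp add: numeral_poly)
  have a4: "q = 2 * X * p - 2 * J * h" if "D = C * h" "D = 2 * h + 2 * X * p - q" "C = 2 * J + 2"
    for C D J X h p q :: "complex poly"
  proof -
    have "q = 2 * h + 2 * X * p - D" using that(2) by simp
    then show ?thesis unfolding that(1,3) by (simp add: algebra_simps)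
  qed
  have p2: "[:s:] * pderiv (pderiv (?h j)) = 2 * ?X * pderiv (?h j) - 2 * [:of_nat j:] * ?h j"
    by (rule a4[OF a1 a2 a3])
  have s': "[:s:] * [:s:] = (1 :: complex poly)" using s by (simp add: one_pCons)
  have p2': "pderiv (pderiv (?h j)) = [:s:] * (2 * ?X * pderiv (?h j) - 2 * [:of_nat j:] * ?h j)"
    unfolding p2[symmetric] using s' by (metis mult.assoc mult_1)
  have c: "[:-a, 1:] = ?X - [:a:]" "[:0, 2 * s:] = 2 * [:s:] * ?X"
    "[:\<kappa> - 2 * s * d * a, 2 * s * d:] = [:\<kappa>:] + 2 * [:s:] * [:d:] * (?X - [:a:])"
    "smult (1 - K) q = (1 - [:K:]) * q" "smult (s * (d - of_nat j)) q = [:s:] * ([:d:] - [:of_nat j:]) * q"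
    "smult (\<kappa> - 2 * s * a * (d - of_nat j)) q = ([:\<kappa>:] - 2 * [:s:] * [:a:] * ([:d:] - [:of_nat j:])) * q"
    "smult (2 * of_nat j * (d + 1 - of_nat j - K)) q = ([:d:] + 1 - [:of_nat j:] - [:K:]) * ([:2 * of_nat j:] * q)" for q
    by (simp_all add: numeral_poly one_pCons algebra_simps smult_diff_left)
  have alg: "(X - A) * h2 + (1 - K) * h1 - (X - A) * (2 * S * X) * h1 + (kk + 2 * S * D * (X - A)) * h
     = S * (D - J) * (2 * X * h - S * h1) + (kk - 2 * S * A * (D - J)) * h + (D + 1 - J - K) * h1"
    if "h2 = S * (2 * X * h1 - 2 * J * h)" "S * S = 1" for X A K S D J kk h h1 h2 :: "complex poly"
  proof -
    have "(X - A) * h2 + (1 - K) * h1 - (X - A) * (2 * S * X) * h1 + (kk + 2 * S * D * (X - A)) * h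
     - (S * (D - J) * (2 * X * h - S * h1) + (kk - 2 * S * A * (D - J)) * h + (D + 1 - J - K) * h1)
     = (S * S - 1) * ((D - J) * h1)"
      unfolding that(1) by (simp add: algebra_simps)
    then show ?thesis using that(2) by simp
  qed
  show ?thesis
    unfolding shifted_ode_def c r p1[symmetric] by (rule alg[OF p2' s'])
qed

lemma shifted_ode_sum:
  "shifted_ode K s a d \<kappa> (\<Sum>k\<in>A. smult (e k) (f k)) = (\<Sum>k\<in>A. smult (e k) (shifted_ode K s a d \<kappa> (f k)))"
proof -
  have add: "shifted_ode K s a d \<kappa> (p + q) = shifted_ode K s a d \<kappa> p + shifted_ode K s a d \<kappa> q" for p q
    by (simp add: shifted_ode_def pderiv_add algebra_simps smult_add_right)
  have sm: "shifted_ode K s a d \<kappa> (smult c p) = smult c (shifted_ode K s a d \<kappa> p)" for c p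
    by (simp add: shifted_ode_def pderiv_smult smult_add_right smult_diff_right mult_ac)
  have "shifted_ode K s a d \<kappa> 0 = 0" by (simp add: shifted_ode_def)
  then show ?thesis by (induction A rule: infinite_finite_induct) (simp_all add: add sm)
qed

lemma fps_ode_pcompose:
  "fps_ode K s a d \<kappa> (fps_of_poly (pcompose G [:a, 1:])) = fps_of_poly (pcompose (shifted_ode K s a d \<kappa> G) [:a, 1:])"
proof -
  have d: "pderiv (pcompose q [:a, 1:]) = pcompose (pderiv q) [:a, 1:]" for q
    by (simp add: pderiv_pcompose pderiv_pCons)
  have l: "pcompose [:-a, 1:] [:a, 1:] = [:0, 1:]" "pcompose [:0, 2 * s:] [:a, 1:] = [:2 * s * a, 2 * s:]"
    "pcompose [:\<kappa> - 2 * s * d * a, 2 * s * d:] [:a, 1:] = [:\<kappa>, 2 * s * d:]"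
    by (simp_all add: pcompose_pCons algebra_simps)
  have "fps_of_poly [:2 * s * a, 2 * s:] = fps_const (2 * s) * (fps_X + fps_const a)"
    by (simp add: fps_of_poly_lin algebra_simps)
  then show ?thesis
    unfolding shifted_ode_def pcompose_add pcompose_diff pcompose_mult pcompose_smult l d[symmetric]
      fps_of_poly_add fps_of_poly_diff fps_of_poly_mult fps_of_poly_smult fps_ode_def fps_of_poly_pderiv
    by (simp add: fps_of_poly_lin algebra_simps)
qed

text \<open>
  Expand in \<open>H\<^sub>N\<^sub>-\<^sub>1\<^sub>-\<^sub>k\<close>. By \<open>shifted_ode_hermite\<close> the coefficients \<open>e k\<close> obey the recursion of the power series \<open>U\<close> up to the factors
  \<open>z k\<close>, and \<open>z n = 0\<close> stops the expansion. That the recursion holds across \<open>k = n - 1\<close>, where \<open>U\<close> meets the resonance, is the apparentness.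
\<close>

lemma apparent_imp_polynomial_solution:
  assumes n: "n \<ge> 1" "n < N" and s: "s * s = 1"
    and U: "fps_nth U 0 \<noteq> 0" "fps_ode (of_nat n) s a (of_nat N - 1) \<kappa> U = 0"
  shows "\<exists>F. degree F = N - 1 \<and> F \<noteq> 0 \<and> fps_ode (of_nat n) s a (of_nat N - 1) \<kappa> (fps_of_poly F) = 0"
proof -
  define z where "z k = (\<Prod>j<k. s * (of_nat (Suc j) - of_nat n))" for k
  define e where "e k = z k * fps_nth U k" for k
  let ?h = "hermite s" and ?d = "N - 1"
  have z_Suc: "z (Suc k) = s * (of_nat (Suc k) - of_nat n) * z k" for k by (simp add: z_def mult.commute)
  have zn: "z n = 0" using n by (auto simp: z_def intro!: bexI[of _ "n - 1"])
  have row: "s * of_nat (Suc k) * e (Suc k) + (\<kappa> - 2 * s * a * of_nat k) * e k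
     + (if k = 0 then 0 else 2 * (of_nat N - of_nat k) * (of_nat k - of_nat n) * e (k - 1)) = 0" for k
  proof -
    have r1: "s * of_nat (Suc k) * e (Suc k) = z k * (of_nat (Suc k) * (of_nat (Suc k) - of_nat n) * fps_nth U (Suc k))"
    proof -
      have "s * of_nat (Suc k) * e (Suc k) = (s * s) * (z k * (of_nat (Suc k) * (of_nat (Suc k) - of_nat n) * fps_nth U (Suc k)))"
        unfolding e_def z_Suc by (simp only: mult_ac)
      then show ?thesis using s by simp
    qed
    have r2: "2 * (of_nat N - of_nat k) * (of_nat k - of_nat n) * e (k - 1)
       = z k * (2 * s * (of_nat N - 1 + 1 - of_nat k) * fps_nth U (k - 1))" if "k \<noteq> 0"
    proof -
      have "z k = s * (of_nat k - of_nat n) * z (k - 1)" using z_Suc[of "k - 1"] that by simp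
      then have "z k * (2 * s * (of_nat N - 1 + 1 - of_nat k) * fps_nth U (k - 1))
         = (s * s) * (2 * (of_nat N - of_nat k) * (of_nat k - of_nat n) * (z (k - 1) * fps_nth U (k - 1)))"
        by (simp add: mult_ac)
      then show ?thesis unfolding s e_def mult_1_left by (rule sym)
    qed
    have r3: "(if k = 0 then 0 else 2 * (of_nat N - of_nat k) * (of_nat k - of_nat n) * e (k - 1))
      = z k * (if k = 0 then 0 else 2 * s * (of_nat N - 1 + 1 - of_nat k) * fps_nth U (k - 1))"
      using r2 by simp
    have r4: "(\<kappa> - 2 * s * a * of_nat k) * e k = z k * ((\<kappa> - 2 * s * a * of_nat k) * fps_nth U k)"
      unfolding e_def by (rule mult.left_commute)
    show ?thesis
      unfolding r1 r3 r4 distrib_left[symmetric] fps_nth_fps_ode[symmetric] using U by simp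
  qed
  define G where "G = (\<Sum>k<n. smult (e k) (?h (?d - k)))"
  have "shifted_ode (of_nat n) s a (of_nat N - 1) \<kappa> G = 0"
  proof -
    have t: "smult (e k) (shifted_ode (of_nat n) s a (of_nat N - 1) \<kappa> (?h (?d - k))) =
       smult (s * of_nat k * e k) (?h (Suc ?d - k)) + smult ((\<kappa> - 2 * s * a * of_nat k) * e k) (?h (?d - k))
       + smult (2 * (of_nat N - of_nat (Suc k)) * (of_nat (Suc k) - of_nat n) * e k) (?h (?d - Suc k))"
      if "k < n" for k
    proof -
      have o: "of_nat (?d - k) = (of_nat N - 1 - of_nat k :: complex)" using that n by (simp add: of_nat_diff)
      have i: "Suc (?d - k) = Suc ?d - k" "?d - k - 1 = ?d - Suc k" using that n by auto
      have c: "s * (of_nat N - 1 - of_nat (?d - k)) = s * of_nat k"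
        "\<kappa> - 2 * s * a * (of_nat N - 1 - of_nat (?d - k)) = \<kappa> - 2 * s * a * of_nat k"
        "2 * of_nat (?d - k) * (of_nat N - 1 + 1 - of_nat (?d - k) - of_nat n)
          = 2 * (of_nat N - of_nat (Suc k)) * (of_nat (Suc k) - of_nat n :: complex)"
        unfolding o by (simp_all add: algebra_simps)
      show ?thesis unfolding shifted_ode_hermite[OF s] c i smult_add_right smult_smult by (simp only: mult_ac)
    qed
    have "shifted_ode (of_nat n) s a (of_nat N - 1) \<kappa> G =
       (\<Sum>k<n. smult (s * of_nat k * e k) (?h (Suc ?d - k))) + (\<Sum>k<n. smult ((\<kappa> - 2 * s * a * of_nat k) * e k) (?h (?d - k)))
       + (\<Sum>k<n. smult (2 * (of_nat N - of_nat (Suc k)) * (of_nat (Suc k) - of_nat n) * e k) (?h (?d - Suc k)))"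
      unfolding G_def shifted_ode_sum using t by (simp add: sum.distrib[symmetric])
    also have "(\<Sum>k<n. smult (s * of_nat k * e k) (?h (Suc ?d - k))) = (\<Sum>k<n. smult (s * of_nat (Suc k) * e (Suc k)) (?h (?d - k)))"
    proof -
      have "(\<Sum>k<Suc n. smult (s * of_nat k * e k) (?h (Suc ?d - k))) = (\<Sum>k<n. smult (s * of_nat (Suc k) * e (Suc k)) (?h (?d - k)))"
        by (subst sum.lessThan_Suc_shift) simp
      then show ?thesis by (simp add: e_def zn)
    qed
    also have "(\<Sum>k<n. smult (2 * (of_nat N - of_nat (Suc k)) * (of_nat (Suc k) - of_nat n) * e k) (?h (?d - Suc k)))
       = (\<Sum>k<n. smult (if k = 0 then 0 else 2 * (of_nat N - of_nat k) * (of_nat k - of_nat n) * e (k - 1)) (?h (?d - k)))"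
    proof -
      have "(\<Sum>k<Suc n. smult (if k = 0 then 0 else 2 * (of_nat N - of_nat k) * (of_nat k - of_nat n) * e (k - 1)) (?h (?d - k)))
        = (\<Sum>k<n. smult (2 * (of_nat N - of_nat (Suc k)) * (of_nat (Suc k) - of_nat n) * e k) (?h (?d - Suc k)))"
        by (subst sum.lessThan_Suc_shift) simp
      then show ?thesis
        by (simp only: sum.lessThan_Suc diff_self mult_zero_right mult_zero_left if_cancel smult_0_left add_0_right)
    qed
    finally show ?thesis
      unfolding sum.distrib[symmetric] smult_add_left[symmetric] row by simp
  qed
  then have "fps_ode (of_nat n) s a (of_nat N - 1) \<kappa> (fps_of_poly (pcompose G [:a, 1:])) = 0"
    by (simp add: fps_ode_pcompose)
  moreover have c: "coeff G ?d \<noteq> 0"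
  proof -
    have "coeff G ?d = (\<Sum>k<n. e k * coeff (?h (?d - k)) ?d)" by (simp add: G_def coeff_sum)
    also have "\<dots> = (\<Sum>k\<in>{0}. e k * coeff (?h (?d - k)) ?d)"
      using n degree_hermite by (intro sum.mono_neutral_right) (auto intro!: coeff_eq_0 simp: degree_hermite)
    finally show ?thesis using U degree_hermite[of s ?d] by (simp add: e_def z_def)
  qed
  moreover have "degree G \<le> ?d"
    unfolding G_def by (intro degree_sum_le) (auto intro!: order.trans[OF degree_smult_le] simp: degree_hermite)
  then have "degree G = ?d" using le_degree[OF c] by simp
  moreover have "pcompose G [:a, 1:] \<noteq> 0" using pcompose_eq_0[of G "[:a, 1:]"] c by auto
  ultimately show ?thesis
    by (intro exI[of _ "pcompose G [:a, 1:]"]) (auto simp: degree_pcompose)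
qed

text \<open>
  The weights that turn the reversed coefficients of a polynomial of degree \<open>N - 1\<close> into those of a solution for the opposite sign.
\<close>

definition reversal_weight :: "complex \<Rightarrow> nat \<Rightarrow> nat \<Rightarrow> complex" where
  "reversal_weight s N k = (\<Prod>j<k. 2 * s / (of_nat (Suc j) - of_nat N))"

lemma reversal_weight_rec:
  "Suc k < N \<Longrightarrow> (of_nat (Suc k) - of_nat N) * reversal_weight s N (Suc k) = 2 * s * reversal_weight s N k"
proof -
  assume "Suc k < N"
  then have "of_nat (Suc k) \<noteq> (of_nat N :: complex)" by (metis less_irrefl of_nat_eq_iff)
  then show ?thesis by (simp add: reversal_weight_def field_simps del: of_nat_Suc)
qed

lemma reversal_weight_nonzero: "s \<noteq> 0 \<Longrightarrow> k < N \<Longrightarrow> reversal_weight s N k \<noteq> 0"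
proof -
  assume *: "s \<noteq> 0" "k < N"
  have "of_nat (Suc j) \<noteq> (of_nat N :: complex)" if "j < k" for j
    using that * by (metis Suc_leI le_less_trans less_irrefl of_nat_eq_iff)
  then show ?thesis using * by (auto simp: reversal_weight_def simp del: of_nat_Suc)
qed

text \<open>
  The recursion is a three-term one and its two outer coefficients change places under \<open>k \<mapsto> N - 1 - k\<close>; the rows
  \<open>k\<close> and \<open>N - 1 - k\<close> of the two equations agree up to the weight.
\<close>

lemma row_reversal:
  assumes k: "k < N" "k \<le> m" and n: "n \<ge> 1" and N: "N = m + n"
    and Q: "\<And>j. j \<le> Suc k \<Longrightarrow> j < N \<Longrightarrow> fps_nth Q j = reversal_weight s N j * fps_nth F (N - 1 - j)"
    and z: "fps_nth F N = 0" and z': "k = N - 1 \<Longrightarrow> fps_nth Q N = 0 "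
  shows "fps_nth (fps_ode (of_nat N) (- s) a (of_nat m - 1) (\<kappa> - 2 * s * a * (of_nat N - 1)) Q) k =
     reversal_weight s N k * fps_nth (fps_ode (of_nat n) s a (of_nat N - 1) \<kappa> F) (N - 1 - k)"
proof -
  let ?t = "reversal_weight s N"
  define j where "j = N - 1 - k"
  have jk: "of_nat j = (of_nat N - 1 - of_nat k :: complex)" using k by (simp add: j_def of_nat_diff)
  have Nn: "of_nat N = (of_nat m + of_nat n :: complex)" by (simp add: N)
  have q0: "fps_nth Q k = ?t k * fps_nth F j" using Q[of k] k by (simp add: j_def)
  have q1: "of_nat (Suc k) * (of_nat (Suc k) - of_nat N) * fps_nth Q (Suc k)
     = ?t k * (if j = 0 then 0 else 2 * s * (of_nat N - 1 + 1 - of_nat j) * fps_nth F (j - 1))"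
  proof (cases "j = 0")
    case True
    then have "k = N - 1" using k by (simp add: j_def)
    then show ?thesis using z' k True by simp
  next
    case False
    then have kN: "Suc k < N" using k by (simp add: j_def)
    have "fps_nth Q (Suc k) = ?t (Suc k) * fps_nth F (j - 1)" using Q[of "Suc k"] kN by (simp add: j_def)
    then have "of_nat (Suc k) * (of_nat (Suc k) - of_nat N) * fps_nth Q (Suc k)
      = of_nat (Suc k) * ((of_nat (Suc k) - of_nat N) * ?t (Suc k)) * fps_nth F (j - 1)" by (simp only: mult_ac)
    also have "\<dots> = of_nat (Suc k) * (2 * s * ?t k) * fps_nth F (j - 1)" by (simp only: reversal_weight_rec[OF kN])
    finally show ?thesis using False by (simp add: jk algebra_simps)
  qed
  have q2: "(if k = 0 then 0 else 2 * (- s) * (of_nat m - 1 + 1 - of_nat k) * fps_nth Q (k - 1))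
    = ?t k * (of_nat (Suc j) * (of_nat (Suc j) - of_nat n) * fps_nth F (Suc j))"
  proof (cases "k = 0")
    case True
    then have "Suc j = N" using k by (simp add: j_def)
    then show ?thesis using z True by simp
  next
    case False
    have r: "(of_nat k - of_nat N) * ?t k = 2 * s * ?t (k - 1)" using reversal_weight_rec[of "k - 1" N s] False k by simp
    have "fps_nth Q (k - 1) = ?t (k - 1) * fps_nth F (Suc j)" using Q[of "k - 1"] False k by (simp add: j_def Suc_diff_Suc)
    then have "2 * (- s) * (of_nat m - 1 + 1 - of_nat k) * fps_nth Q (k - 1)
      = - (2 * s * ?t (k - 1)) * (of_nat m - of_nat k) * fps_nth F (Suc j)" by (simp add: mult_ac)
    also have "\<dots> = (of_nat N - of_nat k) * ?t k * (of_nat m - of_nat k) * fps_nth F (Suc j)"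
      unfolding r[symmetric] by (simp add: algebra_simps)
    finally show ?thesis using False by (simp add: jk Nn algebra_simps)
  qed
  have q3: "(\<kappa> - 2 * s * a * (of_nat N - 1) - 2 * (- s) * a * of_nat k) * fps_nth Q k
     = ?t k * ((\<kappa> - 2 * s * a * of_nat j) * fps_nth F j)"
    unfolding q0 jk by (simp add: algebra_simps)
  show ?thesis unfolding fps_nth_fps_ode j_def[symmetric] q1 q2 q3 by (simp only: distrib_left add_ac)
qed

text \<open>
  Divisibility of \<open>F\<close> by \<open>x^n\<close> bounds the degree of the reversed polynomial by \<open>m - 1\<close>.
\<close>

lemma polynomial_solution_imp_poly_solution:
  assumes m: "m \<ge> 1" and n: "n \<ge> 1" and N: "N = m + n" and s: "s \<noteq> 0"
    and F: "fps_ode (of_nat n) s a (of_nat N - 1) \<kappa> (fps_of_poly F) = 0" "degree F = N - 1" "F \<noteq> 0"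
      "\<And>k. k < n \<Longrightarrow> coeff F k = 0"
  shows "\<exists>Q. poly_solution N (- s) a m (\<kappa> - 2 * s * a * (of_nat N - 1)) Q"
proof -
  define Q where "Q = (\<Sum>k<m. monom (reversal_weight s N k * coeff F (N - 1 - k)) k)"
  have Q: "coeff Q k = (if k < m then reversal_weight s N k * coeff F (N - 1 - k) else 0)" for k by (auto simp: Q_def coeff_sum)
  have Q': "fps_nth (fps_of_poly Q) k = reversal_weight s N k * fps_nth (fps_of_poly F) (N - 1 - k)" if "k < N" for k
    using that F(4)[of "N - 1 - k"] N by (cases "k < m") (auto simp: Q)
  have "fps_nth (fps_ode (of_nat N) (- s) a (of_nat m - 1) (\<kappa> - 2 * s * a * (of_nat N - 1)) (fps_of_poly Q)) k = 0" for k
  proof (cases "k < m")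
    case True
    then show ?thesis
      by (subst row_reversal[OF _ _ n N Q', where \<kappa> = \<kappa>]) (use F N n m in \<open>auto simp: coeff_eq_0 Q\<close>)
  next
    case False
    then show ?thesis unfolding fps_nth_fps_ode by (cases "k = m") (auto simp: Q)
  qed
  moreover have "coeff F (N - 1) \<noteq> 0" using F(2,3) by (metis leading_coeff_0_iff)
  then have "coeff Q 0 \<noteq> 0" using m by (simp add: Q reversal_weight_def)
  moreover have "degree Q < m" using m by (auto intro!: le_less_trans[OF degree_le[of "m - 1"]] simp: Q)
  ultimately show ?thesis unfolding poly_solution_def by (intro exI[of _ Q]) (auto intro: fps_ext)
qed

lemma poly_solution_imp_polynomial_solution:
  assumes n: "n \<ge> 1" and N: "N = m + n" and s: "s \<noteq> 0"
    and Q: "poly_solution N (- s) a m (\<kappa> - 2 * s * a * (of_nat N - 1)) Q"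
  shows "\<exists>F. fps_ode (of_nat n) s a (of_nat N - 1) \<kappa> (fps_of_poly F) = 0 \<and> degree F = N - 1 \<and> coeff F n \<noteq> 0 \<and>
      (\<forall>k<n. coeff F k = 0)"
proof -
  have m: "m \<ge> 1" and Q0: "Q \<noteq> 0" using Q by (auto simp: poly_solution_def)
  have dQ: "degree Q = m - 1" using poly_solution_degree[OF Q] s by simp
  define F where "F = (\<Sum>k\<in>{n..<N}. monom (coeff Q (N - 1 - k) / reversal_weight s N (N - 1 - k)) k)"
  have F: "coeff F k = (if n \<le> k \<and> k < N then coeff Q (N - 1 - k) / reversal_weight s N (N - 1 - k) else 0)" for k
    by (auto simp: F_def coeff_sum)
  have QF: "fps_nth (fps_of_poly Q) k = reversal_weight s N k * fps_nth (fps_of_poly F) (N - 1 - k)" if "k < N" for k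
    using that reversal_weight_nonzero[OF s that] dQ N m by (cases "k < m") (auto simp: F coeff_eq_0)
  have "fps_nth (fps_ode (of_nat n) s a (of_nat N - 1) \<kappa> (fps_of_poly F)) k = 0" for k
  proof (cases "n \<le> k \<and> k < N")
    case True
    let ?j = "N - 1 - k"
    have "reversal_weight s N ?j * fps_nth (fps_ode (of_nat n) s a (of_nat N - 1) \<kappa> (fps_of_poly F)) (N - 1 - ?j) = 0"
      by (subst row_reversal[OF _ _ n N QF, where \<kappa> = \<kappa>, symmetric]) (use Q True N in \<open>auto simp: F poly_solution_def coeff_eq_0\<close>)
    moreover have "N - 1 - ?j = k" using True by auto
    ultimately show ?thesis using reversal_weight_nonzero[OF s, of ?j N] True by simp
  next
    case False
    then consider "Suc k = n" | "Suc k < n" | "k = N" | "k > N" by linarith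
    then show ?thesis
    proof cases
      case 3 then show ?thesis unfolding fps_nth_fps_ode using N by (auto simp: F)
    qed (auto simp: fps_nth_fps_ode F N)
  qed
  moreover have cN: "coeff F (N - 1) \<noteq> 0"
  proof -
    have "coeff Q 0 \<noteq> 0" by (rule poly_solution_0[OF Q]) (simp add: N)
    then show ?thesis using N m by (simp add: F reversal_weight_def)
  qed
  moreover have "degree F \<le> N - 1" by (rule degree_le) (auto simp: F)
  then have "degree F = N - 1" using le_degree[OF cN] by simp
  moreover have "coeff F n \<noteq> 0"
  proof -
    have "N - 1 - n = degree Q" using dQ N by simp
    then show ?thesis using Q0 reversal_weight_nonzero[OF s, of "N - 1 - n" N] m N by (simp add: F)
  qed
  ultimately show ?thesis by (intro exI[of _ F]) (auto intro: fps_ext simp: F)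
qed

lemma cut_plane_eq: "cut_plane = {x. cis (- (3 * pi / 4)) * x \<notin> \<real>\<^sub>\<le>\<^sub>0}"
proof (intro equalityI subsetI)
  have c1: "cis (- (3 * pi / 4)) * cis (- (pi / 4)) = -1"
    by (simp add: cis_mult field_simps) (simp add: complex_eq_iff)
  have c2: "cis (3 * pi / 4) * cis (- (3 * pi / 4)) = 1" by (simp add: cis_mult)
  have c3: "cis (3 * pi / 4) = - cis (- (pi / 4))"
  proof -
    have "cis (3 * pi / 4) = cis (3 * pi / 4) * (cis (- (3 * pi / 4)) * cis (- (pi / 4))) * (-1)" by (simp add: c1)
    also have "\<dots> = cis (3 * pi / 4) * cis (- (3 * pi / 4)) * - cis (- (pi / 4))" by simp
    finally show ?thesis by (simp add: c2)
  qed
  fix x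
  {
    assume x: "x \<in> cut_plane"
    show "x \<in> {x. cis (- (3 * pi / 4)) * x \<notin> \<real>\<^sub>\<le>\<^sub>0}"
    proof (rule ccontr)
      assume "\<not> ?thesis"
      then obtain r where r: "cis (- (3 * pi / 4)) * x = of_real r" "r \<le> 0"
        by (auto elim!: nonpos_Reals_cases)
      have "x = cis (3 * pi / 4) * (cis (- (3 * pi / 4)) * x)" by (simp add: c2 flip: mult.assoc)
      also have "\<dots> = of_real (- r) * cis (- (pi / 4))" by (simp add: r c3)
      finally show False using x r(2) unfolding cut_plane_def by (auto dest: spec[of _ "- r"])
    qed
  next
    assume x: "x \<in> {x. cis (- (3 * pi / 4)) * x \<notin> \<real>\<^sub>\<le>\<^sub>0}"
    show "x \<in> cut_plane" unfolding cut_plane_def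
    proof safe
      fix r :: real assume r: "0 \<le> r" "x = of_real r * cis (- (pi / 4))"
      have "cis (- (3 * pi / 4)) * x = of_real (- r)" using c1 by (simp add: r(2) mult.left_commute)
      then show False using x r(1) by (simp add: nonpos_Reals_of_real_iff)
    qed
  }
qed

lemma open_cut_plane: "open cut_plane"
proof -
  have "open ((\<lambda>x. cis (- (3 * pi / 4)) * x) -` (- \<real>\<^sub>\<le>\<^sub>0))"
    by (intro open_vimage open_Compl closed_nonpos_Reals_complex continuous_intros)
  also have "(\<lambda>x. cis (- (3 * pi / 4)) * x) -` (- \<real>\<^sub>\<le>\<^sub>0) = cut_plane" by (auto simp: cut_plane_eq)
  finally show ?thesis .
qed

lemma zero_notin_cut_plane: "0 \<notin> cut_plane"
  by (simp add: cut_plane_eq)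

lemma rcis_cut_plane:
  assumes "r > 0" "- (pi / 4) < \<theta>" "\<theta> < 7 * pi / 4"
  shows "rcis r \<theta> \<in> cut_plane" and "cut_ln (rcis r \<theta>) = of_real (ln r) + \<i> * of_real \<theta>"
proof -
  let ?\<phi> = "\<theta> - 3 * pi / 4"
  have y: "cis (- (3 * pi / 4)) * rcis r \<theta> = rcis r ?\<phi>"
    by (simp add: rcis_def cis_mult mult.left_commute)
  have \<phi>: "- pi < ?\<phi>" "?\<phi> < pi" using assms by auto
  have "rcis r ?\<phi> \<notin> \<real>\<^sub>\<le>\<^sub>0"
  proof
    assume "rcis r ?\<phi> \<in> \<real>\<^sub>\<le>\<^sub>0"
    then have *: "r * cos ?\<phi> \<le> 0" "r * sin ?\<phi> = 0" by (auto simp: complex_nonpos_Reals_iff)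
    then have "sin ?\<phi> = 0" using assms by simp
    then have "?\<phi> = 0" using \<phi> sin_eq_0_pi by blast
    then have "cos ?\<phi> = 1" by (simp only: cos_zero)
    then show False using *(1) assms by simp
  qed
  then show "rcis r \<theta> \<in> cut_plane" by (simp add: cut_plane_eq y)
  have "rcis r ?\<phi> = exp (of_real (ln r) + \<i> * of_real ?\<phi>)"
    using assms by (simp add: exp_add exp_of_real rcis_def cis_conv_exp mult.commute)
  then have "Ln (rcis r ?\<phi>) = of_real (ln r) + \<i> * of_real ?\<phi>" using \<phi> by simp
  then show "cut_ln (rcis r \<theta>) = of_real (ln r) + \<i> * of_real \<theta>"
    unfolding cut_ln_def y by (simp add: algebra_simps)
qed

lemma connected_cut_plane: "connected cut_plane"
proof -
  have "cut_plane = (\<lambda>y. cis (3 * pi / 4) * y) ` (- complex_of_real ` {..0})"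
  proof (intro equalityI subsetI)
    fix x assume "x \<in> cut_plane"
    then have "cis (- (3 * pi / 4)) * x \<in> - complex_of_real ` {..0}"
      by (auto simp: cut_plane_eq nonpos_Reals_of_real_iff image_iff)
    then show "x \<in> (\<lambda>y. cis (3 * pi / 4) * y) ` (- complex_of_real ` {..0})"
      by (rule rev_image_eqI) (simp add: cis_mult flip: mult.assoc)
  next
    fix x assume "x \<in> (\<lambda>y. cis (3 * pi / 4) * y) ` (- complex_of_real ` {..0})"
    then obtain y where y: "x = cis (3 * pi / 4) * y" "y \<notin> complex_of_real ` {..0}" by auto
    have "cis (- (3 * pi / 4)) * x = y" by (simp add: y cis_mult flip: mult.assoc)
    then show "x \<in> cut_plane" using y(2) by (auto simp: cut_plane_eq elim!: nonpos_Reals_cases)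
  qed
  moreover have "connected (- complex_of_real ` {..0})"
    by (intro starlike_imp_connected starlike_slotted_complex_plane_left)
  moreover have "connected ((\<lambda>y. cis (3 * pi / 4) * y) ` S)" if "connected S" for S
    by (intro connected_continuous_image continuous_intros that)
  ultimately show ?thesis by metis
qed

lemma exp_cut_ln: "x \<noteq> 0 \<Longrightarrow> exp (cut_ln x) = x"
proof -
  assume "x \<noteq> 0"
  moreover have "exp (\<i> * of_real (3 * pi / 4)) = cis (3 * pi / 4)" by (simp only: cis_conv_exp)
  ultimately show ?thesis unfolding cut_ln_def exp_add by (simp add: cis_mult)
qed

lemma DERIV_cut_ln: "x \<in> cut_plane \<Longrightarrow> (cut_ln has_field_derivative inverse x) (at x)"
  unfolding cut_ln_def using zero_notin_cut_plane
  by (auto simp: cut_plane_eq field_simps intro!: derivative_eq_intros)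

lemma cut_powr_add: "cut_powr x (s + t) = cut_powr x s * cut_powr x t"
  by (simp add: cut_powr_def distrib_right exp_add)

lemma cut_powr_of_nat: "x \<noteq> 0 \<Longrightarrow> cut_powr x (of_nat n) = x ^ n"
  by (simp add: cut_powr_def exp_of_nat_mult exp_cut_ln)

lemma cut_powr_0 [simp]: "cut_powr x 0 = 1" by (simp add: cut_powr_def)

lemma cut_powr_nonzero [simp]: "cut_powr x s \<noteq> 0" by (simp add: cut_powr_def)

lemma DERIV_cut_powr:
  "x \<in> cut_plane \<Longrightarrow> ((\<lambda>x. cut_powr x s) has_field_derivative s / x * cut_powr x s) (at x)"
  unfolding cut_powr_def by (auto intro!: derivative_eq_intros DERIV_cut_ln simp: field_simps)

lemma holomorphic_cut_powr: "(\<lambda>x. cut_powr x s) holomorphic_on cut_plane"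
  by (subst holomorphic_on_open[OF open_cut_plane]) (use DERIV_cut_powr in blast)

section \<open>The gauge transformation on the cut plane\<close>

definition ode_op :: "complex \<Rightarrow> complex \<Rightarrow> complex \<Rightarrow> complex \<Rightarrow> complex \<Rightarrow> (complex \<Rightarrow> complex) \<Rightarrow> complex \<Rightarrow> complex" where
  "ode_op K s a d \<kappa> f x = x * deriv (deriv f) x + (1 - K) * deriv f x
     - 2 * s * x * (x + a) * deriv f x + (2 * s * d * x + \<kappa>) * f x"

definition ode_solution :: "complex set \<Rightarrow> complex \<Rightarrow> complex \<Rightarrow> complex \<Rightarrow> complex \<Rightarrow> complex \<Rightarrow> (complex \<Rightarrow> complex) \<Rightarrow> bool" where
  "ode_solution U K s a d \<kappa> f \<longleftrightarrow> f holomorphic_on U \<and> (\<forall>x\<in>U. ode_op K s a d \<kappa> f x = 0)"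

lemma deriv_eq_on_open:
  assumes "open U" "x \<in> U" "\<And>y. y \<in> U \<Longrightarrow> f y = h y" "(h has_field_derivative D) (at x)"
  shows "deriv f x = D"
  by (rule DERIV_imp_deriv) (rule has_field_derivative_transform_within_open[OF assms(4,1,2)], simp add: assms(3))

text \<open>
  Stated for a multiplier \<open>u\<close> given through its logarithmic derivative \<open>q\<close>, so that the powers of \<open>x\<close> and the exponential are treated at once.
\<close>

lemma deriv_gauge:
  assumes U: "open U" and \<psi>: "\<psi> holomorphic_on U" and x: "x \<in> U"
    and u: "\<And>x. x \<in> U \<Longrightarrow> (u has_field_derivative q x * u x) (at x)"
    and q: "\<And>x. x \<in> U \<Longrightarrow> (q has_field_derivative q' x) (at x)"
  shows "deriv (\<lambda>x. \<psi> x * u x) x = (deriv \<psi> x + q x * \<psi> x) * u x"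
    and "deriv (deriv (\<lambda>x. \<psi> x * u x)) x = (deriv (deriv \<psi>) x + 2 * q x * deriv \<psi> x + (q' x + (q x)\<^sup>2) * \<psi> x) * u x"
proof -
  have d1: "(\<psi> has_field_derivative deriv \<psi> x) (at x)" if "x \<in> U" for x using holomorphic_derivI[OF \<psi> U that] .
  have d2: "(deriv \<psi> has_field_derivative deriv (deriv \<psi>) x) (at x)" if "x \<in> U" for x
    using holomorphic_derivI[OF holomorphic_deriv[OF \<psi> U] U that] .
  have 1: "deriv (\<lambda>x. \<psi> x * u x) y = (deriv \<psi> y + q y * \<psi> y) * u y" if "y \<in> U" for y
    by (rule DERIV_imp_deriv) (auto intro!: derivative_eq_intros d1[OF that] u[OF that] simp: algebra_simps)
  show "deriv (\<lambda>x. \<psi> x * u x) x = (deriv \<psi> x + q x * \<psi> x) * u x" by (rule 1[OF x])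
  have "((\<lambda>y. (deriv \<psi> y + q y * \<psi> y) * u y) has_field_derivative
     (deriv (deriv \<psi>) x + 2 * q x * deriv \<psi> x + (q' x + (q x)\<^sup>2) * \<psi> x) * u x) (at x)"
    by (auto intro!: derivative_eq_intros d1 d2 u q x simp: algebra_simps power2_eq_square)
  then show "deriv (deriv (\<lambda>x. \<psi> x * u x)) x = (deriv (deriv \<psi>) x + 2 * q x * deriv \<psi> x + (q' x + (q x)\<^sup>2) * \<psi> x) * u x"
    using deriv_eq_on_open[OF U x, of "deriv (\<lambda>x. \<psi> x * u x)" "\<lambda>y. (deriv \<psi> y + q y * \<psi> y) * u y"] 1 by blast
qed

text \<open>
  The factor with \<open>f = \<psi> * gauge_factor\<close>, where \<open>f\<close> solves the equation \<open>ode_op\<close>.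
\<close>

definition gauge_factor :: "complex \<Rightarrow> complex \<Rightarrow> complex \<Rightarrow> complex \<Rightarrow> complex" where
  "gauge_factor K s a x = cut_powr x ((K - 1) / 2) * exp (s * g x a)"

definition ode_degree :: "complex \<Rightarrow> complex \<Rightarrow> complex \<Rightarrow> complex" where
  "ode_degree K s \<theta> = (K - 2 + s * (2 * \<theta> - 2)) / 2"

definition ode_kappa :: "complex \<Rightarrow> complex \<Rightarrow> complex \<Rightarrow> complex \<Rightarrow> complex \<Rightarrow> complex" where
  "ode_kappa K s a b \<theta> = b + (2 * \<theta> - 1 / 2) * a + s * (K - 1) * a"

lemma DERIV_g: "((\<lambda>x. g x a) has_field_derivative x + a) (at x)"
  unfolding g_def by (auto intro!: derivative_eq_intros)

lemma DERIV_gauge_factor: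
  "x \<in> cut_plane \<Longrightarrow> (gauge_factor K s a has_field_derivative ((K - 1) / (2 * x) + s * (x + a)) * gauge_factor K s a x) (at x)"
  unfolding gauge_factor_def[abs_def]
  by (auto intro!: derivative_eq_intros DERIV_cut_powr DERIV_g simp: algebra_simps)

lemma gauge_factor_nonzero [simp]: "gauge_factor K s a x \<noteq> 0" by (simp add: gauge_factor_def)

lemma ode_op_gauge:
  assumes s: "s * s = 1" and \<psi>: "\<psi> holomorphic_on cut_plane" and x: "x \<in> cut_plane"
  shows "ode_op K s a (ode_degree K s \<theta>) (ode_kappa K s a b \<theta>) (\<lambda>x. \<psi> x * gauge_factor K s a x) x
     = x * gauge_factor K s a x * (deriv (deriv \<psi>) x - potential a b (K / 2) \<theta> x * \<psi> x)"
proof -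
  let ?u = "gauge_factor K s a"
  let ?q = "\<lambda>x. (K - 1) / (2 * x) + s * (x + a)"
  let ?q' = "\<lambda>x. - (K - 1) / (2 * x\<^sup>2) + s"
  have x0: "x \<noteq> 0" using x zero_notin_cut_plane by auto
  have q: "(?q has_field_derivative ?q' x) (at x)" if "x \<in> cut_plane" for x
  proof -
    have x0: "x \<noteq> 0" using that zero_notin_cut_plane by auto
    then have "(?q has_field_derivative (0 * (2 * x) - (K - 1) * 2) / (2 * x * (2 * x)) + s * 1) (at x)"
      by (auto intro!: derivative_eq_intros)
    moreover have "(0 * (2 * x) - (K - 1) * 2) / (2 * x * (2 * x)) + s * 1 = ?q' x"
      using x0 by (simp add: power2_eq_square) (simp add: divide_simps)
    ultimately show ?thesis by simp
  qed
  let ?d = "ode_degree K s \<theta>" and ?k = "ode_kappa K s a b \<theta>"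
  define Q where "Q = ?q x"
  define Q' where "Q' = ?q' x"
  have d: "deriv (\<lambda>x. \<psi> x * ?u x) x = (deriv \<psi> x + Q * \<psi> x) * ?u x"
    "deriv (deriv (\<lambda>x. \<psi> x * ?u x)) x = (deriv (deriv \<psi>) x + 2 * Q * deriv \<psi> x + (Q' + Q\<^sup>2) * \<psi> x) * ?u x"
    using deriv_gauge[where u = ?u and q = ?q and q' = ?q', OF open_cut_plane \<psi> x DERIV_gauge_factor q]
    unfolding Q_def Q'_def by blast+
  have "x * Q = (K - 1) / 2 + s * x * (x + a)" using x0 by (simp add: Q_def field_simps)
  then have 1: "1 - K = 2 * s * x * (x + a) - 2 * (x * Q)" by (simp add: field_simps)
  have "ode_op K s a ?d ?k (\<lambda>x. \<psi> x * ?u x) x =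
     x * ((deriv (deriv \<psi>) x + 2 * Q * deriv \<psi> x + (Q' + Q\<^sup>2) * \<psi> x) * ?u x)
      - 2 * (x * Q) * ((deriv \<psi> x + Q * \<psi> x) * ?u x) + (2 * s * ?d * x + ?k) * (\<psi> x * ?u x)"
    unfolding ode_op_def d 1 by (simp add: algebra_simps)
  also have "\<dots> = ?u x * (x * deriv (deriv \<psi>) x - (x * Q\<^sup>2 - x * Q' - 2 * s * ?d * x - ?k) * \<psi> x)"
    by (simp add: algebra_simps power2_eq_square)
  also have "x * Q\<^sup>2 - x * Q' - 2 * s * ?d * x - ?k = x * potential a b (K / 2) \<theta> x"
  proof -
    have sd: "2 * s * ?d = s * K - 2 * s + (2 * \<theta> - 2)"
    proof -
      have d2: "2 * ?d = K - 2 + s * (2 * \<theta> - 2)" by (simp add: ode_degree_def)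
      have "2 * s * ?d = s * (2 * ?d)" by simp
      also have "\<dots> = s * K - 2 * s + (s * s) * (2 * \<theta> - 2)" unfolding d2 by (simp add: algebra_simps)
      finally show ?thesis by (simp add: s)
    qed
    define T1 T2 T3 where "T1 = (K - 1)\<^sup>2 / (4 * x)" and "T2 = (K - 1) / (2 * x)" and "T3 = (K\<^sup>2 - 1) / (4 * x)"
    have e1: "x * Q\<^sup>2 = T1 + s * (K - 1) * (x + a) + (s * s) * (x * (x + a)\<^sup>2)"
      unfolding Q_def T1_def using x0 by (simp add: field_simps power2_eq_square)
    have e2: "x * Q' = - T2 + s * x"
      unfolding Q'_def T2_def using x0 by (simp add: field_simps power2_eq_square)
    have e3: "x * potential a b (K / 2) \<theta> x = x * (x + a)\<^sup>2 + 2 * (1 - \<theta>) * x - (b + (2 * \<theta> - 1 / 2) * a) + T3"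
      unfolding T3_def using x0 by (simp add: potential_def field_simps power2_eq_square)
    have e4: "T3 = T1 + T2"
      unfolding T1_def T2_def T3_def using x0 by (simp add: field_simps power2_eq_square)
    show ?thesis unfolding e1 e2 e3 e4 sd ode_kappa_def s by (simp add: algebra_simps)
  qed
  finally show ?thesis by (simp add: algebra_simps)
qed

lemma oscillator_solution_iff_ode:
  assumes s: "s * s = 1" and \<psi>: "\<psi> holomorphic_on cut_plane"
  shows "oscillator_solution a b (K / 2) \<theta> \<psi> \<longleftrightarrow>
    ode_solution cut_plane K s a (ode_degree K s \<theta>) (ode_kappa K s a b \<theta>) (\<lambda>x. \<psi> x * gauge_factor K s a x)"
proof -
  have "(\<lambda>x. \<psi> x * gauge_factor K s a x) holomorphic_on cut_plane"
    by (intro holomorphic_intros \<psi>) (use DERIV_gauge_factor holomorphic_on_open[OF open_cut_plane] in blast)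
  moreover have "x \<noteq> 0" if "x \<in> cut_plane" for x using that zero_notin_cut_plane by auto
  ultimately show ?thesis
    unfolding oscillator_solution_def ode_solution_def using \<psi> by (auto simp: ode_op_gauge[OF s \<psi>])
qed

lemma gauge_factor_cancel:
  "cut_powr x ((1 - K) / 2) * exp (- (s * g x a)) * y * gauge_factor K s a x = y"
proof -
  have "cut_powr x ((1 - K) / 2) * cut_powr x ((K - 1) / 2) = 1"
    by (simp flip: cut_powr_add add_divide_distrib)
  moreover have "exp (- (s * g x a)) * exp (s * g x a) = 1" by (simp flip: exp_add)
  moreover have "cut_powr x ((1 - K) / 2) * exp (- (s * g x a)) * y * gauge_factor K s a x
    = (cut_powr x ((1 - K) / 2) * cut_powr x ((K - 1) / 2)) * (exp (- (s * g x a)) * exp (s * g x a)) * y"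
    unfolding gauge_factor_def by (simp only: mult_ac)
  ultimately show ?thesis by simp
qed

lemma oscillator_solution_ode:
  assumes s: "s * s = 1"
    and f: "ode_solution cut_plane K s a (ode_degree K s \<theta>) (ode_kappa K s a b \<theta>) f"
  shows "oscillator_solution a b (K / 2) \<theta> (\<lambda>x. cut_powr x ((1 - K) / 2) * exp (- (s * g x a)) * f x)"
proof -
  have "(\<lambda>x. cut_powr x ((1 - K) / 2) * exp (- (s * g x a)) * f x) holomorphic_on cut_plane"
    using f unfolding ode_solution_def g_def by (intro holomorphic_intros holomorphic_cut_powr) auto
  then show ?thesis
    using f by (simp add: oscillator_solution_iff_ode[OF s] gauge_factor_cancel)
qed

text \<open>
  By the identity theorem the equation for an entire function holds everywhere as soon as it holds on an open set, or at the origin as a power series.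
\<close>

lemma ode_solution_fps:
  assumes f: "f holomorphic_on UNIV" and F: "f has_fps_expansion F"
  shows "(\<forall>x. ode_op K s a d \<kappa> f x = 0) \<longleftrightarrow> fps_ode K s a d \<kappa> F = 0"
    and "open U \<Longrightarrow> U \<noteq> {} \<Longrightarrow> ode_solution U K s a d \<kappa> f \<longleftrightarrow> fps_ode K s a d \<kappa> F = 0"
proof -
  have h: "ode_op K s a d \<kappa> f holomorphic_on UNIV"
    unfolding ode_op_def[abs_def] by (intro holomorphic_intros f) auto
  have E: "ode_op K s a d \<kappa> f has_fps_expansion fps_ode K s a d \<kappa> F"
    unfolding ode_op_def[abs_def] fps_ode_def fps_const_mult[symmetric]
    by (intro fps_expansion_intros F)
  have extend: "\<forall>x. ode_op K s a d \<kappa> f x = 0" if U: "open U" "U \<noteq> {}" "\<forall>x\<in>U. ode_op K s a d \<kappa> f x = 0" for U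
    using analytic_continuation_open[OF U(1) open_UNIV U(2) connected_UNIV _ h holomorphic_on_const[of 0]] U(3) by auto
  show 1: "(\<forall>x. ode_op K s a d \<kappa> f x = 0) \<longleftrightarrow> fps_ode K s a d \<kappa> F = 0"
  proof
    assume "\<forall>x. ode_op K s a d \<kappa> f x = 0"
    then have "ode_op K s a d \<kappa> f = (\<lambda>_. 0)" by auto
    then show "fps_ode K s a d \<kappa> F = 0" using E fps_expansion_unique_complex has_fps_expansion_0 by metis
  next
    assume "fps_ode K s a d \<kappa> F = 0"
    then have "eventually (\<lambda>z. ode_op K s a d \<kappa> f z = 0) (nhds 0)" using E has_fps_expansion_0_iff by metis
    then obtain S where "open S" "0 \<in> S" "\<forall>x\<in>S. ode_op K s a d \<kappa> f x = 0" by (auto simp: eventually_nhds)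
    then show "\<forall>x. ode_op K s a d \<kappa> f x = 0" using extend[of S] by auto
  qed
  assume "open U" "U \<noteq> {}"
  then show "ode_solution U K s a d \<kappa> f \<longleftrightarrow> fps_ode K s a d \<kappa> F = 0"
    using extend[of U] 1 holomorphic_on_subset[OF f] by (auto simp: ode_solution_def)
qed

lemma Arg_sector_iff: "y \<noteq> 0 \<and> - (pi / 4) < Arg y \<and> Arg y < pi / 4 \<longleftrightarrow> \<bar>Im y\<bar> < Re y"
proof (cases "y = 0")
  case False
  define r \<phi> where "r = norm y" and "\<phi> = Arg y"
  have r: "r > 0" using False by (simp add: r_def)
  have y: "y = rcis r \<phi>" by (simp add: r_def \<phi>_def rcis_cmod_Arg)
  have ReIm: "Re y = r * cos \<phi>" "Im y = r * sin \<phi>" by (simp_all add: y)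
  have iff: "\<bar>Im y\<bar> < Re y \<longleftrightarrow> \<bar>sin \<phi>\<bar> < cos \<phi>" using r by (simp add: ReIm abs_mult)
  have dbl: "cos (2 * \<phi>) = (cos \<phi>)\<^sup>2 - \<bar>sin \<phi>\<bar>\<^sup>2" by (simp add: cos_double)
  have "- (pi / 4) < \<phi> \<and> \<phi> < pi / 4 \<longleftrightarrow> \<bar>sin \<phi>\<bar> < cos \<phi>"
  proof
    assume *: "- (pi / 4) < \<phi> \<and> \<phi> < pi / 4"
    then have "cos \<phi> > 0" "cos (2 * \<phi>) > 0" by (auto intro!: cos_gt_zero_pi)
    then have "\<bar>sin \<phi>\<bar>\<^sup>2 < (cos \<phi>)\<^sup>2" unfolding dbl by simp
    then show "\<bar>sin \<phi>\<bar> < cos \<phi>" 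
      by (rule power2_less_imp_less) (use \<open>cos \<phi> > 0\<close> in simp)
  next
    assume *: "\<bar>sin \<phi>\<bar> < cos \<phi>"
    then have "cos \<phi> > 0" by linarith
    then have "Re y > 0" using r by (simp add: ReIm)
    then have lt: "\<bar>\<phi>\<bar> < pi / 2" using Arg_Re_pos[of y] by (simp add: \<phi>_def)
    have "\<bar>sin \<phi>\<bar>\<^sup>2 < (cos \<phi>)\<^sup>2" using * by (intro power_strict_mono) auto
    then have pos: "cos (2 * \<bar>\<phi>\<bar>) > 0" using dbl by (cases "\<phi> \<ge> 0") auto
    have "\<not> pi / 4 \<le> \<bar>\<phi>\<bar>"
    proof
      assume "pi / 4 \<le> \<bar>\<phi>\<bar>"
      then have "cos (2 * \<bar>\<phi>\<bar>) \<le> cos (pi / 2)" using lt by (intro cos_monotone_0_pi_le) auto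
      then show False using pos by simp
    qed
    then show "- (pi / 4) < \<phi> \<and> \<phi> < pi / 4" by linarith
  qed
  then show ?thesis using False iff by (simp add: \<phi>_def)
qed auto

lemma stokes_sector_iff:
  "x \<in> stokes_sector k \<longleftrightarrow> \<bar>Im (cis (- (of_nat k * pi / 2)) * x)\<bar> < Re (cis (- (of_nat k * pi / 2)) * x)"
proof -
  have inv: "cis (- (of_nat k * pi / 2)) * (cis (of_nat k * pi / 2) * y) = y"
    "cis (of_nat k * pi / 2) * (cis (- (of_nat k * pi / 2)) * y) = y" for y
    by (simp_all add: cis_mult flip: mult.assoc)
  have "x \<in> stokes_sector k \<longleftrightarrow> cis (- (of_nat k * pi / 2)) * x \<in> {x. x \<noteq> 0 \<and> - (pi / 4) < Arg x \<and> Arg x < pi / 4}"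
    (is "_ \<longleftrightarrow> ?w \<in> ?T")
  proof
    assume "x \<in> stokes_sector k"
    then obtain y where y: "x = cis (of_nat k * pi / 2) * y" "y \<in> ?T" unfolding stokes_sector_def by blast
    have "?w = y" unfolding y(1) by (rule inv(1))
    then show "?w \<in> ?T" using y(2) by (simp only:)
  next
    assume "?w \<in> ?T"
    then show "x \<in> stokes_sector k" unfolding stokes_sector_def using inv(2)[of x] by (intro image_eqI[of _ _ ?w]) (simp_all only:)
  qed
  then show ?thesis by (simp only: Arg_sector_iff mem_Collect_eq)
qed

lemma rcis_stokes_sector:
  assumes "r > 0" "\<bar>\<delta>\<bar> < pi / 4"
  shows "rcis r (of_nat k * pi / 2 + \<delta>) \<in> stokes_sector k"
proof -
  have "rcis r (of_nat k * pi / 2 + \<delta>) = cis (of_nat k * pi / 2) * rcis r \<delta>"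
    by (simp add: rcis_def cis_mult mult.left_commute)
  moreover have "Arg (rcis r \<delta>) = \<delta>" using assms by (intro Arg_rcis) auto
  ultimately show ?thesis using assms unfolding stokes_sector_def
    by (intro image_eqI[of _ _ "rcis r \<delta>"]) auto
qed

lemma stokes_sector_polar:
  assumes "x \<in> stokes_sector k"
  obtains \<delta> where "\<bar>\<delta>\<bar> < pi / 4" "x = rcis (norm x) (of_nat k * pi / 2 + \<delta>)" "norm x > 0"
proof -
  obtain y where y: "x = cis (of_nat k * pi / 2) * y" "y \<noteq> 0" "- (pi / 4) < Arg y" "Arg y < pi / 4"
    using assms unfolding stokes_sector_def by auto
  have "y = rcis (norm x) (Arg y)" by (simp add: y(1) norm_mult rcis_cmod_Arg)
  then have "x = cis (of_nat k * pi / 2) * rcis (norm x) (Arg y)" using y(1) by simp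
  also have "\<dots> = rcis (norm x) (of_nat k * pi / 2 + Arg y)"
    by (simp add: rcis_def cis_mult mult.left_commute)
  finally show ?thesis using y by (intro that[of "Arg y"]) (auto simp: norm_mult)
qed

lemma stokes_sector_subset: "k \<le> 3 \<Longrightarrow> stokes_sector k \<subseteq> cut_plane"
proof
  fix x assume k: "k \<le> 3" and "x \<in> stokes_sector k"
  then obtain \<delta> where \<delta>: "\<bar>\<delta>\<bar> < pi / 4" "x = rcis (norm x) (of_nat k * pi / 2 + \<delta>)" "norm x > 0"
    by (auto elim: stokes_sector_polar)
  have kp: "real k * pi / 2 \<le> 3 * pi / 2" "real k * pi / 2 \<ge> 0" using k by auto
  have "- (pi / 4) < real k * pi / 2 + \<delta>" "real k * pi / 2 + \<delta> < 7 * pi / 4" using kp \<delta>(1) by linarith+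
  then have "rcis (norm x) (of_nat k * pi / 2 + \<delta>) \<in> cut_plane" using \<delta>(3) by (intro rcis_cut_plane)
  then show "x \<in> cut_plane" using \<delta> by simp
qed

text \<open>
  The sign \<open>s\<close> of the gauge in which the solution subdominant in the sector \<open>k\<close> behaves like a power, and its leading coefficient.
\<close>

definition sector_sign :: "nat \<Rightarrow> complex" where "sector_sign k = (if odd k then - 1 else 1)"
definition sector_coeff :: "nat \<Rightarrow> complex" where "sector_coeff k = (if odd k then 1 else - 1 / 2)"

lemma sector_sign_square [simp]: "sector_sign k * sector_sign k = 1" by (simp add: sector_sign_def)
lemma sector_sign_nz [simp]: "sector_sign k \<noteq> 0" by (simp add: sector_sign_def)
lemma sector_coeff_nz [simp]: "sector_coeff k \<noteq> 0" by (simp add: sector_coeff_def)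

text \<open>
  \<open>f = (c + O(1/x)) x^D\<close> as \<open>x\<close> tends to infinity in \<open>S\<close>, with explicit constants.
\<close>

definition asymptotic_on :: "complex set \<Rightarrow> (complex \<Rightarrow> complex) \<Rightarrow> nat \<Rightarrow> complex \<Rightarrow> bool" where
  "asymptotic_on S f D c \<longleftrightarrow> (\<exists>C R. C > 0 \<and> R > 0 \<and> (\<forall>x\<in>S. norm x \<ge> R \<longrightarrow> norm (f x / x ^ D - c) \<le> C / norm x))"

text \<open>
  The gauge factor removes the exponential and the power from the normalisation of \<open>\<psi>\<^sub>k\<close>, as \<open>d\<close> is exactly the remaining exponent.
\<close>

lemma is_psi_infty_iff:
  assumes k: "k \<le> 3" and D: "ode_degree K (sector_sign k) \<theta> = of_nat D"
  defines "f \<equiv> \<lambda>a \<psi> x. \<psi> x * gauge_factor K (sector_sign k) a x"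
  shows "is_psi_infty a b (K / 2) \<theta> k \<psi> \<longleftrightarrow> \<psi> holomorphic_on cut_plane \<and>
    ode_solution cut_plane K (sector_sign k) a (of_nat D) (ode_kappa K (sector_sign k) a b \<theta>) (f a \<psi>) \<and>
    asymptotic_on (stokes_sector k) (f a \<psi>) D (sector_coeff k)"
proof -
  let ?S = "stokes_sector k" and ?c = "sector_coeff k"
  define E where "E x = (if odd k then exp (g x a) * cut_powr x (1 / 2 - \<theta>) else exp (- g x a) * cut_powr x (\<theta> - 3 / 2))" for x
  have E: "E x * gauge_factor K (sector_sign k) a x = x ^ D" if "x \<in> ?S" for x
  proof -
    have x0: "x \<noteq> 0" using that stokes_sector_subset[OF k] zero_notin_cut_plane by auto
    have ee: "exp (g x a) * exp (- g x a) = 1" by (simp flip: exp_add)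
    show ?thesis
    proof (cases "odd k")
      case True
      have "1 / 2 - \<theta> + (K - 1) / 2 = ode_degree K (- 1) \<theta>" by (simp add: ode_degree_def field_simps)
      then have "1 / 2 - \<theta> + (K - 1) / 2 = of_nat D" using D True by (simp only: sector_sign_def if_True not_False_eq_True)
      then have "cut_powr x (1 / 2 - \<theta>) * cut_powr x ((K - 1) / 2) = x ^ D"
        by (simp add: cut_powr_of_nat[OF x0] flip: cut_powr_add)
      moreover have "E x * gauge_factor K (sector_sign k) a x =
        (exp (g x a) * exp (- g x a)) * (cut_powr x (1 / 2 - \<theta>) * cut_powr x ((K - 1) / 2))"
        using True by (simp add: E_def gauge_factor_def sector_sign_def mult_ac)
      ultimately show ?thesis by (simp add: ee)
    next
      case False
      have "\<theta> - 3 / 2 + (K - 1) / 2 = ode_degree K 1 \<theta>" by (simp add: ode_degree_def field_simps)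
      then have "\<theta> - 3 / 2 + (K - 1) / 2 = of_nat D" using D False by (simp only: sector_sign_def if_False not_True_eq_False not_False_eq_True if_True)
      then have "cut_powr x (\<theta> - 3 / 2) * cut_powr x ((K - 1) / 2) = x ^ D"
        by (simp add: cut_powr_of_nat[OF x0] flip: cut_powr_add)
      moreover have "E x * gauge_factor K (sector_sign k) a x =
        (exp (g x a) * exp (- g x a)) * (cut_powr x (\<theta> - 3 / 2) * cut_powr x ((K - 1) / 2))"
        using False by (simp add: E_def gauge_factor_def sector_sign_def mult_ac)
      ultimately show ?thesis by (simp add: ee)
    qed
  qed
  have eq: "\<psi> x = (?c + \<rho>) * E x \<longleftrightarrow> f a \<psi> x / x ^ D - ?c = \<rho>" if "x \<in> ?S" for x \<rho>
  proof -
    have x0: "x \<noteq> 0" using that stokes_sector_subset[OF k] zero_notin_cut_plane by auto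
    have "\<psi> x = (?c + \<rho>) * E x \<longleftrightarrow> f a \<psi> x = (?c + \<rho>) * (E x * gauge_factor K (sector_sign k) a x)"
      by (simp add: f_def flip: mult.assoc)
    also have "\<dots> \<longleftrightarrow> f a \<psi> x / x ^ D - ?c = \<rho>" unfolding E[OF that] using x0 by (auto simp: field_simps)
    finally show ?thesis .
  qed
  have form: "(if odd k then (1 + \<rho>) * exp (g x a) * cut_powr x (1 / 2 - \<theta>)
        else (- 1 / 2 + \<rho>) * exp (- g x a) * cut_powr x (\<theta> - 3 / 2)) = (?c + \<rho>) * E x" for x \<rho>
    by (simp add: E_def sector_coeff_def)
  have "is_psi_infty a b (K / 2) \<theta> k \<psi> \<longleftrightarrow> oscillator_solution a b (K / 2) \<theta> \<psi> \<and>
     (\<lambda>x. f a \<psi> x / x ^ D - ?c) \<in> O[inf at_infinity (principal ?S)](\<lambda>x. inverse x)"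
  proof -
    have "(\<exists>r. r \<in> O[inf at_infinity (principal ?S)](\<lambda>x. inverse x) \<and> (\<forall>x\<in>?S. f a \<psi> x / x ^ D - ?c = r x))
      \<longleftrightarrow> (\<lambda>x. f a \<psi> x / x ^ D - ?c) \<in> O[inf at_infinity (principal ?S)](\<lambda>x. inverse x)" (is "?L \<longleftrightarrow> ?R")
    proof
      assume ?L
      then obtain r where r: "r \<in> O[inf at_infinity (principal ?S)](\<lambda>x. inverse x)" "\<forall>x\<in>?S. f a \<psi> x / x ^ D - ?c = r x" by blast
      have ev: "eventually (\<lambda>x. f a \<psi> x / x ^ D - ?c = r x) (inf at_infinity (principal ?S))"
        using r(2) by (auto simp: eventually_inf_principal)
      show ?R using r(1) landau_o.big.in_cong[OF ev] by blast
    qed blast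
    moreover have "(\<forall>x\<in>?S. \<psi> x = (?c + r x) * E x) \<longleftrightarrow> (\<forall>x\<in>?S. f a \<psi> x / x ^ D - ?c = r x)" for r
      using eq by blast
    ultimately show ?thesis by (simp only: is_psi_infty_def form)
  qed
  also have "(\<lambda>x. f a \<psi> x / x ^ D - ?c) \<in> O[inf at_infinity (principal ?S)](\<lambda>x. inverse x) \<longleftrightarrow> asymptotic_on ?S (f a \<psi>) D ?c"
  proof
    assume "(\<lambda>x. f a \<psi> x / x ^ D - ?c) \<in> O[inf at_infinity (principal ?S)](\<lambda>x. inverse x)"
    then obtain C where C: "C > 0" "eventually (\<lambda>x. norm (f a \<psi> x / x ^ D - ?c) \<le> C * norm (inverse x)) (inf at_infinity (principal ?S))"
      by (elim landau_o.bigE)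
    then obtain R where "\<forall>x. R \<le> norm x \<longrightarrow> x \<in> ?S \<longrightarrow> norm (f a \<psi> x / x ^ D - ?c) \<le> C * norm (inverse x)"
      by (auto simp: eventually_inf_principal eventually_at_infinity)
    then show "asymptotic_on ?S (f a \<psi>) D ?c" unfolding asymptotic_on_def using C(1)
      by (intro exI[of _ C] exI[of _ "max R 1"]) (auto simp: norm_inverse divide_inverse)
  next
    assume "asymptotic_on ?S (f a \<psi>) D ?c"
    then obtain C R where "\<forall>x\<in>?S. norm x \<ge> R \<longrightarrow> norm (f a \<psi> x / x ^ D - ?c) \<le> C / norm x" unfolding asymptotic_on_def by blast
    then show "(\<lambda>x. f a \<psi> x / x ^ D - ?c) \<in> O[inf at_infinity (principal ?S)](\<lambda>x. inverse x)"
      by (intro bigoI[of _ C]) (auto simp: eventually_inf_principal eventually_at_infinity norm_inverse divide_inverse intro!: exI[of _ R])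
  qed
  also have "oscillator_solution a b (K / 2) \<theta> \<psi> \<longleftrightarrow> \<psi> holomorphic_on cut_plane \<and>
    ode_solution cut_plane K (sector_sign k) a (of_nat D) (ode_kappa K (sector_sign k) a b \<theta>) (f a \<psi>)"
  proof -
    have ss: "sector_sign k * sector_sign k = 1" by simp
    show ?thesis
    proof (cases "\<psi> holomorphic_on cut_plane")
      case True
      show ?thesis using oscillator_solution_iff_ode[OF ss True] True D by (simp add: f_def)
    qed (simp add: oscillator_solution_def)
  qed
  finally show ?thesis by blast
qed

section \<open>Stokes sectors, Wronskians and uniqueness\<close>

definition wronskian :: "(complex \<Rightarrow> complex) \<Rightarrow> (complex \<Rightarrow> complex) \<Rightarrow> complex \<Rightarrow> complex" where
  "wronskian f h x = f x * deriv h x - deriv f x * h x"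

lemma wronskian_zero_imp_dependent:
  assumes U: "open U" "connected U" and f: "f holomorphic_on U" and h: "h holomorphic_on U"
    and W: "\<And>x. x \<in> U \<Longrightarrow> wronskian f h x = 0" and x0: "x0 \<in> U" "f x0 \<noteq> 0"
  shows "\<exists>k. \<forall>x\<in>U. h x = k * f x"
proof -
  have "continuous (at x0) f"
    using f U x0 holomorphic_on_imp_continuous_on continuous_on_eq_continuous_at by blast
  then obtain e where e: "e > 0" "\<forall>y. dist x0 y < e \<longrightarrow> f y \<noteq> 0"
    using continuous_at_avoid[where f = f and x = x0 and a = 0] x0(2) by blast
  obtain e' where e': "e' > 0" "ball x0 e' \<subseteq> U" using U x0 open_contains_ball by blast
  let ?B = "ball x0 (min e e')"
  have nz: "f y \<noteq> 0" "y \<in> U" if "y \<in> ?B" for y using that e e' by auto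
  have "((\<lambda>x. h x / f x) has_field_derivative 0) (at y)" if "y \<in> ?B" for y
  proof -
    have "(f has_field_derivative deriv f y) (at y)" "(h has_field_derivative deriv h y) (at y)"
      using f h U(1) nz(2)[OF that] holomorphic_derivI by blast+
    then have "((\<lambda>x. h x / f x) has_field_derivative (deriv h y * f y - h y * deriv f y) / (f y * f y)) (at y)"
      using nz(1)[OF that] by (intro DERIV_divide)
    moreover have "deriv h y * f y - h y * deriv f y = 0"
      using W[OF nz(2)[OF that]] by (simp add: wronskian_def mult.commute)
    ultimately show ?thesis by simp
  qed
  then have "\<exists>c. \<forall>x\<in>?B. h x / f x = c"
    by (intro has_field_derivative_zero_constant) (auto intro: has_field_derivative_at_within)
  then obtain c where c: "\<forall>x\<in>?B. h x / f x = c" by blast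
  have "h x = c * f x" if "x \<in> U" for x
  proof (rule analytic_continuation_open[where s = ?B and s' = U and f = h and g = "\<lambda>x. c * f x"])
    show "?B \<noteq> {}" using e e' by auto
    show "?B \<subseteq> U" using nz by auto
    show "h y = c * f y" if "y \<in> ?B" for y
    proof -
      have "h y / f y = c" using c that by blast
      then show ?thesis using nz(1)[OF that] by (simp add: field_simps)
    qed
  qed (use U h f that in \<open>auto intro!: holomorphic_intros\<close>)
  then show ?thesis by blast
qed

text \<open>
  Abel's formula; the quotient of the two sides has derivative zero.
\<close>

lemma wronskian_ode_const:
  assumes U: "open U" "connected U" "0 \<notin> U" and K: "K \<ge> 1"
    and f: "ode_solution U (of_nat K) s a d \<kappa> f" and h: "ode_solution U (of_nat K) s a d \<kappa> h"
  shows "\<exists>w. \<forall>x\<in>U. wronskian f h x = w * x ^ (K - 1) * exp (2 * s * g x a)"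
proof -
  let ?T = "\<lambda>x. wronskian f h x * exp (- (2 * s * g x a)) / x ^ (K - 1)"
  have fh: "f holomorphic_on U" "h holomorphic_on U" using f h by (auto simp: ode_solution_def)
  have "(?T has_field_derivative 0) (at x)" if x: "x \<in> U" for x
  proof -
    have x0: "x \<noteq> 0" using U x by auto
    have d: "(f has_field_derivative deriv f x) (at x)" "(h has_field_derivative deriv h x) (at x)"
      "(deriv f has_field_derivative deriv (deriv f) x) (at x)" "(deriv h has_field_derivative deriv (deriv h) x) (at x)"
      using fh U(1) x holomorphic_deriv holomorphic_derivI by blast+
    define W' where "W' = f x * deriv (deriv h) x - deriv (deriv f) x * h x"
    have dW: "(wronskian f h has_field_derivative W') (at x)"
      unfolding wronskian_def[abs_def] W'_def by (auto intro!: derivative_eq_intros d)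
    obtain j where j: "K = Suc j" using K by (cases K) auto
    have "f x * ode_op (of_nat K) s a d \<kappa> h x - h x * ode_op (of_nat K) s a d \<kappa> f x = 0"
      using f h x by (simp add: ode_solution_def)
    then have W': "x * W' = (of_nat j + 2 * s * x * (x + a)) * wronskian f h x"
      unfolding ode_op_def W'_def wronskian_def j by (simp add: algebra_simps)
    have dp: "((\<lambda>x. x ^ j) has_field_derivative of_nat j * x ^ j / x) (at x)"
    proof -
      have "((\<lambda>x. x ^ j) has_field_derivative of_nat j * x ^ (j - 1)) (at x)" by (auto intro!: derivative_eq_intros)
      moreover have "of_nat j * x ^ (j - 1) = of_nat j * x ^ j / x" using x0 by (cases j) auto
      ultimately show ?thesis by simp
    qed
    have de: "((\<lambda>x. exp (- (2 * s * g x a))) has_field_derivative (- (2 * s * (x + a))) * exp (- (2 * s * g x a))) (at x)"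
      by (auto intro!: derivative_eq_intros DERIV_g)
    have "(?T has_field_derivative ((W' * exp (- (2 * s * g x a)) + (- (2 * s * (x + a))) * exp (- (2 * s * g x a)) * wronskian f h x) * x ^ j
        - wronskian f h x * exp (- (2 * s * g x a)) * (of_nat j * x ^ j / x)) / (x ^ j * x ^ j)) (at x)"
      unfolding j diff_Suc_1 using x0 by (intro DERIV_divide DERIV_mult dW de dp) auto
    moreover have "(W' * exp (- (2 * s * g x a)) + (- (2 * s * (x + a))) * exp (- (2 * s * g x a)) * wronskian f h x) * x ^ j
        - wronskian f h x * exp (- (2 * s * g x a)) * (of_nat j * x ^ j / x)
       = exp (- (2 * s * g x a)) * x ^ j / x * (x * W' - (of_nat j + 2 * s * x * (x + a)) * wronskian f h x)"
      using x0 by (simp add: field_simps)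
    ultimately show ?thesis by (simp add: W')
  qed
  then obtain w where w: "?T x = w" if "x \<in> U" for x
    using has_field_derivative_0_imp_constant_on[of U ?T] U by (auto simp: constant_on_def)
  have "wronskian f h x = w * x ^ (K - 1) * exp (2 * s * g x a)" if "x \<in> U" for x
  proof -
    have "x ^ (K - 1) \<noteq> 0" using U that by auto
    then have "wronskian f h x * exp (- (2 * s * g x a)) = w * x ^ (K - 1)" using w[OF that] by (simp add: field_simps)
    then have "wronskian f h x * (exp (- (2 * s * g x a)) * exp (2 * s * g x a)) = w * x ^ (K - 1) * exp (2 * s * g x a)"
      by (simp flip: mult.assoc)
    then show ?thesis by (simp flip: exp_add)
  qed
  then show ?thesis by blast
qed

lemma norm_deriv_le:
  assumes "f holomorphic_on S" "open S" "cball x r \<subseteq> S" "r > 0" "\<And>y. y \<in> cball x r \<Longrightarrow> norm (f y) \<le> B"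
  shows "norm (deriv f x) \<le> B / r"
proof -
  have "norm ((deriv ^^ 1) f x) \<le> fact 1 * B / r ^ 1"
  proof (rule Cauchy_inequality)
    show "f holomorphic_on ball x r" using assms(1,3) by (meson holomorphic_on_subset ball_subset_cball order_trans)
    show "continuous_on (cball x r) f" using assms(1,3) by (meson holomorphic_on_imp_continuous_on continuous_on_subset)
    show "norm (f y) \<le> B" if "norm (x - y) = r" for y using assms(5)[of y] that by (simp add: dist_norm)
  qed fact
  then show ?thesis by simp
qed

lemma asymptotic_imp_bound:
  assumes "asymptotic_on S f D c"
  obtains B R where "B > 0" "R > 0" "\<And>x. x \<in> S \<Longrightarrow> norm x \<ge> R \<Longrightarrow> norm (f x) \<le> B * norm x ^ D"
proof -
  obtain C R where CR: "C > 0" "R > 0" "\<forall>x\<in>S. norm x \<ge> R \<longrightarrow> norm (f x / x ^ D - c) \<le> C / norm x"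
    using assms unfolding asymptotic_on_def by blast
  show ?thesis
  proof (rule that[of "norm c + C / R" R])
    fix x assume x: "x \<in> S" "norm x \<ge> R"
    have "norm (f x / x ^ D) \<le> norm c + norm (f x / x ^ D - c)" using norm_triangle_ineq[of c "f x / x ^ D - c"] by simp
    also have "\<dots> \<le> norm c + C / norm x" using CR x by auto
    also have "\<dots> \<le> norm c + C / R" using CR x by (auto intro!: divide_left_mono mult_pos_pos)
    finally have "norm (f x) / norm x ^ D \<le> norm c + C / R" by (simp add: norm_divide norm_power)
    moreover have "norm x ^ D > 0" using CR x by (auto intro!: zero_less_power)
    ultimately show "norm (f x) \<le> (norm c + C / R) * norm x ^ D" by (simp only: pos_divide_le_eq)
  qed (use CR in \<open>auto intro: add_nonneg_pos\<close>)
qed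

lemma asymptotic_on_ray_limit:
  assumes "asymptotic_on S f D c" "\<And>R. R > 0 \<Longrightarrow> of_real R * \<omega> \<in> S" "norm \<omega> = 1"
  shows "((\<lambda>R. f (of_real R * \<omega>) / (of_real R * \<omega>) ^ D) \<longlongrightarrow> c) at_top"
proof -
  obtain C R0 where CR: "C > 0" "R0 > 0" "\<forall>x\<in>S. norm x \<ge> R0 \<longrightarrow> norm (f x / x ^ D - c) \<le> C / norm x"
    using assms(1) unfolding asymptotic_on_def by blast
  have "((\<lambda>R. f (of_real R * \<omega>) / (of_real R * \<omega>) ^ D - c) \<longlongrightarrow> 0) at_top"
  proof (rule Lim_null_comparison)
    show "eventually (\<lambda>R. norm (f (of_real R * \<omega>) / (of_real R * \<omega>) ^ D - c) \<le> C / R) at_top"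
      using eventually_ge_at_top[of "max R0 1"]
    proof eventually_elim
      case (elim R)
      then show ?case using CR(3) assms(2)[of R] assms(3) CR(2) by (auto simp: norm_mult dest!: bspec)
    qed
    show "((\<lambda>R. C / R) \<longlongrightarrow> 0) at_top" by real_asymp
  qed
  then show ?thesis using LIM_zero_iff by blast
qed

lemma ball_in_stokes_sector:
  assumes "R > 0"
  shows "cball (of_real R * cis (of_nat k * pi / 2)) (R / 4) \<subseteq> stokes_sector k"
proof
  fix y assume y: "y \<in> cball (of_real R * cis (of_nat k * pi / 2)) (R / 4)"
  let ?w = "cis (- (of_nat k * pi / 2)) * y"
  have "norm (?w - of_real R) = norm (cis (- (of_nat k * pi / 2)) * (y - of_real R * cis (of_nat k * pi / 2)))"
    by (simp add: algebra_simps cis_mult)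
  also have "\<dots> \<le> R / 4" using y by (simp add: norm_mult dist_norm norm_minus_commute)
  finally have *: "norm (?w - of_real R) \<le> R / 4" .
  have "\<bar>Im ?w\<bar> \<le> R / 4" using order.trans[OF abs_Im_le_cmod *] by simp
  moreover have "\<bar>Re ?w - R\<bar> \<le> R / 4"
    using order.trans[OF abs_Re_le_cmod *] by (simp only: minus_complex.sel Re_complex_of_real)
  ultimately show "y \<in> stokes_sector k" unfolding stokes_sector_iff using assms by linarith
qed

lemma sector_sign_ray: "sector_sign k * (of_real R * cis (of_nat k * pi / 2))\<^sup>2 = of_real (R\<^sup>2)"
proof -
  have "(cis (of_nat k * pi / 2))\<^sup>2 = cis (of_nat k * pi)" by (simp add: Complex.DeMoivre)
  also have "\<dots> = cis pi ^ k" by (simp only: Complex.DeMoivre)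
  also have "\<dots> = (-1) ^ k" by simp
  also have "\<dots> = sector_sign k" by (auto simp: sector_sign_def)
  finally show ?thesis by (simp add: power_mult_distrib mult.left_commute)
qed

text \<open>
  On the middle ray of the sector the Wronskian is \<open>w x^(K - 1) exp (2 s g)\<close>, which grows like \<open>exp (R^2)\<close> unless \<open>w = 0\<close>, while
  \<open>f\<close> and \<open>h\<close> and, by Cauchy's estimate, their derivatives are bounded by powers. So the solutions are
  proportional, and their leading coefficients are equal.
\<close>

lemma psi_infty_ode_unique:
  assumes k: "k \<le> 3" and K: "K \<ge> 1"
    and f: "ode_solution cut_plane (of_nat K) (sector_sign k) a d \<kappa> f" "asymptotic_on (stokes_sector k) f D c"
    and h: "ode_solution cut_plane (of_nat K) (sector_sign k) a d \<kappa> h" "asymptotic_on (stokes_sector k) h D c"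
    and c: "c \<noteq> 0"
  shows "\<forall>x\<in>cut_plane. f x = h x"
proof -
  let ?\<omega> = "cis (of_nat k * pi / 2)" and ?s = "sector_sign k" and ?S = "stokes_sector k"
  have fh: "f holomorphic_on cut_plane" "h holomorphic_on cut_plane" using f h by (auto simp: ode_solution_def)
  have Ssub: "?S \<subseteq> cut_plane" by (rule stokes_sector_subset[OF k])
  have ray: "of_real R * ?\<omega> \<in> ?S" if "R > 0" for R using ball_in_stokes_sector[OF that, of k] that by auto
  obtain w where w: "\<And>x. x \<in> cut_plane \<Longrightarrow> wronskian f h x = w * x ^ (K - 1) * exp (2 * ?s * g x a)"
    using wronskian_ode_const[OF open_cut_plane connected_cut_plane zero_notin_cut_plane K f(1) h(1)] by blast
  obtain B1 R1 where B1: "B1 > 0" "R1 > 0" "\<And>x. x \<in> ?S \<Longrightarrow> norm x \<ge> R1 \<Longrightarrow> norm (f x) \<le> B1 * norm x ^ D"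
    using asymptotic_imp_bound[OF f(2)] by blast
  obtain B2 R2 where B2: "B2 > 0" "R2 > 0" "\<And>x. x \<in> ?S \<Longrightarrow> norm x \<ge> R2 \<Longrightarrow> norm (h x) \<le> B2 * norm x ^ D"
    using asymptotic_imp_bound[OF h(2)] by blast
  define B where "B = B1 * 2 ^ D * (B2 * 2 ^ D)"
  have bound: "norm w * (R ^ (K - 1) * exp (R\<^sup>2 - 2 * norm a * R)) \<le> 2 * B * R ^ D * R ^ D"
    if R: "R \<ge> max (2 * max R1 R2) 4" for R
  proof -
    let ?x = "of_real R * ?\<omega>"
    have Rp: "R > 0" "R \<ge> 4" using R by auto
    have xS: "?x \<in> ?S" by (rule ray[OF Rp(1)])
    have cb: "norm y \<ge> R1 \<and> norm y \<ge> R2 \<and> norm y \<le> 2 * R \<and> y \<in> ?S" if "y \<in> cball ?x (R / 4)" for y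
    proof -
      have "norm ?x = R" using Rp by (simp add: norm_mult)
      then have "norm y \<ge> 3 * R / 4" "norm y \<le> 5 * R / 4"
        using that norm_triangle_ineq2[of ?x "?x - y"] norm_triangle_ineq4[of ?x "?x - y"] by (auto simp: dist_norm)
      then show ?thesis using R that ball_in_stokes_sector[OF Rp(1), of k] by auto
    qed
    have pw: "norm y ^ D \<le> 2 ^ D * R ^ D" if "y \<in> cball ?x (R / 4)" for y
      using cb[OF that] power_mono[of "norm y" "2 * R" D] by (simp add: power_mult_distrib)
    have fb: "norm (f y) \<le> B1 * 2 ^ D * R ^ D" if "y \<in> cball ?x (R / 4)" for y
      using B1(3)[of y] cb[OF that] pw[OF that] B1(1) by (smt (verit) mult.assoc mult_left_mono)
    have hb: "norm (h y) \<le> B2 * 2 ^ D * R ^ D" if "y \<in> cball ?x (R / 4)" for y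
      using B2(3)[of y] cb[OF that] pw[OF that] B2(1) by (smt (verit) mult.assoc mult_left_mono)
    have sub: "cball ?x (R / 4) \<subseteq> cut_plane" using ball_in_stokes_sector[OF Rp(1), of k] Ssub by blast
    have "norm (deriv f ?x) \<le> B1 * 2 ^ D * R ^ D / (R / 4)"
      by (rule norm_deriv_le[OF fh(1) open_cut_plane sub _ fb]) (use Rp in auto)
    also have "\<dots> \<le> B1 * 2 ^ D * R ^ D" using Rp B1 by (simp add: field_simps)
    finally have df: "norm (deriv f ?x) \<le> B1 * 2 ^ D * R ^ D" .
    have "norm (deriv h ?x) \<le> B2 * 2 ^ D * R ^ D / (R / 4)"
      by (rule norm_deriv_le[OF fh(2) open_cut_plane sub _ hb]) (use Rp in auto)
    also have "\<dots> \<le> B2 * 2 ^ D * R ^ D" using Rp B2 by (simp add: field_simps)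
    finally have dh: "norm (deriv h ?x) \<le> B2 * 2 ^ D * R ^ D" .
    have xc: "?x \<in> cball ?x (R / 4)" using Rp by simp
    have "norm (wronskian f h ?x) \<le> norm (f ?x) * norm (deriv h ?x) + norm (deriv f ?x) * norm (h ?x)"
      unfolding wronskian_def using norm_triangle_ineq4[of "f ?x * deriv h ?x" "deriv f ?x * h ?x"] by (simp only: norm_mult)
    also have "\<dots> \<le> (B1 * 2 ^ D * R ^ D) * (B2 * 2 ^ D * R ^ D) + (B1 * 2 ^ D * R ^ D) * (B2 * 2 ^ D * R ^ D)"
      using fb[OF xc] hb[OF xc] df dh B1 B2 Rp by (intro add_mono mult_mono) auto
    also have "\<dots> = 2 * B * R ^ D * R ^ D" by (simp add: B_def mult_ac)
    finally have "norm (wronskian f h ?x) \<le> 2 * B * R ^ D * R ^ D" .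
    moreover have "norm (wronskian f h ?x) = norm w * (R ^ (K - 1) * exp (Re (2 * ?s * g ?x a)))"
      using w[of ?x] xS Ssub Rp by (simp add: norm_mult norm_power subset_iff)
    moreover have "Re (2 * ?s * g ?x a) \<ge> R\<^sup>2 - 2 * norm a * R"
    proof -
      have "2 * ?s * g ?x a = ?s * ?x\<^sup>2 + 2 * ?s * a * ?x" by (simp add: g_def algebra_simps)
      also have "\<dots> = of_real (R\<^sup>2) + 2 * ?s * a * ?x" unfolding sector_sign_ray ..
      finally have "Re (2 * ?s * g ?x a) = R\<^sup>2 + Re (2 * ?s * a * ?x)" by simp
      moreover have "norm (2 * ?s * a * ?x) = 2 * norm a * R" using Rp by (simp add: norm_mult sector_sign_def)
      moreover have "\<bar>Re (2 * ?s * a * ?x)\<bar> \<le> norm (2 * ?s * a * ?x)" by (rule abs_Re_le_cmod)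
      ultimately show ?thesis by linarith
    qed
    then have "norm w * (R ^ (K - 1) * exp (R\<^sup>2 - 2 * norm a * R)) \<le> norm w * (R ^ (K - 1) * exp (Re (2 * ?s * g ?x a)))"
      using Rp by (intro mult_left_mono) auto
    ultimately show ?thesis by linarith
  qed
  have "w = 0"
  proof (rule ccontr)
    assume w0: "w \<noteq> 0"
    have "((\<lambda>R. 2 * B * R ^ D * R ^ D / (R ^ (K - 1) * exp (R\<^sup>2 - 2 * norm a * R))) \<longlongrightarrow> 0) at_top"
      by real_asymp
    moreover have "eventually (\<lambda>R. norm w \<le> 2 * B * R ^ D * R ^ D / (R ^ (K - 1) * exp (R\<^sup>2 - 2 * norm a * R))) at_top"
      using eventually_ge_at_top[of "max (2 * max R1 R2) 4"]
    proof eventually_elim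
      case (elim R)
      then show ?case using bound[OF elim] by (simp add: field_simps)
    qed
    ultimately have "norm w \<le> 0" by (rule tendsto_lowerbound) auto
    then show False using w0 by simp
  qed
  then have W: "wronskian f h x = 0" if "x \<in> cut_plane" for x using w[OF that] by simp
  have lf: "((\<lambda>R. f (of_real R * ?\<omega>) / (of_real R * ?\<omega>) ^ D) \<longlongrightarrow> c) at_top"
    and lh: "((\<lambda>R. h (of_real R * ?\<omega>) / (of_real R * ?\<omega>) ^ D) \<longlongrightarrow> c) at_top"
    by (auto intro!: asymptotic_on_ray_limit[OF f(2)] asymptotic_on_ray_limit[OF h(2)] ray)
  have "eventually (\<lambda>R. f (of_real R * ?\<omega>) / (of_real R * ?\<omega>) ^ D \<noteq> 0) at_top"
    using lf c by (rule tendsto_imp_eventually_ne)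
  then have "eventually (\<lambda>R. f (of_real R * ?\<omega>) \<noteq> 0 \<and> R > 0) at_top"
    using eventually_gt_at_top[of 0] by eventually_elim auto
  then obtain R where R: "f (of_real R * ?\<omega>) \<noteq> 0" "R > 0" using eventually_happens[of _ at_top] by force
  obtain l where l: "\<forall>x\<in>cut_plane. h x = l * f x"
    using wronskian_zero_imp_dependent[OF open_cut_plane connected_cut_plane fh W _ R(1)] ray[OF R(2)] Ssub by blast
  have "((\<lambda>R. l * (f (of_real R * ?\<omega>) / (of_real R * ?\<omega>) ^ D)) \<longlongrightarrow> c) at_top"
  proof (rule Lim_transform_eventually[OF lh])
    show "eventually (\<lambda>R. h (of_real R * ?\<omega>) / (of_real R * ?\<omega>) ^ D = l * (f (of_real R * ?\<omega>) / (of_real R * ?\<omega>) ^ D)) at_top"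
      using eventually_gt_at_top[of 0] by eventually_elim (use l ray Ssub in auto)
  qed
  then have "l * c = c" using tendsto_mult_left[OF lf, of l] tendsto_unique trivial_limit_at_top_linorder by blast
  then show ?thesis using l c by simp
qed

section \<open>Frobenius solutions are entire\<close>

lemma frobenius_Suc:
  assumes "of_nat (Suc k) \<noteq> K"
  shows "of_nat (Suc k) * (of_nat (Suc k) - K) * fps_nth (frobenius K s a d \<kappa> S) (Suc k) =
     S k - (\<kappa> - 2 * s * a * of_nat k) * fps_nth (frobenius K s a d \<kappa> S) k
      - (if k = 0 then 0 else 2 * s * (d + 1 - of_nat k) * fps_nth (frobenius K s a d \<kappa> S) (k - 1))"
  using fps_ode_frobenius[OF assms, of s a d \<kappa> S] unfolding fps_nth_fps_ode by (simp add: algebra_simps)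

text \<open>
  Far out, the recursion bounds each coefficient by a small multiple of the previous two and the source term, since it divides by \<open>k^2\<close> and multiplies by \<open>k\<close>.
  Weighted by \<open>r^k\<close> the coefficients therefore stay bounded for every \<open>r\<close>.
\<close>

lemma frobenius_bound:
  assumes S: "\<And>r. r > 0 \<Longrightarrow> \<exists>M. \<forall>k. norm (S k) * r ^ k \<le> M" and r: "r > 0"
  shows "\<exists>M. \<forall>k. norm (fps_nth (frobenius K s a d \<kappa> S) k) * r ^ k \<le> M"
proof -
  define u where "u k = norm (fps_nth (frobenius K s a d \<kappa> S) k) * r ^ k" for k
  define A where "A = norm \<kappa> + 2 * norm s * norm a + 2 * norm s * (norm d + 1)"
  have A: "A \<ge> 0" by (simp add: A_def)
  obtain M1 where M1: "\<And>k. norm (S k) * r ^ k \<le> M1" using S[OF r] by blast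
  have M1nn: "M1 \<ge> 0" using order.trans[OF norm_ge_zero[of "S 0"], of M1] M1[of 0] by simp
  obtain k0 where k0: "real k0 \<ge> 4 * (A * (r + r\<^sup>2)) + 2 * norm K + 2" using real_arch_simple by blast
  have step: "u (Suc k) \<le> 2 * M1 * r + M / 2" if k: "k \<ge> k0" and M: "\<And>j. j \<le> k \<Longrightarrow> u j \<le> M" for k M
  proof -
    let ?n = "real (Suc k)"
    have kk: "?n \<ge> 4 * (A * (r + r\<^sup>2)) + 2 * norm K + 2" using k k0 by linarith
    have AR: "0 \<le> A * (r + r\<^sup>2)" using A r by simp
    have kp: "k \<ge> 1"
    proof (rule ccontr)
      assume "\<not> k \<ge> 1"
      then have "real k0 \<le> 0" using k by simp
      then show False using k0 AR norm_ge_zero[of K] by linarith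
    qed
    have nK: "norm (of_nat (Suc k) - K) \<ge> ?n / 2"
    proof -
      have arith: "n / 2 \<le> q" if "n - l \<le> q" "4 * z + 2 * l + 2 \<le> n" "0 \<le> z" for n l q z :: real
        using that by linarith
      have "norm (of_nat (Suc k) :: complex) - norm K \<le> norm (of_nat (Suc k) - K)" by (rule norm_triangle_ineq2)
      then have "?n - norm K \<le> norm (of_nat (Suc k) - K)" by (simp only: norm_of_nat)
      then show ?thesis using kk AR by (rule arith)
    qed
    have ne: "of_nat (Suc k) \<noteq> K"
    proof
      assume "of_nat (Suc k) = K"
      then have "?n / 2 \<le> 0" using nK by simp
      then show False by simp
    qed
    let ?F = "fps_nth (frobenius K s a d \<kappa> S)"
    have "norm (of_nat (Suc k) * (of_nat (Suc k) - K) * ?F (Suc k)) =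
       norm (S k - (\<kappa> - 2 * s * a * of_nat k) * ?F k - 2 * s * (d + 1 - of_nat k) * ?F (k - 1))"
      using frobenius_Suc[OF ne] kp by simp
    also have "\<dots> \<le> norm (S k) + norm (\<kappa> - 2 * s * a * of_nat k) * norm (?F k)
        + norm (2 * s * (d + 1 - of_nat k)) * norm (?F (k - 1))"
      by (intro order.trans[OF norm_triangle_ineq4] add_mono) (auto simp: norm_mult intro: order.trans[OF norm_triangle_ineq4])
    also have "\<dots> \<le> norm (S k) + A * ?n * norm (?F k) + A * ?n * norm (?F (k - 1))"
    proof (intro add_mono mult_right_mono order_refl)
      have "norm (\<kappa> - 2 * s * a * of_nat k) \<le> norm \<kappa> + norm (2 * s * a * of_nat k)" by (rule norm_triangle_ineq4)
      also have "\<dots> = norm \<kappa> + 2 * norm s * norm a * real k" by (simp add: norm_mult)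
      also have "\<dots> \<le> norm \<kappa> * ?n + 2 * norm s * norm a * ?n"
        by (intro add_mono mult_left_mono) (auto intro: mult_left_mono[of 1 ?n "norm \<kappa>", simplified])
      also have "\<dots> \<le> A * ?n" by (simp add: A_def algebra_simps)
      finally show "norm (\<kappa> - 2 * s * a * of_nat k) \<le> A * ?n" .
      have "norm (d + 1 - of_nat k) \<le> norm d + 1 + real k"
        using norm_triangle_ineq4[of "d + 1" "of_nat k"] norm_triangle_ineq[of d 1] by simp
      also have "\<dots> \<le> (norm d + 1) * ?n" by (simp add: algebra_simps)
      finally have "2 * norm s * norm (d + 1 - of_nat k) \<le> 2 * norm s * ((norm d + 1) * ?n)" by (intro mult_left_mono) auto
      also have "\<dots> \<le> A * ?n" by (simp add: A_def algebra_simps)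
      finally show "norm (2 * s * (d + 1 - of_nat k)) \<le> A * ?n" by (simp add: norm_mult)
    qed auto
    finally have "?n * norm (of_nat (Suc k) - K) * norm (?F (Suc k)) \<le>
        norm (S k) + A * ?n * norm (?F k) + A * ?n * norm (?F (k - 1))"
      by (simp add: norm_mult del: of_nat_Suc)
    moreover have "?n * (?n / 2) * norm (?F (Suc k)) \<le> ?n * norm (of_nat (Suc k) - K) * norm (?F (Suc k))"
      using nK by (intro mult_right_mono mult_left_mono) auto
    ultimately have "?n * (?n / 2) * norm (?F (Suc k)) \<le> norm (S k) + A * ?n * norm (?F k) + A * ?n * norm (?F (k - 1))"
      by linarith
    then have "r ^ Suc k * (?n * (?n / 2) * norm (?F (Suc k))) \<le>
        r ^ Suc k * (norm (S k) + A * ?n * norm (?F k) + A * ?n * norm (?F (k - 1)))"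
      using r by (intro mult_left_mono) auto
    also have "\<dots> = r * (norm (S k) * r ^ k) + A * ?n * r * u k + A * ?n * r\<^sup>2 * u (k - 1)"
    proof -
      have "r ^ Suc k = r\<^sup>2 * r ^ (k - 1)" using kp by (cases k) (auto simp: power2_eq_square)
      then have "r ^ Suc k * (A * ?n * norm (?F (k - 1))) = A * ?n * r\<^sup>2 * u (k - 1)" by (simp add: u_def mult_ac)
      then show ?thesis by (simp add: u_def algebra_simps)
    qed
    also have "\<dots> \<le> r * M1 + A * ?n * r * M + A * ?n * r\<^sup>2 * M"
      using M1[of k] M[of k] M[of "k - 1"] A r by (intro add_mono mult_left_mono) auto
    also have "\<dots> = r * M1 + ?n * (A * (r + r\<^sup>2)) * M" by (simp add: algebra_simps)
    also have "\<dots> \<le> ?n * ?n * (r * M1) + ?n * (?n / 4) * M"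
    proof -
      have "u 0 \<ge> 0" by (simp add: u_def)
      then have "M \<ge> 0" using M[of 0] by simp
      moreover have "A * (r + r\<^sup>2) \<le> ?n / 4"
      proof -
        have "z \<le> n / 4" if "4 * z + 2 * l + 2 \<le> n" "0 \<le> l" for n l z :: real using that by linarith
        then show ?thesis using kk norm_ge_zero[of K] by blast
      qed
      moreover have "1 * (r * M1) \<le> ?n * ?n * (r * M1)" using r M1nn by (intro mult_right_mono) (auto simp: field_simps)
      ultimately show ?thesis by (intro add_mono mult_right_mono mult_left_mono) auto
    qed
    finally have fin: "r ^ Suc k * (?n * (?n / 2) * norm (?F (Suc k))) \<le> ?n * ?n * (r * M1) + ?n * (?n / 4) * M" .
    have cancel: "x * P / 2 \<le> q + M / 4"
      if le: "P * (n * (n / 2) * x) \<le> n * n * q + n * (n / 4) * M" and n: "n > 0" for P n x q :: real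
    proof -
      have "(n * n) * (x * P / 2) \<le> (n * n) * (q + M / 4)" using le by (simp add: algebra_simps)
      then show ?thesis using n by (simp only: mult_le_cancel_left_pos mult_pos_pos)
    qed
    have "u (Suc k) / 2 \<le> r * M1 + M / 4" unfolding u_def by (rule cancel[OF fin]) simp
    then show ?thesis by (simp add: mult_ac)
  qed
  define M where "M = Max (u ` {..k0}) + 4 * M1 * r"
  have Mu: "u j \<le> M" if "j \<le> k0" for j
  proof -
    have "u j \<le> Max (u ` {..k0})" using that by (intro Max_ge) auto
    moreover have "0 \<le> 4 * M1 * r" using M1nn r by simp
    ultimately show ?thesis unfolding M_def by linarith
  qed
  have "Max (u ` {..k0}) \<ge> 0" 
  proof -
    have "0 \<le> u 0" using r by (simp add: u_def)
    also have "u 0 \<le> Max (u ` {..k0})" by (intro Max_ge) auto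
    finally show ?thesis .
  qed
  then have MM: "4 * M1 * r \<le> M" by (simp add: M_def)
  have "\<forall>j\<le>k. u j \<le> M" for k
  proof (induction k)
    case (Suc k)
    show ?case
    proof (cases "Suc k \<le> k0")
      case False
      have "u (Suc k) \<le> 2 * M1 * r + M / 2" using Suc False by (intro step) auto
      also have "\<dots> \<le> M" using MM by simp
      finally show ?thesis using Suc by (auto simp: le_Suc_eq)
    qed (use Mu in auto)
  qed (use Mu in auto)
  then show ?thesis unfolding u_def by blast
qed

lemma fps_conv_radius_infinity_iff_bound:
  "fps_conv_radius (F :: complex fps) = \<infinity> \<longleftrightarrow> (\<forall>r>0. \<exists>M. \<forall>k. norm (fps_nth F k) * r ^ k \<le> M)"
proof
  assume *: "fps_conv_radius F = \<infinity>"
  show "\<forall>r>0. \<exists>M. \<forall>k. norm (fps_nth F k) * r ^ k \<le> M"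
  proof (intro allI impI)
    fix r :: real assume r: "r > 0"
    have "summable (\<lambda>k. fps_nth F k * of_real r ^ k)"
      using * by (intro summable_fps) auto
    then have "Bseq (\<lambda>k. fps_nth F k * of_real r ^ k)"
      by (intro convergent_imp_Bseq) (auto dest: summable_LIMSEQ_zero simp: convergent_def)
    then obtain M where "\<forall>k. norm (fps_nth F k * of_real r ^ k) \<le> M" by (auto simp: Bseq_def)
    then show "\<exists>M. \<forall>k. norm (fps_nth F k) * r ^ k \<le> M" using r by (auto simp: norm_mult norm_power)
  qed
next
  assume *: "\<forall>r>0. \<exists>M. \<forall>k. norm (fps_nth F k) * r ^ k \<le> M"
  have "fps_conv_radius F \<ge> ereal r" if r: "r > 0" for r
  proof -
    obtain M where M: "\<And>k. norm (fps_nth F k) * (2 * r) ^ k \<le> M" using * r by (metis mult_pos_pos zero_less_numeral)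
    have "summable (\<lambda>k. fps_nth F k * of_real r ^ k)"
    proof (rule summable_comparison_test'[of "\<lambda>k. M * (1 / 2) ^ k" 0])
      show "summable (\<lambda>k. M * (1 / 2) ^ k)" by (intro summable_mult summable_geometric) auto
      fix k
      have "norm (fps_nth F k * of_real r ^ k) = norm (fps_nth F k) * (2 * r) ^ k * (1 / 2) ^ k"
        using r by (simp add: norm_mult norm_power power_mult_distrib power_divide)
      also have "\<dots> \<le> M * (1 / 2) ^ k" using M[of k] by (intro mult_right_mono) auto
      finally show "norm (fps_nth F k * of_real r ^ k) \<le> M * (1 / 2) ^ k" .
    qed
    then have "conv_radius (fps_nth F) \<ge> norm (of_real r :: complex)" by (rule conv_radius_geI)
    then show ?thesis using r by (simp add: fps_conv_radius_def)
  qed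
  then show "fps_conv_radius F = \<infinity>"
  proof -
    assume ge: "\<And>r. r > 0 \<Longrightarrow> ereal r \<le> fps_conv_radius F"
    show ?thesis
    proof (rule ereal_top)
      fix B :: real
      have "ereal B \<le> ereal (max B 1)" by simp
      also have "\<dots> \<le> fps_conv_radius F" by (rule ge) simp
      finally show "ereal B \<le> fps_conv_radius F" .
    qed
  qed
qed

lemma entire_eval_fps:
  assumes "fps_conv_radius (F :: complex fps) = \<infinity>"
  shows "eval_fps F holomorphic_on UNIV" "eval_fps F has_fps_expansion F"
  using assms by (auto intro!: holomorphic_on_eval_fps eval_fps_has_fps_expansion)

lemma frobenius_entire:
  assumes "fps_conv_radius S = \<infinity>"
  shows "fps_conv_radius (frobenius K s a d \<kappa> (fps_nth S)) = \<infinity>"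
  using frobenius_bound[of "fps_nth S"] assms unfolding fps_conv_radius_infinity_iff_bound by blast

lemma fps_ode_shift:
  assumes E: "fps_ode (- of_nat K) s a (d - of_nat K) (\<kappa> - 2 * s * a * of_nat K) E = 0"
  shows "fps_ode (of_nat K) s a d \<kappa> (fps_X ^ K * E) = 0"
proof (rule fps_ext)
  fix k
  have n: "fps_nth (fps_X ^ K * E) j = (if j < K then 0 else fps_nth E (j - K))" for j by (rule fps_X_power_mult_nth)
  consider "Suc k < K" | "Suc k = K" | "K \<le> k" by linarith
  then show "fps_nth (fps_ode (of_nat K) s a d \<kappa> (fps_X ^ K * E)) k = fps_nth 0 k"
  proof cases
    case le: 3
    then obtain j where 3: "k = K + j" using le_Suc_ex by blast
    have "fps_nth (fps_ode (- of_nat K) s a (d - of_nat K) (\<kappa> - 2 * s * a * of_nat K) E) j = 0" using E by simp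
    then show ?thesis unfolding fps_nth_fps_ode n 3 by (cases j) (auto simp: algebra_simps)
  qed (auto simp: fps_nth_fps_ode n)
qed

text \<open>
  A basis \<open>\<beta> = x^K E\<close>, \<open>A + c log x \<beta>\<close>. The last equation is what \<open>ode_op\<close> of the second function requires of \<open>A\<close> for
  any branch of the logarithm. The right-hand side begins with \<open>- c K x^(K - 1)\<close>, so that \<open>c\<close> can be chosen to satisfy the row at the resonance.
\<close>

lemma frobenius_solutions:
  assumes K: "K \<ge> 1"
  obtains E A c where "E holomorphic_on UNIV" "A holomorphic_on UNIV" "E 0 = 1" "A 0 = 1"
    "ode_solution UNIV (of_nat K) s a d \<kappa> (\<lambda>x. x ^ K * E x)"
    "\<And>x. x \<noteq> 0 \<Longrightarrow> ode_op (of_nat K) s a d \<kappa> A x =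
       - c * (2 * deriv (\<lambda>x. x ^ K * E x) x - of_nat K * (x ^ K * E x) / x - 2 * s * (x + a) * (x ^ K * E x))"
proof -
  define E where "E = frobenius (- of_nat K) s a (d - of_nat K) (\<kappa> - 2 * s * a * of_nat K) (fps_nth 0)"
  have Er: "fps_conv_radius E = \<infinity>" unfolding E_def by (rule frobenius_entire) simp
  have ne: "of_nat (Suc k) \<noteq> (- of_nat K :: complex)" for k
  proof
    assume "of_nat (Suc k) = (- of_nat K :: complex)"
    then have "of_nat (Suc k + K) = (0 :: complex)" unfolding of_nat_add by simp
    then show False by (simp only: of_nat_eq_0_iff)
  qed
  have Eode: "fps_ode (- of_nat K) s a (d - of_nat K) (\<kappa> - 2 * s * a * of_nat K) E = 0"
    unfolding E_def by (rule fps_ext) (use fps_ode_frobenius[OF ne] in simp)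
  obtain J where J: "K = Suc J" using K by (cases K) auto
  define B where "B = fps_X ^ K * E"
  have B: "fps_ode (of_nat K) s a d \<kappa> B = 0" unfolding B_def by (rule fps_ode_shift[OF Eode])
  define T where "T = 2 * fps_deriv B - of_nat K * (fps_X ^ J * E) - fps_const (2 * s) * (fps_X + fps_const a) * B"
  have E0: "fps_nth E 0 = 1" by (simp add: E_def)
  have Bk: "fps_nth B k = (if k < K then 0 else fps_nth E (k - K))" for k unfolding B_def by (rule fps_X_power_mult_nth)
  have T_nth: "fps_nth T k = 2 * (of_nat (Suc k) * fps_nth B (Suc k)) - of_nat K * (if k < J then 0 else fps_nth E (k - J))
      - 2 * s * ((if k = 0 then 0 else fps_nth B (k - 1)) + a * fps_nth B k)" for k
    unfolding T_def by (simp add: fps_X_power_mult_nth distrib_right distrib_left mult.assoc fps_numeral_fps_const flip: fps_of_nat)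
  have T_low: "fps_nth T k = 0" if "k < J" for k using that by (simp add: T_nth Bk J)
  have T_J: "fps_nth T J = of_nat K" by (simp add: T_nth Bk J E0)
  have Br: "fps_conv_radius B = \<infinity>"
    unfolding B_def using fps_conv_radius_mult[of "fps_X ^ K" E] Er by simp
  have Tr: "fps_conv_radius T = \<infinity>"
  proof -
    have 1: "fps_conv_radius (F * G) = \<infinity>" if "fps_conv_radius F = \<infinity>" "fps_conv_radius G = \<infinity>" for F G :: "complex fps"
      using fps_conv_radius_mult[of F G] that by simp
    have 2: "fps_conv_radius (F - G) = \<infinity>" if "fps_conv_radius F = \<infinity>" "fps_conv_radius G = \<infinity>" for F G :: "complex fps"
      using fps_conv_radius_diff[of F G] that by simp
    have 3: "fps_conv_radius (F + G) = \<infinity>" if "fps_conv_radius F = \<infinity>" "fps_conv_radius G = \<infinity>" for F G :: "complex fps"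
      using fps_conv_radius_add[of F G] that by simp
    have 4: "fps_conv_radius (fps_deriv F) = \<infinity>" if "fps_conv_radius F = \<infinity>" for F :: "complex fps"
      using fps_conv_radius_deriv[of F] that by simp
    have 5: "fps_conv_radius (of_nat k :: complex fps) = \<infinity>" for k by (simp flip: fps_of_nat)
    show ?thesis unfolding T_def by (intro 1 2 3 4 5 Br Er) auto
  qed
  define G where "G c = frobenius (of_nat K) s a d \<kappa> (fps_nth (fps_const (- c) * T))" for c
  have low: "fps_nth (G c) k = fps_nth (G 0) k" if "k \<le> J" for c k
    using that
  proof (induction k rule: less_induct)
    case (less k)
    show ?case
    proof (cases k)
      case 0 then show ?thesis by (simp add: G_def)
    next
      case (Suc j)
      have "Suc j \<noteq> K" using less.prems Suc J by simp
      then have e: "of_nat (Suc j) \<noteq> (of_nat K :: complex)" by (simp only: of_nat_eq_iff not_False_eq_True)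
      have "of_nat (Suc j) * (of_nat (Suc j) - of_nat K) * fps_nth (G c) (Suc j)
        = of_nat (Suc j) * (of_nat (Suc j) - of_nat K) * fps_nth (G 0) (Suc j)"
        unfolding G_def frobenius_Suc[OF e] unfolding G_def[symmetric]
        using less.IH[of j] less.IH[of "j - 1"] less.prems Suc T_low[of j] by simp
      then show ?thesis using e Suc by (simp del: of_nat_Suc)
    qed
  qed
  define c where "c = - fps_nth (fps_ode (of_nat K) s a d \<kappa> (G 0)) J / of_nat K"
  have Gode: "fps_ode (of_nat K) s a d \<kappa> (G c) = fps_const (- c) * T"
  proof (rule fps_ext)
    fix k
    show "fps_nth (fps_ode (of_nat K) s a d \<kappa> (G c)) k = fps_nth (fps_const (- c) * T) k"
    proof (cases "k = J")
      case False
      then have e: "of_nat (Suc k) \<noteq> (of_nat K :: complex)" using J by (metis Suc_inject of_nat_eq_iff)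
      show ?thesis unfolding G_def by (rule fps_ode_frobenius[OF e])
    next
      case True
      have z: "of_nat (Suc J) - of_nat K = (0 :: complex)" by (simp add: J)
      have "fps_nth (fps_ode (of_nat K) s a d \<kappa> (G c)) J = fps_nth (fps_ode (of_nat K) s a d \<kappa> (G 0)) J"
        unfolding fps_nth_fps_ode z using low[of J c] low[of "J - 1" c] by simp
      also have "\<dots> = - c * of_nat K" using K by (simp add: c_def)
      finally show ?thesis using True by (simp add: T_J)
    qed
  qed
  have Gr: "fps_conv_radius (G c) = \<infinity>" unfolding G_def
    using fps_conv_radius_mult[of "fps_const (- c)" T] Tr by (intro frobenius_entire) simp
  obtain e where e: "e holomorphic_on UNIV" "e has_fps_expansion E" using entire_eval_fps[OF Er] by blast
  obtain \<alpha> where \<alpha>: "\<alpha> holomorphic_on UNIV" "\<alpha> has_fps_expansion G c" using entire_eval_fps[OF Gr] by blast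
  define \<beta> where "\<beta> = (\<lambda>x. x ^ K * e x)"
  have \<beta>: "\<beta> holomorphic_on UNIV" "\<beta> has_fps_expansion B"
    unfolding \<beta>_def B_def by (intro holomorphic_intros e) (intro fps_expansion_intros e)
  have \<beta>_sol: "ode_solution UNIV (of_nat K) s a d \<kappa> \<beta>"
    using ode_solution_fps(2)[OF \<beta>, of UNIV] B by simp
  define L where "L = (\<lambda>x. ode_op (of_nat K) s a d \<kappa> \<alpha> x - (- c) * (2 * deriv \<beta> x - of_nat K * (x ^ J * e x) - 2 * s * (x + a) * \<beta> x))"
  have hL: "L holomorphic_on UNIV" unfolding L_def ode_op_def
    by (intro holomorphic_intros holomorphic_deriv \<alpha>(1) \<beta>(1) e(1) open_UNIV)
  have "L has_fps_expansion fps_ode (of_nat K) s a d \<kappa> (G c) - fps_const (- c) * T"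
    unfolding L_def ode_op_def fps_ode_def T_def fps_const_mult[symmetric] fps_of_nat[symmetric] fps_numeral_fps_const
    by (intro fps_expansion_intros \<alpha>(2) \<beta>(2) e(2))
  then have "L has_fps_expansion 0" by (simp add: Gode)
  then have "eventually (\<lambda>z. L z = 0) (nhds 0)" by (simp add: has_fps_expansion_0_iff)
  then obtain V where V: "open V" "0 \<in> V" "\<And>z. z \<in> V \<Longrightarrow> L z = 0" by (auto simp: eventually_nhds)
  have L0: "L x = 0" for x
    using analytic_continuation_open[where s = V and s' = UNIV and f = L and g = "\<lambda>_. 0"] V hL by auto
  have \<alpha>_eq: "ode_op (of_nat K) s a d \<kappa> \<alpha> x = - c * (2 * deriv \<beta> x - of_nat K * (x ^ K * e x) / x - 2 * s * (x + a) * (x ^ K * e x))"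
    if x: "x \<noteq> 0" for x
  proof -
    have "x ^ J * e x = x ^ K * e x / x" using x by (simp add: J)
    then show ?thesis using L0[of x] by (simp add: L_def \<beta>_def eq_neg_iff_add_eq_0)
  qed
  have "e 0 = 1" "\<alpha> 0 = 1"
    using has_fps_expansion_imp_0_eq_fps_nth_0[OF e(2)] has_fps_expansion_imp_0_eq_fps_nth_0[OF \<alpha>(2)] E0 by (simp_all add: G_def)
  then show ?thesis using that[OF e(1) \<alpha>(1)] \<beta>_sol \<alpha>_eq unfolding \<beta>_def by blast
qed

section \<open>Crossing the ray between two Stokes sectors\<close>

text \<open>
  Elementary geometry of the chord from \<open>r\<close> to \<open>u + i v\<close> on the circle of radius \<open>r\<close>, with argument between \<open>0\<close> and \<open>pi / 4\<close>: it
  stays away from the origin, and the quadratic form that governs \<open>Re g\<close> decreases along it.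
\<close>

lemma half_opening_chord:
  fixes u v r t :: real
  assumes uv: "0 \<le> v" "v \<le> u" "u\<^sup>2 + v\<^sup>2 = r\<^sup>2" and r: "r > 0" and t: "0 \<le> t" "t \<le> 1"
  shows "- (v * (r - 2 * t * (r - u))) \<le> - (r * norm (Complex (u - r) v) / 5)"
    and "r / 2 \<le> norm (Complex (r + t * (u - r)) (t * v))" and "norm (Complex (r + t * (u - r)) (t * v)) \<le> r"
    and "u \<le> r"
proof -
  have "u\<^sup>2 \<le> r\<^sup>2" using uv(3) zero_le_power2[of v] by linarith
  then show ur: "u \<le> r" by (rule power2_le_imp_le) (use r in simp)
  have u7: "u \<ge> 7 / 10 * r"
  proof (rule ccontr)
    assume "\<not> ?thesis"
    then have lt: "u < 7 / 10 * r" by simp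
    then have "u\<^sup>2 < (7 / 10 * r)\<^sup>2" using uv by (intro power_strict_mono) auto
    moreover have "v\<^sup>2 \<le> u\<^sup>2" using uv by (intro power_mono) auto
    moreover have "(7 / 10 * r)\<^sup>2 = 49 / 100 * r\<^sup>2" by (simp add: power2_eq_square)
    ultimately have "r\<^sup>2 < 98 / 100 * r\<^sup>2" using uv(3) by linarith
    then show False using r by simp
  qed
  have "(r - u) * (r + u) = v\<^sup>2" using uv(3) by (simp add: algebra_simps power2_eq_square)
  have ru: "r - u \<le> v"
  proof (rule ccontr)
    assume "\<not> r - u \<le> v"
    then have "v * (r + u) < (r - u) * (r + u)" using r uv by (intro mult_strict_right_mono) auto
    also have "\<dots> = v * v" using \<open>(r - u) * (r + u) = v\<^sup>2\<close> by (simp add: power2_eq_square)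
    finally have "v * (r + u) < v * v" .
    moreover have "v * v \<le> v * (r + u)" using uv r by (intro mult_left_mono) auto
    ultimately show False by simp
  qed
  have nd: "norm (Complex (u - r) v) \<le> 2 * v"
    using complex_norm_square[of "Complex (u - r) v"] cmod_le[of "Complex (u - r) v"] ru ur uv by simp
  have "t * (r - u) \<le> 1 * (r - u)" using t ur by (intro mult_right_mono) auto
  moreover have "7 * r \<le> 10 * u" using u7 by simp
  ultimately have tru: "10 * (t * (r - u)) \<le> 3 * r" by (simp add: algebra_simps)
  have e: "2 * t * (r - u) = 2 * (t * (r - u))" "t * (u - r) = - (t * (r - u))" by (simp_all add: algebra_simps)
  have ar: "r / 2 \<le> r + - x" "2 / 5 * r \<le> r - 2 * x" if "10 * x \<le> 3 * r" for x
    using that r by (simp_all add: field_simps)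
  have half: "r / 2 \<le> r + t * (u - r)" unfolding e by (rule ar(1)[OF tru])
  have "2 / 5 * r \<le> r - 2 * t * (r - u)" unfolding e by (rule ar(2)[OF tru])
  then have "v * (2 / 5 * r) \<le> v * (r - 2 * t * (r - u))" using uv by (intro mult_left_mono) auto
  moreover have "r * norm (Complex (u - r) v) / 5 \<le> r * (2 * v) / 5" using nd r by simp
  moreover have "v * (2 / 5 * r) = r * (2 * v) / 5" by simp
  ultimately show "- (v * (r - 2 * t * (r - u))) \<le> - (r * norm (Complex (u - r) v) / 5)" by linarith
  have "r + t * (u - r) \<le> norm (Complex (r + t * (u - r)) (t * v))"
    using complex_Re_le_cmod[of "Complex (r + t * (u - r)) (t * v)"] by simp
  then show "r / 2 \<le> norm (Complex (r + t * (u - r)) (t * v))" using half by linarith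
  have "Complex (r + t * (u - r)) (t * v) = of_real (1 - t) * of_real r + of_real t * Complex u v"
    by (simp add: complex_eq_iff algebra_simps)
  also have "norm \<dots> \<le> norm (of_real (1 - t) * of_real r :: complex) + norm (of_real t * Complex u v)" by (rule norm_triangle_ineq)
  also have "\<dots> = (1 - t) * r + t * r"
  proof -
    have "norm (Complex u v) = r" using uv(3) r by (simp add: complex_norm)
    moreover have "norm (of_real (1 - t) * of_real r :: complex) = (1 - t) * r" using t r by (simp only: norm_mult norm_of_real abs_of_nonneg diff_ge_0_iff_ge less_imp_le)
    ultimately show ?thesis using t by (simp add: norm_mult)
  qed
  finally show "norm (Complex (r + t * (u - r)) (t * v)) \<le> r" by (simp add: algebra_simps)
qed

text \<open>
  \<open>G\<close> is comparable to \<open>x^q\<close> on the closed sector between the ray through \<open>\<omega>\<close> and the one at angle \<open>pi / 4\<close> to it, whereas \<open>F\<close> is controlled on the first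
  ray only. The relation says that \<open>\<Theta> = F exp (- 2 \<sigma> g) / G\<close> has derivative \<open>- w x^(p + q + 1) exp (- 2 \<sigma> g) / G^2\<close>. Along the chord of
  \<open>half_opening_chord\<close> the exponential increases so fast that the integral of this derivative is a multiple of
  its value at the end point. Hence \<open>F\<close> is bounded by a multiple of \<open>x^p\<close> there as well.
\<close>

lemma crossing_bound:
  fixes \<sigma> \<tau> :: real and F G :: "complex \<Rightarrow> complex" and p q :: nat
  assumes \<sigma>: "\<sigma> * \<sigma> = 1" and \<tau>: "\<tau> * \<tau> = 1" and \<omega>: "norm \<omega> = 1" "\<omega>\<^sup>2 = \<i> * of_real (\<sigma> * \<tau>)"
    and U: "open U" and F: "F holomorphic_on U" and G: "G holomorphic_on U" and R0: "R0 > 0"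
    and S: "\<And>y. norm y \<ge> R0 \<Longrightarrow> 0 \<le> \<tau> * Im y \<Longrightarrow> \<tau> * Im y \<le> Re y \<Longrightarrow> \<omega> * y \<in> U"
    and rel: "\<And>x. x \<in> U \<Longrightarrow> F x * deriv G x - deriv F x * G x + 2 * of_real \<sigma> * (x + a) * F x * G x = w * x ^ (p + q + 1)"
    and Fb: "\<And>r. r \<ge> R0 \<Longrightarrow> norm (F (\<omega> * of_real r)) \<le> C1 * r ^ p"
    and Gb: "\<And>y. norm y \<ge> R0 \<Longrightarrow> 0 \<le> \<tau> * Im y \<Longrightarrow> \<tau> * Im y \<le> Re y \<Longrightarrow>
       c2 * norm y ^ q \<le> norm (G (\<omega> * y)) \<and> norm (G (\<omega> * y)) \<le> C2 * norm y ^ q"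
    and c: "c2 > 0" "C1 > 0" "C2 > 0"
  shows "\<exists>C R. R > 0 \<and> C > 0 \<and> (\<forall>y. norm y \<ge> R \<longrightarrow> 0 \<le> \<tau> * Im y \<longrightarrow> \<tau> * Im y \<le> Re y \<longrightarrow> norm (F (\<omega> * y)) \<le> C * norm y ^ p)"
proof -
  have \<tau>2: "\<tau>\<^sup>2 = 1" by (simp add: power2_eq_square \<tau>)
  define C where "C = C2 * C1 / c2 + C2 * (5 * (norm w * 4 ^ q / c2\<^sup>2)) + 1"
  define R where "R = max (2 * R0) (10 * norm a)"
  have "norm (F (\<omega> * y1)) \<le> C * norm y1 ^ p"
    if y1: "norm y1 \<ge> R" "0 \<le> \<tau> * Im y1" "\<tau> * Im y1 \<le> Re y1" for y1
  proof -
    define r u v where "r = norm y1" and "u = Re y1" and "v = \<tau> * Im y1"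
    have r: "r > 0" "r \<ge> 2 * R0" "r \<ge> 10 * norm a" using y1 R0 by (auto simp: R_def r_def)
    have Imv: "Im y1 = \<tau> * v" using \<tau> by (simp add: v_def flip: mult.assoc)
    have uv: "0 \<le> v" "v \<le> u" "u\<^sup>2 + v\<^sup>2 = r\<^sup>2"
    proof -
      show "0 \<le> v" "v \<le> u" using y1 by (simp_all add: u_def v_def)
      have "v\<^sup>2 = \<tau>\<^sup>2 * (Im y1)\<^sup>2" by (simp add: v_def power_mult_distrib)
      then show "u\<^sup>2 + v\<^sup>2 = r\<^sup>2" by (simp add: \<tau>2 u_def r_def cmod_power2)
    qed
    define d where "d = \<omega> * (y1 - of_real r)"
    define z where "z t = \<omega> * (of_real r + of_real t * (y1 - of_real r))" for t :: real
    have z_alt: "z t = \<omega> * of_real r + of_real t * d" for t by (simp add: z_def d_def algebra_simps)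
    define Y where "Y t = of_real r + of_real t * (y1 - of_real r)" for t :: real
    have zY: "z t = \<omega> * Y t" for t by (simp add: z_def Y_def)
    have ReY: "Re (Y t) = r + t * (u - r)" and ImY: "Im (Y t) = \<tau> * (t * v)" for t by (simp_all add: Y_def u_def Imv)
    have normY: "norm (Y t) = norm (Complex (r + t * (u - r)) (t * v))" for t
      by (simp add: cmod_def ReY ImY power_mult_distrib \<tau>2)
    have normd: "norm d = norm (Complex (u - r) v)"
      unfolding d_def norm_mult \<omega>(1) by (simp add: cmod_def u_def Imv power_mult_distrib \<tau>2)
    have sec: "norm (Y t) \<ge> R0" "norm (Y t) \<ge> r / 2" "norm (Y t) \<le> r" "0 \<le> \<tau> * Im (Y t)" "\<tau> * Im (Y t) \<le> Re (Y t)" if t: "0 \<le> t" "t \<le> 1" for t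
    proof -
      note h = half_opening_chord[OF uv r(1) t]
      show "norm (Y t) \<ge> r / 2" "norm (Y t) \<le> r" unfolding normY using h by auto
      then show "norm (Y t) \<ge> R0" using r by simp
      have tI: "\<tau> * Im (Y t) = t * v" using \<tau> by (simp add: ImY flip: mult.assoc)
      then show "0 \<le> \<tau> * Im (Y t)" using t uv by simp
      have "t * v \<le> t * u" using t uv by (intro mult_left_mono) auto
      also have "\<dots> \<le> t * u + (1 - t) * r" using t r by simp
      finally show "\<tau> * Im (Y t) \<le> Re (Y t)" unfolding tI ReY by (simp add: algebra_simps)
    qed
    have zU: "z t \<in> U" if "0 \<le> t" "t \<le> 1" for t unfolding zY using S sec[OF that] by blast
    have Glow: "norm (G (z t)) \<ge> c2 * (r / 2) ^ q" if "0 \<le> t" "t \<le> 1" for t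
    proof -
      have "c2 * (r / 2) ^ q \<le> c2 * norm (Y t) ^ q" using sec[OF that] c r by (intro mult_left_mono power_mono) auto
      also have "\<dots> \<le> norm (G (z t))" unfolding zY using Gb sec[OF that] by blast
      finally show ?thesis .
    qed
    have Gnz: "G (z t) \<noteq> 0" if "0 \<le> t" "t \<le> 1" for t
    proof -
      have "c2 * (r / 2) ^ q > 0" using c r by simp
      then show ?thesis using Glow[OF that] by auto
    qed
    define h where "h t = \<sigma> * Re (g (z t) a)" for t
    define h' where "h' t = \<sigma> * Re ((z t + a) * d)" for t
    have dz: "(z has_vector_derivative d) (at t)" for t
      unfolding z_alt[abs_def] by (auto intro!: derivative_eq_intros simp: has_vector_derivative_def scaleR_conv_of_real)
    have dh: "(h has_real_derivative h' t) (at t)" for t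
    proof -
      have "((\<lambda>x. g x a) has_field_derivative z t + a) (at (z t))" by (rule DERIV_g)
      from field_vector_diff_chain_at[OF dz this]
      have "((\<lambda>t. g (z t) a) has_vector_derivative d * (z t + a)) (at t)" by (simp add: o_def)
      then have "((\<lambda>t. Re (g (z t) a)) has_vector_derivative Re (d * (z t + a))) (at t)"
        by (rule bounded_linear.has_vector_derivative[OF bounded_linear_Re])
      then have "((\<lambda>t. Re (g (z t) a)) has_real_derivative Re (d * (z t + a))) (at t)"
        by (simp only: has_real_derivative_iff_has_vector_derivative)
      then have "((\<lambda>t. \<sigma> * Re (g (z t) a)) has_real_derivative \<sigma> * Re (d * (z t + a))) (at t)"
        by (rule DERIV_cmult)
      then show ?thesis unfolding h_def[abs_def] h'_def by (simp only: mult.commute[of d])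
    qed
    have h'_le: "h' t \<le> - (r * norm d / 10)" if t: "0 \<le> t" "t \<le> 1" for t
    proof -
      have "z t * d = \<i> * of_real (\<sigma> * \<tau>) * (Y t * (y1 - of_real r))"
        unfolding \<omega>(2)[symmetric] zY d_def by (simp add: power2_eq_square mult_ac)
      then have "\<sigma> * Re (z t * d) = - ((\<sigma> * \<sigma>) * \<tau> * Im (Y t * (y1 - of_real r)))" by simp
      also have "\<dots> = - (\<tau> * Im (Y t * (y1 - of_real r)))" by (simp add: \<sigma>)
      also have "Im (Y t * (y1 - of_real r)) = \<tau> * (v * (r - 2 * t * (r - u)))"
        by (simp add: ReY ImY Imv u_def[symmetric] algebra_simps)
      also have "- (\<tau> * (\<tau> * (v * (r - 2 * t * (r - u))))) = - (v * (r - 2 * t * (r - u)))"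
        using \<tau> by (simp flip: mult.assoc)
      finally have 1: "\<sigma> * Re (z t * d) \<le> - (r * norm d / 5)"
        using half_opening_chord(1)[OF uv r(1) t] by (simp add: normd)
      have "\<sigma> * Re (a * d) \<le> \<bar>\<sigma>\<bar> * norm (a * d)" using abs_Re_le_cmod[of "a * d"]
        by (metis abs_ge_self abs_mult abs_ge_zero mult_left_mono order_trans)
      also have "\<bar>\<sigma>\<bar> = 1" using \<sigma> by (metis abs_mult_self_eq abs_one abs_ge_zero mult.right_neutral power2_eq_1_iff power2_eq_square abs_minus_cancel)
      also have "1 * norm (a * d) \<le> r * norm d / 10" using r(3) mult_right_mono[of "10 * norm a" r "norm d"] by (simp add: norm_mult)
      finally show ?thesis using 1 unfolding h'_def by (simp add: distrib_right distrib_left)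
    qed
    (* the bound for \<open>w x^(p + q + 1) / G^2\<close> on the chord; \<open>\<Phi>\<close> below majorises \<open>\<Theta>\<close> because \<open>h' \<le> - r |d| / 10\<close> *)
    define B where "B = norm w * r ^ (p + q + 1) / (c2 * (r / 2) ^ q)\<^sup>2"
    have Bnn: "B \<ge> 0" using r by (simp add: B_def)
    define \<Theta> where "\<Theta> t = F (z t) * exp (- (2 * of_real \<sigma> * g (z t) a)) / G (z t)" for t
    define \<Theta>' where "\<Theta>' t = d * (- w * z t ^ (p + q + 1) * exp (- (2 * of_real \<sigma> * g (z t) a)) / (G (z t))\<^sup>2)" for t
    have normexp: "norm (exp (- (2 * of_real \<sigma> * g (z t) a))) = exp (- (2 * h t))" for t by (simp add: h_def)
    have d\<Theta>: "(\<Theta> has_vector_derivative \<Theta>' t) (at t)" if t: "0 \<le> t" "t \<le> 1" for t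
    proof -
      let ?x = "z t"
      have dF: "(F has_field_derivative deriv F ?x) (at ?x)" and dG: "(G has_field_derivative deriv G ?x) (at ?x)"
        using holomorphic_derivI[OF F U zU[OF t]] holomorphic_derivI[OF G U zU[OF t]] by auto
      have de: "((\<lambda>x. exp (- (2 * of_real \<sigma> * g x a))) has_field_derivative - (2 * of_real \<sigma> * (?x + a)) * exp (- (2 * of_real \<sigma> * g ?x a))) (at ?x)"
        by (auto intro!: derivative_eq_intros DERIV_g)
      let ?e = "exp (- (2 * of_real \<sigma> * g ?x a)) :: complex"
      have "((\<lambda>x. F x * exp (- (2 * of_real \<sigma> * g x a)) / G x) has_field_derivative
         ((deriv F ?x * ?e + - (2 * of_real \<sigma> * (?x + a)) * ?e * F ?x) * G ?x - F ?x * ?e * deriv G ?x) / (G ?x * G ?x)) (at ?x)"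
        by (intro DERIV_divide DERIV_mult dF dG de Gnz[OF t])
      also have "(deriv F ?x * ?e + - (2 * of_real \<sigma> * (?x + a)) * ?e * F ?x) * G ?x - F ?x * ?e * deriv G ?x
        = - (F ?x * deriv G ?x - deriv F ?x * G ?x + 2 * of_real \<sigma> * (?x + a) * F ?x * G ?x) * ?e" by (simp add: algebra_simps)
      also have "\<dots> = - w * ?x ^ (p + q + 1) * ?e" unfolding rel[OF zU[OF t]] by simp
      finally have "((\<lambda>x. F x * exp (- (2 * of_real \<sigma> * g x a)) / G x) has_field_derivative
         - w * ?x ^ (p + q + 1) * ?e / (G ?x)\<^sup>2) (at ?x)" by (simp add: power2_eq_square)
      from field_vector_diff_chain_at[OF dz this] show ?thesis unfolding \<Theta>_def[abs_def] \<Theta>'_def by (simp only: o_def)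
    qed
    define \<Phi> where "\<Phi> t = 5 * B / r * exp (- (2 * h t))" for t
    define \<Phi>' where "\<Phi>' t = 5 * B / r * (- (2 * h' t) * exp (- (2 * h t)))" for t
    have d\<Phi>: "(\<Phi> has_vector_derivative \<Phi>' t) (at t)" for t
      unfolding has_real_derivative_iff_has_vector_derivative[symmetric] \<Phi>_def[abs_def] \<Phi>'_def
      using r by (auto intro!: derivative_eq_intros dh)
    have le: "norm (\<Theta>' t) \<le> \<Phi>' t" if t: "0 < t" "t < 1" for t
    proof -
      have t': "0 \<le> t" "t \<le> 1" using t by auto
      have "norm (\<Theta>' t) = norm d * exp (- (2 * h t)) * (norm w * norm (Y t) ^ (p + q + 1) / (norm (G (z t)))\<^sup>2)"
      proof -
        have nz: "norm (z t) = norm (Y t)" by (simp add: zY norm_mult \<omega>(1))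
        show ?thesis unfolding \<Theta>'_def norm_mult norm_divide norm_power norm_minus_cancel normexp nz by (simp add: mult_ac)
      qed
      also have "norm w * norm (Y t) ^ (p + q + 1) / (norm (G (z t)))\<^sup>2 \<le> B"
        unfolding B_def using sec[OF t'] Glow[OF t'] c r by (intro frac_le mult_left_mono power_mono zero_less_power) auto
      then have "norm d * exp (- (2 * h t)) * (norm w * norm (Y t) ^ (p + q + 1) / (norm (G (z t)))\<^sup>2) \<le> norm d * exp (- (2 * h t)) * B"
        by (intro mult_left_mono) auto
      also have "\<dots> = 5 * B / r * ((2 * (r * norm d / 10)) * exp (- (2 * h t)))" using r by simp
      also have "\<dots> \<le> \<Phi>' t" unfolding \<Phi>'_def
        using h'_le[OF t'] r Bnn by (intro mult_left_mono mult_right_mono) auto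
      finally show ?thesis .
    qed
    have h'_np: "h' t \<le> 0" if "0 \<le> t" "t \<le> 1" for t
    proof -
      have "0 \<le> r * norm d / 10" using r by simp
      then show ?thesis using h'_le[OF that] by linarith
    qed
    have hmono: "h 1 \<le> h 0"
      by (rule DERIV_nonpos_imp_nonincreasing[of 0 1 h]) (use dh h'_np in auto)
    have "norm (\<Theta> 1 - \<Theta> 0) \<le> \<Phi> 1 - \<Phi> 0"
    proof (rule differentiable_bound_general[of 0 1 \<Theta> \<Phi> \<Theta>' \<Phi>'])
      show "continuous_on {0..1} \<Theta>"
        using d\<Theta> by (intro continuous_at_imp_continuous_on ballI) (auto intro: has_vector_derivative_continuous)
      show "continuous_on {0..1} \<Phi>"
        using d\<Phi> by (intro continuous_at_imp_continuous_on ballI) (auto intro: has_vector_derivative_continuous)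
    qed (use d\<Theta> d\<Phi> le in auto)
    moreover have "\<Phi> 0 \<ge> 0" using Bnn r by (simp add: \<Phi>_def)
    ultimately have "norm (\<Theta> 1) \<le> norm (\<Theta> 0) + \<Phi> 1"
      using norm_triangle_ineq2[of "\<Theta> 1" "\<Theta> 0"] by linarith
    also have "norm (\<Theta> 0) \<le> C1 * r ^ p / (c2 * r ^ q) * exp (- (2 * h 1))"
    proof -
      have z0: "z 0 = \<omega> * of_real r" by (simp add: z_def)
      have "norm (F (z 0)) \<le> C1 * r ^ p" unfolding z0 by (rule Fb) (use r R0 in auto)
      moreover have "c2 * r ^ q \<le> norm (G (z 0))" using Gb[of "of_real r"] r R0 by (simp add: z0)
      moreover have "exp (- (2 * h 0)) \<le> exp (- (2 * h 1))" using hmono by simp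
      ultimately have "norm (F (z 0)) / norm (G (z 0)) * exp (- (2 * h 0)) \<le> C1 * r ^ p / (c2 * r ^ q) * exp (- (2 * h 1))"
        using c r by (intro mult_mono frac_le) auto
      then show ?thesis unfolding \<Theta>_def norm_mult norm_divide normexp by (simp add: mult_ac)
    qed
    also have "C1 * r ^ p / (c2 * r ^ q) * exp (- (2 * h 1)) + \<Phi> 1 = (C1 * r ^ p / (c2 * r ^ q) + 5 * B / r) * exp (- (2 * h 1))"
      by (simp add: \<Phi>_def distrib_right)
    finally have T1: "norm (\<Theta> 1) \<le> (C1 * r ^ p / (c2 * r ^ q) + 5 * B / r) * exp (- (2 * h 1))" by simp
    have z1: "z 1 = \<omega> * y1" by (simp add: z_def)
    have "norm (\<Theta> 1) = norm (F (z 1)) * exp (- (2 * h 1)) / norm (G (z 1))"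
      unfolding \<Theta>_def norm_mult norm_divide normexp ..
    then have "norm (F (z 1)) = norm (\<Theta> 1) * exp (2 * h 1) * norm (G (z 1))"
      using Gnz[of 1] by (simp add: exp_minus)
    also have "\<dots> \<le> (C1 * r ^ p / (c2 * r ^ q) + 5 * B / r) * exp (- (2 * h 1)) * exp (2 * h 1) * (C2 * r ^ q)"
    proof -
      have "0 \<le> (C1 * r ^ p / (c2 * r ^ q) + 5 * B / r) * exp (- (2 * h 1))" using T1 norm_ge_zero order.trans by blast
      moreover have "norm (G (z 1)) \<le> C2 * r ^ q" unfolding z1 r_def using Gb[of y1] y1 R0 by (auto simp: R_def)
      ultimately show ?thesis by (intro mult_mono[OF mult_right_mono[OF T1]]) (simp_all only: norm_ge_zero exp_ge_zero mult_nonneg_nonneg)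
    qed
    also have "\<dots> = (C1 * r ^ p / (c2 * r ^ q) + 5 * B / r) * (C2 * r ^ q)"
      by (simp add: exp_minus)
    also have "\<dots> = (C - 1) * r ^ p"
    proof -
      have four: "(4::real) ^ q = 2 ^ q * 2 ^ q" by (simp flip: power_mult_distrib)
      have e1: "(c2 * (r / 2) ^ q)\<^sup>2 = c2\<^sup>2 * (r ^ q * r ^ q) / 4 ^ q"
        unfolding four by (simp add: power_divide power2_eq_square)
      have e2: "r ^ (p + q + 1) = r ^ p * r ^ q * r" by (simp add: power_add)
      have e3: "5 * B / r * (C2 * r ^ q) = C2 * (5 * (norm w * 4 ^ q / c2\<^sup>2)) * r ^ p"
        unfolding B_def e1 e2 using c r by (simp add: field_simps)
      have e4: "C1 * r ^ p / (c2 * r ^ q) * (C2 * r ^ q) = C2 * C1 / c2 * r ^ p" using c r by simp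
      show ?thesis unfolding distrib_right e3 e4 C_def by (simp add: distrib_right)
    qed
    also have "\<dots> \<le> C * r ^ p" using r by (simp add: algebra_simps)
    finally show ?thesis by (simp add: z1 r_def)
  qed
  moreover have "C > 0" unfolding C_def using c by (intro add_nonneg_pos add_nonneg_nonneg) auto
  moreover have "R > 0" using R0 by (simp add: R_def)
  ultimately show ?thesis by blast
qed

text \<open>
  The direction between the sectors \<open>k\<close> and \<open>k + 1\<close>, on which \<open>exp g\<close> oscillates.
\<close>

definition crossing_ray :: "nat \<Rightarrow> complex" where
  "crossing_ray k = cis (of_nat k * pi / 2 + pi / 4)"

lemma norm_crossing_ray [simp]: "norm (crossing_ray k) = 1" by (simp add: crossing_ray_def)

lemma crossing_ray_nz [simp]: "crossing_ray k \<noteq> 0" using norm_crossing_ray[of k] by (metis norm_zero zero_neq_one)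

lemma crossing_ray_square: "(crossing_ray k)\<^sup>2 = \<i> * of_real ((-1) ^ k)"
proof -
  have "(crossing_ray k)\<^sup>2 = cis (of_nat k * pi + pi / 2)"
    unfolding crossing_ray_def Complex.DeMoivre by (rule arg_cong[of _ _ cis]) (simp add: field_simps)
  also have "\<dots> = cis (of_nat k * pi) * cis (pi / 2)" by (simp only: cis_mult)
  also have "cis (of_nat k * pi) = cis pi ^ k" by (simp only: Complex.DeMoivre)
  finally show ?thesis by simp
qed

lemma crossing_ray_sector:
  "crossing_ray k * y \<in> stokes_sector k \<longleftrightarrow> Im y < 0 \<and> Re y > 0"
  "crossing_ray k * y \<in> stokes_sector (Suc k) \<longleftrightarrow> Im y > 0 \<and> Re y > 0"
proof -
  let ?c = "sqrt 2 / 2 :: real"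
  have c: "?c > 0" by simp
  have s: "\<bar>?c * A\<bar> < ?c * B \<longleftrightarrow> \<bar>A\<bar> < B" for A B :: real
    unfolding abs_mult using c by (simp add: mult_less_cancel_left_pos)
  have 1: "cis (- (of_nat k * pi / 2)) * (crossing_ray k * y) = cis (pi / 4) * y"
    unfolding crossing_ray_def mult.assoc[symmetric] cis_mult by simp
  have R1: "Re (cis (pi / 4) * y) = ?c * (Re y - Im y)" "Im (cis (pi / 4) * y) = ?c * (Re y + Im y)"
    by (simp_all add: cos_45 sin_45 algebra_simps)
  have 2: "cis (- (of_nat (Suc k) * pi / 2)) * (crossing_ray k * y) = cis (- (pi / 4)) * y"
    unfolding crossing_ray_def mult.assoc[symmetric] cis_mult
    by (rule arg_cong[of _ _ "\<lambda>t. cis t * y"]) (simp add: field_simps)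
  have R2: "Re (cis (- (pi / 4)) * y) = ?c * (Re y + Im y)" "Im (cis (- (pi / 4)) * y) = ?c * (Im y - Re y)"
    by (simp_all add: cos_45 sin_45 algebra_simps)
  show "crossing_ray k * y \<in> stokes_sector k \<longleftrightarrow> Im y < 0 \<and> Re y > 0"
    unfolding stokes_sector_iff 1 R1 s by linarith
  show "crossing_ray k * y \<in> stokes_sector (Suc k) \<longleftrightarrow> Im y > 0 \<and> Re y > 0"
    unfolding stokes_sector_iff 2 R2 s by linarith
qed

text \<open>
  The sectors are open, but the estimate extends to the boundary ray by continuity, since \<open>f\<close> is defined across it.
\<close>

lemma asymptotic_on_closed_side:
  fixes \<tau> :: real
  assumes as: "asymptotic_on S f p c" and \<tau>: "\<tau> * \<tau> = 1" and \<omega>: "norm \<omega> = 1"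
    and S: "\<And>y. \<tau> * Im y > 0 \<Longrightarrow> Re y > 0 \<Longrightarrow> \<omega> * y \<in> S"
    and U: "open U" "f holomorphic_on U" and R0: "R0 > 0" and cone: "\<And>y. norm y \<ge> R0 \<Longrightarrow> \<bar>Im y\<bar> \<le> Re y \<Longrightarrow> \<omega> * y \<in> U"
  shows "\<exists>C R. C > 0 \<and> R \<ge> R0 \<and> (\<forall>y. norm y \<ge> R \<longrightarrow> 0 \<le> \<tau> * Im y \<longrightarrow> \<tau> * Im y \<le> Re y \<longrightarrow>
     norm (f (\<omega> * y) / (\<omega> * y) ^ p - c) \<le> C / norm y)"
proof -
  obtain C R where CR: "C > 0" "R > 0" "\<And>x. x \<in> S \<Longrightarrow> norm x \<ge> R \<Longrightarrow> norm (f x / x ^ p - c) \<le> C / norm x"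
    using as unfolding asymptotic_on_def by blast
  have ab: "\<bar>\<tau>\<bar> = 1" using \<tau> by (metis abs_mult_self_eq abs_ge_zero abs_one mult.right_neutral power2_eq_square power2_eq_iff_nonneg zero_le_one one_power2)
  have "norm (f (\<omega> * y) / (\<omega> * y) ^ p - c) \<le> C / norm y"
    if y: "norm y \<ge> max R R0" "0 \<le> \<tau> * Im y" "\<tau> * Im y \<le> Re y" for y
  proof (cases "\<tau> * Im y = 0")
    case False
    then have "\<tau> * Im y > 0" using y by linarith
    moreover from this have "Re y > 0" using y by linarith
    ultimately have "\<omega> * y \<in> S" by (rule S)
    then show ?thesis using CR(3)[of "\<omega> * y"] y \<omega> by (simp add: norm_mult)
  next
    case True
    then have Im0: "Im y = 0" using \<tau> by auto
    define r where "r = Re y"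
    have yr: "y = of_real r" by (simp add: r_def complex_eq_iff Im0)
    have r: "r > 0" using y R0 by (auto simp: yr)
    define Y where "Y n = y * (1 + \<i> * of_real (\<tau> / real (Suc n)))" for n
    have Y: "Y \<longlonglongrightarrow> y"
    proof -
      have "(\<lambda>n. \<tau> / real (Suc n)) \<longlonglongrightarrow> 0" by (rule LIMSEQ_Suc[OF lim_const_over_n])
      then have "(\<lambda>n. y * (1 + \<i> * of_real (\<tau> / real (Suc n)))) \<longlonglongrightarrow> y * (1 + \<i> * of_real 0)"
        by (intro tendsto_intros)
      then show ?thesis by (simp add: Y_def[abs_def])
    qed
    have "\<bar>Im y\<bar> \<le> Re y" using r by (simp add: yr)
    then have yU: "\<omega> * y \<in> U" using cone y by simp
    have nz: "\<omega> * y \<noteq> 0" using r \<omega> by (auto simp: yr)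
    have "isCont f (\<omega> * y)"
      using U yU holomorphic_on_imp_continuous_on continuous_on_eq_continuous_at by blast
    moreover have "(\<lambda>n. \<omega> * Y n) \<longlonglongrightarrow> \<omega> * y" by (intro tendsto_intros Y)
    ultimately have "(\<lambda>n. f (\<omega> * Y n)) \<longlonglongrightarrow> f (\<omega> * y)" by (rule isCont_tendsto_compose)
    then have "(\<lambda>n. norm (f (\<omega> * Y n) / (\<omega> * Y n) ^ p - c)) \<longlonglongrightarrow> norm (f (\<omega> * y) / (\<omega> * y) ^ p - c)"
      using nz by (intro tendsto_intros Y) auto
    moreover have "norm (f (\<omega> * Y n) / (\<omega> * Y n) ^ p - c) \<le> C / norm y" for n
    proof -
      have ReY: "Re (Y n) = r" and ImY: "Im (Y n) = r * (\<tau> / real (Suc n))" by (simp_all add: Y_def yr)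
      have "\<tau> * Im (Y n) = r / real (Suc n) * (\<tau> * \<tau>)" by (simp add: ImY)
      then have "\<tau> * Im (Y n) > 0" using r \<tau> by simp
      then have YS: "\<omega> * Y n \<in> S" using S ReY r by simp
      have nY: "norm y \<le> norm (Y n)" using complex_Re_le_cmod[of "Y n"] r by (simp add: ReY yr)
      have "norm (f (\<omega> * Y n) / (\<omega> * Y n) ^ p - c) \<le> C / norm (\<omega> * Y n)"
        using nY y \<omega> by (intro CR(3) YS) (simp add: norm_mult)
      also have "\<dots> \<le> C / norm y" using nY CR r \<omega> by (intro divide_left_mono mult_pos_pos) (auto simp: norm_mult yr)
      finally show ?thesis .
    qed
    ultimately show ?thesis by (intro LIMSEQ_le_const2) auto
  qed
  then show ?thesis using CR(1) by (intro exI[of _ C] exI[of _ "max R R0"]) auto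
qed

lemma asymptotic_two_sided_bound:
  fixes z c :: complex
  assumes "norm (F / z ^ p - c) \<le> C / norm z" "norm z \<ge> 2 * C / norm c" "c \<noteq> 0" "C > 0" "z \<noteq> 0"
  shows "norm c / 2 * norm z ^ p \<le> norm F \<and> norm F \<le> 2 * norm c * norm z ^ p"
proof -
  have "C / norm z \<le> norm c / 2" using assms by (simp add: field_simps)
  then have "norm (F / z ^ p - c) \<le> norm c / 2" using assms(1) by linarith
  then have "norm c / 2 \<le> norm (F / z ^ p)" "norm (F / z ^ p) \<le> 2 * norm c"
    using norm_triangle_ineq2[of c "F / z ^ p"] norm_triangle_ineq2[of "F / z ^ p" c] norm_minus_commute[of c "F / z ^ p"] norm_ge_zero[of c]
    by linarith+
  then show ?thesis using assms(5) by (simp add: norm_divide norm_power field_simps)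
qed

text \<open>
  Growth in the cone of opening \<open>pi / 2\<close> around the crossing ray; the four cones cover the plane.
\<close>

definition cone_bound :: "(complex \<Rightarrow> complex) \<Rightarrow> nat \<Rightarrow> nat \<Rightarrow> bool" where
  "cone_bound F k p \<longleftrightarrow> (\<exists>C R. C > 0 \<and> R > 0 \<and>
     (\<forall>y. norm y \<ge> R \<longrightarrow> \<bar>Im y\<bar> \<le> Re y \<longrightarrow> norm (F (crossing_ray k * y)) \<le> C * norm y ^ p))"

text \<open>
  \<open>F\<close> has the asymptotics of its gauge in the even sector and \<open>G\<close> in the odd one. On their own sides they are bounded by
  definition and on the other side by \<open>crossing_bound\<close>, applied once to each of them. By Cauchy's estimate the terms \<open>F G' - F' G\<close> are then of order
  \<open>x^(p + q - 1)\<close>, so that \<open>2 (x + a) F G\<close> alone gives the limit \<open>w\<close> on the ray.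
\<close>

lemma crossing:
  assumes U: "open U" and F: "F holomorphic_on U" and G: "G holomorphic_on U" and R0: "R0 > 0"
    and cone: "\<And>y. norm y \<ge> R0 \<Longrightarrow> \<bar>Im y\<bar> \<le> Re y \<Longrightarrow> crossing_ray k * y \<in> U"
    and rel: "\<And>x. x \<in> U \<Longrightarrow> F x * deriv G x - deriv F x * G x + 2 * (x + a) * F x * G x = w * x ^ (p + q + 1)"
    and asF: "asymptotic_on (stokes_sector (if even k then k else Suc k)) F p cF"
    and asG: "asymptotic_on (stokes_sector (if even k then Suc k else k)) G q cG"
    and c: "cF \<noteq> 0" "cG \<noteq> 0"
  shows "w = 2 * cF * cG"
    and "cone_bound F k p" and "cone_bound G k q"
proof -
  let ?\<omega> = "crossing_ray k"
  define \<tau> :: real where "\<tau> = (-1) ^ k"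
  have \<tau>: "\<tau> * \<tau> = 1" "- \<tau> * - \<tau> = 1" unfolding \<tau>_def by (simp_all flip: power_mult_distrib)
  have \<tau>': "\<tau> = 1 \<or> \<tau> = -1" by (cases "even k") (simp_all add: \<tau>_def)
  have \<omega>: "norm ?\<omega> = 1" by simp
  have SF: "?\<omega> * y \<in> stokes_sector (if even k then k else Suc k)" if "- \<tau> * Im y > 0" "Re y > 0" for y
    using that crossing_ray_sector[of k y] by (cases "even k") (auto simp: \<tau>_def)
  have SG: "?\<omega> * y \<in> stokes_sector (if even k then Suc k else k)" if "\<tau> * Im y > 0" "Re y > 0" for y
    using that crossing_ray_sector[of k y] by (cases "even k") (auto simp: \<tau>_def)
  obtain CF RF where F1: "CF > 0" "RF \<ge> R0" "\<And>y. norm y \<ge> RF \<Longrightarrow> 0 \<le> - \<tau> * Im y \<Longrightarrow> - \<tau> * Im y \<le> Re y \<Longrightarrow>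
     norm (F (?\<omega> * y) / (?\<omega> * y) ^ p - cF) \<le> CF / norm y"
    using asymptotic_on_closed_side[OF asF \<tau>(2) \<omega> SF U F R0 cone] by blast
  obtain CG RG where G1: "CG > 0" "RG \<ge> R0" "\<And>y. norm y \<ge> RG \<Longrightarrow> 0 \<le> \<tau> * Im y \<Longrightarrow> \<tau> * Im y \<le> Re y \<Longrightarrow>
     norm (G (?\<omega> * y) / (?\<omega> * y) ^ q - cG) \<le> CG / norm y"
    using asymptotic_on_closed_side[OF asG \<tau>(1) \<omega> SG U G R0 cone] by blast
  define R1 where "R1 = max (max RF RG) (max (2 * CF / norm cF) (2 * CG / norm cG))"
  have R1: "R1 > 0" "R1 \<ge> R0" "R1 \<ge> RF" "R1 \<ge> RG" "2 * CF / norm cF \<le> R1" "2 * CG / norm cG \<le> R1"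
    using F1 G1 R0 by (auto simp: R1_def)
  have nz: "?\<omega> * y \<noteq> 0" "norm (?\<omega> * y) = norm y" if "norm y \<ge> R1" for y using that R1(1) by (auto simp: norm_mult)
  have F2: "norm cF / 2 * norm y ^ p \<le> norm (F (?\<omega> * y)) \<and> norm (F (?\<omega> * y)) \<le> 2 * norm cF * norm y ^ p"
    if "norm y \<ge> R1" "0 \<le> - \<tau> * Im y" "- \<tau> * Im y \<le> Re y" for y
  proof -
    have "norm (F (?\<omega> * y) / (?\<omega> * y) ^ p - cF) \<le> CF / norm y" using that R1 by (intro F1(3)) auto
    then show ?thesis using asymptotic_two_sided_bound[of "F (?\<omega> * y)" "?\<omega> * y" p cF CF] F1(1) that R1 c nz[OF that(1)]
      by auto
  qed
  have G2: "norm cG / 2 * norm y ^ q \<le> norm (G (?\<omega> * y)) \<and> norm (G (?\<omega> * y)) \<le> 2 * norm cG * norm y ^ q"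
    if "norm y \<ge> R1" "0 \<le> \<tau> * Im y" "\<tau> * Im y \<le> Re y" for y
  proof -
    have "norm (G (?\<omega> * y) / (?\<omega> * y) ^ q - cG) \<le> CG / norm y" using that R1 by (intro G1(3)) auto
    then show ?thesis using asymptotic_two_sided_bound[of "G (?\<omega> * y)" "?\<omega> * y" q cG CG] G1(1) that R1 c nz[OF that(1)]
      by auto
  qed
  have SU: "?\<omega> * y \<in> U" if "norm y \<ge> R1" "0 \<le> t * Im y" "t * Im y \<le> Re y" "t = \<tau> \<or> t = - \<tau>" for y and t :: real
    using cone[of y] that R1 \<tau>' by auto
  have "\<exists>C R. R > 0 \<and> C > 0 \<and> (\<forall>y. norm y \<ge> R \<longrightarrow> 0 \<le> \<tau> * Im y \<longrightarrow> \<tau> * Im y \<le> Re y \<longrightarrow> norm (F (?\<omega> * y)) \<le> C * norm y ^ p)"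
  proof (rule crossing_bound[where \<sigma> = 1 and w = w and a = a and ?C1.0 = "2 * norm cF" and ?c2.0 = "norm cG / 2" and ?C2.0 = "2 * norm cG" and ?R0.0 = R1 and U = U and q = q and G = G])
    show "?\<omega>\<^sup>2 = \<i> * of_real (1 * \<tau>)" by (simp add: crossing_ray_square \<tau>_def)
    show "?\<omega> * y \<in> U" if "norm y \<ge> R1" "0 \<le> \<tau> * Im y" "\<tau> * Im y \<le> Re y" for y by (rule SU[OF that]) simp
    show "F x * deriv G x - deriv F x * G x + 2 * of_real 1 * (x + a) * F x * G x = w * x ^ (p + q + 1)" if "x \<in> U" for x
      using rel[OF that] by simp
    show "norm (F (?\<omega> * of_real r)) \<le> 2 * norm cF * r ^ p" if "r \<ge> R1" for r using F2[of "of_real r"] that R1 by simp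
  qed (use \<tau> U F G R1 G2 c in auto)
  then obtain C3 R3 where F3: "R3 > 0" "C3 > 0" "\<And>y. norm y \<ge> R3 \<Longrightarrow> 0 \<le> \<tau> * Im y \<Longrightarrow> \<tau> * Im y \<le> Re y \<Longrightarrow> norm (F (?\<omega> * y)) \<le> C3 * norm y ^ p"
    by blast
  have "\<exists>C R. R > 0 \<and> C > 0 \<and> (\<forall>y. norm y \<ge> R \<longrightarrow> 0 \<le> - \<tau> * Im y \<longrightarrow> - \<tau> * Im y \<le> Re y \<longrightarrow> norm (G (?\<omega> * y)) \<le> C * norm y ^ q)"
  proof (rule crossing_bound[where \<sigma> = "-1" and w = "- w" and a = a and ?C1.0 = "2 * norm cG" and ?c2.0 = "norm cF / 2" and ?C2.0 = "2 * norm cF" and ?R0.0 = R1 and U = U and q = p and G = F])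
    show "?\<omega>\<^sup>2 = \<i> * of_real (-1 * - \<tau>)" by (simp add: crossing_ray_square \<tau>_def)
    show "?\<omega> * y \<in> U" if "norm y \<ge> R1" "0 \<le> - \<tau> * Im y" "- \<tau> * Im y \<le> Re y" for y by (rule SU[OF that]) simp
    show "G x * deriv F x - deriv G x * F x + 2 * of_real (-1) * (x + a) * G x * F x = - w * x ^ (q + p + 1)" if "x \<in> U" for x
    proof -
      have "G x * deriv F x - deriv G x * F x + 2 * of_real (-1) * (x + a) * G x * F x
        = - (F x * deriv G x - deriv F x * G x + 2 * (x + a) * F x * G x)" by (simp add: algebra_simps)
      then show ?thesis unfolding rel[OF that] by (simp add: add.commute)
    qed
    show "norm (G (?\<omega> * of_real r)) \<le> 2 * norm cG * r ^ q" if "r \<ge> R1" for r using G2[of "of_real r"] that R1 by simp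
  qed (use \<tau> U F G R1 F2 c in auto)
  then obtain C4 R4 where G4: "R4 > 0" "C4 > 0" "\<And>y. norm y \<ge> R4 \<Longrightarrow> 0 \<le> - \<tau> * Im y \<Longrightarrow> - \<tau> * Im y \<le> Re y \<Longrightarrow> norm (G (?\<omega> * y)) \<le> C4 * norm y ^ q"
    by blast
  define C where "C = max (max C3 C4) (max (2 * norm cF) (2 * norm cG))"
  define R where "R = max (max R3 R4) R1"
  have C: "C > 0" "C \<ge> C3" "C \<ge> C4" "C \<ge> 2 * norm cF" "C \<ge> 2 * norm cG" using F3 by (auto simp: C_def)
  have R: "R > 0" "R \<ge> R3" "R \<ge> R4" "R \<ge> R1" using F3 by (auto simp: R_def)
  have bnd: "norm (F (?\<omega> * y)) \<le> C * norm y ^ p \<and> norm (G (?\<omega> * y)) \<le> C * norm y ^ q"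
    if y: "norm y \<ge> R" "\<bar>Im y\<bar> \<le> Re y" for y
  proof -
    have m: "C' * norm y ^ j \<le> C * norm y ^ j" if "C' \<le> C" for C' j using that by (intro mult_right_mono) auto
    consider "0 \<le> \<tau> * Im y" "\<tau> * Im y \<le> Re y" | "0 \<le> - \<tau> * Im y" "- \<tau> * Im y \<le> Re y"
      using y(2) \<tau>' by (auto simp: abs_if split: if_splits)
    then show ?thesis
    proof cases
      case 1
      then show ?thesis using F3(3)[of y] G2[of y] y R m[OF C(2), of p] m[OF C(5), of q] by auto
    next
      case 2
      then show ?thesis using G4(3)[of y] F2[of y] y R m[OF C(3), of q] m[OF C(4), of p] by auto
    qed
  qed
  then show "cone_bound F k p" "cone_bound G k q" unfolding cone_bound_def using C(1) R(1) by blast+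
  let ?x = "\<lambda>r. ?\<omega> * of_real r"
  define M where "M = 2 * (C * 2 ^ p * (C * 2 ^ q) * 4)"
  have main: "norm (w - 2 * (1 + a / ?x r) * (F (?x r) / ?x r ^ p) * (G (?x r) / ?x r ^ q)) \<le> M / r"
    if r: "r \<ge> max (2 * R) 1" for r
  proof -
    have r0: "r > 0" "r \<ge> 1" using r by auto
    have cb: "z \<in> U \<and> norm (F z) \<le> C * 2 ^ p * r ^ p \<and> norm (G z) \<le> C * 2 ^ q * r ^ q" if z: "z \<in> cball (?x r) (r / 4)" for z
    proof -
      define y where "y = cnj ?\<omega> * z"
      have inv: "?\<omega> * cnj ?\<omega> = 1" by (metis complex_norm_square norm_crossing_ray of_real_1 power_one)
      have zy: "z = ?\<omega> * y" by (simp add: y_def inv flip: mult.assoc)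
      have "norm (z - ?x r) = norm (y - of_real r)" unfolding zy by (simp add: norm_mult flip: right_diff_distrib)
      then have yr: "norm (y - of_real r) \<le> r / 4" using z by (simp add: dist_norm norm_minus_commute)
      have "\<bar>Im y\<bar> \<le> r / 4" using order.trans[OF abs_Im_le_cmod yr] by simp
      moreover have "\<bar>Re y - r\<bar> \<le> r / 4" using order.trans[OF abs_Re_le_cmod yr] by simp
      ultimately have y1: "\<bar>Im y\<bar> \<le> Re y" "Re y \<ge> r / 2" using r0 by (auto simp: abs_if split: if_splits)
      have y2: "norm y \<ge> R" using y1(2) complex_Re_le_cmod[of y] r by simp
      have y3: "norm y \<le> 2 * r" using norm_triangle_ineq2[of y "of_real r"] yr r0 by simp
      have pw: "norm y ^ j \<le> 2 ^ j * r ^ j" for j using power_mono[OF y3, of j] by (simp add: power_mult_distrib)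
      have "C * norm y ^ j \<le> C * 2 ^ j * r ^ j" for j using pw[of j] C by (simp add: mult.assoc)
      then show ?thesis using bnd[OF y2 y1(1)] cone[of y] y1 y2 R R1 unfolding zy by (meson order.trans)
    qed
    have sub: "cball (?x r) (r / 4) \<subseteq> U" using cb by blast
    have dF: "norm (deriv F (?x r)) \<le> C * 2 ^ p * r ^ p / (r / 4)"
      by (rule norm_deriv_le[OF F U sub]) (use cb r0 in auto)
    have dG: "norm (deriv G (?x r)) \<le> C * 2 ^ q * r ^ q / (r / 4)"
      by (rule norm_deriv_le[OF G U sub]) (use cb r0 in auto)
    have xin: "?x r \<in> cball (?x r) (r / 4)" using r0 by simp
    have x0: "?x r \<noteq> 0" using r0 by simp
    have nx: "norm (?x r) = r" using r0 by (simp add: norm_mult)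
    have "w = (F (?x r) * deriv G (?x r) - deriv F (?x r) * G (?x r)) / ?x r ^ (p + q + 1)
       + 2 * (1 + a / ?x r) * (F (?x r) / ?x r ^ p) * (G (?x r) / ?x r ^ q)"
    proof -
      have gen: "w = (f * g' - f' * g1) / x ^ (p + q + 1) + 2 * (1 + a / x) * (f / x ^ p) * (g1 / x ^ q)"
        if "f * g' - f' * g1 + 2 * (x + a) * f * g1 = w * x ^ (p + q + 1)" "x \<noteq> 0" for f g' f' g1 x
      proof -
        have "2 * (1 + a / x) * (f / x ^ p) * (g1 / x ^ q) = 2 * (x + a) * f * g1 / x ^ (p + q + 1)"
          using that(2) by (simp add: power_add field_simps)
        then have "(f * g' - f' * g1) / x ^ (p + q + 1) + 2 * (1 + a / x) * (f / x ^ p) * (g1 / x ^ q) = w * x ^ (p + q + 1) / x ^ (p + q + 1)"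
          unfolding that(1)[symmetric] by (simp only: add_divide_distrib)
        then show ?thesis using that(2) by simp
      qed
      show ?thesis by (rule gen[OF rel x0]) (use cb[OF xin] in blast)
    qed
    then have "w - 2 * (1 + a / ?x r) * (F (?x r) / ?x r ^ p) * (G (?x r) / ?x r ^ q)
       = (F (?x r) * deriv G (?x r) - deriv F (?x r) * G (?x r)) / ?x r ^ (p + q + 1)"
      by (metis add_diff_cancel_right')
    also have "norm \<dots> \<le> (norm (F (?x r)) * norm (deriv G (?x r)) + norm (deriv F (?x r)) * norm (G (?x r))) / r ^ (p + q + 1)"
      unfolding norm_divide norm_power nx using r0
      by (intro divide_right_mono order.trans[OF norm_triangle_ineq4]) (auto simp: norm_mult)
    also have "\<dots> \<le> ((C * 2 ^ p * r ^ p) * (C * 2 ^ q * r ^ q / (r / 4)) + (C * 2 ^ p * r ^ p / (r / 4)) * (C * 2 ^ q * r ^ q)) / r ^ (p + q + 1)"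
      using cb[OF xin] dF dG r0 C by (intro divide_right_mono add_mono mult_mono) auto
    also have "\<dots> = M / r / r" using r0 by (simp add: M_def power_add field_simps)
    also have "\<dots> \<le> M / r" using r0 C by (simp add: M_def field_simps)
    finally show ?thesis .
  qed
  have side0: "norm (of_real r :: complex) \<ge> R1" "0 \<le> - \<tau> * Im (of_real r)" "- \<tau> * Im (of_real r) \<le> Re (of_real r)"
     "0 \<le> \<tau> * Im (of_real r)" "\<tau> * Im (of_real r) \<le> Re (of_real r)" if "r \<ge> R1" for r :: real
    using that R1 by auto
  have limF: "((\<lambda>r. F (?x r) / ?x r ^ p) \<longlongrightarrow> cF) at_top"
  proof (rule LIM_zero_cancel, rule Lim_null_comparison)
    show "eventually (\<lambda>r. norm (F (?x r) / ?x r ^ p - cF) \<le> CF / r) at_top"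
      using eventually_ge_at_top[of R1]
    proof eventually_elim
      case (elim r)
      then show ?case using F1(3)[of "of_real r"] R1 by simp
    qed
    show "((\<lambda>r. CF / r) \<longlongrightarrow> 0) at_top" by real_asymp
  qed
  have limG: "((\<lambda>r. G (?x r) / ?x r ^ q) \<longlongrightarrow> cG) at_top"
  proof (rule LIM_zero_cancel, rule Lim_null_comparison)
    show "eventually (\<lambda>r. norm (G (?x r) / ?x r ^ q - cG) \<le> CG / r) at_top"
      using eventually_ge_at_top[of R1]
    proof eventually_elim
      case (elim r)
      then show ?case using G1(3)[of "of_real r"] R1 by simp
    qed
    show "((\<lambda>r. CG / r) \<longlongrightarrow> 0) at_top" by real_asymp
  qed
  have limx: "((\<lambda>r. a / ?x r) \<longlongrightarrow> 0) at_top"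
  proof (rule Lim_null_comparison)
    show "eventually (\<lambda>r. norm (a / ?x r) \<le> norm a / r) at_top"
      using eventually_gt_at_top[of 0] by eventually_elim (simp add: norm_divide norm_mult)
    show "((\<lambda>r. norm a / r) \<longlongrightarrow> 0) at_top" by real_asymp
  qed
  have "((\<lambda>r. 2 * (1 + a / ?x r) * (F (?x r) / ?x r ^ p) * (G (?x r) / ?x r ^ q)) \<longlongrightarrow> 2 * (1 + 0) * cF * cG) at_top"
    by (intro tendsto_intros limF limG limx)
  moreover have "((\<lambda>r. 2 * (1 + a / ?x r) * (F (?x r) / ?x r ^ p) * (G (?x r) / ?x r ^ q)) \<longlongrightarrow> w) at_top"
  proof (rule LIM_zero_cancel, rule Lim_null_comparison)
    show "eventually (\<lambda>r. norm (2 * (1 + a / ?x r) * (F (?x r) / ?x r ^ p) * (G (?x r) / ?x r ^ q) - w) \<le> M / r) at_top"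
      using eventually_ge_at_top[of "max (2 * R) 1"]
    proof eventually_elim
      case (elim r)
      then show ?case using main[OF elim] by (simp only: norm_minus_commute)
    qed
    show "((\<lambda>r. M / r) \<longlongrightarrow> 0) at_top" by real_asymp
  qed
  ultimately have "2 * (1 + 0) * cF * cG = w" using tendsto_unique trivial_limit_at_top_linorder by blast
  then show "w = 2 * cF * cG" by simp
qed

section \<open>The logarithmic basis\<close>

text \<open>
  Only the derivative of \<open>L\<close> enters, so this covers every branch of the logarithm.
\<close>

lemma ode_op_log:
  assumes U: "open U" "0 \<notin> U" and A: "A holomorphic_on U" and \<beta>: "\<beta> holomorphic_on U" and x: "x \<in> U"
    and L: "\<And>x. x \<in> U \<Longrightarrow> (L has_field_derivative inverse x) (at x)"
  shows "ode_op K s a d \<kappa> (\<lambda>x. A x + c * L x * \<beta> x) x = ode_op K s a d \<kappa> A x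
    + c * (L x * ode_op K s a d \<kappa> \<beta> x + (2 * deriv \<beta> x - K * \<beta> x / x - 2 * s * (x + a) * \<beta> x))"
proof -
  have d1: "((\<lambda>x. A x + c * L x * \<beta> x) has_field_derivative deriv A x + c * (inverse x * \<beta> x + L x * deriv \<beta> x)) (at x)" if "x \<in> U" for x
    using holomorphic_derivI[OF A U(1) that] holomorphic_derivI[OF \<beta> U(1) that] L[OF that]
    by (auto intro!: derivative_eq_intros simp: algebra_simps)
  have A': "deriv A holomorphic_on U" and \<beta>': "deriv \<beta> holomorphic_on U" using A \<beta> U by (auto intro: holomorphic_deriv)
  have nz: "x \<noteq> 0" using x U by auto
  have "((\<lambda>x. deriv A x + c * (inverse x * \<beta> x + L x * deriv \<beta> x)) has_field_derivative
     deriv (deriv A) x + c * (- (1 / x\<^sup>2) * \<beta> x + 2 * (inverse x * deriv \<beta> x) + L x * deriv (deriv \<beta>) x)) (at x)"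
    using holomorphic_derivI[OF A' U(1) x] holomorphic_derivI[OF \<beta>' U(1) x] holomorphic_derivI[OF \<beta> U(1) x] L[OF x] nz
    by (auto intro!: derivative_eq_intros simp: algebra_simps power2_eq_square field_simps)
  then have d2: "deriv (deriv (\<lambda>x. A x + c * L x * \<beta> x)) x =
     deriv (deriv A) x + c * (- (1 / x\<^sup>2) * \<beta> x + 2 * (inverse x * deriv \<beta> x) + L x * deriv (deriv \<beta>) x)"
    by (intro deriv_eq_on_open[OF U(1) x]) (auto intro: DERIV_imp_deriv d1)
  have "x * (- (1 / x\<^sup>2) * \<beta> x + 2 * (inverse x * deriv \<beta> x)) = 2 * deriv \<beta> x - \<beta> x / x"
    using nz by (simp add: field_simps power2_eq_square)
  then have e: "x * (deriv (deriv A) x + c * (- (1 / x\<^sup>2) * \<beta> x + 2 * (inverse x * deriv \<beta> x) + L x * deriv (deriv \<beta>) x))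
     = x * deriv (deriv A) x + c * (2 * deriv \<beta> x - \<beta> x / x + x * L x * deriv (deriv \<beta>) x)"
  proof -
    have gen: "x * (A2 + c * (t + l * B2)) = x * A2 + c * (x * t + x * l * B2)" for A2 t l B2 by (simp add: algebra_simps)
    show ?thesis unfolding gen \<open>x * (- (1 / x\<^sup>2) * \<beta> x + 2 * (inverse x * deriv \<beta> x)) = _\<close> ..
  qed
  show ?thesis unfolding ode_op_def d2 DERIV_imp_deriv[OF d1[OF x]] e
    using nz by (simp add: field_simps)
qed

text \<open>
  The last factor does not contain \<open>L\<close>. Wronskians computed with different branches of the logarithm can therefore be
  compared through their coefficients.
\<close>

lemma wronskian_log_basis:
  assumes U: "open U" "0 \<notin> U" and A: "A holomorphic_on U" and \<beta>: "\<beta> holomorphic_on U" and x: "x \<in> U"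
    and L: "\<And>x. x \<in> U \<Longrightarrow> (L has_field_derivative inverse x) (at x)"
  shows "wronskian (\<lambda>x. p1 * \<beta> x + q1 * (A x + c * L x * \<beta> x)) (\<lambda>x. p2 * \<beta> x + q2 * (A x + c * L x * \<beta> x)) x =
    (p1 * q2 - q1 * p2) * (wronskian \<beta> A x + c * (\<beta> x)\<^sup>2 / x)"
proof -
  have d: "deriv (\<lambda>x. p * \<beta> x + q * (A x + c * L x * \<beta> x)) x =
     p * deriv \<beta> x + q * (deriv A x + c * (inverse x * \<beta> x + L x * deriv \<beta> x))" for p q
    using holomorphic_derivI[OF A U(1) x] holomorphic_derivI[OF \<beta> U(1) x] L[OF x]
    by (intro DERIV_imp_deriv) (auto intro!: derivative_eq_intros simp: algebra_simps)
  have nz: "x \<noteq> 0" using x U by auto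
  show ?thesis unfolding wronskian_def d by (simp add: divide_inverse power2_eq_square algebra_simps)
qed

lemma wronskian_exp:
  assumes U: "open U" "G holomorphic_on U" "x \<in> U"
  shows "wronskian F (\<lambda>x. G x * exp (2 * g x a)) x =
    (F x * deriv G x - deriv F x * G x + 2 * (x + a) * F x * G x) * exp (2 * g x a)"
proof -
  have "((\<lambda>x. G x * exp (2 * g x a)) has_field_derivative (deriv G x + 2 * (x + a) * G x) * exp (2 * g x a)) (at x)"
    using holomorphic_derivI[OF U(2,1,3)] by (auto intro!: derivative_eq_intros DERIV_g simp: algebra_simps)
  from DERIV_imp_deriv[OF this] show ?thesis unfolding wronskian_def by (simp add: algebra_simps)
qed

text \<open>
  If the Wronskian of the two basis functions vanished, the second one would be a multiple of \<open>\<beta>\<close>; but at the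
  origin it tends to \<open>1\<close> and \<open>\<beta>\<close> to \<open>0\<close>.
\<close>

lemma log_basis:
  assumes K: "K \<ge> 1"
  obtains \<beta> E A c where "E holomorphic_on UNIV" "A holomorphic_on UNIV" "\<beta> = (\<lambda>x. x ^ K * E x)"
    "\<forall>U L. open U \<longrightarrow> 0 \<notin> U \<longrightarrow> (\<forall>x\<in>U. (L has_field_derivative inverse x) (at x)) \<longrightarrow>
       ode_solution U (of_nat K) s a d \<kappa> \<beta> \<and> ode_solution U (of_nat K) s a d \<kappa> (\<lambda>x. A x + c * L x * \<beta> x)"
    "\<forall>x\<in>cut_plane. wronskian \<beta> A x + c * (\<beta> x)\<^sup>2 / x \<noteq> 0"
proof -
  obtain E A c where 1: "E holomorphic_on UNIV" "A holomorphic_on UNIV" "E 0 = 1" "A 0 = 1"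
    and \<beta>: "ode_solution UNIV (of_nat K) s a d \<kappa> (\<lambda>x. x ^ K * E x)"
    and A: "\<And>x. x \<noteq> 0 \<Longrightarrow> ode_op (of_nat K) s a d \<kappa> A x =
       - c * (2 * deriv (\<lambda>x. x ^ K * E x) x - of_nat K * (x ^ K * E x) / x - 2 * s * (x + a) * (x ^ K * E x))"
    using frobenius_solutions[OF K] by blast
  define \<beta> where "\<beta> = (\<lambda>x. x ^ K * E x)"
  note b = \<beta>[folded \<beta>_def] and AA = A[folded \<beta>_def]
  have bh: "\<beta> holomorphic_on U" and Ah: "A holomorphic_on U" for U
    using b 1(2) by (auto simp: ode_solution_def intro: holomorphic_on_subset)
  have sol: "ode_solution U (of_nat K) s a d \<kappa> \<beta> \<and> ode_solution U (of_nat K) s a d \<kappa> (\<lambda>x. A x + c * L x * \<beta> x)"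
    if U: "open U" "0 \<notin> U" and L: "\<And>x. x \<in> U \<Longrightarrow> (L has_field_derivative inverse x) (at x)" for U L
  proof -
    have "L holomorphic_on U" using L U(1) holomorphic_on_open by blast
    then have "(\<lambda>x. A x + c * L x * \<beta> x) holomorphic_on U" by (intro holomorphic_intros Ah bh)
    moreover have "ode_op (of_nat K) s a d \<kappa> (\<lambda>x. A x + c * L x * \<beta> x) x = 0" if "x \<in> U" for x
    proof -
      have nz: "x \<noteq> 0" using that U by auto
      have b0: "ode_op (of_nat K) s a d \<kappa> \<beta> x = 0" using b by (simp add: ode_solution_def)
      have bx: "x ^ K * E x = \<beta> x" by (simp add: \<beta>_def)
      have "ode_op (of_nat K) s a d \<kappa> (\<lambda>x. A x + c * L x * \<beta> x) x = ode_op (of_nat K) s a d \<kappa> A x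
        + c * (L x * ode_op (of_nat K) s a d \<kappa> \<beta> x + (2 * deriv \<beta> x - of_nat K * \<beta> x / x - 2 * s * (x + a) * \<beta> x))"
        by (rule ode_op_log[OF U Ah bh that]) (rule L)
      then show ?thesis using AA[OF nz] unfolding b0 bx by simp
    qed
    ultimately show ?thesis using b bh by (auto simp: ode_solution_def)
  qed
  have bs: "ode_solution cut_plane (of_nat K) s a d \<kappa> \<beta>"
    and es: "ode_solution cut_plane (of_nat K) s a d \<kappa> (\<lambda>x. A x + c * cut_ln x * \<beta> x)"
    using sol[OF open_cut_plane zero_notin_cut_plane DERIV_cut_ln] by auto
  obtain w where w: "\<forall>x\<in>cut_plane. wronskian \<beta> (\<lambda>x. A x + c * cut_ln x * \<beta> x) x = w * x ^ (K - 1) * exp (2 * s * g x a)"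
    using wronskian_ode_const[OF open_cut_plane connected_cut_plane zero_notin_cut_plane K bs es] by blast
  have pos: "of_real t \<in> cut_plane" "cut_ln (of_real t) = of_real (ln t)" if "t > 0" for t
    using rcis_cut_plane[OF that, of 0] by (simp_all add: rcis_def)
  have EA: "isCont E 0" "isCont A 0" using 1 holomorphic_on_imp_continuous_on continuous_on_eq_continuous_at open_UNIV by blast+
  have t0: "((\<lambda>t::real. of_real t :: complex) \<longlongrightarrow> 0) (at_right 0)"
    by (rule tendsto_eq_intros | simp)+
  have limE: "((\<lambda>t. E (of_real t)) \<longlongrightarrow> 1) (at_right 0)" and limA: "((\<lambda>t. A (of_real t)) \<longlongrightarrow> 1) (at_right 0)"
    using isCont_tendsto_compose[OF EA(1) t0] isCont_tendsto_compose[OF EA(2) t0] 1 by simp_all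
  have "w \<noteq> 0"
  proof
    assume "w = 0"
    then have W0: "wronskian \<beta> (\<lambda>x. A x + c * cut_ln x * \<beta> x) x = 0" if "x \<in> cut_plane" for x using w that by simp
    have "eventually (\<lambda>t. E (of_real t) \<noteq> 0 \<and> t > 0) (at_right (0::real))"
      using tendsto_imp_eventually_ne[OF limE, of 0] by (simp add: eventually_conj_iff eventually_at_right_less)
    then obtain t where "E (of_real t) \<noteq> 0" "t > 0" using eventually_happens' trivial_limit_at_right_real by blast
    then have "\<beta> (of_real t) \<noteq> 0" "of_real t \<in> cut_plane" using pos by (auto simp: \<beta>_def)
    then obtain k where k: "\<forall>x\<in>cut_plane. A x + c * cut_ln x * \<beta> x = k * \<beta> x"
      using wronskian_zero_imp_dependent[OF open_cut_plane connected_cut_plane bh _ W0] es unfolding ode_solution_def by blast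
    have b1: "((\<lambda>t. of_real t ^ (K - 1) * E (of_real t)) \<longlongrightarrow> 0 ^ (K - 1) * 1) (at_right 0)"
      by (intro tendsto_intros limE t0)
    have "((\<lambda>t. ln t * t) \<longlongrightarrow> 0) (at_right (0::real))" by real_asymp
    then have lnt: "((\<lambda>t. of_real (ln t * t) :: complex) \<longlongrightarrow> 0) (at_right 0)" by (metis tendsto_of_real of_real_0)
    have "((\<lambda>t. A (of_real t) + c * (of_real (ln t * t) * (of_real t ^ (K - 1) * E (of_real t)))
        - k * (of_real t * (of_real t ^ (K - 1) * E (of_real t)))) \<longlongrightarrow> 1 + c * (0 * (0 ^ (K - 1) * 1)) - k * (0 * (0 ^ (K - 1) * 1))) (at_right 0)"
      by (intro tendsto_intros limA b1 lnt t0)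
    moreover have "eventually (\<lambda>t. A (of_real t) + c * (of_real (ln t * t) * (of_real t ^ (K - 1) * E (of_real t)))
        - k * (of_real t * (of_real t ^ (K - 1) * E (of_real t))) = 0) (at_right 0)"
      using eventually_at_right_less[of 0]
    proof eventually_elim
      case (elim t)
      have pw: "(of_real t :: complex) ^ K = of_real t * of_real t ^ (K - 1)" using K by (cases K) auto
      show ?case using bspec[OF k pos(1)[OF elim]] unfolding pos(2)[OF elim] \<beta>_def pw by (simp add: mult_ac)
    qed
    ultimately have "((\<lambda>t. 0) \<longlongrightarrow> (1::complex)) (at_right (0::real))"
      using tendsto_cong by fastforce
    then show False by (simp add: tendsto_const_iff)
  qed
  moreover have "wronskian \<beta> (\<lambda>x. A x + c * cut_ln x * \<beta> x) x = wronskian \<beta> A x + c * (\<beta> x)\<^sup>2 / x" if "x \<in> cut_plane" for x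
    using wronskian_log_basis[OF open_cut_plane zero_notin_cut_plane Ah bh that DERIV_cut_ln, of 1 0 c 0 1] by simp
  ultimately have nz: "wronskian \<beta> A x + c * (\<beta> x)\<^sup>2 / x \<noteq> 0" if "x \<in> cut_plane" for x
    using w that zero_notin_cut_plane by (metis exp_not_eq_zero mult_eq_0_iff power_eq_0_iff)
  show ?thesis
  proof (rule that[OF 1(1,2) \<beta>_def])
    show "\<forall>U L. open U \<longrightarrow> 0 \<notin> U \<longrightarrow> (\<forall>x\<in>U. (L has_field_derivative inverse x) (at x)) \<longrightarrow>
       ode_solution U (of_nat K) s a d \<kappa> \<beta> \<and> ode_solution U (of_nat K) s a d \<kappa> (\<lambda>x. A x + c * L x * \<beta> x)"
    proof (intro allI impI)
      fix U :: "complex set" and L :: "complex \<Rightarrow> complex"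
      assume "open U" "0 \<notin> U" "\<forall>x\<in>U. (L has_field_derivative inverse x) (at x)"
      then show "ode_solution U (of_nat K) s a d \<kappa> \<beta> \<and> ode_solution U (of_nat K) s a d \<kappa> (\<lambda>x. A x + c * L x * \<beta> x)"
        by (intro sol) auto
    qed
    show "\<forall>x\<in>cut_plane. wronskian \<beta> A x + c * (\<beta> x)\<^sup>2 / x \<noteq> 0" using nz by blast
  qed
qed

text \<open>
  Cramer's rule; the coefficients are quotients of Wronskians, which are constant by Abel's formula.
\<close>

lemma solution_span:
  assumes K: "K \<ge> 1" and e1: "ode_solution cut_plane (of_nat K) s a d \<kappa> e1" and e2: "ode_solution cut_plane (of_nat K) s a d \<kappa> e2"
    and W: "\<And>x. x \<in> cut_plane \<Longrightarrow> wronskian e1 e2 x \<noteq> 0" and f: "ode_solution cut_plane (of_nat K) s a d \<kappa> f"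
  obtains p q where "\<And>x. x \<in> cut_plane \<Longrightarrow> f x = p * e1 x + q * e2 x"
proof -
  note wc = wronskian_ode_const[OF open_cut_plane connected_cut_plane zero_notin_cut_plane K]
  obtain w w1 w2 where w: "\<forall>x\<in>cut_plane. wronskian e1 e2 x = w * x ^ (K - 1) * exp (2 * s * g x a)"
    "\<forall>x\<in>cut_plane. wronskian f e2 x = w1 * x ^ (K - 1) * exp (2 * s * g x a)"
    "\<forall>x\<in>cut_plane. wronskian e1 f x = w2 * x ^ (K - 1) * exp (2 * s * g x a)"
    using wc[OF e1 e2] wc[OF f e2] wc[OF e1 f] by blast
  show ?thesis
  proof (rule that)
    fix x assume x: "x \<in> cut_plane"
    define v where "v = x ^ (K - 1) * exp (2 * s * g x a)"
    have "w * v \<noteq> 0" using W[OF x] w x by (simp add: v_def mult.assoc)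
    have "f x * wronskian e1 e2 x = e1 x * wronskian f e2 x + e2 x * wronskian e1 f x"
      by (simp add: wronskian_def algebra_simps)
    then have "f x * (w * v) = e1 x * (w1 * v) + e2 x * (w2 * v)" using w x by (simp add: v_def mult.assoc)
    then have "v * (w * f x) = v * (w1 * e1 x + w2 * e2 x)" by (simp add: algebra_simps)
    then have "w * f x = w1 * e1 x + w2 * e2 x" using \<open>w * v \<noteq> 0\<close> by simp
    then show "f x = w1 / w * e1 x + w2 / w * e2 x" using \<open>w * v \<noteq> 0\<close> by (auto simp: field_simps)
  qed
qed

lemma cone_cover:
  fixes x :: complex
  obtains k y where "k < 4" "x = crossing_ray k * y" "\<bar>Im y\<bar> \<le> Re y"
proof -
  define z where "z = cnj (crossing_ray 0) * x"
  have inv: "crossing_ray k * cnj (crossing_ray k) = 1" for k by (metis complex_norm_square norm_crossing_ray of_real_1 power_one)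
  have xz: "x = crossing_ray 0 * z" by (simp add: z_def inv flip: mult.assoc)
  have ray: "crossing_ray k = crossing_ray 0 * \<i> ^ k" for k
    unfolding crossing_ray_def cis_pi_half[symmetric] Complex.DeMoivre cis_mult by (simp add: add.commute)
  have ii: "\<i> * (\<i> * w) = - w" for w by (simp flip: mult.assoc)
  have "\<bar>Im z\<bar> \<le> Re z \<or> \<bar>Re z\<bar> \<le> Im z \<or> \<bar>Im z\<bar> \<le> - Re z \<or> \<bar>Re z\<bar> \<le> - Im z" by linarith
  then show ?thesis
  proof (elim disjE)
    assume "\<bar>Im z\<bar> \<le> Re z"
    then show ?thesis using that[of 0 z] xz by simp
  next
    assume "\<bar>Re z\<bar> \<le> Im z"
    then show ?thesis using that[of 1 "- \<i> * z"] xz ray[of 1] by (simp add: mult.assoc ii)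
  next
    assume "\<bar>Im z\<bar> \<le> - Re z"
    then show ?thesis using that[of 2 "- z"] xz ray[of 2] by simp
  next
    assume "\<bar>Re z\<bar> \<le> - Im z"
    then show ?thesis using that[of 3 "\<i> * z"] xz ray[of 3] by (simp add: power3_eq_cube mult.assoc ii)
  qed
qed

lemma cone_bound_cong:
  assumes "cone_bound F k p" and eq: "\<And>y. norm y \<ge> 1 \<Longrightarrow> \<bar>Im y\<bar> \<le> Re y \<Longrightarrow> F (crossing_ray k * y) = G (crossing_ray k * y)"
  shows "cone_bound G k p"
proof -
  obtain C R where CR: "C > 0" "R > 0" "\<And>y. norm y \<ge> R \<Longrightarrow> \<bar>Im y\<bar> \<le> Re y \<Longrightarrow> norm (F (crossing_ray k * y)) \<le> C * norm y ^ p"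
    using assms(1) unfolding cone_bound_def by blast
  show ?thesis unfolding cone_bound_def
  proof (intro exI conjI allI impI)
    show "C > 0" "max R 1 > 0" using CR by auto
    fix y assume y: "max R 1 \<le> norm y" "\<bar>Im y\<bar> \<le> Re y"
    then show "norm (G (crossing_ray k * y)) \<le> C * norm y ^ p" using CR(3)[of y] eq[of y] by simp
  qed
qed

text \<open>
  Liouville's theorem, with the growth checked cone by cone.
\<close>

lemma polynomial_growth_imp_poly:
  assumes F: "F holomorphic_on UNIV"
    and bnd: "\<And>k. k < 4 \<Longrightarrow> cone_bound F k p"
  shows "\<exists>P. degree P \<le> p \<and> (\<forall>x. F x = poly P x)"
proof -
  obtain C R where CR: "\<And>k. k < 4 \<Longrightarrow> C k > 0 \<and> R k > (0::real) \<and> (\<forall>y. norm y \<ge> R k \<longrightarrow> \<bar>Im y\<bar> \<le> Re y \<longrightarrow> norm (F (crossing_ray k * y)) \<le> C k * norm y ^ p)"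
    using bnd unfolding cone_bound_def by metis
  define C' R' where "C' = (\<Sum>k<4. C k)" and "R' = (\<Sum>k<4. R k)"
  have le: "C k \<le> C'" "R k \<le> R'" if "k < 4" for k
    unfolding C'_def R'_def using that CR by (auto intro!: member_le_sum simp: less_imp_le)
  have "norm (F x) \<le> C' * norm x ^ p" if "R' \<le> norm x" for x
  proof -
    obtain k y where k: "k < 4" "x = crossing_ray k * y" "\<bar>Im y\<bar> \<le> Re y" using cone_cover by blast
    have n: "norm x = norm y" by (simp add: k norm_mult)
    have "norm (F x) \<le> C k * norm y ^ p" using CR[OF k(1)] k le[OF k(1)] that n by auto
    also have "\<dots> \<le> C' * norm x ^ p" unfolding n using le[OF k(1)] by (intro mult_right_mono) auto
    finally show ?thesis .
  qed
  then have eq: "F x = (\<Sum>k\<le>p. (deriv ^^ k) F 0 / fact k * x ^ k)" for x using Liouville_polynomial[OF F] by blast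
  define P where "P = (\<Sum>k\<le>p. monom ((deriv ^^ k) F 0 / fact k) k)"
  have "degree P \<le> p" unfolding P_def by (intro degree_sum_le) (auto intro: order.trans[OF degree_monom_le])
  moreover have "F x = poly P x" for x by (simp add: eq P_def poly_sum poly_monom)
  ultimately show ?thesis by blast
qed

lemma poly_vanishing_order:
  assumes E: "E holomorphic_on UNIV" and P: "degree P < N" "\<And>x. k * (x ^ N * E x) = poly P x"
  shows "P = 0"
proof (rule ccontr)
  assume P0: "P \<noteq> 0"
  define r where "r = order 0 P"
  obtain S where S: "P = [:0, 1:] ^ r * S" "poly S 0 \<noteq> 0"
    using order_decomp[OF P0, of 0] unfolding r_def by (auto simp: poly_eq_0_iff_dvd)
  have rN: "r < N" using order_degree[OF P0, of 0] P(1) unfolding r_def by linarith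
  have "poly S x = k * (x ^ (N - r) * E x)" if "x \<noteq> 0" for x
  proof -
    have "x ^ N = x ^ r * x ^ (N - r)" using rN by (simp flip: power_add)
    then have "x ^ r * poly S x = x ^ r * (k * (x ^ (N - r) * E x))" using P(2)[of x] by (auto simp: S mult_ac)
    then show ?thesis using that by (auto simp: mult_ac)
  qed
  then have "eventually (\<lambda>x. poly S x = k * (x ^ (N - r) * E x)) (at 0)" by (auto simp: eventually_at_filter)
  moreover have "isCont E 0" using E holomorphic_on_imp_continuous_on continuous_on_eq_continuous_at open_UNIV by blast
  then have "((\<lambda>x. k * (x ^ (N - r) * E x)) \<longlongrightarrow> k * (0 ^ (N - r) * E 0)) (at 0)"
    by (intro tendsto_intros) (simp add: isCont_def)
  ultimately have "(poly S \<longlongrightarrow> k * (0 ^ (N - r) * E 0)) (at 0)" by (simp add: tendsto_cong)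
  moreover have "(poly S \<longlongrightarrow> poly S 0) (at 0)" using poly_isCont isCont_def by blast
  ultimately have "poly S 0 = k * (0 ^ (N - r) * E 0)" using tendsto_unique trivial_limit_at by blast
  then show False using S rN by simp
qed

section \<open>Dependent solutions in opposite sectors are polynomials\<close>

lemma ode_solution_lincomb:
  assumes U: "open U" and e: "ode_solution U K s a d \<kappa> e1" "ode_solution U K s a d \<kappa> e2"
  shows "ode_solution U K s a d \<kappa> (\<lambda>x. p * e1 x + q * e2 x)"
proof -
  have h: "e1 holomorphic_on U" "e2 holomorphic_on U" using e by (auto simp: ode_solution_def)
  have h': "deriv e1 holomorphic_on U" "deriv e2 holomorphic_on U" using h U by (auto intro: holomorphic_deriv)
  have d1: "((\<lambda>x. p * e1 x + q * e2 x) has_field_derivative p * deriv e1 x + q * deriv e2 x) (at x)" if "x \<in> U" for x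
    using holomorphic_derivI[OF h(1) U that] holomorphic_derivI[OF h(2) U that] by (auto intro!: derivative_eq_intros)
  have "((\<lambda>x. p * deriv e1 x + q * deriv e2 x) has_field_derivative p * deriv (deriv e1) x + q * deriv (deriv e2) x) (at x)" if "x \<in> U" for x
    using holomorphic_derivI[OF h'(1) U that] holomorphic_derivI[OF h'(2) U that] by (auto intro!: derivative_eq_intros)
  then have d2: "deriv (deriv (\<lambda>x. p * e1 x + q * e2 x)) x = p * deriv (deriv e1) x + q * deriv (deriv e2) x" if "x \<in> U" for x
    using that by (intro deriv_eq_on_open[OF U that, where h = "\<lambda>x. p * deriv e1 x + q * deriv e2 x"]) (auto intro: DERIV_imp_deriv d1)
  have "ode_op K s a d \<kappa> (\<lambda>x. p * e1 x + q * e2 x) x = p * ode_op K s a d \<kappa> e1 x + q * ode_op K s a d \<kappa> e2 x" if "x \<in> U" for x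
    unfolding ode_op_def d2[OF that] DERIV_imp_deriv[OF d1[OF that]] by (simp add: algebra_simps)
  then show ?thesis using e h by (auto simp: ode_solution_def intro!: holomorphic_intros)
qed

lemma wronskian_cong:
  assumes "open U" "x \<in> U" "\<And>x. x \<in> U \<Longrightarrow> f x = f' x" "\<And>x. x \<in> U \<Longrightarrow> h x = h' x"
  shows "wronskian f h x = wronskian f' h' x"
proof -
  have "eventually (\<lambda>y. y \<in> U) (nhds x)" using assms eventually_nhds_in_open by blast
  note ev = this
  have "deriv f x = deriv f' x" by (rule deriv_cong_ev[OF eventually_mono[OF ev] refl]) (rule assms)
  moreover have "deriv h x = deriv h' x" by (rule deriv_cong_ev[OF eventually_mono[OF ev] refl]) (rule assms)
  ultimately show ?thesis using assms(2-4) by (simp only: wronskian_def)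
qed

lemma asymptotic_on_cong: "(\<And>x. x \<in> S \<Longrightarrow> f x = h x) \<Longrightarrow> asymptotic_on S f D c \<Longrightarrow> asymptotic_on S h D c"
  unfolding asymptotic_on_def by simp

lemma asymptotic_on_nonzero:
  assumes "asymptotic_on (stokes_sector k) f D c" "c \<noteq> 0"
  shows "\<exists>x\<in>stokes_sector k. f x \<noteq> 0"
proof (rule ccontr)
  assume z: "\<not> ?thesis"
  obtain C R where CR: "C > 0" "R > 0" "\<And>x. x \<in> stokes_sector k \<Longrightarrow> norm x \<ge> R \<Longrightarrow> norm (f x / x ^ D - c) \<le> C / norm x"
    using assms unfolding asymptotic_on_def by blast
  define r where "r = max R (2 * C / norm c)"
  have r: "r > 0" "r \<ge> R" "2 * C / norm c \<le> r" using CR by (auto simp: r_def)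
  have "rcis r (of_nat k * pi / 2 + 0) \<in> stokes_sector k" using r by (intro rcis_stokes_sector) auto
  then have "norm c \<le> C / r" using CR(3)[of "rcis r (of_nat k * pi / 2 + 0)"] z r by simp
  then have "norm c * r \<le> C" using r by (simp add: field_simps)
  moreover have "2 * C \<le> r * norm c" using r assms(2) by (simp add: field_simps)
  ultimately show False using CR(1) by (simp add: mult.commute)
qed

lemma wronskian_relation:
  assumes U: "open U" "connected U" "0 \<notin> U" and N: "N = p + q + 2"
    and f: "ode_solution U (of_nat N) 1 a d \<kappa> f"
    and G: "G holomorphic_on U" "ode_solution U (of_nat N) 1 a d \<kappa> (\<lambda>x. G x * exp (2 * g x a))"
  obtains w where "\<And>x. x \<in> U \<Longrightarrow> f x * deriv G x - deriv f x * G x + 2 * (x + a) * f x * G x = w * x ^ (p + q + 1)"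
    "\<And>x. x \<in> U \<Longrightarrow> wronskian f (\<lambda>x. G x * exp (2 * g x a)) x = w * (x ^ (p + q + 1) * exp (2 * g x a))"
proof -
  have N1: "N \<ge> 1" using N by simp
  obtain w where w: "\<forall>x\<in>U. wronskian f (\<lambda>x. G x * exp (2 * g x a)) x = w * x ^ (N - 1) * exp (2 * 1 * g x a)"
    using wronskian_ode_const[OF U N1 f G(2)] by blast
  have W: "wronskian f (\<lambda>x. G x * exp (2 * g x a)) x = w * x ^ (p + q + 1) * exp (2 * g x a)" if "x \<in> U" for x
    using w that by (simp add: N)
  show ?thesis
  proof (rule that)
    fix x assume x: "x \<in> U"
    show "f x * deriv G x - deriv f x * G x + 2 * (x + a) * f x * G x = w * x ^ (p + q + 1)"
      using W[OF x] unfolding wronskian_exp[OF U(1) G(1) x] by (simp only: mult_cancel_right exp_not_eq_zero simp_thms)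
    show "wronskian f (\<lambda>x. G x * exp (2 * g x a)) x = w * (x ^ (p + q + 1) * exp (2 * g x a))"
      using W[OF x] by (simp only: mult.assoc)
  qed
qed

lemma crossing_ray_inverse: "crossing_ray k * cnj (crossing_ray k) = 1" "cnj (crossing_ray k) * (crossing_ray k * y) = y"
proof -
  show 1: "crossing_ray k * cnj (crossing_ray k) = 1" by (metis complex_norm_square norm_crossing_ray of_real_1 power_one)
  have "cnj (crossing_ray k) * (crossing_ray k * y) = (crossing_ray k * cnj (crossing_ray k)) * y" by (simp only: mult_ac)
  then show "cnj (crossing_ray k) * (crossing_ray k * y) = y" unfolding 1 by simp
qed

lemma crossing_cone_cut_plane:
  assumes "k < 3" "y \<noteq> 0" "\<bar>Im y\<bar> \<le> Re y"
  shows "crossing_ray k * y \<in> cut_plane"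
proof (rule ccontr)
  assume "crossing_ray k * y \<notin> cut_plane"
  then obtain r where r: "r \<ge> 0" "crossing_ray k * y = of_real r * cis (- (pi / 4))" by (auto simp: cut_plane_def)
  have "y = cnj (crossing_ray k) * (of_real r * cis (- (pi / 4)))" using r(2) crossing_ray_inverse(2)[of k y] by simp
  also have "\<dots> = of_real r * (cnj (crossing_ray k) * cis (- (pi / 4)))" by (simp only: mult_ac)
  also have "cnj (crossing_ray k) * cis (- (pi / 4)) = cis (of_nat (k + 1) * (- (pi / 2)))"
    unfolding crossing_ray_def cis_cnj cis_mult by (rule arg_cong[of _ _ cis]) (simp add: field_simps)
  also have "\<dots> = cis (- (pi / 2)) ^ (k + 1)" by (rule Complex.DeMoivre[symmetric])
  also have "cis (- (pi / 2)) = - \<i>" by (simp add: complex_eq_iff)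
  finally have y: "y = of_real r * (- \<i>) ^ (k + 1)" .
  have "k = 0 \<or> k = 1 \<or> k = 2" using assms(1) by auto
  then have "y = - (of_real r * \<i>) \<or> y = - of_real r \<or> y = of_real r * \<i>"
    unfolding y by (elim disjE) (simp_all add: power3_eq_cube numeral_2_eq_2)
  then have "r = 0" using assms(3) r(1) by (elim disjE) simp_all
  then show False using assms(2) y by simp
qed

lemma Ln_rcis:
  assumes "r > 0" "- pi < t" "t \<le> pi"
  shows "Ln (rcis r t) = of_real (ln r) + \<i> * of_real t"
proof -
  have "rcis r t = exp (of_real (ln r) + \<i> * of_real t)"
    using assms(1) by (simp add: exp_add rcis_def cis_conv_exp exp_of_real)
  then show ?thesis using assms by simp
qed

text \<open>
  A branch of the logarithm near the remaining crossing ray, which lies on the branch cut. It continues \<open>cut_ln\<close> counterclockwise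
  from the sector \<open>3\<close> and exceeds it by \<open>2 pi i\<close> in the sector \<open>0\<close>.
\<close>

definition seam_ln :: "complex \<Rightarrow> complex" where
  "seam_ln x = Ln (cnj (crossing_ray 3) * x) + \<i> * of_real (7 * pi / 4)"

definition seam_plane :: "complex set" where
  "seam_plane = {x. 0 < inner (crossing_ray 3) x}"

lemma seam_plane_iff: "x \<in> seam_plane \<longleftrightarrow> 0 < Re (cnj (crossing_ray 3) * x)"
  by (simp add: seam_plane_def inner_complex_def)

lemma seam_plane: "open seam_plane" "connected seam_plane" "0 \<notin> seam_plane"
  unfolding seam_plane_def by (simp_all add: open_halfspace_gt convex_halfspace_gt convex_connected)

lemma crossing_cone_seam_plane: "y \<noteq> 0 \<Longrightarrow> \<bar>Im y\<bar> \<le> Re y \<Longrightarrow> crossing_ray 3 * y \<in> seam_plane"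
  unfolding seam_plane_iff crossing_ray_inverse by (auto simp: complex_eq_iff)

lemma DERIV_seam_ln:
  assumes "x \<in> seam_plane"
  shows "(seam_ln has_field_derivative inverse x) (at x)"
proof -
  let ?c = "cnj (crossing_ray 3)"
  have "?c * x \<notin> \<real>\<^sub>\<le>\<^sub>0" using assms by (auto simp: seam_plane_iff complex_nonpos_Reals_iff)
  then have "((\<lambda>x. Ln (?c * x) + \<i> * of_real (7 * pi / 4)) has_field_derivative inverse (?c * x) * ?c + 0) (at x)"
    by (intro DERIV_add DERIV_const DERIV_chain2[OF has_field_derivative_Ln] DERIV_cmult_Id)
  moreover have "inverse (?c * x) * ?c + 0 = inverse x" by (simp add: mult.commute)
  ultimately show ?thesis unfolding seam_ln_def[abs_def] by (simp only:)
qed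

lemma stokes_sector_4: "stokes_sector 4 = stokes_sector 0"
proof -
  have "cis (- (of_nat 4 * pi / 2)) = cis (2 * pi * of_int (- 1))" by simp
  also have "\<dots> = 1" by (rule cis_multiple_2pi) simp
  finally show ?thesis unfolding set_eq_iff stokes_sector_iff by simp
qed

lemma seam_ln_sectors:
  shows "x \<in> stokes_sector 3 \<Longrightarrow> x \<in> seam_plane \<and> cut_ln x = seam_ln x"
    and "x \<in> stokes_sector 0 \<Longrightarrow> x \<in> seam_plane \<and> cut_ln x = seam_ln x - 2 * of_real pi * \<i>"
proof -
  have sp: "x \<in> stokes_sector 3 \<or> x \<in> stokes_sector 4 \<Longrightarrow> x \<in> seam_plane" for x
    using crossing_ray_sector[of 3 "cnj (crossing_ray 3) * x"] crossing_ray_inverse(1)[of 3]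
    by (auto simp: seam_plane_iff simp flip: mult.assoc)
  show "x \<in> seam_plane \<and> cut_ln x = seam_ln x" if xs: "x \<in> stokes_sector 3"
  proof
    obtain \<delta> where d: "\<bar>\<delta>\<bar> < pi / 4" "x = rcis (norm x) (of_nat 3 * pi / 2 + \<delta>)" "norm x > 0"
      using stokes_sector_polar[OF xs] by blast
    define r where "r = norm x"
    have \<delta>: "\<bar>\<delta>\<bar> < pi / 4" "r > 0" and x: "x = rcis r (of_nat 3 * pi / 2 + \<delta>)"
      using d unfolding r_def by blast+
    have c: "cut_ln x = of_real (ln r) + \<i> * of_real (of_nat 3 * pi / 2 + \<delta>)"
      unfolding x by (rule rcis_cut_plane) (use \<delta> in auto)
    have "cnj (crossing_ray 3) * x = rcis r (\<delta> - pi / 4)"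
      unfolding x by (simp add: rcis_def crossing_ray_def cis_cnj cis_mult mult.left_commute)
    moreover have "Ln (rcis r (\<delta> - pi / 4)) = of_real (ln r) + \<i> * of_real (\<delta> - pi / 4)"
      by (rule Ln_rcis) (use \<delta> in auto)
    ultimately have LL: "Ln (cnj (crossing_ray 3) * x) = of_real (ln r) + \<i> * of_real (\<delta> - pi / 4)" by (simp only:)
    show "cut_ln x = seam_ln x" unfolding c seam_ln_def LL by (simp add: field_simps)
  qed (use sp xs in blast)
  show "x \<in> seam_plane \<and> cut_ln x = seam_ln x - 2 * of_real pi * \<i>" if xs: "x \<in> stokes_sector 0"
  proof
    obtain \<delta> where d: "\<bar>\<delta>\<bar> < pi / 4" "x = rcis (norm x) (of_nat 0 * pi / 2 + \<delta>)" "norm x > 0"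
      using stokes_sector_polar[OF xs] by blast
    define r where "r = norm x"
    have \<delta>: "\<bar>\<delta>\<bar> < pi / 4" "r > 0" and x: "x = rcis r (of_nat 0 * pi / 2 + \<delta>)"
      using d unfolding r_def by blast+
    have c: "cut_ln x = of_real (ln r) + \<i> * of_real (of_nat 0 * pi / 2 + \<delta>)"
      unfolding x by (rule rcis_cut_plane) (use \<delta> in auto)
    have "cis (- (of_nat 3 * pi / 2 + pi / 4)) = cis (pi / 4) * cis (2 * pi * of_int (- 1))"
      unfolding cis_mult by (rule arg_cong[of _ _ cis]) simp
    also have "cis (2 * pi * of_int (- 1)) = 1" by (rule cis_multiple_2pi) simp
    finally have ray: "cnj (crossing_ray 3) = cis (pi / 4)" by (simp add: crossing_ray_def cis_cnj)
    have "cnj (crossing_ray 3) * x = rcis r (\<delta> + pi / 4)"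
      unfolding x by (simp add: rcis_def ray cis_mult mult.left_commute add.commute)
    moreover have "Ln (rcis r (\<delta> + pi / 4)) = of_real (ln r) + \<i> * of_real (\<delta> + pi / 4)"
      by (rule Ln_rcis) (use \<delta> in auto)
    ultimately have LL: "Ln (cnj (crossing_ray 3) * x) = of_real (ln r) + \<i> * of_real (\<delta> + pi / 4)" by (simp only:)
    show "cut_ln x = seam_ln x - 2 * of_real pi * \<i>" unfolding c seam_ln_def LL by (simp add: field_simps)
  qed (use sp xs stokes_sector_4 in blast)
qed

text \<open>
  In the logarithmic basis \<open>f = p1 \<beta> + q1 (A + l log x \<beta>)\<close>, and \<open>G exp (2 g)\<close> has coefficients \<open>p2\<close>, \<open>q2\<close>. The three crossings inside
  the cut plane give \<open>w = 2 c0 c1 = 2 c2 c1 = 2 c2 c3\<close>, and therefore \<open>w = 2 c0 c3\<close>, which is the value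
  required at the fourth crossing, for \<open>G\<close> continued through the cut. This continuation adds \<open>2 pi i l q1 q2\<close>, up to
  sign and a nonzero factor, to the Wronskian, so \<open>l q1 q2 = 0\<close>. If \<open>l q1 = 0\<close> then \<open>f\<close> is the restriction of an entire function, which by
  \<open>cone_bound\<close> is a polynomial of degree at most \<open>p\<close>; the same holds for \<open>G\<close> if \<open>l q2 = 0\<close>. Neither \<open>q1\<close> nor \<open>q2\<close> is zero, because \<open>\<beta>\<close>
  vanishes to order \<open>N > p, q\<close> at the origin. Hence \<open>l = 0\<close>.
\<close>

lemma opposite_sectors_imp_polynomial:
  assumes N: "N = p + q + 2"
    and f: "ode_solution cut_plane (of_nat N) 1 a d \<kappa> f"
    and G: "G holomorphic_on cut_plane" "ode_solution cut_plane (of_nat N) 1 a d \<kappa> (\<lambda>x. G x * exp (2 * g x a))"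
    and as: "asymptotic_on (stokes_sector 0) f p c0" "asymptotic_on (stokes_sector 2) f p c2"
      "asymptotic_on (stokes_sector 1) G q c1" "asymptotic_on (stokes_sector 3) G q c3"
    and c: "c0 \<noteq> 0" "c1 \<noteq> 0" "c2 \<noteq> 0" "c3 \<noteq> 0"
  obtains P Q where "degree P \<le> p" "P \<noteq> 0" "\<And>x. x \<in> cut_plane \<Longrightarrow> f x = poly P x"
    "degree Q \<le> q" "Q \<noteq> 0" "\<And>x. x \<in> cut_plane \<Longrightarrow> G x = poly Q x"
proof -
  have K: "N \<ge> 1" using N by simp
  define h where "h = (\<lambda>x. G x * exp (2 * g x a))"
  note hs = G(2)[folded h_def]
  obtain \<beta> E A l where E: "E holomorphic_on UNIV" and A: "A holomorphic_on UNIV" and \<beta>: "\<beta> = (\<lambda>x. x ^ N * E x)"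
    and sol: "\<forall>U L. open U \<longrightarrow> 0 \<notin> U \<longrightarrow> (\<forall>x\<in>U. (L has_field_derivative inverse x) (at x)) \<longrightarrow>
       ode_solution U (of_nat N) 1 a d \<kappa> \<beta> \<and> ode_solution U (of_nat N) 1 a d \<kappa> (\<lambda>x. A x + l * L x * \<beta> x)"
    and Dnz: "\<forall>x\<in>cut_plane. wronskian \<beta> A x + l * (\<beta> x)\<^sup>2 / x \<noteq> 0"
    by (rule log_basis[OF K, of 1 a d \<kappa>]) (rule that)
  define D where "D x = wronskian \<beta> A x + l * (\<beta> x)\<^sup>2 / x" for x
  have bh: "\<beta> holomorphic_on U" and Ah: "A holomorphic_on U" for U
    unfolding \<beta> by (intro holomorphic_intros holomorphic_on_subset[OF E] holomorphic_on_subset[OF A] subset_UNIV)+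
  have s1: "ode_solution cut_plane (of_nat N) 1 a d \<kappa> \<beta>" "ode_solution cut_plane (of_nat N) 1 a d \<kappa> (\<lambda>x. A x + l * cut_ln x * \<beta> x)"
  proof -
    have L: "\<forall>x\<in>cut_plane. (cut_ln has_field_derivative inverse x) (at x)" by (intro ballI DERIV_cut_ln)
    note s = sol[THEN spec, THEN spec, THEN mp, THEN mp, THEN mp, OF open_cut_plane zero_notin_cut_plane L]
    show "ode_solution cut_plane (of_nat N) 1 a d \<kappa> \<beta>" "ode_solution cut_plane (of_nat N) 1 a d \<kappa> (\<lambda>x. A x + l * cut_ln x * \<beta> x)"
      by (rule conjunct1[OF s], rule conjunct2[OF s])
  qed
  have s2: "ode_solution seam_plane (of_nat N) 1 a d \<kappa> \<beta>" "ode_solution seam_plane (of_nat N) 1 a d \<kappa> (\<lambda>x. A x + l * seam_ln x * \<beta> x)"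
  proof -
    have L: "\<forall>x\<in>seam_plane. (seam_ln has_field_derivative inverse x) (at x)" by (intro ballI DERIV_seam_ln)
    note s = sol[THEN spec, THEN spec, THEN mp, THEN mp, THEN mp, OF seam_plane(1,3) L]
    show "ode_solution seam_plane (of_nat N) 1 a d \<kappa> \<beta>" "ode_solution seam_plane (of_nat N) 1 a d \<kappa> (\<lambda>x. A x + l * seam_ln x * \<beta> x)"
      by (rule conjunct1[OF s], rule conjunct2[OF s])
  qed
  have wl1: "wronskian (\<lambda>x. p1 * \<beta> x + q1 * (A x + l * cut_ln x * \<beta> x)) (\<lambda>x. p2 * \<beta> x + q2 * (A x + l * cut_ln x * \<beta> x)) x =
    (p1 * q2 - q1 * p2) * D x" if "x \<in> cut_plane" for p1 q1 p2 q2 x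
    unfolding D_def by (rule wronskian_log_basis[OF open_cut_plane zero_notin_cut_plane Ah bh that]) (rule DERIV_cut_ln)
  have wl2: "wronskian (\<lambda>x. p1 * \<beta> x + q1 * (A x + l * seam_ln x * \<beta> x)) (\<lambda>x. p2 * \<beta> x + q2 * (A x + l * seam_ln x * \<beta> x)) x =
    (p1 * q2 - q1 * p2) * D x" if "x \<in> seam_plane" for p1 q1 p2 q2 x
    unfolding D_def by (rule wronskian_log_basis[OF seam_plane(1,3) Ah bh that]) (rule DERIV_seam_ln)
  have W: "wronskian \<beta> (\<lambda>x. A x + l * cut_ln x * \<beta> x) x \<noteq> 0" if "x \<in> cut_plane" for x
    using wl1[OF that, of 1 0 0 1] Dnz[rule_format, OF that] by (simp add: D_def)
  have cr: "\<exists>p q. \<forall>x\<in>cut_plane. F x = p * \<beta> x + q * (A x + l * cut_ln x * \<beta> x)"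
    if F: "ode_solution cut_plane (of_nat N) 1 a d \<kappa> F" for F
  proof (rule solution_span[OF K s1 _ F])
    show "wronskian \<beta> (\<lambda>x. A x + l * cut_ln x * \<beta> x) x \<noteq> 0" if "x \<in> cut_plane" for x by (rule W[OF that])
  next
    fix p q assume "\<And>x. x \<in> cut_plane \<Longrightarrow> F x = p * \<beta> x + q * (A x + l * cut_ln x * \<beta> x)"
    then show "\<exists>p q. \<forall>x\<in>cut_plane. F x = p * \<beta> x + q * (A x + l * cut_ln x * \<beta> x)" by blast
  qed
  obtain p1 q1 where fb: "\<forall>x\<in>cut_plane. f x = p1 * \<beta> x + q1 * (A x + l * cut_ln x * \<beta> x)" using cr[OF f] by blast
  obtain p2 q2 where hb: "\<forall>x\<in>cut_plane. h x = p2 * \<beta> x + q2 * (A x + l * cut_ln x * \<beta> x)" using cr[OF hs] by blast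
  note fb = fb[rule_format] and hb = hb[rule_format]
  have Gh: "G x = h x * exp (- (2 * g x a))" for x by (simp add: h_def exp_minus)
  \<comment> \<open>both solutions near the seam: \<open>ft\<close> agrees with \<open>f\<close> in the sector \<open>0\<close> and \<open>Gt\<close> with \<open>G\<close> in the sector \<open>3\<close>\<close>
  define ft where "ft = (\<lambda>x. (p1 - q1 * l * (2 * of_real pi * \<i>)) * \<beta> x + q1 * (A x + l * seam_ln x * \<beta> x))"
  define ht where "ht = (\<lambda>x. p2 * \<beta> x + q2 * (A x + l * seam_ln x * \<beta> x))"
  define Gt where "Gt = (\<lambda>x. ht x * exp (- (2 * g x a)))"
  have fts: "ode_solution seam_plane (of_nat N) 1 a d \<kappa> ft" unfolding ft_def by (rule ode_solution_lincomb[OF seam_plane(1) s2])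
  have hts: "ode_solution seam_plane (of_nat N) 1 a d \<kappa> ht" unfolding ht_def by (rule ode_solution_lincomb[OF seam_plane(1) s2])
  have htG: "ht = (\<lambda>x. Gt x * exp (2 * g x a))" by (simp add: Gt_def exp_minus fun_eq_iff)
  have gh: "(\<lambda>x. exp (- (2 * g x a))) holomorphic_on U" for U unfolding g_def by (intro holomorphic_intros) simp
  have Gth: "Gt holomorphic_on seam_plane" unfolding Gt_def using hts gh by (auto simp: ode_solution_def intro: holomorphic_on_mult)
  have "ft x = f x" if "x \<in> stokes_sector 0" for x
    proof -
    have xc: "x \<in> cut_plane" using stokes_sector_subset[of 0] that by auto
    show ?thesis unfolding ft_def fb[OF xc] conjunct2[OF seam_ln_sectors(2)[OF that]] by (simp add: algebra_simps)
  qed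
  then have asft: "asymptotic_on (stokes_sector 4) ft p c0"
    unfolding stokes_sector_4 by (intro asymptotic_on_cong[OF _ as(1)]) simp
  have "Gt x = G x" if "x \<in> stokes_sector 3" for x
  proof -
    have xc: "x \<in> cut_plane" using stokes_sector_subset[of 3] that by auto
    show ?thesis unfolding Gt_def Gh ht_def hb[OF xc] conjunct2[OF seam_ln_sectors(1)[OF that]] ..
  qed
  then have asGt: "asymptotic_on (stokes_sector 3) Gt q c3" by (intro asymptotic_on_cong[OF _ as(4)]) simp
  have fh: "f holomorphic_on cut_plane" using f by (simp add: ode_solution_def)
  have fth: "ft holomorphic_on seam_plane" using fts by (simp add: ode_solution_def)
  obtain w where w: "\<And>x. x \<in> cut_plane \<Longrightarrow> f x * deriv G x - deriv f x * G x + 2 * (x + a) * f x * G x = w * x ^ (p + q + 1)"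
    "\<And>x. x \<in> cut_plane \<Longrightarrow> wronskian f h x = w * (x ^ (p + q + 1) * exp (2 * g x a))"
    using wronskian_relation[OF open_cut_plane connected_cut_plane zero_notin_cut_plane N f G] unfolding h_def[symmetric] by blast
  obtain w' where w': "\<And>x. x \<in> seam_plane \<Longrightarrow> ft x * deriv Gt x - deriv ft x * Gt x + 2 * (x + a) * ft x * Gt x = w' * x ^ (p + q + 1)"
    "\<And>x. x \<in> seam_plane \<Longrightarrow> wronskian ft ht x = w' * (x ^ (p + q + 1) * exp (2 * g x a))"
    using wronskian_relation[OF seam_plane N fts Gth hts[unfolded htG]] unfolding htG[symmetric] by blast
  have cone: "crossing_ray k * y \<in> cut_plane" if "k < 3" "norm y \<ge> 1" "\<bar>Im y\<bar> \<le> Re y" for k y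
    using crossing_cone_cut_plane[of k y] that by fastforce
  have cone': "crossing_ray 3 * y \<in> seam_plane" if "norm y \<ge> 1" "\<bar>Im y\<bar> \<le> Re y" for y
    using crossing_cone_seam_plane[of y] that by fastforce
  have one_pos: "(0::real) < 1" by simp
  have cut: "w = 2 * cF * cG" "cone_bound f k p" "cone_bound G k q"
    if k: "k < 3" and aF: "asymptotic_on (stokes_sector (if even k then k else Suc k)) f p cF"
      and aG: "asymptotic_on (stokes_sector (if even k then Suc k else k)) G q cG" and cF: "cF \<noteq> 0" and cG: "cG \<noteq> 0" for k cF cG
  proof -
  show "w = 2 * cF * cG"
  proof (rule crossing(1)[where U = cut_plane and F = f and G = G and ?R0.0 = 1 and k = k and a = a and w = w and p = p and q = q and cF = cF and cG = cG])
    show "crossing_ray k * y \<in> cut_plane" if "norm y \<ge> 1" "\<bar>Im y\<bar> \<le> Re y" for y by (rule cone[OF k that])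
    show "f x * deriv G x - deriv f x * G x + 2 * (x + a) * f x * G x = w * x ^ (p + q + 1)" if "x \<in> cut_plane" for x
      by (rule w(1)[OF that])
  qed (rule open_cut_plane fh G(1) one_pos aF aG cF cG)+
  show "cone_bound f k p"
  proof (rule crossing(2)[where U = cut_plane and F = f and G = G and ?R0.0 = 1 and k = k and a = a and w = w and p = p and q = q and cF = cF and cG = cG])
    show "crossing_ray k * y \<in> cut_plane" if "norm y \<ge> 1" "\<bar>Im y\<bar> \<le> Re y" for y by (rule cone[OF k that])
    show "f x * deriv G x - deriv f x * G x + 2 * (x + a) * f x * G x = w * x ^ (p + q + 1)" if "x \<in> cut_plane" for x
      by (rule w(1)[OF that])
  qed (rule open_cut_plane fh G(1) one_pos aF aG cF cG)+
  show "cone_bound G k q"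
  proof (rule crossing(3)[where U = cut_plane and F = f and G = G and ?R0.0 = 1 and k = k and a = a and w = w and p = p and q = q and cF = cF and cG = cG])
    show "crossing_ray k * y \<in> cut_plane" if "norm y \<ge> 1" "\<bar>Im y\<bar> \<le> Re y" for y by (rule cone[OF k that])
    show "f x * deriv G x - deriv f x * G x + 2 * (x + a) * f x * G x = w * x ^ (p + q + 1)" if "x \<in> cut_plane" for x
      by (rule w(1)[OF that])
  qed (rule open_cut_plane fh G(1) one_pos aF aG cF cG)+
  qed
  have three: "Suc 0 = 1" "Suc 1 = 2" "Suc 2 = 3" "Suc 3 = 4" by simp_all
  have even3: "even (0::nat)" "odd (1::nat)" "even (2::nat)" "odd (3::nat)" by simp_all
  note sel = three even3 if_True if_False simp_thms
  note cut0 = cut[of 0 c0 c1, unfolded sel] and cut1 = cut[of 1 c2 c1, unfolded sel] and cut2 = cut[of 2 c2 c3, unfolded sel]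
  have as4: "asymptotic_on (stokes_sector (if even 3 then 3 else Suc 3)) ft p c0" "asymptotic_on (stokes_sector (if even 3 then Suc 3 else 3)) Gt q c3"
    unfolding sel using asft asGt by simp_all
  have k0: "w = 2 * c0 * c1" and b0: "cone_bound f 0 p" "cone_bound G 0 q" using cut0 as c by simp_all
  have k1: "w = 2 * c2 * c1" and b1: "cone_bound f 1 p" "cone_bound G 1 q" using cut1 as c by simp_all
  have k2: "w = 2 * c2 * c3" and b2: "cone_bound f 2 p" "cone_bound G 2 q" using cut2 as c by simp_all
  have k3: "w' = 2 * c0 * c3"
  proof (rule crossing(1)[where U = seam_plane and F = ft and G = Gt and ?R0.0 = 1 and k = 3 and a = a and w = w' and p = p and q = q and cF = c0 and cG = c3])
    show "crossing_ray 3 * y \<in> seam_plane" if "norm y \<ge> 1" "\<bar>Im y\<bar> \<le> Re y" for y by (rule cone'[OF that])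
    show "ft x * deriv Gt x - deriv ft x * Gt x + 2 * (x + a) * ft x * Gt x = w' * x ^ (p + q + 1)" if "x \<in> seam_plane" for x
      by (rule w'(1)[OF that])
  qed (rule seam_plane(1) fth Gth one_pos as4 as4 c(1) c(4))+
  have b3f: "cone_bound ft 3 p"
  proof (rule crossing(2)[where U = seam_plane and F = ft and G = Gt and ?R0.0 = 1 and k = 3 and a = a and w = w' and p = p and q = q and cF = c0 and cG = c3])
    show "crossing_ray 3 * y \<in> seam_plane" if "norm y \<ge> 1" "\<bar>Im y\<bar> \<le> Re y" for y by (rule cone'[OF that])
    show "ft x * deriv Gt x - deriv ft x * Gt x + 2 * (x + a) * ft x * Gt x = w' * x ^ (p + q + 1)" if "x \<in> seam_plane" for x
      by (rule w'(1)[OF that])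
  qed (rule seam_plane(1) fth Gth one_pos as4 as4 c(1) c(4))+
  have b3G: "cone_bound Gt 3 q"
  proof (rule crossing(3)[where U = seam_plane and F = ft and G = Gt and ?R0.0 = 1 and k = 3 and a = a and w = w' and p = p and q = q and cF = c0 and cG = c3])
    show "crossing_ray 3 * y \<in> seam_plane" if "norm y \<ge> 1" "\<bar>Im y\<bar> \<le> Re y" for y by (rule cone'[OF that])
    show "ft x * deriv Gt x - deriv ft x * Gt x + 2 * (x + a) * ft x * Gt x = w' * x ^ (p + q + 1)" if "x \<in> seam_plane" for x
      by (rule w'(1)[OF that])
  qed (rule seam_plane(1) fth Gth one_pos as4 as4 c(1) c(4))+
  have ww: "w = w'" using k0 k1 k2 k3 c by auto
  define x0 where "x0 = rcis 1 (of_nat 3 * pi / 2 + 0)"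
  have "x0 \<in> stokes_sector 3" unfolding x0_def by (rule rcis_stokes_sector) auto
  then have x0: "x0 \<in> cut_plane" "x0 \<in> seam_plane" using seam_ln_sectors(1) stokes_sector_subset[of 3] by auto
  have wc: "wronskian f h x0 = (p1 * q2 - q1 * p2) * D x0"
    unfolding wl1[OF x0(1), symmetric] by (rule wronskian_cong[OF open_cut_plane x0(1)]) (rule fb hb, assumption)+
  have "(p1 * q2 - q1 * p2) * D x0 = ((p1 - q1 * l * (2 * of_real pi * \<i>)) * q2 - q1 * p2) * D x0"
    using w(2)[OF x0(1)] w'(2)[OF x0(2)] unfolding ww wc ft_def ht_def wl2[OF x0(2)] by simp
  moreover have "D x0 \<noteq> 0" unfolding D_def by (rule Dnz[rule_format, OF x0(1)])
  ultimately have "p1 * q2 - q1 * p2 = (p1 - q1 * l * (2 * of_real pi * \<i>)) * q2 - q1 * p2" by simp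
  then have "q1 * l * q2 * (2 * of_real pi * \<i>) = 0" by (simp add: algebra_simps)
  then have "q1 * l * q2 = 0" by simp
  then have alt: "q1 = 0 \<or> l = 0 \<or> q2 = 0" by auto
  have cases4: "k = 0 \<or> k = 1 \<or> k = 2 \<or> k = (3::nat)" if "k < 4" for k using that by auto
  have polyf: "\<exists>P. degree P \<le> p \<and> (\<forall>x. p1 * \<beta> x + q1 * A x = poly P x)" if "l * q1 = 0"
  proof (rule polynomial_growth_imp_poly)
    show "(\<lambda>x. p1 * \<beta> x + q1 * A x) holomorphic_on UNIV" by (intro holomorphic_intros bh Ah)
    have e1: "f x = p1 * \<beta> x + q1 * A x" if "x \<in> cut_plane" for x using fb[OF that] \<open>l * q1 = 0\<close> by auto
    have e2: "ft x = p1 * \<beta> x + q1 * A x" for x using \<open>l * q1 = 0\<close> by (auto simp: ft_def)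
    show "cone_bound (\<lambda>x. p1 * \<beta> x + q1 * A x) k p" if "k < 4" for k
    proof -
      have "cone_bound (if k = 3 then ft else f) k p" using cases4[OF that] b0 b1 b2 b3f by (elim disjE) simp_all
      moreover have "(if k = 3 then ft else f) (crossing_ray k * y) = p1 * \<beta> (crossing_ray k * y) + q1 * A (crossing_ray k * y)"
        if "norm y \<ge> 1" "\<bar>Im y\<bar> \<le> Re y" for y
        using e1[OF cone[of k y]] e2[of "crossing_ray k * y"] that \<open>k < 4\<close> by (cases "k = 3") auto
      ultimately show ?thesis by (rule cone_bound_cong)
    qed
  qed
  have polyG: "\<exists>Q. degree Q \<le> q \<and> (\<forall>x. (p2 * \<beta> x + q2 * A x) * exp (- (2 * g x a)) = poly Q x)" if "l * q2 = 0"
  proof (rule polynomial_growth_imp_poly)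
    show "(\<lambda>x. (p2 * \<beta> x + q2 * A x) * exp (- (2 * g x a))) holomorphic_on UNIV" by (intro holomorphic_intros bh Ah gh)
    have e1: "G x = (p2 * \<beta> x + q2 * A x) * exp (- (2 * g x a))" if "x \<in> cut_plane" for x using hb[OF that] \<open>l * q2 = 0\<close> Gh[of x] by auto
    have e2: "Gt x = (p2 * \<beta> x + q2 * A x) * exp (- (2 * g x a))" for x using \<open>l * q2 = 0\<close> by (auto simp: Gt_def ht_def)
    show "cone_bound (\<lambda>x. (p2 * \<beta> x + q2 * A x) * exp (- (2 * g x a))) k q" if "k < 4" for k
    proof -
      have "cone_bound (if k = 3 then Gt else G) k q" using cases4[OF that] b0 b1 b2 b3G by (elim disjE) simp_all
      moreover have "(if k = 3 then Gt else G) (crossing_ray k * y) =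
          (p2 * \<beta> (crossing_ray k * y) + q2 * A (crossing_ray k * y)) * exp (- (2 * g (crossing_ray k * y) a))"
        if "norm y \<ge> 1" "\<bar>Im y\<bar> \<le> Re y" for y
        using e1[OF cone[of k y]] e2[of "crossing_ray k * y"] that \<open>k < 4\<close> by (cases "k = 3") auto
      ultimately show ?thesis by (rule cone_bound_cong)
    qed
  qed
  have pN: "p < N" "q < N" using N by auto
  have "q1 \<noteq> 0"
  proof
    assume q: "q1 = 0"
    have "l * q1 = 0" using q by simp
    from polyf[OF this] obtain P where P: "degree P \<le> p" "\<And>x. p1 * (x ^ N * E x) = poly P x" unfolding \<beta> q mult_zero_left add_0_right by blast
    then have "P = 0" using poly_vanishing_order[OF E _ P(2)] pN by simp
    then have z: "p1 * \<beta> x = 0" for x using P(2)[of x] by (simp only: \<beta> poly_0)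
    obtain x where x: "x \<in> stokes_sector 0" "f x \<noteq> 0" using asymptotic_on_nonzero[OF as(1) c(1)] by blast
    have "x \<in> cut_plane" using stokes_sector_subset[of 0] x(1) by (simp add: subset_iff)
    then have "f x = 0" unfolding fb[OF \<open>x \<in> cut_plane\<close>] q using z[of x] by (simp only: mult_zero_left add_0_right)
    then show False using x(2) by contradiction
  qed
  moreover have "q2 \<noteq> 0"
  proof
    assume q: "q2 = 0"
    have "l * q2 = 0" using q by simp
    from polyG[OF this] obtain Q where Q: "degree Q \<le> q" "\<And>x. p2 * (x ^ N * (E x * exp (- (2 * g x a)))) = poly Q x"
      unfolding \<beta> q mult_zero_left add_0_right mult.assoc by blast
    have "(\<lambda>x. E x * exp (- (2 * g x a))) holomorphic_on UNIV" by (intro holomorphic_intros E gh)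
    from poly_vanishing_order[OF this _ Q(2)] have "Q = 0" using Q(1) pN by simp
    then have z: "p2 * \<beta> x * exp (- (2 * g x a)) = 0" for x using Q(2)[of x] by (simp only: \<beta> mult.assoc poly_0)
    obtain x where x: "x \<in> stokes_sector 1" "G x \<noteq> 0" using asymptotic_on_nonzero[OF as(3) c(2)] by blast
    have "x \<in> cut_plane" using stokes_sector_subset[of 1] x(1) by (simp add: subset_iff)
    then have "G x = (p2 * \<beta> x + q2 * (A x + l * cut_ln x * \<beta> x)) * exp (- (2 * g x a))" unfolding Gh by (simp only: hb)
    then have "G x = 0" unfolding q using z[of x] by (simp only: mult_zero_left add_0_right)
    then show False using x(2) by contradiction
  qed
  ultimately have l: "l = 0" using alt by simp
  then have lz: "l * q1 = 0" "l * q2 = 0" by simp_all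
  obtain P where P: "degree P \<le> p" "\<And>x. p1 * \<beta> x + q1 * A x = poly P x" using polyf[OF lz(1)] by blast
  obtain Q where Q: "degree Q \<le> q" "\<And>x. (p2 * \<beta> x + q2 * A x) * exp (- (2 * g x a)) = poly Q x" using polyG[OF lz(2)] by blast
  have fP: "f x = poly P x" if "x \<in> cut_plane" for x using P(2)[of x] unfolding fb[OF that] l by (simp only: mult_zero_left add_0_right)
  have GQ: "G x = poly Q x" if "x \<in> cut_plane" for x using Q(2)[of x] unfolding Gh hb[OF that] l by (simp only: mult_zero_left add_0_right)
  have "P \<noteq> 0" using asymptotic_on_nonzero[OF as(1) c(1)] stokes_sector_subset[of 0] fP by fastforce
  moreover have "Q \<noteq> 0" using asymptotic_on_nonzero[OF as(3) c(2)] stokes_sector_subset[of 1] GQ by fastforce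
  ultimately show ?thesis by (intro that[OF P(1) _ fP Q(1) _ GQ])
qed

section \<open>Polynomial solutions as normalised solutions\<close>

lemma poly_has_fps_expansion: "poly (P :: complex poly) has_fps_expansion fps_of_poly P"
proof -
  have "eval_fps (fps_of_poly P) = poly P" by (simp add: fun_eq_iff)
  then show ?thesis using entire_eval_fps(2)[of "fps_of_poly P"] by simp
qed

lemma cut_plane_nonempty: "cut_plane \<noteq> {}"
  using stokes_sector_subset[of 0] rcis_stokes_sector[of 1 0 0] by auto

lemma ode_solution_poly: "ode_solution cut_plane K s a d \<kappa> (poly P) \<longleftrightarrow> fps_ode K s a d \<kappa> (fps_of_poly P) = 0"
  by (rule ode_solution_fps(2)[OF _ poly_has_fps_expansion open_cut_plane cut_plane_nonempty]) (intro holomorphic_intros)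

lemma ode_solution_cong:
  assumes U: "open U" and eq: "\<And>x. x \<in> U \<Longrightarrow> f x = h x" and f: "ode_solution U K s a d \<kappa> f"
  shows "ode_solution U K s a d \<kappa> h"
proof -
  have ev: "eventually (\<lambda>y. y \<in> U) (nhds x)" if "x \<in> U" for x using that U eventually_nhds_in_open by blast
  have d1: "deriv f x = deriv h x" if "x \<in> U" for x
    by (rule deriv_cong_ev[OF eventually_mono[OF ev[OF that]] refl]) (rule eq)
  have d2: "deriv (deriv f) x = deriv (deriv h) x" if "x \<in> U" for x
    by (rule deriv_cong_ev[OF eventually_mono[OF ev[OF that]] refl]) (rule d1)
  have "h holomorphic_on U" using f eq unfolding ode_solution_def by (metis holomorphic_transform)
  moreover have "ode_op K s a d \<kappa> h x = 0" if "x \<in> U" for x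
  proof -
    have "ode_op K s a d \<kappa> f x = 0" using f that unfolding ode_solution_def by blast
    then show ?thesis unfolding ode_op_def d1[OF that] d2[OF that] eq[OF that] .
  qed
  ultimately show ?thesis by (simp add: ode_solution_def)
qed

lemma asymptotic_on_poly: "asymptotic_on S (poly P) (degree P) (lead_coeff P)"
proof -
  define C where "C = (\<Sum>k<degree P. norm (coeff P k)) + 1"
  have "C > 0" unfolding C_def by (intro add_nonneg_pos sum_nonneg) auto
  moreover have "norm (poly P x / x ^ degree P - lead_coeff P) \<le> C / norm x" if x: "norm x \<ge> 1" for x
  proof -
    have x0: "x \<noteq> 0" using x by auto
    have "poly P x = (\<Sum>k<degree P. coeff P k * x ^ k) + lead_coeff P * x ^ degree P"
      unfolding poly_altdef by (simp flip: lessThan_Suc_atMost)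
    then have "poly P x / x ^ degree P - lead_coeff P = (\<Sum>k<degree P. coeff P k * x ^ k) / x ^ degree P"
      using x0 by (simp add: field_simps)
    also have "\<dots> = (\<Sum>k<degree P. coeff P k * x ^ k / x ^ degree P)" by (rule sum_divide_distrib)
    also have "norm \<dots> \<le> (\<Sum>k<degree P. norm (coeff P k) / norm x)"
    proof (rule order.trans[OF norm_sum sum_mono])
      fix k assume "k \<in> {..<degree P}"
      then have pw: "norm x ^ degree P = norm x ^ k * norm x ^ (degree P - k)" by (simp flip: power_add)
      have mono: "norm x \<le> norm x ^ (degree P - k)"
        using power_increasing[of 1 "degree P - k" "norm x"] x \<open>k \<in> _\<close> by simp
      have pk: "norm x ^ k > 0" using x0 by simp
      have bnd: "norm (coeff P k) * p / (p * r) \<le> norm (coeff P k) / n" if "p > 0" "n \<le> r" "n > 0" for p r n :: real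
        using that by (simp add: field_simps mult_right_mono)
      show "norm (coeff P k * x ^ k / x ^ degree P) \<le> norm (coeff P k) / norm x"
        unfolding norm_mult norm_divide norm_power pw by (rule bnd[OF pk mono]) (use x0 in simp)
    qed
    also have "\<dots> = (\<Sum>k<degree P. norm (coeff P k)) / norm x" by (rule sum_divide_distrib[symmetric])
    also have "\<dots> \<le> C / norm x" unfolding C_def by (intro divide_right_mono) auto
    finally show ?thesis .
  qed
  ultimately show ?thesis unfolding asymptotic_on_def by (intro exI[of _ C] exI[of _ 1]) auto
qed

lemma gauge_unique:
  "f * gauge_factor K s a x = y \<Longrightarrow> f = cut_powr x ((1 - K) / 2) * exp (- (s * g x a)) * y"
  using gauge_factor_cancel[of x K s a y] gauge_factor_nonzero[of K s a x] by (metis mult_right_cancel)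

text \<open>
  A polynomial of degree \<open>d\<close> has the required asymptotics in every direction, so a polynomial solution, with its leading
  coefficient normalised, is the subdominant solution in both sectors of the matching parity.
\<close>

lemma psi_infty_polynomial:
  assumes k: "k \<le> 3" and K: "K \<ge> 1" and deg: "ode_degree (of_nat K) (sector_sign k) \<theta> = of_nat (degree F)"
    and F: "F \<noteq> 0" "fps_ode (of_nat K) (sector_sign k) a (of_nat (degree F)) (ode_kappa (of_nat K) (sector_sign k) a b \<theta>) (fps_of_poly F) = 0"
  defines "c \<equiv> sector_coeff k / lead_coeff F"
  shows "is_psi_infty a b (of_nat K / 2) \<theta> k (\<lambda>x. cut_powr x ((1 - of_nat K) / 2) * exp (- (sector_sign k * g x a)) * poly (smult c F) x)" (is ?ex)
    and "is_psi_infty a b (of_nat K / 2) \<theta> k \<psi> \<Longrightarrow> x \<in> cut_plane \<Longrightarrow>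
      \<psi> x = cut_powr x ((1 - of_nat K) / 2) * exp (- (sector_sign k * g x a)) * poly (smult c F) x"
proof -
  let ?s = "sector_sign k" and ?\<kappa> = "ode_kappa (of_nat K) (sector_sign k) a b \<theta>" and ?F = "smult c F"
  have c: "c \<noteq> 0" using F by (simp add: c_def)
  have ode: "ode_solution cut_plane (of_nat K) ?s a (of_nat (degree F)) ?\<kappa> (poly ?F)"
    unfolding ode_solution_poly fps_of_poly_smult fps_ode_const_mult F(2) by simp
  have as: "asymptotic_on (stokes_sector k) (poly ?F) (degree F) (sector_coeff k)"
    using asymptotic_on_poly[of "stokes_sector k" ?F] c F by (simp add: c_def)
  note iff = is_psi_infty_iff[OF k deg, of a b]
  have gf: "(\<lambda>x. cut_powr x ((1 - of_nat K) / 2) * exp (- (?s * g x a)) * poly ?F x * gauge_factor (of_nat K) ?s a x) = poly ?F"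
    by (simp only: gauge_factor_cancel)
  have "oscillator_solution a b (of_nat K / 2) \<theta> (\<lambda>x. cut_powr x ((1 - of_nat K) / 2) * exp (- (?s * g x a)) * poly ?F x)"
    by (rule oscillator_solution_ode) (rule sector_sign_square, unfold deg, rule ode)
  then show ?ex unfolding iff gf using ode as by (simp add: oscillator_solution_def)
  show "\<psi> x = cut_powr x ((1 - of_nat K) / 2) * exp (- (?s * g x a)) * poly ?F x"
    if \<psi>: "is_psi_infty a b (of_nat K / 2) \<theta> k \<psi>" and x: "x \<in> cut_plane"
  proof (rule gauge_unique)
    show "\<psi> x * gauge_factor (of_nat K) ?s a x = poly ?F x"
      using psi_infty_ode_unique[OF k K conjunct1[OF conjunct2[OF iffD1[OF iff \<psi>]]] conjunct2[OF conjunct2[OF iffD1[OF iff \<psi>]]] ode as] x by simp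
  qed
qed

section \<open>Roots of solutions\<close>

lemma norm_cut_powr_real: "x \<noteq> 0 \<Longrightarrow> norm (cut_powr x (of_real \<sigma>)) = norm x powr \<sigma>"
proof -
  assume x: "x \<noteq> 0"
  have "exp (Re (cut_ln x)) = norm (exp (cut_ln x))" by simp
  also have "\<dots> = norm x" using exp_cut_ln[OF x] by simp
  finally have "Re (cut_ln x) = ln (norm x)" by (metis ln_exp)
  then show ?thesis using x by (simp add: cut_powr_def powr_def)
qed

text \<open>
  The complement of the cut plane lies on a line; a point is approached orthogonally to it.
\<close>

lemma cut_plane_islimpt: "x islimpt cut_plane"
  unfolding islimpt_approachable
proof (intro allI impI)
  fix e :: real assume e: "e > 0"
  define c where "c = Im (x * cis (pi / 4))"
  obtain t where t: "0 < t" "t < e" "c + t \<noteq> 0"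
  proof (cases "c + e / 2 = 0")
    case True
    then show ?thesis using e by (intro that[of "e / 3"]) auto
  next
    case False
    then show ?thesis using e by (intro that[of "e / 2"]) auto
  qed
  define y where "y = x + of_real t * cis (pi / 4)"
  have ii: "cis (pi / 4) * cis (pi / 4) = \<i>" by (simp add: cis_mult)
  have yc: "y * cis (pi / 4) = x * cis (pi / 4) + of_real t * \<i>"
    unfolding y_def distrib_right mult.assoc ii ..
  have "y \<in> cut_plane"
  proof (rule ccontr)
    assume "y \<notin> cut_plane"
    then obtain r where "y = of_real r * cis (- (pi / 4))" by (auto simp: cut_plane_def)
    then have "y * cis (pi / 4) = of_real r" by (simp add: mult.assoc cis_mult)
    then have "Im (x * cis (pi / 4) + of_real t * \<i>) = 0" unfolding yc by simp
    then show False using t by (simp add: c_def)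
  qed
  moreover have "dist y x < e" "y \<noteq> x" using t by (auto simp: y_def dist_norm norm_mult)
  ultimately show "\<exists>y\<in>cut_plane. y \<noteq> x \<and> dist y x < e" by blast
qed

lemma at_within_cut_plane_nontrivial: "at x within cut_plane \<noteq> bot"
  using cut_plane_islimpt trivial_limit_within by blast

text \<open>
  The power is discontinuous across the cut, but its absolute value is not. So the limits that define roots are taken
  for absolute values, where all factors but \<open>poly P\<close> are continuous and positive off the origin.
\<close>

lemma exactly_nonzero_simple_roots_poly:
  assumes \<psi>: "\<And>x. x \<in> cut_plane \<Longrightarrow> \<psi> x = cut_powr x (of_real \<sigma>) * exp (h x) * poly P x" and h: "continuous_on UNIV h"
    and P: "rsquarefree P" "poly P 0 \<noteq> 0"
  shows "exactly_nonzero_simple_roots \<psi> (degree P)"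
proof -
  define v where "v x = norm x powr \<sigma> * norm (exp (h x))" for x
  have n\<psi>: "norm (\<psi> x) = v x * norm (poly P x)" if "x \<in> cut_plane" for x
  proof -
    have "x \<noteq> 0" using that zero_notin_cut_plane by auto
    then show ?thesis by (simp add: \<psi>[OF that] v_def norm_mult norm_cut_powr_real del: norm_exp_eq_Re)
  qed
  have lim_v: "(v \<longlongrightarrow> v x) (at x within cut_plane)" and v0: "v x > 0" if "x \<noteq> 0" for x
  proof -
    have "(h \<longlongrightarrow> h x) (at x within cut_plane)"
      using h by (metis UNIV_I continuous_on_eq_continuous_within continuous_within tendsto_within_subset subset_UNIV)
    then show "(v \<longlongrightarrow> v x) (at x within cut_plane)" unfolding v_def[abs_def] using that by (intro tendsto_intros) auto
    show "v x > 0" using that by (simp add: v_def)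
  qed
  have lim_poly: "(poly Q \<longlongrightarrow> poly Q x) (at x within cut_plane)" for Q :: "complex poly" and x
    by (intro tendsto_intros)
  have ev: "eventually (\<lambda>y. y \<in> cut_plane) (at x within cut_plane)" for x by (simp add: eventually_at_filter)
  have roots: "(\<psi> \<longlongrightarrow> 0) (at x within cut_plane) \<longleftrightarrow> poly P x = 0" if x: "x \<noteq> 0" for x
  proof -
    have "((\<lambda>y. v y * norm (poly P y)) \<longlongrightarrow> v x * norm (poly P x)) (at x within cut_plane)"
      by (intro tendsto_mult tendsto_norm lim_v[OF x] lim_poly)
    moreover have "eventually (\<lambda>y. v y * norm (poly P y) = norm (\<psi> y)) (at x within cut_plane)"
      using ev by eventually_elim (simp add: n\<psi>)
    ultimately have lim: "((\<lambda>y. norm (\<psi> y)) \<longlongrightarrow> v x * norm (poly P x)) (at x within cut_plane)" by (rule Lim_transform_eventually)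
    have "(\<psi> \<longlongrightarrow> 0) (at x within cut_plane) \<longleftrightarrow> ((\<lambda>y. norm (\<psi> y)) \<longlongrightarrow> 0) (at x within cut_plane)"
      by (rule tendsto_norm_zero_iff[symmetric])
    also have "\<dots> \<longleftrightarrow> v x * norm (poly P x) = 0"
      using lim tendsto_unique[OF at_within_cut_plane_nontrivial] by fastforce
    also have "\<dots> \<longleftrightarrow> poly P x = 0" using v0[OF x] by simp
    finally show ?thesis .
  qed
  have P0: "P \<noteq> 0" using P by auto
  have set: "nonzero_roots \<psi> = {x. poly P x = 0}" 
    unfolding nonzero_roots_def by (rule Collect_cong) (metis roots P(2))
  have "card {x. poly P x = 0} = (\<Sum>x\<in>{x. poly P x = 0}. count (proots P) x)"
  proof -
    have "count (proots P) x = 1" if "poly P x = 0" for x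
      using that P(1) P0 by (metis count_proots order_root rsquarefree_def)
    then show ?thesis by simp
  qed
  also have "\<dots> = size (proots P)" using P0 by (simp add: size_multiset_overloaded_eq)
  finally have "card {x. poly P x = 0} = degree P" by (simp add: size_proots_complex)
  moreover have "simple_root \<psi> x" if xr: "poly P x = 0" for x
  proof -
    have x0: "x \<noteq> 0" using xr P(2) by auto
    obtain S where S: "P = [:-x, 1:] * S" using xr by (auto simp: poly_eq_0_iff_dvd)
    have "poly S x \<noteq> 0"
    proof
      assume "poly S x = 0"
      then have "poly (pderiv P) x = 0" unfolding S pderiv_mult by (simp add: pderiv_pCons)
      then show False using P(1) xr by (simp add: rsquarefree_roots)
    qed
    have "\<psi> \<in> \<Theta>[at x within cut_plane](\<lambda>y. y - x)"
    proof (rule bigthetaI_tendsto_norm)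
      show "v x * norm (poly S x) \<noteq> 0" using v0[OF x0] \<open>poly S x \<noteq> 0\<close> by simp
      have "((\<lambda>y. v y * norm (poly S y)) \<longlongrightarrow> v x * norm (poly S x)) (at x within cut_plane)"
        by (intro tendsto_mult tendsto_norm lim_v[OF x0] lim_poly)
      moreover have "eventually (\<lambda>y. v y * norm (poly S y) = norm (\<psi> y / (y - x))) (at x within cut_plane)"
        unfolding eventually_at_filter
      proof (intro always_eventually allI impI)
        fix y assume y: "y \<noteq> x" "y \<in> cut_plane"
        have PS: "poly P y = (y - x) * poly S y" by (simp add: S algebra_simps)
        have "norm (\<psi> y / (y - x)) = v y * (norm (y - x) * norm (poly S y)) / norm (y - x)"
          unfolding norm_divide n\<psi>[OF y(2)] PS norm_mult ..
        then show "v y * norm (poly S y) = norm (\<psi> y / (y - x))" using y(1) by simp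
      qed
      ultimately show "((\<lambda>y. norm (\<psi> y / (y - x))) \<longlongrightarrow> v x * norm (poly S x)) (at x within cut_plane)"
        by (rule Lim_transform_eventually)
    qed
    then show ?thesis using roots[OF x0] xr by (simp add: simple_root_def)
  qed
  ultimately show ?thesis unfolding exactly_nonzero_simple_roots_def set using poly_roots_finite[OF P0] by simp
qed

text \<open>
  At a double root \<open>x \<noteq> 0\<close> the term \<open>x F''\<close> of the equation would vanish to a smaller order than all others.
\<close>

lemma ode_no_double_root:
  assumes F: "F \<noteq> 0" "fps_ode K s a d \<kappa> (fps_of_poly F) = 0" and x: "x \<noteq> 0"
  shows "\<not> (poly F x = 0 \<and> poly (pderiv F) x = 0)"
proof
  assume "poly F x = 0 \<and> poly (pderiv F) x = 0"
  then have r: "poly F x = 0" "poly (pderiv F) x = 0" by auto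
  have nz: "pderiv p \<noteq> 0" if "p \<noteq> 0" "poly p x = 0" for p :: "complex poly"
  proof
    assume "pderiv p = 0"
    then have "degree p = 0" by (simp add: pderiv_eq_0_iff)
    then obtain c where "p = [:c:]" by (rule degree_eq_zeroE)
    then show False using that by simp
  qed
  have F': "pderiv F \<noteq> 0" and F'': "pderiv (pderiv F) \<noteq> 0" using nz F r by auto
  define j where "j = order x (pderiv (pderiv F))"
  have o1: "order x (pderiv F) = Suc j" unfolding j_def by (rule order_pderiv[OF F' r(2)])
  have o0: "order x F = Suc (Suc j)" using order_pderiv[OF F(1) r(1)] o1 by simp
  have d: "deriv (poly p) = poly (pderiv p)" for p :: "complex poly" by (intro ext DERIV_imp_deriv poly_DERIV)
  have "\<forall>x. ode_op K s a d \<kappa> (poly F) x = 0"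
  proof -
    have "poly F holomorphic_on UNIV" by (intro holomorphic_intros)
    from ode_solution_fps(1)[OF this poly_has_fps_expansion, of K s a d \<kappa>] F(2) show ?thesis by blast
  qed
  then have "poly ([:0, 1:] * pderiv (pderiv F)) y = poly (([:0, 2 * s:] * [:a, 1:] - [:1 - K:]) * pderiv F - [:\<kappa>, 2 * s * d:] * F) y" for y
    unfolding ode_op_def d by (auto simp: algebra_simps dest: spec[of _ y])
  then have "poly ([:0, 1:] * pderiv (pderiv F)) = poly (([:0, 2 * s:] * [:a, 1:] - [:1 - K:]) * pderiv F - [:\<kappa>, 2 * s * d:] * F)"
    by (intro ext)
  then have eq: "[:0, 1:] * pderiv (pderiv F) = ([:0, 2 * s:] * [:a, 1:] - [:1 - K:]) * pderiv F - [:\<kappa>, 2 * s * d:] * F"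
    by (simp only: poly_eq_poly_eq_iff)
  have "[:-x, 1:] ^ Suc j dvd pderiv F" "[:-x, 1:] ^ Suc j dvd F" using o0 o1 by (auto simp only: order_divides)
  then have "[:-x, 1:] ^ Suc j dvd [:0, 1:] * pderiv (pderiv F)" unfolding eq by (intro dvd_diff dvd_mult)
  then have "Suc j \<le> order x ([:0, 1:] * pderiv (pderiv F))" using F'' by (simp only: order_divides) simp
  also have "\<dots> = order x [:0, 1:] + j" unfolding j_def using F'' by (intro order_mult) simp
  also have "order x [:0, 1:] = 0" using x by (intro order_0I) simp
  finally show False by simp
qed

section \<open>Solutions near the origin\<close>

text \<open>
  Without the logarithm, the gauge transform of the dominant solution is an entire function with value \<open>1\<close> at the origin.
\<close>

lemma apparent_imp_fps:
  assumes s: "s * s = 1" and ap: "apparent_singularity a b (of_nat K / 2) \<theta>"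
  shows "\<exists>U. fps_nth U 0 \<noteq> 0 \<and> fps_ode (of_nat K) s a (ode_degree (of_nat K) s \<theta>) (ode_kappa (of_nat K) s a b \<theta>) U = 0"
proof -
  obtain \<psi> u where os: "oscillator_solution a b (of_nat K / 2) \<theta> \<psi>" and u0: "u 0 = 1"
    and u: "\<forall>x\<in>cut_plane. summable (\<lambda>k. u k * x ^ k) \<and> \<psi> x = cut_powr x (1 / 2 - of_nat K / 2) * (\<Sum>k. u k * x ^ k)"
    using ap unfolding apparent_singularity_def is_psi_minus_def mult_zero_left add_0_left by blast
  define U where "U = Abs_fps u"
  have "conv_radius u \<ge> \<infinity>"
  proof (rule conv_radius_geI_ex')
    fix r :: real assume "0 < r"
    then have "rcis r 0 \<in> cut_plane" by (intro rcis_cut_plane) auto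
    then show "summable (\<lambda>n. u n * of_real r ^ n)" using u by (auto simp: rcis_def)
  qed
  then have "fps_conv_radius U = \<infinity>" by (simp add: fps_conv_radius_def U_def)
  note ent = entire_eval_fps[OF this]
  define f where "f = (\<lambda>x. eval_fps U x * exp (s * g x a))"
  have fh: "f holomorphic_on UNIV" unfolding f_def g_def by (intro holomorphic_intros ent(1)) simp_all
  have "\<psi> x * gauge_factor (of_nat K) s a x = f x" if x: "x \<in> cut_plane" for x
  proof -
    have "1 / 2 - of_nat K / 2 + (of_nat K - 1) / 2 = (0::complex)" by (simp add: field_simps)
    then have cp: "cut_powr x (1 / 2 - of_nat K / 2) * cut_powr x ((of_nat K - 1) / 2) = 1"
      by (simp only: cut_powr_add[symmetric] cut_powr_0)
    have "\<psi> x = cut_powr x (1 / 2 - of_nat K / 2) * eval_fps U x" using u x by (simp add: eval_fps_def U_def)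
    then have "\<psi> x * gauge_factor (of_nat K) s a x =
      (cut_powr x (1 / 2 - of_nat K / 2) * cut_powr x ((of_nat K - 1) / 2)) * (eval_fps U x * exp (s * g x a))"
      by (simp only: gauge_factor_def mult_ac)
    then show ?thesis unfolding cp f_def by simp
  qed
  moreover have "ode_solution cut_plane (of_nat K) s a (ode_degree (of_nat K) s \<theta>) (ode_kappa (of_nat K) s a b \<theta>) (\<lambda>x. \<psi> x * gauge_factor (of_nat K) s a x)"
    using oscillator_solution_iff_ode[OF s, of \<psi> a b "of_nat K" \<theta>] os unfolding oscillator_solution_def by blast
  ultimately have "ode_solution cut_plane (of_nat K) s a (ode_degree (of_nat K) s \<theta>) (ode_kappa (of_nat K) s a b \<theta>) f"
    by (rule ode_solution_cong[OF open_cut_plane])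
  moreover have ex: "f has_fps_expansion fps_expansion f 0" by (rule has_fps_expansion_fps_expansion[OF open_UNIV UNIV_I fh])
  ultimately have "fps_ode (of_nat K) s a (ode_degree (of_nat K) s \<theta>) (ode_kappa (of_nat K) s a b \<theta>) (fps_expansion f 0) = 0"
    using ode_solution_fps(2)[OF fh ex open_cut_plane cut_plane_nonempty] by blast
  moreover have "fps_nth (fps_expansion f 0) 0 \<noteq> 0"
    unfolding fps_nth_fps_expansion[OF ex] by (simp add: f_def g_def eval_fps_at_0 U_def u0)
  ultimately show ?thesis by blast
qed

lemma is_psi_plusI:
  assumes s: "s * s = 1" and E: "E holomorphic_on UNIV" "E 0 = 1"
    and ode: "ode_solution cut_plane (of_nat K) s a (ode_degree (of_nat K) s \<theta>) (ode_kappa (of_nat K) s a b \<theta>) (\<lambda>x. x ^ K * E x)"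
  shows "is_psi_plus a b (of_nat K / 2) \<theta> (\<lambda>x. cut_powr x ((1 - of_nat K) / 2) * exp (- (s * g x a)) * (x ^ K * E x))"
proof -
  define h where "h = (\<lambda>x. exp (- (s * g x a)) * E x)"
  have hh: "h holomorphic_on UNIV" unfolding h_def g_def by (intro holomorphic_intros E(1)) simp_all
  have h0: "h 0 = 1" by (simp add: h_def g_def E)
  have "((\<lambda>y. (h y - h 0) / (y - 0)) \<longlongrightarrow> deriv h 0) (at 0)"
    using holomorphic_derivI[OF hh open_UNIV UNIV_I, of 0] by (simp only: has_field_derivative_iff)
  then have "((\<lambda>y. (h y - 1) / y) \<longlongrightarrow> deriv h 0) (at 0 within cut_plane)"
    unfolding h0 diff_zero by (rule tendsto_within_subset) simp
  moreover have "eventually (\<lambda>y. y \<noteq> 0) (at 0 within cut_plane)" by (simp add: eventually_at_filter)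
  ultimately have bo: "(\<lambda>y. h y - 1) \<in> O[at 0 within cut_plane](\<lambda>x. x)" by (rule bigoI_tendsto)
  have "cut_powr x ((1 - of_nat K) / 2) * exp (- (s * g x a)) * (x ^ K * E x) = cut_powr x (1 / 2 + of_nat K / 2) * (1 + (h x - 1))"
    if "x \<in> cut_plane" for x
  proof -
    have x0: "x \<noteq> 0" using that zero_notin_cut_plane by auto
    have "1 / 2 + of_nat K / 2 = (1 - of_nat K) / 2 + (of_nat K :: complex)" by (simp add: field_simps)
    then have "cut_powr x (1 / 2 + of_nat K / 2) = cut_powr x ((1 - of_nat K) / 2) * x ^ K"
      by (simp only: cut_powr_add cut_powr_of_nat[OF x0])
    then show ?thesis by (simp add: h_def mult_ac)
  qed
  then show ?thesis unfolding is_psi_plus_def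
    using oscillator_solution_ode[OF s ode] bo by (intro conjI exI[of _ "\<lambda>x. h x - 1"]) auto
qed

text \<open>
  The definition of an apparent singularity refers to \<open>\<psi>\<^sub>+\<close> also when the coefficient of the logarithm is zero.
\<close>

lemma psi_plus_exists:
  assumes K: "K \<ge> 1"
  shows "\<exists>\<phi>. is_psi_plus a b (of_nat K / 2) \<theta> \<phi>"
proof (rule frobenius_solutions[OF K, of 1 a "ode_degree (of_nat K) 1 \<theta>" "ode_kappa (of_nat K) 1 a b \<theta>"])
  fix E assume E: "E holomorphic_on UNIV" "E 0 = 1"
    and ode: "ode_solution UNIV (of_nat K) 1 a (ode_degree (of_nat K) 1 \<theta>) (ode_kappa (of_nat K) 1 a b \<theta>) (\<lambda>x. x ^ K * E x)"
  have "ode_solution cut_plane (of_nat K) 1 a (ode_degree (of_nat K) 1 \<theta>) (ode_kappa (of_nat K) 1 a b \<theta>) (\<lambda>x. x ^ K * E x)"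
    using ode unfolding ode_solution_def by (auto intro: holomorphic_on_subset)
  from is_psi_plusI[OF _ E this] show ?thesis by auto
qed

lemma entire_imp_apparent:
  assumes K: "K \<ge> 1" and s: "s * s = 1" and f: "f holomorphic_on UNIV" "f 0 = 1"
    and ode: "ode_solution cut_plane (of_nat K) s a (ode_degree (of_nat K) s \<theta>) (ode_kappa (of_nat K) s a b \<theta>) f"
  shows "apparent_singularity a b (of_nat K / 2) \<theta>"
proof -
  define h where "h = (\<lambda>x. exp (- (s * g x a)) * f x)"
  have hh: "h holomorphic_on A" for A
  proof -
    have "h holomorphic_on UNIV" unfolding h_def g_def by (intro holomorphic_intros f(1)) simp_all
    then show ?thesis by (rule holomorphic_on_subset) simp
  qed
  define u where "u k = (deriv ^^ k) h 0 / fact k" for k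
  have sm: "(\<lambda>k. u k * x ^ k) sums h x" for x
    using holomorphic_power_series[OF hh, of x 0 "norm x + 1"] by (simp add: u_def)
  obtain \<phi> where \<phi>: "is_psi_plus a b (of_nat K / 2) \<theta> \<phi>" using psi_plus_exists[OF K] by blast
  define \<psi> where "\<psi> = (\<lambda>x. cut_powr x ((1 - of_nat K) / 2) * exp (- (s * g x a)) * f x)"
  have ex: "1 / 2 - of_nat K / 2 = (1 - of_nat K) / (2::complex)" by (simp add: field_simps)
  have "u 0 = 1" by (simp add: u_def h_def g_def f(2))
  moreover have "summable (\<lambda>k. u k * x ^ k) \<and> \<psi> x = 0 * cut_ln x * \<phi> x + cut_powr x (1 / 2 - of_nat K / 2) * (\<Sum>k. u k * x ^ k)" for x
    unfolding ex sums_unique[OF sm, symmetric] using sums_summable[OF sm] by (simp add: \<psi>_def h_def mult_ac)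
  moreover have "oscillator_solution a b (of_nat K / 2) \<theta> \<psi>" unfolding \<psi>_def by (rule oscillator_solution_ode[OF s ode])
  ultimately have "is_psi_minus a b (of_nat K / 2) \<theta> 0 \<psi>" unfolding is_psi_minus_def using \<phi> by blast
  then show ?thesis unfolding apparent_singularity_def using K by blast
qed

lemma poly_low_coeffs_zero:
  assumes F: "\<And>x. x \<in> cut_plane \<Longrightarrow> poly F x = x ^ K * B x" and B: "(B \<longlongrightarrow> L) (at 0 within cut_plane)" and j: "j < K"
  shows "coeff F j = 0"
proof (cases "F = 0")
  case False
  define r where "r = order 0 F"
  obtain S where S: "F = [:0, 1:] ^ r * S" "poly S 0 \<noteq> 0"
    using order_decomp[OF False, of 0] unfolding r_def by (auto simp: poly_eq_0_iff_dvd)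
  have "\<not> r < K"
  proof
    assume rK: "r < K"
    have "poly S x = x ^ (K - r) * B x" if "x \<in> cut_plane" for x
    proof -
      have "x \<noteq> 0" using that zero_notin_cut_plane by auto
      moreover have "x ^ K = x ^ r * x ^ (K - r)" using rK by (simp flip: power_add)
      ultimately show ?thesis using F[OF that] by (simp add: S mult.assoc)
    qed
    then have "eventually (\<lambda>x. x ^ (K - r) * B x = poly S x) (at 0 within cut_plane)" by (simp add: eventually_at_filter)
    moreover have "((\<lambda>x. x ^ (K - r) * B x) \<longlongrightarrow> 0 ^ (K - r) * L) (at 0 within cut_plane)" by (intro tendsto_intros B)
    ultimately have "(poly S \<longlongrightarrow> 0 ^ (K - r) * L) (at 0 within cut_plane)" by (rule Lim_transform_eventually[rotated])
    moreover have "(poly S \<longlongrightarrow> poly S 0) (at 0 within cut_plane)" by (intro tendsto_intros)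
    ultimately have "poly S 0 = 0 ^ (K - r) * L" using tendsto_unique[OF at_within_cut_plane_nontrivial] by blast
    then show False using S rK by simp
  qed
  then have "j < r" using j by simp
  moreover have "F = monom 1 r * S" by (simp add: S monom_altdef)
  ultimately show ?thesis by (simp add: coeff_monom_mult)
qed simp

text \<open>
  A solution dependent on \<open>\<psi>\<^sub>+\<close> is of order \<open>x^(1/2 + K/2)\<close> at the origin, hence its gauge transform is of order \<open>x^K\<close>.
\<close>

lemma dependent_psi_plus_imp_low_coeffs_zero:
  assumes \<phi>: "is_psi_plus a b (of_nat K / 2) \<theta> \<phi>" and dep: "linearly_dependent \<psi> \<phi>"
    and F: "\<And>x. x \<in> cut_plane \<Longrightarrow> \<psi> x = cut_powr x ((1 - of_nat K) / 2) * exp (- (s * g x a)) * poly F x" and j: "j < K"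
  shows "coeff F j = 0"
proof -
  obtain c d where cd: "(c, d) \<noteq> (0, 0)" "\<forall>x\<in>cut_plane. c * \<psi> x + d * \<phi> x = 0" using dep unfolding linearly_dependent_def by blast
  obtain r where r: "r \<in> O[at 0 within cut_plane](\<lambda>x. x)" "\<forall>x\<in>cut_plane. \<phi> x = cut_powr x (1 / 2 + of_nat K / 2) * (1 + r x)"
    using \<phi> unfolding is_psi_plus_def by blast
  obtain M where M: "eventually (\<lambda>x. norm (r x) \<le> M * norm x) (at 0 within cut_plane)" using landau_o.bigE[OF r(1)] by blast
  have "((\<lambda>x::complex. M * norm x) \<longlongrightarrow> M * norm (0::complex)) (at 0 within cut_plane)" by (intro tendsto_intros)
  then have r0: "(r \<longlongrightarrow> 0) (at 0 within cut_plane)" by (intro Lim_null_comparison[OF M]) simp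
  have "c \<noteq> 0"
  proof
    assume "c = 0"
    then have "1 + r x = 0" if "x \<in> cut_plane" for x using cd r(2) that by auto
    then have "eventually (\<lambda>x. r x = - 1) (at 0 within cut_plane)" by (simp add: eventually_at_filter add_eq_0_iff)
    then have "(r \<longlongrightarrow> - 1) (at 0 within cut_plane)" by (rule tendsto_eventually)
    then have "(0::complex) = - 1" using r0 tendsto_unique[OF at_within_cut_plane_nontrivial] by blast
    then show False by simp
  qed
  have "poly F x = x ^ K * (- (d / c) * (1 + r x) * exp (s * g x a))" if x: "x \<in> cut_plane" for x
  proof -
    let ?G = "gauge_factor (of_nat K) s a x"
    have x0: "x \<noteq> 0" using x zero_notin_cut_plane by auto
    have "1 / 2 + of_nat K / 2 + (of_nat K - 1) / 2 = (of_nat K :: complex)" by (simp add: field_simps)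
    then have "cut_powr x (1 / 2 + of_nat K / 2) * cut_powr x ((of_nat K - 1) / 2) = x ^ K"
      by (simp only: cut_powr_add[symmetric] cut_powr_of_nat[OF x0])
    then have pg: "cut_powr x (1 / 2 + of_nat K / 2) * (1 + r x) * ?G = x ^ K * ((1 + r x) * exp (s * g x a))"
      unfolding gauge_factor_def by (simp only: mult_ac)
    have "(c * \<psi> x + d * \<phi> x) * ?G = 0" using cd x by simp
    then have "c * (\<psi> x * ?G) + d * (cut_powr x (1 / 2 + of_nat K / 2) * (1 + r x) * ?G) = 0"
      using r(2) x by (simp add: distrib_right mult.assoc)
    then have "c * poly F x + d * (x ^ K * ((1 + r x) * exp (s * g x a))) = 0"
      unfolding pg F[OF x] gauge_factor_cancel .
    then have "c * poly F x = c * (x ^ K * (- (d / c) * (1 + r x) * exp (s * g x a)))"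
      using \<open>c \<noteq> 0\<close> by (simp add: eq_neg_iff_add_eq_0 mult_ac)
    then show ?thesis by (rule mult_left_cancel[OF \<open>c \<noteq> 0\<close>, THEN iffD1])
  qed
  moreover have "((\<lambda>x. - (d / c) * (1 + r x) * exp (s * g x a)) \<longlongrightarrow> - (d / c) * (1 + 0) * exp (s * g 0 a)) (at 0 within cut_plane)"
    unfolding g_def by (intro tendsto_intros r0) simp_all
  ultimately show ?thesis using j by (rule poly_low_coeffs_zero)
qed

section \<open>Solutions subdominant at infinity and at the origin\<close>

lemma dependent_multiples:
  assumes "\<And>x. x \<in> cut_plane \<Longrightarrow> \<psi> x = c * f x" "\<And>x. x \<in> cut_plane \<Longrightarrow> \<phi> x = d * f x" "c \<noteq> 0"
  shows "linearly_dependent \<psi> \<phi>"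
  unfolding linearly_dependent_def using assms by (intro exI[of _ d] exI[of _ "- c"]) auto

lemma polynomial_solution_imp_one_sided:
  assumes k: "k \<le> 1" and n: "n \<ge> 1" and m: "m \<ge> 1"
    and deg: "ode_degree (of_nat n) (sector_sign k) \<theta> = of_nat (m + n - 1)"
    and F: "fps_ode (of_nat n) (sector_sign k) a (of_nat (m + n - 1)) (ode_kappa (of_nat n) (sector_sign k) a b \<theta>) (fps_of_poly F) = 0"
      "degree F = m + n - 1" "coeff F n \<noteq> 0" "\<And>j. j < n \<Longrightarrow> coeff F j = 0"
  shows "is_psi_infty a b (of_nat n / 2) \<theta> k \<sim>\<^sub>s is_psi_plus a b (of_nat n / 2) \<theta>"
    and "is_psi_infty a b (of_nat n / 2) \<theta> k \<sim>\<^sub>s is_psi_infty a b (of_nat n / 2) \<theta> (k + 2)"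
    and "is_psi_infty a b (of_nat n / 2) \<theta> k \<psi> \<Longrightarrow>
      (\<exists>p. degree p = m - 1 \<and> rsquarefree p \<and> poly p 0 \<noteq> 0 \<and>
        (\<forall>x\<in>cut_plane. \<psi> x = cut_powr x ((of_nat n + 1) / 2) * exp (- (sector_sign k * g x a)) * poly p x)) \<and>
      exactly_nonzero_simple_roots \<psi> (m - 1)"
proof -
  let ?s = "sector_sign k"
  have F0: "F \<noteq> 0" using F(3) by auto
  define p0 where "p0 = poly_shift n F"
  have Fp0: "F = monom 1 n * p0" by (rule poly_eqI) (simp add: p0_def coeff_monom_mult coeff_poly_shift F(4))
  have p00: "poly p0 0 \<noteq> 0" using F(3) by (simp add: poly_0_coeff_0 p0_def coeff_poly_shift)
  then have p0nz: "p0 \<noteq> 0" by auto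
  have dp0: "degree p0 = m - 1"
    using F(2) p0nz unfolding Fp0 by (simp add: degree_mult_eq degree_monom_eq monom_eq_0_iff)
  have ode: "F \<noteq> 0" "fps_ode (of_nat n) ?s a (of_nat (degree F)) (ode_kappa (of_nat n) ?s a b \<theta>) (fps_of_poly F) = 0"
    using F0 F(1,2) by simp_all
  have deg': "ode_degree (of_nat n) ?s \<theta> = of_nat (degree F)" using deg F(2) by simp
  define lc where "lc = sector_coeff k / lead_coeff F"
  have lc: "lc \<noteq> 0" using F0 by (simp add: lc_def)
  have k3: "k \<le> 3" "k + 2 \<le> 3" using k by auto
  have sh: "sector_sign (k + 2) = ?s" "sector_coeff (k + 2) = sector_coeff k" by (simp_all add: sector_sign_def sector_coeff_def)
  define ex where "ex = (\<lambda>x. cut_powr x ((1 - of_nat n) / 2) * exp (- (?s * g x a)) * poly (smult lc F) x)"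
  have ex1: "is_psi_infty a b (of_nat n / 2) \<theta> k ex"
    unfolding ex_def lc_def by (rule psi_infty_polynomial(1)[OF k3(1) n deg' ode])
  have ex2: "is_psi_infty a b (of_nat n / 2) \<theta> (k + 2) ex"
    using psi_infty_polynomial(1)[OF k3(2) n, unfolded sh, OF deg' ode] unfolding ex_def lc_def .
  have uniq: "\<psi> x = ex x" if "is_psi_infty a b (of_nat n / 2) \<theta> k \<psi>" "x \<in> cut_plane" for \<psi> x
    unfolding ex_def lc_def by (rule psi_infty_polynomial(2)[OF k3(1) n deg' ode that])
  show "is_psi_infty a b (of_nat n / 2) \<theta> k \<sim>\<^sub>s is_psi_infty a b (of_nat n / 2) \<theta> (k + 2)"
    unfolding dependent_solutions_def using ex1 ex2 by (intro exI[of _ ex] conjI dependent_multiples[where c = 1 and d = 1 and f = ex]) auto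
  define E where "E = (\<lambda>x. poly p0 x / poly p0 0)"
  have Eh: "E holomorphic_on UNIV" "E 0 = 1" unfolding E_def using p00 by (auto intro!: holomorphic_intros)
  have Ef: "(\<lambda>x. x ^ n * E x) = poly (smult (1 / poly p0 0) F)" by (simp add: fun_eq_iff Fp0 E_def poly_monom)
  have "ode_solution cut_plane (of_nat n) ?s a (ode_degree (of_nat n) ?s \<theta>) (ode_kappa (of_nat n) ?s a b \<theta>) (\<lambda>x. x ^ n * E x)"
    unfolding Ef ode_solution_poly fps_of_poly_smult fps_ode_const_mult deg' ode(2) by simp
  note pl = is_psi_plusI[OF sector_sign_square Eh this]
  show "is_psi_infty a b (of_nat n / 2) \<theta> k \<sim>\<^sub>s is_psi_plus a b (of_nat n / 2) \<theta>"
    unfolding dependent_solutions_def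
  proof (intro exI conjI)
    show "linearly_dependent ex (\<lambda>x. cut_powr x ((1 - of_nat n) / 2) * exp (- (?s * g x a)) * (x ^ n * E x))"
    proof (rule dependent_multiples[where c = lc and d = "1 / poly p0 0" and f = "\<lambda>x. cut_powr x ((1 - of_nat n) / 2) * exp (- (?s * g x a)) * poly F x"])
      show "ex x = lc * (cut_powr x ((1 - of_nat n) / 2) * exp (- (?s * g x a)) * poly F x)" for x by (simp add: ex_def)
      show "cut_powr x ((1 - of_nat n) / 2) * exp (- (?s * g x a)) * (x ^ n * E x) =
        1 / poly p0 0 * (cut_powr x ((1 - of_nat n) / 2) * exp (- (?s * g x a)) * poly F x)" for x
        by (simp add: E_def Fp0 poly_monom)
    qed (rule lc)
  qed (rule ex1 pl)+
  define p where "p = smult lc p0"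
  have p: "degree p = m - 1" "poly p 0 \<noteq> 0" using lc dp0 p00 by (simp_all add: p_def)
  have lF: "smult lc F = monom 1 n * p" by (simp add: p_def Fp0)
  have sq: "rsquarefree p"
    unfolding rsquarefree_roots
  proof (intro allI notI)
    fix y assume y: "poly p y = 0 \<and> poly (pderiv p) y = 0"
    then have "y \<noteq> 0" using p(2) by auto
    moreover have "fps_ode (of_nat n) ?s a (of_nat (degree F)) (ode_kappa (of_nat n) ?s a b \<theta>) (fps_of_poly (smult lc F)) = 0"
      unfolding fps_of_poly_smult fps_ode_const_mult ode(2) by simp
    moreover have "smult lc F \<noteq> 0" using lc F0 by simp
    moreover have "poly (smult lc F) y = 0 \<and> poly (pderiv (smult lc F)) y = 0" unfolding lF pderiv_mult using y by simp
    ultimately show False using ode_no_double_root by blast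
  qed
  have form: "ex x = cut_powr x ((of_nat n + 1) / 2) * exp (- (?s * g x a)) * poly p x" if "x \<in> cut_plane" for x
  proof -
    have x0: "x \<noteq> 0" using that zero_notin_cut_plane by auto
    have "(of_nat n + 1) / 2 = (1 - of_nat n) / 2 + (of_nat n :: complex)" by (simp add: field_simps)
    then have "cut_powr x ((of_nat n + 1) / 2) = cut_powr x ((1 - of_nat n) / 2) * x ^ n"
      by (simp only: cut_powr_add cut_powr_of_nat[OF x0])
    then show ?thesis unfolding ex_def lF by (simp add: poly_monom mult_ac)
  qed
  show "(\<exists>p. degree p = m - 1 \<and> rsquarefree p \<and> poly p 0 \<noteq> 0 \<and>
        (\<forall>x\<in>cut_plane. \<psi> x = cut_powr x ((of_nat n + 1) / 2) * exp (- (sector_sign k * g x a)) * poly p x)) \<and>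
      exactly_nonzero_simple_roots \<psi> (m - 1)" if \<psi>: "is_psi_infty a b (of_nat n / 2) \<theta> k \<psi>" for \<psi>
  proof -
    have f: "\<psi> x = cut_powr x ((of_nat n + 1) / 2) * exp (- (?s * g x a)) * poly p x" if "x \<in> cut_plane" for x
      using uniq[OF \<psi> that] form[OF that] by simp
    have r: "(of_nat n + 1) / 2 = (of_real ((real n + 1) / 2) :: complex)" by simp
    have "exactly_nonzero_simple_roots \<psi> (degree p)"
    proof (rule exactly_nonzero_simple_roots_poly[OF _ _ sq p(2)])
      show "\<psi> x = cut_powr x (of_real ((real n + 1) / 2)) * exp (- (?s * g x a)) * poly p x" if "x \<in> cut_plane" for x
        using f[OF that] unfolding r .
      show "continuous_on UNIV (\<lambda>x. - (?s * g x a))" unfolding g_def by (intro continuous_intros) simp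
    qed
    then show ?thesis using f p sq by auto
  qed
qed

text \<open>
  The common core of the first two statements, with \<open>k = 0\<close> and \<open>k = 1\<close>. Apparentness yields \<open>P\<close> and a polynomial \<open>F\<close>, which is the
  gauge transform of \<open>\<psi>\<^sub>k\<close> by uniqueness; dependence on \<open>\<psi>\<^sub>+\<close> makes it divisible by \<open>x^n\<close> and yields \<open>Q\<close>.
  Conversely \<open>Q\<close> gives back such an \<open>F\<close>, and \<open>P\<close> gives an entire solution that does not vanish at the origin.
\<close>

lemma one_sided:
  fixes a b \<theta> :: complex and k m n :: nat
  assumes k: "k \<le> 1" and n: "n \<ge> 1" and m: "m \<ge> 1"
    and deg: "ode_degree (of_nat n) (sector_sign k) \<theta> = of_nat (m + n - 1)"
  defines "\<kappa> \<equiv> ode_kappa (of_nat n) (sector_sign k) a b \<theta>"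
  shows "apparent_singularity a b (of_nat n / 2) \<theta> \<and> is_psi_infty a b (of_nat n / 2) \<theta> k \<sim>\<^sub>s is_psi_plus a b (of_nat n / 2) \<theta> \<longleftrightarrow>
    (\<exists>P Q. poly_solution (m + n) (sector_sign k) a n \<kappa> P \<and>
       poly_solution (m + n) (- sector_sign k) a m (\<kappa> - 2 * sector_sign k * a * (of_nat (m + n) - 1)) Q)" (is "?C \<longleftrightarrow> ?PQ")
    and "apparent_singularity a b (of_nat n / 2) \<theta> \<and> is_psi_infty a b (of_nat n / 2) \<theta> k \<sim>\<^sub>s is_psi_plus a b (of_nat n / 2) \<theta> \<Longrightarrow>
      is_psi_infty a b (of_nat n / 2) \<theta> k \<sim>\<^sub>s is_psi_infty a b (of_nat n / 2) \<theta> (k + 2) \<and>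
      (\<forall>\<psi>. is_psi_infty a b (of_nat n / 2) \<theta> k \<psi> \<longrightarrow>
      (\<exists>p. degree p = m - 1 \<and> rsquarefree p \<and> poly p 0 \<noteq> 0 \<and>
        (\<forall>x\<in>cut_plane. \<psi> x = cut_powr x ((of_nat n + 1) / 2) * exp (- (sector_sign k * g x a)) * poly p x)) \<and>
      exactly_nonzero_simple_roots \<psi> (m - 1))"
proof -
  let ?s = "sector_sign k"
  define N where "N = m + n"
  have nN: "n < N" "N = m + n" using m by (simp_all add: N_def)
  have N1: "of_nat (m + n - 1) = (of_nat N - 1 :: complex)" using m by (simp add: N_def of_nat_diff)
  have k3: "k \<le> 3" using k by simp
  have forward: "\<exists>P Q. poly_solution N ?s a n \<kappa> P \<and> poly_solution N (- ?s) a m (\<kappa> - 2 * ?s * a * (of_nat N - 1)) Q" if C: ?C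
  proof -
    obtain U where U: "fps_nth U 0 \<noteq> 0" "fps_ode (of_nat n) ?s a (of_nat N - 1) \<kappa> U = 0"
      using apparent_imp_fps[OF sector_sign_square conjunct1[OF C], of k] unfolding deg N1 \<kappa>_def by blast
    obtain P where P: "poly_solution N ?s a n \<kappa> P" using apparent_imp_poly_solution[OF n nN(1) U] by blast
    obtain F where F: "degree F = N - 1" "F \<noteq> 0" "fps_ode (of_nat n) ?s a (of_nat N - 1) \<kappa> (fps_of_poly F) = 0"
      using apparent_imp_polynomial_solution[OF n nN(1) sector_sign_square U] by blast
    obtain \<psi> \<phi> where \<psi>: "is_psi_infty a b (of_nat n / 2) \<theta> k \<psi>" "is_psi_plus a b (of_nat n / 2) \<theta> \<phi>" "linearly_dependent \<psi> \<phi>"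
      using C unfolding dependent_solutions_def by blast
    define lc where "lc = sector_coeff k / lead_coeff F"
    have lc: "lc \<noteq> 0" using F(2) by (simp add: lc_def)
    have dF: "of_nat (degree F) = (of_nat N - 1 :: complex)" unfolding F(1) using N1 by (simp add: N_def)
    have F': "F \<noteq> 0" "fps_ode (of_nat n) ?s a (of_nat (degree F)) (ode_kappa (of_nat n) ?s a b \<theta>) (fps_of_poly F) = 0"
      using F(2,3) unfolding dF \<kappa>_def by simp_all
    have deg': "ode_degree (of_nat n) ?s \<theta> = of_nat (degree F)" unfolding deg dF N1 ..
    have "\<psi> x = cut_powr x ((1 - of_nat n) / 2) * exp (- (?s * g x a)) * poly (smult lc F) x" if "x \<in> cut_plane" for x
      unfolding lc_def by (rule psi_infty_polynomial(2)[OF k3 n deg' F' \<psi>(1) that])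
    from dependent_psi_plus_imp_low_coeffs_zero[OF \<psi>(2,3) this] have "coeff F j = 0" if "j < n" for j
      using that lc by auto
    from polynomial_solution_imp_poly_solution[OF m n nN(2) sector_sign_nz F(3,1,2) this] P show ?thesis by blast
  qed
  have backward: "\<exists>F. fps_ode (of_nat n) ?s a (of_nat (m + n - 1)) (ode_kappa (of_nat n) ?s a b \<theta>) (fps_of_poly F) = 0 \<and>
      degree F = m + n - 1 \<and> coeff F n \<noteq> 0 \<and> (\<forall>j<n. coeff F j = 0)"
    if "poly_solution N (- ?s) a m (\<kappa> - 2 * ?s * a * (of_nat N - 1)) Q" for Q
    using poly_solution_imp_polynomial_solution[OF n nN(2) sector_sign_nz that] unfolding N1 \<kappa>_def N_def by blast
  have "?C" if PQ: "poly_solution N ?s a n \<kappa> P" "poly_solution N (- ?s) a m (\<kappa> - 2 * ?s * a * (of_nat N - 1)) Q" for P Q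
  proof
    obtain F where F: "fps_ode (of_nat n) ?s a (of_nat (m + n - 1)) (ode_kappa (of_nat n) ?s a b \<theta>) (fps_of_poly F) = 0"
      "degree F = m + n - 1" "coeff F n \<noteq> 0" "\<forall>j<n. coeff F j = 0" using backward[OF PQ(2)] by blast
    show "is_psi_infty a b (of_nat n / 2) \<theta> k \<sim>\<^sub>s is_psi_plus a b (of_nat n / 2) \<theta>"
      by (rule polynomial_solution_imp_one_sided(1)[OF k n m deg F(1-3)]) (use F(4) in blast)
    define U where "U = frobenius (of_nat n) ?s a (of_nat N - 1) \<kappa> (\<lambda>_. 0)"
    have U: "fps_ode (of_nat n) ?s a (of_nat N - 1) \<kappa> U = 0" unfolding U_def by (rule poly_solution_imp_apparent[OF n nN(1) PQ(1)])
    have z: "(\<lambda>_. 0) = fps_nth (0 :: complex fps)" by (simp add: fun_eq_iff)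
    have "fps_conv_radius U = \<infinity>" unfolding U_def z by (rule frobenius_entire) simp
    note ent = entire_eval_fps[OF this]
    show "apparent_singularity a b (of_nat n / 2) \<theta>"
    proof (rule entire_imp_apparent[OF n sector_sign_square ent(1)])
      show "eval_fps U 0 = 1" by (simp add: eval_fps_at_0 U_def)
      show "ode_solution cut_plane (of_nat n) ?s a (ode_degree (of_nat n) ?s \<theta>) (ode_kappa (of_nat n) ?s a b \<theta>) (eval_fps U)"
        unfolding ode_solution_fps(2)[OF ent open_cut_plane cut_plane_nonempty] deg N1 using U unfolding \<kappa>_def .
    qed
  qed
  then show "?C \<longleftrightarrow> ?PQ" using forward unfolding N_def by blast
  show "is_psi_infty a b (of_nat n / 2) \<theta> k \<sim>\<^sub>s is_psi_infty a b (of_nat n / 2) \<theta> (k + 2) \<and>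
      (\<forall>\<psi>. is_psi_infty a b (of_nat n / 2) \<theta> k \<psi> \<longrightarrow>
      (\<exists>p. degree p = m - 1 \<and> rsquarefree p \<and> poly p 0 \<noteq> 0 \<and>
        (\<forall>x\<in>cut_plane. \<psi> x = cut_powr x ((of_nat n + 1) / 2) * exp (- (sector_sign k * g x a)) * poly p x)) \<and>
      exactly_nonzero_simple_roots \<psi> (m - 1))" if C: ?C
  proof -
    obtain Q where Q: "poly_solution N (- ?s) a m (\<kappa> - 2 * ?s * a * (of_nat N - 1)) Q" using forward[OF C] by blast
    obtain F where F: "fps_ode (of_nat n) ?s a (of_nat (m + n - 1)) (ode_kappa (of_nat n) ?s a b \<theta>) (fps_of_poly F) = 0"
      "degree F = m + n - 1" "coeff F n \<noteq> 0" "\<forall>j<n. coeff F j = 0" using backward[OF Q] by blast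
    note F4 = F(4)[rule_format]
    show ?thesis
      using polynomial_solution_imp_one_sided(2,3)[OF k n m deg F(1-3) F4] by blast
  qed
qed

section \<open>Solutions subdominant in opposite sectors\<close>

lemma asymptotic_on_scale:
  assumes "asymptotic_on S f D c"
  shows "asymptotic_on S (\<lambda>x. k * f x) D (k * c)"
proof -
  obtain C R where CR: "C > 0" "R > 0" "\<And>x. x \<in> S \<Longrightarrow> norm x \<ge> R \<Longrightarrow> norm (f x / x ^ D - c) \<le> C / norm x"
    using assms unfolding asymptotic_on_def by blast
  have "norm (k * f x / x ^ D - k * c) \<le> (norm k * C + 1) / norm x" if "x \<in> S" "norm x \<ge> R" for x
  proof -
    have "k * f x / x ^ D - k * c = k * (f x / x ^ D - c)" by (simp add: algebra_simps)
    then have "norm (k * f x / x ^ D - k * c) = norm k * norm (f x / x ^ D - c)" by (simp only: norm_mult)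
    also have "\<dots> \<le> norm k * (C / norm x)" using CR(3)[OF that] by (intro mult_left_mono) auto
    also have "\<dots> \<le> (norm k * C + 1) / norm x" by (simp add: divide_right_mono)
    finally show ?thesis .
  qed
  moreover have "norm k * C + 1 > 0" using CR(1) by (simp add: add_nonneg_pos)
  ultimately show ?thesis using CR(2) unfolding asymptotic_on_def by (intro exI[of _ "norm k * C + 1"] exI[of _ R]) auto
qed

text \<open>
  Dependence transports the asymptotics of \<open>\<psi>\<^sub>k\<^sub>+\<^sub>2\<close> to \<open>\<psi>\<^sub>k\<close>; the leading coefficient in the second sector is known to be nonzero only.
\<close>

lemma dependent_opposite_asymptotics:
  assumes k: "k \<le> 1" and deg: "ode_degree K (sector_sign k) \<theta> = of_nat D"
    and dep: "is_psi_infty a b (K / 2) \<theta> k \<sim>\<^sub>s is_psi_infty a b (K / 2) \<theta> (k + 2)"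
  obtains \<psi> c where "is_psi_infty a b (K / 2) \<theta> k \<psi>" "c \<noteq> 0"
    "asymptotic_on (stokes_sector k) (\<lambda>x. \<psi> x * gauge_factor K (sector_sign k) a x) D (sector_coeff k)"
    "asymptotic_on (stokes_sector (k + 2)) (\<lambda>x. \<psi> x * gauge_factor K (sector_sign k) a x) D c"
proof -
  let ?G = "gauge_factor K (sector_sign k) a"
  obtain \<psi> \<phi> where \<psi>: "is_psi_infty a b (K / 2) \<theta> k \<psi>" and \<phi>: "is_psi_infty a b (K / 2) \<theta> (k + 2) \<phi>" and ld: "linearly_dependent \<psi> \<phi>"
    using dep unfolding dependent_solutions_def by blast
  have k3: "k \<le> 3" "k + 2 \<le> 3" using k by auto
  have sh: "sector_sign (k + 2) = sector_sign k" "sector_coeff (k + 2) = sector_coeff k" by (simp_all add: sector_sign_def sector_coeff_def)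
  have a\<psi>: "asymptotic_on (stokes_sector k) (\<lambda>x. \<psi> x * ?G x) D (sector_coeff k)"
    using is_psi_infty_iff[OF k3(1) deg] \<psi> by blast
  have a\<phi>: "asymptotic_on (stokes_sector (k + 2)) (\<lambda>x. \<phi> x * ?G x) D (sector_coeff k)"
    using is_psi_infty_iff[OF k3(2), unfolded sh, OF deg] \<phi> by blast
  obtain c d where cd: "(c, d) \<noteq> (0, 0)" "\<forall>x\<in>cut_plane. c * \<psi> x + d * \<phi> x = 0" using ld unfolding linearly_dependent_def by blast
  note sub = stokes_sector_subset[OF k3(1)] stokes_sector_subset[OF k3(2)]
  have "d \<noteq> 0"
  proof
    assume "d = 0"
    then have "\<psi> x = 0" if "x \<in> cut_plane" for x using cd that by auto
    then show False using asymptotic_on_nonzero[OF a\<psi> sector_coeff_nz] sub(1) by auto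
  qed
  have "c \<noteq> 0"
  proof
    assume "c = 0"
    then have "\<phi> x = 0" if "x \<in> cut_plane" for x using cd that by auto
    then show False using asymptotic_on_nonzero[OF a\<phi> sector_coeff_nz] sub(2) by auto
  qed
  have "- (d / c) * (\<phi> x * ?G x) = \<psi> x * ?G x" if "x \<in> stokes_sector (k + 2)" for x
  proof -
    have "c * \<psi> x + d * \<phi> x = 0" using cd(2) sub(2) that by blast
    then have "\<psi> x = - (d / c) * \<phi> x" using \<open>c \<noteq> 0\<close> by (simp add: field_simps eq_neg_iff_add_eq_0)
    then show ?thesis by simp
  qed
  then have "asymptotic_on (stokes_sector (k + 2)) (\<lambda>x. \<psi> x * ?G x) D (- (d / c) * sector_coeff k)"
    by (rule asymptotic_on_cong[OF _ asymptotic_on_scale[OF a\<phi>]])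
  from that[OF \<psi> _ a\<psi> this] show ?thesis using \<open>c \<noteq> 0\<close> \<open>d \<noteq> 0\<close> by simp
qed

lemma poly_solution_psi_infty:
  assumes k: "k \<le> 1" and r: "r \<ge> 1" "r \<le> K"
    and deg: "ode_degree (of_nat K) (sector_sign k) \<theta> = of_nat (r - 1)"
    and P: "poly_solution K (sector_sign k) a r (ode_kappa (of_nat K) (sector_sign k) a b \<theta>) P"
  shows "is_psi_infty a b (of_nat K / 2) \<theta> k \<sim>\<^sub>s is_psi_infty a b (of_nat K / 2) \<theta> (k + 2)"
    and "apparent_singularity a b (of_nat K / 2) \<theta>"
    and "is_psi_infty a b (of_nat K / 2) \<theta> k \<psi> \<Longrightarrow>
      (\<exists>p. degree p = r - 1 \<and> rsquarefree p \<and> poly p 0 \<noteq> 0 \<and>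
        (\<forall>x\<in>cut_plane. \<psi> x = cut_powr x ((1 - of_nat K) / 2) * exp (- (sector_sign k * g x a)) * poly p x)) \<and>
      exactly_nonzero_simple_roots \<psi> (r - 1)"
proof -
  let ?s = "sector_sign k" and ?\<kappa> = "ode_kappa (of_nat K) (sector_sign k) a b \<theta>"
  have dP: "degree P = r - 1" by (rule poly_solution_degree[OF P sector_sign_nz])
  have K: "K \<ge> 1" using r by simp
  have r1: "of_nat (r - 1) = (of_nat r - 1 :: complex)" using r by (simp add: of_nat_diff)
  have ode: "P \<noteq> 0" "fps_ode (of_nat K) ?s a (of_nat (degree P)) ?\<kappa> (fps_of_poly P) = 0"
    using P unfolding poly_solution_def dP r1 by auto
  have P0: "coeff P 0 \<noteq> 0" by (rule poly_solution_0[OF P r(2)])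
  have deg': "ode_degree (of_nat K) ?s \<theta> = of_nat (degree P)" using deg dP by simp
  define lc where "lc = sector_coeff k / lead_coeff P"
  have lc: "lc \<noteq> 0" using ode(1) by (simp add: lc_def)
  have k3: "k \<le> 3" "k + 2 \<le> 3" using k by auto
  have sh: "sector_sign (k + 2) = ?s" "sector_coeff (k + 2) = sector_coeff k" by (simp_all add: sector_sign_def sector_coeff_def)
  define p where "p = smult lc P"
  define ex where "ex = (\<lambda>x. cut_powr x ((1 - of_nat K) / 2) * exp (- (?s * g x a)) * poly p x)"
  have ex1: "is_psi_infty a b (of_nat K / 2) \<theta> k ex"
    unfolding ex_def p_def lc_def by (rule psi_infty_polynomial(1)[OF k3(1) K deg' ode])
  have ex2: "is_psi_infty a b (of_nat K / 2) \<theta> (k + 2) ex"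
    using psi_infty_polynomial(1)[OF k3(2) K, unfolded sh, OF deg' ode] unfolding ex_def p_def lc_def .
  have uniq: "\<psi> x = ex x" if "is_psi_infty a b (of_nat K / 2) \<theta> k \<psi>" "x \<in> cut_plane" for \<psi> x
    unfolding ex_def p_def lc_def by (rule psi_infty_polynomial(2)[OF k3(1) K deg' ode that])
  show "is_psi_infty a b (of_nat K / 2) \<theta> k \<sim>\<^sub>s is_psi_infty a b (of_nat K / 2) \<theta> (k + 2)"
    unfolding dependent_solutions_def using ex1 ex2 by (intro exI[of _ ex] conjI dependent_multiples[where c = 1 and d = 1 and f = ex]) auto
  have sol: "fps_ode (of_nat K) ?s a (of_nat (degree P)) ?\<kappa> (fps_of_poly (smult c P)) = 0" for c
    unfolding fps_of_poly_smult fps_ode_const_mult ode(2) by simp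
  show "apparent_singularity a b (of_nat K / 2) \<theta>"
  proof (rule entire_imp_apparent[OF K sector_sign_square])
    show "poly (smult (1 / coeff P 0) P) holomorphic_on UNIV" by (intro holomorphic_intros)
    show "poly (smult (1 / coeff P 0) P) 0 = 1" using P0 by (simp add: poly_0_coeff_0)
    show "ode_solution cut_plane (of_nat K) ?s a (ode_degree (of_nat K) ?s \<theta>) ?\<kappa> (poly (smult (1 / coeff P 0) P))"
      unfolding ode_solution_poly deg' by (rule sol)
  qed
  have p: "degree p = r - 1" "poly p 0 \<noteq> 0" "p \<noteq> 0" using lc dP P0 ode(1) by (simp_all add: p_def poly_0_coeff_0)
  have "\<not> (poly p y = 0 \<and> poly (pderiv p) y = 0)" for y
  proof (cases "y = 0")
    case False
    show ?thesis by (rule ode_no_double_root[OF p(3) sol[of lc, folded p_def] False])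
  qed (use p in simp)
  then have sq: "rsquarefree p" by (simp add: rsquarefree_roots)
  show "(\<exists>p. degree p = r - 1 \<and> rsquarefree p \<and> poly p 0 \<noteq> 0 \<and>
        (\<forall>x\<in>cut_plane. \<psi> x = cut_powr x ((1 - of_nat K) / 2) * exp (- (sector_sign k * g x a)) * poly p x)) \<and>
      exactly_nonzero_simple_roots \<psi> (r - 1)" if \<psi>: "is_psi_infty a b (of_nat K / 2) \<theta> k \<psi>" for \<psi>
  proof -
    have f: "\<psi> x = cut_powr x ((1 - of_nat K) / 2) * exp (- (?s * g x a)) * poly p x" if "x \<in> cut_plane" for x
      using uniq[OF \<psi> that] unfolding ex_def .
    have rr: "(1 - of_nat K) / 2 = (of_real ((1 - real K) / 2) :: complex)" by simp
    have "exactly_nonzero_simple_roots \<psi> (degree p)"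
    proof (rule exactly_nonzero_simple_roots_poly[OF _ _ sq p(2)])
      show "\<psi> x = cut_powr x (of_real ((1 - real K) / 2)) * exp (- (?s * g x a)) * poly p x" if "x \<in> cut_plane" for x
        using f[OF that] unfolding rr .
      show "continuous_on UNIV (\<lambda>x. - (?s * g x a))" unfolding g_def by (intro continuous_intros) simp
    qed
    then show ?thesis using f p sq by auto
  qed
qed

text \<open>
  \<open>\<phi>\<close> is used in both gauges: with \<open>s = - 1\<close> it has the asymptotics, with \<open>s = 1\<close> it solves the same equation as \<open>\<psi>\<close>.
\<close>

lemma two_sided:
  assumes m: "m \<ge> 1" and n: "n \<ge> 1"
    and deg0: "ode_degree (of_nat (m + n)) 1 \<theta> = of_nat (n - 1)" and deg1: "ode_degree (of_nat (m + n)) (- 1) \<theta> = of_nat (m - 1)"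
    and dep: "is_psi_infty a b (of_nat (m + n) / 2) \<theta> 0 \<sim>\<^sub>s is_psi_infty a b (of_nat (m + n) / 2) \<theta> 2"
      "is_psi_infty a b (of_nat (m + n) / 2) \<theta> 1 \<sim>\<^sub>s is_psi_infty a b (of_nat (m + n) / 2) \<theta> 3"
  shows "\<exists>P Q. poly_solution (m + n) 1 a n (ode_kappa (of_nat (m + n)) 1 a b \<theta>) P \<and>
    poly_solution (m + n) (- 1) a m (ode_kappa (of_nat (m + n)) (- 1) a b \<theta>) Q"
proof -
  define N where "N = m + n"
  have Npq: "N = (n - 1) + (m - 1) + 2" using m n by (simp add: N_def)
  have s01: "sector_sign 0 = 1" "sector_sign 1 = - 1" "(0::nat) + 2 = 2" "(1::nat) + 2 = 3" by (simp_all add: sector_sign_def)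
  note dg0 = deg0[folded N_def] and dg1 = deg1[folded N_def]
  have i0: "is_psi_infty a b (of_nat N / 2) \<theta> 0 \<psi> \<Longrightarrow> \<psi> holomorphic_on cut_plane \<and>
    ode_solution cut_plane (of_nat N) 1 a (of_nat (n - 1)) (ode_kappa (of_nat N) 1 a b \<theta>) (\<lambda>x. \<psi> x * gauge_factor (of_nat N) 1 a x)" for \<psi>
    using is_psi_infty_iff[of 0 "of_nat N" \<theta> "n - 1" a b \<psi>, unfolded s01] dg0 by simp
  have i1: "is_psi_infty a b (of_nat N / 2) \<theta> 1 \<psi> \<Longrightarrow> \<psi> holomorphic_on cut_plane \<and>
    ode_solution cut_plane (of_nat N) (- 1) a (of_nat (m - 1)) (ode_kappa (of_nat N) (- 1) a b \<theta>) (\<lambda>x. \<psi> x * gauge_factor (of_nat N) (- 1) a x)" for \<psi>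
    using is_psi_infty_iff[of 1 "of_nat N" \<theta> "m - 1" a b \<psi>, unfolded s01] dg1 by simp
  obtain \<psi> c2 where \<psi>: "is_psi_infty a b (of_nat N / 2) \<theta> 0 \<psi>" "c2 \<noteq> 0"
    "asymptotic_on (stokes_sector 0) (\<lambda>x. \<psi> x * gauge_factor (of_nat N) 1 a x) (n - 1) (sector_coeff 0)"
    "asymptotic_on (stokes_sector 2) (\<lambda>x. \<psi> x * gauge_factor (of_nat N) 1 a x) (n - 1) c2"
    using dependent_opposite_asymptotics[of 0 "of_nat N" \<theta> "n - 1" a b, unfolded s01, OF _ dg0 dep(1)[folded N_def]] by blast
  obtain \<phi> c3 where \<phi>: "is_psi_infty a b (of_nat N / 2) \<theta> 1 \<phi>" "c3 \<noteq> 0"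
    "asymptotic_on (stokes_sector 1) (\<lambda>x. \<phi> x * gauge_factor (of_nat N) (- 1) a x) (m - 1) (sector_coeff 1)"
    "asymptotic_on (stokes_sector 3) (\<lambda>x. \<phi> x * gauge_factor (of_nat N) (- 1) a x) (m - 1) c3"
    using dependent_opposite_asymptotics[of 1 "of_nat N" \<theta> "m - 1" a b, unfolded s01, OF _ dg1 dep(2)[folded N_def]] by blast
  define G where "G = (\<lambda>x. \<phi> x * gauge_factor (of_nat N) (- 1) a x)"
  have Gs: "ode_solution cut_plane (of_nat N) (- 1) a (of_nat (m - 1)) (ode_kappa (of_nat N) (- 1) a b \<theta>) G"
    unfolding G_def using i1[OF \<phi>(1)] by blast
  then have Gh: "G holomorphic_on cut_plane" by (simp add: ode_solution_def)
  have "G x * exp (2 * g x a) = \<phi> x * gauge_factor (of_nat N) 1 a x" for x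
  proof -
    have "exp (- g x a) * exp (2 * g x a) = exp (g x a)" by (simp flip: exp_add)
    then show ?thesis unfolding G_def gauge_factor_def by (simp add: mult.assoc)
  qed
  moreover have "ode_solution cut_plane (of_nat N) 1 a (of_nat (n - 1)) (ode_kappa (of_nat N) 1 a b \<theta>) (\<lambda>x. \<phi> x * gauge_factor (of_nat N) 1 a x)"
  proof -
    have h: "\<phi> holomorphic_on cut_plane" using i1[OF \<phi>(1)] by blast
    have "oscillator_solution a b (of_nat N / 2) \<theta> \<phi>" using \<phi>(1) by (simp add: is_psi_infty_def)
    then show ?thesis using oscillator_solution_iff_ode[OF _ h, of 1 a b "of_nat N" \<theta>] unfolding dg0 by simp
  qed
  ultimately have Gs': "ode_solution cut_plane (of_nat N) 1 a (of_nat (n - 1)) (ode_kappa (of_nat N) 1 a b \<theta>) (\<lambda>x. G x * exp (2 * g x a))"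
    by simp
  show ?thesis
  proof (rule opposite_sectors_imp_polynomial[OF Npq conjunct2[OF i0[OF \<psi>(1)]] Gh Gs' \<psi>(3,4) \<phi>(3,4)[folded G_def] sector_coeff_nz sector_coeff_nz \<psi>(2) \<phi>(2)])
    fix P Q assume P: "degree P \<le> n - 1" "P \<noteq> 0" "\<And>x. x \<in> cut_plane \<Longrightarrow> \<psi> x * gauge_factor (of_nat N) 1 a x = poly P x"
      and Q: "degree Q \<le> m - 1" "Q \<noteq> 0" "\<And>x. x \<in> cut_plane \<Longrightarrow> G x = poly Q x"
    have r: "of_nat (n - 1) = (of_nat n - 1 :: complex)" "of_nat (m - 1) = (of_nat m - 1 :: complex)" using m n by (simp_all add: of_nat_diff)
    have "poly_solution N 1 a n (ode_kappa (of_nat N) 1 a b \<theta>) P"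
      using ode_solution_cong[OF open_cut_plane P(3) conjunct2[OF i0[OF \<psi>(1)]]] P n unfolding poly_solution_def ode_solution_poly r by auto
    moreover have "poly_solution N (- 1) a m (ode_kappa (of_nat N) (- 1) a b \<theta>) Q"
      using ode_solution_cong[OF open_cut_plane Q(3) Gs] Q m unfolding poly_solution_def ode_solution_poly r by auto
    ultimately show ?thesis unfolding N_def by blast
  qed
qed

section \<open>The three characterisations\<close>

lemma generalised_hermite_zero_iff:
  assumes H: "generalised_hermite H" and m: "m \<ge> 1" and n: "n \<ge> 1"
  shows "poly (H m n) a = 0 \<longleftrightarrow> (\<exists>\<kappa> P Q. poly_solution (m + n) 1 a n \<kappa> P \<and>
    poly_solution (m + n) (- 1) a m (\<kappa> - 2 * a * (of_nat (m + n) - 1)) Q)"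
proof
  assume "poly (H m n) a = 0"
  then obtain p where "p \<noteq> 0" "pade_kernel a m n p" using generalised_hermite_zero_iff_pade[OF H n] by blast
  then show "\<exists>\<kappa> P Q. poly_solution (m + n) 1 a n \<kappa> P \<and> poly_solution (m + n) (- 1) a m (\<kappa> - 2 * a * (of_nat (m + n) - 1)) Q"
    using pade_imp_poly_solutions[OF m n] by blast
next
  assume "\<exists>\<kappa> P Q. poly_solution (m + n) 1 a n \<kappa> P \<and> poly_solution (m + n) (- 1) a m (\<kappa> - 2 * a * (of_nat (m + n) - 1)) Q"
  then obtain \<kappa> P Q where PQ: "poly_solution (m + n) 1 a n \<kappa> P" "poly_solution (m + n) (- 1) a m (\<kappa> - 2 * a * (of_nat (m + n) - 1)) Q" by blast
  have "P \<noteq> 0" using PQ(1) by (simp add: poly_solution_def)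
  then show "poly (H m n) a = 0" using poly_solutions_imp_pade[OF PQ] generalised_hermite_zero_iff_pade[OF H n] by blast
qed

text \<open>
  Existence and uniqueness of \<open>b\<close> from those of \<open>\<kappa> = b + e\<close>.
\<close>

lemma affine_parameter:
  assumes X: "X \<longleftrightarrow> (\<exists>\<kappa>. R \<kappa>)" and R: "\<And>\<kappa> \<kappa>'. R \<kappa> \<Longrightarrow> R \<kappa>' \<Longrightarrow> \<kappa> = (\<kappa>'::complex)" and C: "\<And>b. C b \<longleftrightarrow> R (b + e)"
  shows "(X \<longleftrightarrow> (\<exists>b. C b)) \<and> (\<forall>b b'. C b \<and> C b' \<longrightarrow> b = b')"
proof -
  have "R \<kappa> \<Longrightarrow> C (\<kappa> - e)" for \<kappa> using C[of "\<kappa> - e"] by simp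
  moreover have "C b \<Longrightarrow> C b' \<Longrightarrow> b = b'" for b b' using R[of "b + e" "b' + e"] C by simp
  ultimately show ?thesis using X C by blast
qed

lemma hermite_zero_iff_sector_0:
  assumes H: "generalised_hermite H" and m: "m \<ge> 1" and n: "n \<ge> 1"
  shows "(let \<theta>\<^sub>0 = of_nat n / 2; \<theta>\<^sub>i = of_nat m + 1 + of_nat n / 2;
          C = (\<lambda>b. apparent_singularity a b \<theta>\<^sub>0 \<theta>\<^sub>i \<and>
                   is_psi_infty a b \<theta>\<^sub>0 \<theta>\<^sub>i 0 \<sim>\<^sub>s is_psi_plus a b \<theta>\<^sub>0 \<theta>\<^sub>i)
      in (poly (H m n) a = 0 \<longleftrightarrow> (\<exists>b. C b)) \<and>
         (\<forall>b b'. C b \<and> C b' \<longrightarrow> b = b') \<and>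
         (\<forall>b. C b \<longrightarrow>
            is_psi_infty a b \<theta>\<^sub>0 \<theta>\<^sub>i 0 \<sim>\<^sub>s is_psi_infty a b \<theta>\<^sub>0 \<theta>\<^sub>i 2 \<and>
            (\<forall>\<psi>. is_psi_infty a b \<theta>\<^sub>0 \<theta>\<^sub>i 0 \<psi> \<longrightarrow>
               (\<exists>p. degree p = m - 1 \<and> rsquarefree p \<and> poly p 0 \<noteq> 0 \<and>
                  (\<forall>x\<in>cut_plane.
                     \<psi> x = cut_powr x ((of_nat n + 1) / 2) * exp (- g x a) * poly p x)) \<and>
               exactly_nonzero_simple_roots \<psi> (m - 1))))"
proof -
  define R where "R \<kappa> \<longleftrightarrow> (\<exists>P Q. poly_solution (m + n) 1 a n \<kappa> P \<and>
    poly_solution (m + n) (- 1) a m (\<kappa> - 2 * a * (of_nat (m + n) - 1)) Q)" for \<kappa>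
  have X: "poly (H m n) a = 0 \<longleftrightarrow> (\<exists>\<kappa>. R \<kappa>)" unfolding R_def by (rule generalised_hermite_zero_iff[OF H m n])
  have U: "R \<kappa> \<Longrightarrow> R \<kappa>' \<Longrightarrow> \<kappa> = \<kappa>'" for \<kappa> \<kappa>'
    unfolding R_def using poly_solutions_kappa_unique by blast
  define \<theta> :: complex where "\<theta> = of_nat m + 1 + of_nat n / 2"
  have s: "sector_sign 0 = 1" "(0::nat) + 2 = 2" by (simp_all add: sector_sign_def)
  have nn: "of_nat (m + n - 1) = (of_nat m + of_nat n - 1 :: complex)" using m by (simp add: of_nat_diff)
  have deg: "ode_degree (of_nat n) (sector_sign 0) \<theta> = of_nat (m + n - 1)"
    unfolding s nn by (simp add: ode_degree_def \<theta>_def field_simps)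
  define e where "e = (2 * \<theta> - 1 / 2) * a + (of_nat n - 1) * a"
  have k: "ode_kappa (of_nat n) 1 a b \<theta> = b + e" for b by (simp add: ode_kappa_def e_def)
  note os = one_sided[OF zero_le n m deg, of a, unfolded s k mult_1_left mult_1_right]
  have iff: "apparent_singularity a b (of_nat n / 2) \<theta> \<and> is_psi_infty a b (of_nat n / 2) \<theta> 0 \<sim>\<^sub>s is_psi_plus a b (of_nat n / 2) \<theta> \<longleftrightarrow> R (b + e)" for b
    unfolding R_def by (rule os(1))
  note AP = affine_parameter[OF X U iff]
  show ?thesis unfolding Let_def \<theta>_def[symmetric]
    using AP os(2) by blast
qed

lemma hermite_zero_iff_sector_1:
  assumes H: "generalised_hermite H" and m: "m \<ge> 1" and n: "n \<ge> 1"
  shows "(let \<theta>\<^sub>0 = of_nat m / 2; \<theta>\<^sub>i = 1 - of_nat m / 2 - of_nat n;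
          C = (\<lambda>b. apparent_singularity a b \<theta>\<^sub>0 \<theta>\<^sub>i \<and>
                   is_psi_infty a b \<theta>\<^sub>0 \<theta>\<^sub>i 1 \<sim>\<^sub>s is_psi_plus a b \<theta>\<^sub>0 \<theta>\<^sub>i)
      in (poly (H m n) a = 0 \<longleftrightarrow> (\<exists>b. C b)) \<and>
         (\<forall>b b'. C b \<and> C b' \<longrightarrow> b = b') \<and>
         (\<forall>b. C b \<longrightarrow>
            is_psi_infty a b \<theta>\<^sub>0 \<theta>\<^sub>i 1 \<sim>\<^sub>s is_psi_infty a b \<theta>\<^sub>0 \<theta>\<^sub>i 3 \<and>
            (\<forall>\<psi>. is_psi_infty a b \<theta>\<^sub>0 \<theta>\<^sub>i 1 \<psi> \<longrightarrow>
               (\<exists>p. degree p = n - 1 \<and> rsquarefree p \<and> poly p 0 \<noteq> 0 \<and>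
                  (\<forall>x\<in>cut_plane.
                     \<psi> x = cut_powr x ((of_nat m + 1) / 2) * exp (g x a) * poly p x)) \<and>
               exactly_nonzero_simple_roots \<psi> (n - 1))))"
proof -
  define R where "R \<kappa> \<longleftrightarrow> (\<exists>P Q. poly_solution (m + n) 1 a n \<kappa> P \<and>
    poly_solution (m + n) (- 1) a m (\<kappa> - 2 * a * (of_nat (m + n) - 1)) Q)" for \<kappa>
  have X: "poly (H m n) a = 0 \<longleftrightarrow> (\<exists>\<kappa>. R \<kappa>)" unfolding R_def by (rule generalised_hermite_zero_iff[OF H m n])
  have U: "R \<kappa> \<Longrightarrow> R \<kappa>' \<Longrightarrow> \<kappa> = \<kappa>'" for \<kappa> \<kappa>'
    unfolding R_def using poly_solutions_kappa_unique by blast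
  define \<theta> :: complex where "\<theta> = 1 - of_nat m / 2 - of_nat n"
  have s: "sector_sign 1 = - 1" "(1::nat) + 2 = 3" by (simp_all add: sector_sign_def)
  have nn: "of_nat (n + m - 1) = (of_nat m + of_nat n - 1 :: complex)" using m by (simp add: of_nat_diff)
  have deg: "ode_degree (of_nat m) (sector_sign 1) \<theta> = of_nat (n + m - 1)"
    unfolding s nn by (simp add: ode_degree_def \<theta>_def field_simps)
  define e0 where "e0 = (2 * \<theta> - 1 / 2) * a - (of_nat m - 1) * a"
  define e where "e = e0 + 2 * a * (of_nat (m + n) - 1)"
  have k: "ode_kappa (of_nat m) (- 1) a b \<theta> = b + e0" for b by (simp add: ode_kappa_def e0_def algebra_simps)
  have ex: "b + e0 - 2 * - 1 * a * (of_nat (m + n) - 1) = b + e" "b + e - 2 * a * (of_nat (m + n) - 1) = b + e0" for b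
    unfolding e_def by (simp_all add: algebra_simps)
  note os = one_sided[OF le_refl m n deg, of a, unfolded s k add.commute[of n m] ex minus_minus mult_minus1]
  have iff: "apparent_singularity a b (of_nat m / 2) \<theta> \<and> is_psi_infty a b (of_nat m / 2) \<theta> 1 \<sim>\<^sub>s is_psi_plus a b (of_nat m / 2) \<theta> \<longleftrightarrow> R (b + e)" for b
    unfolding R_def ex os(1) by blast
  note AP = affine_parameter[OF X U iff]
  show ?thesis unfolding Let_def \<theta>_def[symmetric]
    using AP os(2) by blast
qed

lemma hermite_zero_iff_opposite_sectors:
  assumes H: "generalised_hermite H" and m: "m \<ge> 1" and n: "n \<ge> 1"
  shows "(let \<theta>\<^sub>0 = (of_nat m + of_nat n) / 2; \<theta>\<^sub>i = (of_nat n - of_nat m + 2) / 2;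
          C = (\<lambda>b. is_psi_infty a b \<theta>\<^sub>0 \<theta>\<^sub>i 0 \<sim>\<^sub>s is_psi_infty a b \<theta>\<^sub>0 \<theta>\<^sub>i 2 \<and>
                   is_psi_infty a b \<theta>\<^sub>0 \<theta>\<^sub>i 1 \<sim>\<^sub>s is_psi_infty a b \<theta>\<^sub>0 \<theta>\<^sub>i 3)
      in (poly (H m n) a = 0 \<longleftrightarrow> (\<exists>b. C b)) \<and>
         (\<forall>b b'. C b \<and> C b' \<longrightarrow> b = b') \<and>
         (\<forall>b. C b \<longrightarrow>
            apparent_singularity a b \<theta>\<^sub>0 \<theta>\<^sub>i \<and>
            (\<forall>\<psi>. is_psi_infty a b \<theta>\<^sub>0 \<theta>\<^sub>i 0 \<psi> \<longrightarrow>
               (\<exists>p. degree p = n - 1 \<and> rsquarefree p \<and> poly p 0 \<noteq> 0 \<and>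
                  (\<forall>x\<in>cut_plane.
                     \<psi> x = cut_powr x (- ((of_nat m + of_nat n - 1) / 2)) * exp (- g x a) * poly p x)) \<and>
               exactly_nonzero_simple_roots \<psi> (n - 1)) \<and>
            (\<forall>\<psi>. is_psi_infty a b \<theta>\<^sub>0 \<theta>\<^sub>i 1 \<psi> \<longrightarrow>
               (\<exists>q. degree q = m - 1 \<and> rsquarefree q \<and> poly q 0 \<noteq> 0 \<and>
                  (\<forall>x\<in>cut_plane.
                     \<psi> x = cut_powr x (- ((of_nat m + of_nat n - 1) / 2)) * exp (g x a) * poly q x)) \<and>
               exactly_nonzero_simple_roots \<psi> (m - 1))))"
proof -
  define R where "R \<kappa> \<longleftrightarrow> (\<exists>P Q. poly_solution (m + n) 1 a n \<kappa> P \<and>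
    poly_solution (m + n) (- 1) a m (\<kappa> - 2 * a * (of_nat (m + n) - 1)) Q)" for \<kappa>
  have X: "poly (H m n) a = 0 \<longleftrightarrow> (\<exists>\<kappa>. R \<kappa>)" unfolding R_def by (rule generalised_hermite_zero_iff[OF H m n])
  have U: "R \<kappa> \<Longrightarrow> R \<kappa>' \<Longrightarrow> \<kappa> = \<kappa>'" for \<kappa> \<kappa>'
    unfolding R_def using poly_solutions_kappa_unique by blast
  define \<theta> :: complex where "\<theta> = (of_nat n - of_nat m + 2) / 2"
  define \<theta>0 :: complex where "\<theta>0 = (of_nat m + of_nat n) / 2"
  have \<theta>0: "of_nat (m + n) / 2 = \<theta>0" by (simp add: \<theta>0_def)
  have s: "sector_sign 0 = 1" "(0::nat) + 2 = 2" "sector_sign 1 = - 1" "(1::nat) + 2 = 3" by (simp_all add: sector_sign_def)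
  have r: "of_nat (n - 1) = (of_nat n - 1 :: complex)" "of_nat (m - 1) = (of_nat m - 1 :: complex)" using m n by (simp_all add: of_nat_diff)
  have deg: "ode_degree (of_nat (m + n)) (sector_sign 0) \<theta> = of_nat (n - 1)" "ode_degree (of_nat (m + n)) (sector_sign 1) \<theta> = of_nat (m - 1)"
    unfolding s r by (simp_all add: ode_degree_def \<theta>_def field_simps)
  define e where "e = (2 * \<theta> - 1 / 2) * a + (of_nat (m + n) - 1) * a"
  have k: "ode_kappa (of_nat (m + n)) 1 a b \<theta> = b + e" "ode_kappa (of_nat (m + n)) (- 1) a b \<theta> = b + e - 2 * a * (of_nat (m + n) - 1)" for b
    unfolding ode_kappa_def e_def by (simp_all add: algebra_simps)
  have pw: "(1 - of_nat (m + n)) / 2 = - ((of_nat m + of_nat n - 1) / 2 :: complex)" by (simp add: field_simps)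
  have nN: "n \<le> m + n" "m \<le> m + n" by simp_all
  note p0 = poly_solution_psi_infty[OF zero_le n nN(1) deg(1), of a, unfolded s k \<theta>0 pw mult_1_left]
  note p1 = poly_solution_psi_infty[OF le_refl m nN(2) deg(2), of a, unfolded s k \<theta>0 pw mult_minus1 minus_minus]
  note ts = two_sided[OF m n deg[unfolded s], of a, unfolded k \<theta>0]
  have iff: "is_psi_infty a b \<theta>0 \<theta> 0 \<sim>\<^sub>s is_psi_infty a b \<theta>0 \<theta> 2 \<and> is_psi_infty a b \<theta>0 \<theta> 1 \<sim>\<^sub>s is_psi_infty a b \<theta>0 \<theta> 3 \<longleftrightarrow> R (b + e)" for b
    unfolding R_def using ts p0(1) p1(1) by blast
  note AP = affine_parameter[OF X U iff]
  have "apparent_singularity a b \<theta>0 \<theta> \<and>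
            (\<forall>\<psi>. is_psi_infty a b \<theta>0 \<theta> 0 \<psi> \<longrightarrow>
               (\<exists>p. degree p = n - 1 \<and> rsquarefree p \<and> poly p 0 \<noteq> 0 \<and>
                  (\<forall>x\<in>cut_plane.
                     \<psi> x = cut_powr x (- ((of_nat m + of_nat n - 1) / 2)) * exp (- g x a) * poly p x)) \<and>
               exactly_nonzero_simple_roots \<psi> (n - 1)) \<and>
            (\<forall>\<psi>. is_psi_infty a b \<theta>0 \<theta> 1 \<psi> \<longrightarrow>
               (\<exists>q. degree q = m - 1 \<and> rsquarefree q \<and> poly q 0 \<noteq> 0 \<and>
                  (\<forall>x\<in>cut_plane.
                     \<psi> x = cut_powr x (- ((of_nat m + of_nat n - 1) / 2)) * exp (g x a) * poly q x)) \<and>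
               exactly_nonzero_simple_roots \<psi> (m - 1))" if Rb: "R (b + e)" for b
  proof -
    obtain P Q where P: "poly_solution (m + n) 1 a n (b + e) P" and Q: "poly_solution (m + n) (- 1) a m (b + e - 2 * a * (of_nat (m + n) - 1)) Q"
      using Rb unfolding R_def by blast
    show ?thesis by (intro conjI allI impI p0(2)[OF P] p0(3)[OF P] p1(3)[OF Q])
  qed
  then show ?thesis unfolding Let_def \<theta>_def[symmetric] \<theta>0_def[symmetric]
    using AP iff by blast
qed

theorem theorem2p2:
  fixes H :: "nat \<Rightarrow> nat \<Rightarrow> complex poly" and m n :: nat and a :: complex
  assumes "generalised_hermite H" and "m \<ge> 1" and "n \<ge> 1"
  shows
    "(let \<theta>\<^sub>0 = of_nat n / 2; \<theta>\<^sub>i = of_nat m + 1 + of_nat n / 2;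
          C = (\<lambda>b. apparent_singularity a b \<theta>\<^sub>0 \<theta>\<^sub>i \<and>
                   is_psi_infty a b \<theta>\<^sub>0 \<theta>\<^sub>i 0 \<sim>\<^sub>s is_psi_plus a b \<theta>\<^sub>0 \<theta>\<^sub>i)
      in (poly (H m n) a = 0 \<longleftrightarrow> (\<exists>b. C b)) \<and>
         (\<forall>b b'. C b \<and> C b' \<longrightarrow> b = b') \<and>
         (\<forall>b. C b \<longrightarrow>
            is_psi_infty a b \<theta>\<^sub>0 \<theta>\<^sub>i 0 \<sim>\<^sub>s is_psi_infty a b \<theta>\<^sub>0 \<theta>\<^sub>i 2 \<and>
            (\<forall>\<psi>. is_psi_infty a b \<theta>\<^sub>0 \<theta>\<^sub>i 0 \<psi> \<longrightarrow>
               (\<exists>p. degree p = m - 1 \<and> rsquarefree p \<and> poly p 0 \<noteq> 0 \<and>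
                  (\<forall>x\<in>cut_plane.
                     \<psi> x = cut_powr x ((of_nat n + 1) / 2) * exp (- g x a) * poly p x)) \<and>
               exactly_nonzero_simple_roots \<psi> (m - 1))))
     \<and>
     (let \<theta>\<^sub>0 = of_nat m / 2; \<theta>\<^sub>i = 1 - of_nat m / 2 - of_nat n;
          C = (\<lambda>b. apparent_singularity a b \<theta>\<^sub>0 \<theta>\<^sub>i \<and>
                   is_psi_infty a b \<theta>\<^sub>0 \<theta>\<^sub>i 1 \<sim>\<^sub>s is_psi_plus a b \<theta>\<^sub>0 \<theta>\<^sub>i)
      in (poly (H m n) a = 0 \<longleftrightarrow> (\<exists>b. C b)) \<and>
         (\<forall>b b'. C b \<and> C b' \<longrightarrow> b = b') \<and>
         (\<forall>b. C b \<longrightarrow>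
            is_psi_infty a b \<theta>\<^sub>0 \<theta>\<^sub>i 1 \<sim>\<^sub>s is_psi_infty a b \<theta>\<^sub>0 \<theta>\<^sub>i 3 \<and>
            (\<forall>\<psi>. is_psi_infty a b \<theta>\<^sub>0 \<theta>\<^sub>i 1 \<psi> \<longrightarrow>
               (\<exists>p. degree p = n - 1 \<and> rsquarefree p \<and> poly p 0 \<noteq> 0 \<and>
                  (\<forall>x\<in>cut_plane.
                     \<psi> x = cut_powr x ((of_nat m + 1) / 2) * exp (g x a) * poly p x)) \<and>
               exactly_nonzero_simple_roots \<psi> (n - 1))))
     \<and>
     (let \<theta>\<^sub>0 = (of_nat m + of_nat n) / 2; \<theta>\<^sub>i = (of_nat n - of_nat m + 2) / 2;
          C = (\<lambda>b. is_psi_infty a b \<theta>\<^sub>0 \<theta>\<^sub>i 0 \<sim>\<^sub>s is_psi_infty a b \<theta>\<^sub>0 \<theta>\<^sub>i 2 \<and>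
                   is_psi_infty a b \<theta>\<^sub>0 \<theta>\<^sub>i 1 \<sim>\<^sub>s is_psi_infty a b \<theta>\<^sub>0 \<theta>\<^sub>i 3)
      in (poly (H m n) a = 0 \<longleftrightarrow> (\<exists>b. C b)) \<and>
         (\<forall>b b'. C b \<and> C b' \<longrightarrow> b = b') \<and>
         (\<forall>b. C b \<longrightarrow>
            apparent_singularity a b \<theta>\<^sub>0 \<theta>\<^sub>i \<and>
            (\<forall>\<psi>. is_psi_infty a b \<theta>\<^sub>0 \<theta>\<^sub>i 0 \<psi> \<longrightarrow>
               (\<exists>p. degree p = n - 1 \<and> rsquarefree p \<and> poly p 0 \<noteq> 0 \<and>
                  (\<forall>x\<in>cut_plane.
                     \<psi> x = cut_powr x (- ((of_nat m + of_nat n - 1) / 2)) * exp (- g x a) * poly p x)) \<and>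
               exactly_nonzero_simple_roots \<psi> (n - 1)) \<and>
            (\<forall>\<psi>. is_psi_infty a b \<theta>\<^sub>0 \<theta>\<^sub>i 1 \<psi> \<longrightarrow>
               (\<exists>q. degree q = m - 1 \<and> rsquarefree q \<and> poly q 0 \<noteq> 0 \<and>
                  (\<forall>x\<in>cut_plane.
                     \<psi> x = cut_powr x (- ((of_nat m + of_nat n - 1) / 2)) * exp (g x a) * poly q x)) \<and>
               exactly_nonzero_simple_roots \<psi> (m - 1))))"
  using hermite_zero_iff_sector_0[OF assms, of a] hermite_zero_iff_sector_1[OF assms, of a]
    hermite_zero_iff_opposite_sectors[OF assms, of a]
  by (intro conjI)

end
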